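(* (Adequacy.) Let $M$ be a closed term of the language $\mathsf{pCBPV}$ such that $\vdash M:1$. Then the interpretation $[\![M]\!]\in[0,1]$ of $M$ in the model of probabilistic coherence spaces is equal to $\mathrm{Red}^\infty_{M,()}$, the probability that $M$ reduces to the value $()$.
   Context: PROBABILISTIC COHERENCE SPACES. For a countable set $I$ and $u,u'\in[0,\infty)^I$ put $\langle u,u'\rangle=\sum_{i\in I}u_iu'_i\in[0,\infty]$; for $F\subseteq[0,\infty)^I$ put $F^\perp=\{u'\mid\forall u\in F\ \langle u,u'\rangle\le1\}$. A probabilistic coherence space (PCS) is $X=(|X|,\mathrm P X)$ with $|X|$ countable, $\mathrm PX\subseteq[0,\infty)^{|X|}$, $\mathrm PX^{\perp\perp}=\mathrm PX$, such that for every $a\in|X|$ some $u\in\mathrm PX$ has $u_a>0$ and there is $A>0$ with $u_a\le A$ for all $u\in\mathrm PX$. $X^\perp=(|X|,\mathrm PX^\perp)$. A morphism $t\in\mathbf{Pcoh}(X,Y)$ is a matrix $t\in[0,\infty)^{|X|\times|Y|}$ with $t\cdot u\in\mathrm PY$ for all $u\in\mathrm PX$, where $(t\cdot u)_b=\sum_a t_{a,b}u_a$; composition is matrix product. $1=(\{*\},[0,1])$, and $\mathrm P1\cong[0,1]$, $\mathbf{Pcoh}(1,X)\cong\mathrm PX$. Tensor: $|X\otimes Y|=|X|\times|Y|$, $\mathrm P(X\otimes Y)=\{u\otimes v\mid u\in\mathrm PX,v\in\mathrm PY\}^{\perp\perp}$ with $(u\otimes v)_{(a,b)}=u_av_b$;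 $(s_1\otimes s_2)_{((a_1,a_2),(b_1,b_2))}=(s_1)_{a_1,b_1}(s_2)_{a_2,b_2}$. Linear maps: $X\multimap Y=(X\otimes Y^\perp)^\perp$, whose web is $|X|\times|Y|$ and $\mathrm P(X\multimap Y)=\mathbf{Pcoh}(X,Y)$. Norm: $\|u\|_X=\sup\{\langle u,u'\rangle\mid u'\in\mathrm PX^\perp\}$. Coproduct: $|X_\ell\oplus X_r|=\{\ell\}\times|X_\ell|\cup\{r\}\times|X_r|$, $u\in\mathrm P(X_\ell\oplus X_r)$ iff $u(i)=(u_{(i,a)})_a\in\mathrm PX_i$ for $i\in\{\ell,r\}$ and $\|u(\ell)\|+\|u(r)\|\le1$; injections $(\mathrm{in}_i)_{a',(j,a)}=\delta_{ij}\delta_{a a'}$. Exponential: $|!X|$ = finite multisets on $|X|$; for $u\in\mathrm PX$, $u^!=(u^b)_b$ with $u^b=\prod_a u_a^{b(a)}$; $\mathrm P(!X)=\{u^!\mid u\in\mathrm PX\}^{\perp\perp}$. For $t\in\mathbf{Pcoh}(X,Y)$, $(!t)_{c,d}=\sum_{r}\frac{d!}{r!}t^r$ over multisets $r$ on $|X|\times|Y|$ with first marginal $c$ and second marginal $d$, where $b!=\prod_a b(a)!$. Dereliction $\mathrm{der}_X\in\mathbf{Pcoh}(!X,X)$, $(\mathrm{der})_{b,a}=\delta_{b,[a]}$; digging $\mathrm{dig}_X\in\mathbf{Pcoh}(!X,!!X)$, $(\mathrm{dig})_{b,[b_1,\dots,b_n]}=\delta_{b,b_1+\dots+b_n}$.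 A coalgebra is $P=(X,h)$ with $h\in\mathbf{Pcoh}(X,!X)$, $\mathrm{der}_X h=\mathrm{id}$, $\mathrm{dig}_Xh=!h\,h$; $u\in\mathrm PX$ is coalgebraic if $h\cdot u=u^!$. Coalgebras used: on $1$, $h_{*,k[*]}=1$ for all $k$; on $!X$, $h=\mathrm{dig}_X$; on $(X,h_X)\otimes(Y,h_Y)$, $h=m\circ(h_X\otimes h_Y)$ where $m\in\mathbf{Pcoh}(!X\otimes!Y,!(X\otimes Y))$ is the unique morphism with $m(u^!\otimes v^!)=(u\otimes v)^!$; on $(X,h_X)\oplus(Y,h_Y)$, the $h$ with $h\,\mathrm{in}_\ell=!\mathrm{in}_\ell\,h_X$, $h\,\mathrm{in}_r=!\mathrm{in}_r\,h_Y$. Substructure: $X\subseteq Y$ if $|X|\subseteq|Y|$, extension by $0$ maps $\mathrm PX$ into $\mathrm PY$ and restriction maps $\mathrm PY$ into $\mathrm PX$; for coalgebras additionally $h_Y\circ\eta=!\eta\circ h_X$ where $\eta$ is the extension-by-zero matrix. Directed families have least upper bounds (web = union, $\mathrm PX$ = families all of whose restrictions lie in the members). LANGUAGE. Positive types $\phi,\psi::=1\mid\,!\sigma\mid\phi\otimes\psi\mid\phi\oplus\psi\mid\zeta\mid\mu\zeta.\phi$; general types $\sigma,\tau::=\phi\mid\phi\multimap\sigma$ ($\zeta$ type variables, no variance restriction). Terms: $x\mid()\mid\mathrm{stop}(M)\mid\langle M,N\rangle\mid\mathrm{in}_\ell M\mid\mathrm{in}_rM\mid\lambda x^\phi.M\mid\langle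 M\rangle N\mid\mathrm{case}(M,x_\ell\cdot N_\ell,x_r\cdot N_r)\mid\mathrm{pr}_\ell M\mid\mathrm{pr}_rM\mid\mathrm{go}(M)\mid\mathrm{fix}\,x^\sigma.M\mid\mathrm{fold}(M)\mid\mathrm{unfold}(M)\mid\mathrm{coin}(p)$ with $p\in[0,1]\cap\mathbb Q$. Contexts $\mathcal P=(x_1:\phi_1,\dots,x_k:\phi_k)$ of positive types. Typing: $\mathcal P,x:\phi\vdash x:\phi$; $\mathcal P\vdash():1$; from $\mathcal P,x:\phi\vdash M:\sigma$ infer $\lambda x^\phi.M:\phi\multimap\sigma$; from $M:\phi\multimap\sigma$, $N:\phi$ infer $\langle M\rangle N:\sigma$; $M:\sigma$ gives $\mathrm{stop}(M):!\sigma$; $M:!\sigma$ gives $\mathrm{go}(M):\sigma$; $M_i:\phi_i$ gives $\langle M_\ell,M_r\rangle:\phi_\ell\otimes\phi_r$ and $\mathrm{in}_iM_i:\phi_\ell\oplus\phi_r$; $M:\phi_\ell\otimes\phi_r$ gives $\mathrm{pr}_iM:\phi_i$; from $\mathcal P,x:!\sigma\vdash M:\sigma$ infer $\mathrm{fix}\,x^\sigma.M:\sigma$; from $M:\phi_\ell\oplus\phi_r$ and $\mathcal P,x_i:\phi_i\vdash N_i:\sigma$ infer $\mathrm{case}(M,x_\ell\cdot N_\ell,x_r\cdot N_r):\sigma$; $\mathrm{coin}(p):1\oplus1$; $M:\psi[\mu\zeta.\psi/\zeta]$ gives $\mathrm{fold}(M):\mu\zeta.\psi$ and conversely for $\mathrm{unfold}$.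 Values $V,W::=x\mid()\mid\mathrm{stop}(M)\mid\langle V,W\rangle\mid\mathrm{in}_iV\mid\mathrm{fold}(V)$. Weak reduction $\rightsquigarrow$: $\mathrm{go}(\mathrm{stop}(M))\rightsquigarrow M$; $\langle\lambda x^\phi.M\rangle V\rightsquigarrow M[V/x]$; $\mathrm{pr}_i\langle V_\ell,V_r\rangle\rightsquigarrow V_i$; $\mathrm{fix}\,x^\sigma.M\rightsquigarrow M[\mathrm{stop}(\mathrm{fix}\,x^\sigma.M)/x]$; $\mathrm{case}(\mathrm{in}_iV,x_\ell\cdot M_\ell,x_r\cdot M_r)\rightsquigarrow M_i[V/x_i]$; $\mathrm{unfold}(\mathrm{fold}(V))\rightsquigarrow V$. Probabilistic one-step reduction $M\to_pM'$: $M\rightsquigarrow M'$ gives $M\to_1M'$; $\mathrm{coin}(p)\to_p\mathrm{in}_\ell()$, $\mathrm{coin}(p)\to_{1-p}\mathrm{in}_r()$; and if $M\to_pM'$ then $\mathrm{go}(M)\to_p\mathrm{go}(M')$, $\langle M\rangle V\to_p\langle M'\rangle V$ ($V$ value), $\langle N\rangle M\to_p\langle N\rangle M'$, $\mathrm{pr}_iM\to_p\mathrm{pr}_iM'$, $\langle M,N\rangle\to_p\langle M',N\rangle$, $\langle V,M\rangle\to_p\langle V,M'\rangle$, $\mathrm{in}_iM\to_p\mathrm{in}_iM'$, $\mathrm{case}(M,\dots)\to_p\mathrm{case}(M',\dots)$, $\mathrm{fold}(M)\to_p\mathrm{fold}(M')$, $\mathrm{unfold}(M)\to_p\mathrm{unfold}(M')$.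 $M$ is weak normal if it has no reduct. $\mathrm{Red}_{M,M'}=p$ if $M\to_pM'$, $=1$ if $M$ is weak normal and $M'=M$, $=0$ otherwise; $\mathrm{Red}^\infty_{M,M'}=\sup_n(\mathrm{Red}^n)_{M,M'}$ if $M'$ weak normal and $0$ otherwise. SEMANTICS. Each closed positive type $\phi$ is interpreted as a coalgebra $([\![\phi]\!],h_\phi)$ and each closed general type as a PCS: $1$, $!\sigma$, $\otimes$, $\oplus$ by the coalgebras above, $[\![\phi\multimap\sigma]\!]=[\![\phi]\!]\multimap[\![\sigma]\!]$; open types define operations monotone and continuous for $\subseteq$ (in all arguments), and $[\![\mu\zeta.\phi]\!]$ is the union of the chain $F^n(\emptyset)$ where $F$ is the operation defined by $\phi$ in $\zeta$ and $\emptyset$ is the empty-web space; so $[\![\mu\zeta.\phi]\!]=[\![\phi[\mu\zeta.\phi/\zeta]]\!]$. For $\mathcal P\vdash M:\sigma$, $[\![M]\!]^{\mathcal P}\in\mathbf{Pcoh}([\![\phi_1]\!]\otimes\dots\otimes[\![\phi_k]\!],[\![\sigma]\!])$ is determined by its values on $\vec u=u_1\otimes\dots\otimes u_k$ with each $u_i$ coalgebraic, given by: $[\![()]\!]=1$; $[\![x_i]\!](\vec u)=u_i$; $[\![\mathrm{stop}(N)]\!](\vec u)=([\![N]\!](\vec u))^!$; $[\![\langle M_\ell,M_r\rangle]\!](\vec u)=[\![M_\ell]\!](\vec u)\otimes[\![M_r]\!](\vec u)$; $[\![\mathrm{in}_iN]\!](\vec u)=\mathrm{in}_i[\![N]\!](\vec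 u)$; $[\![\mathrm{go}(N)]\!](\vec u)=\mathrm{der}\cdot[\![N]\!](\vec u)$; $[\![\langle N\rangle R]\!](\vec u)=[\![N]\!](\vec u)\cdot[\![R]\!](\vec u)$; $[\![\lambda x^\phi.N]\!](\vec u)$ is the $t\in\mathrm P([\![\phi]\!]\multimap[\![\sigma]\!])$ with $t\cdot v=[\![N]\!](\vec u\otimes v)$ for all coalgebraic $v$; $[\![\mathrm{case}(N,y_\ell\cdot R_\ell,y_r\cdot R_r)]\!](\vec u)=\sum_{i\in\{\ell,r\}}[\![R_i]\!](\vec u\otimes\rho_i[\![N]\!](\vec u))$ with $(\rho_i)_{(j,a),b}=\delta_{ij}\delta_{ab}$; $[\![\mathrm{pr}_iN]\!](\vec u)=\pi_i\cdot[\![N]\!](\vec u)$ with $(\pi_\ell)_{(a,b),a'}=\delta_{aa'}(h_{\phi_r})_{b,[]}$ and symmetrically for $\pi_r$; $[\![\mathrm{fix}\,x^\sigma.N]\!](\vec u)=\sup_nf^n(0)$ with $f(w)=[\![N]\!](\vec u\otimes w^!)$; $[\![\mathrm{fold}(N)]\!]=[\![\mathrm{unfold}(N)]\!]=[\![N]\!]$; $[\![\mathrm{coin}(p)]\!]=p\,e_{(\ell,* )}+(1-p)e_{(r,* )}$. *)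

theory Defs
  imports "HOL-Analysis.Analysis" "HOL-Library.Multiset"
begin

section \<open>Probabilistic coherence spaces\<close>

text \<open>
  All webs are subsets of one universal set of points, closed under the formation of pairs,
  tagged copies and finite multisets. This is what lets unions of chains of spaces be taken
  literally and makes a recursive type equal to its unfolding.
\<close>

datatype point =
  Star | Pr point point | PL point | PR point | Ms "point multiset"

text \<open>Every web is countable: points are images of trees in which multisets are replaced by lists.\<close>

datatype ptree = TStar | TPr ptree ptree | TL ptree | TR ptree | TMs "ptree list"

instance ptree :: countable
  by countable_datatype

primrec point_of :: "ptree \<Rightarrow> point" where
  "point_of TStar = Star"
| "point_of (TPr a b) = Pr (point_of a) (point_of b)"
| "point_of (TL a) = PL (point_of a)"
| "point_of (TR a) = PR (point_of a)"
| "point_of (TMs ts) = Ms (mset (map point_of ts))"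

lemma point_of_surj: "\<exists>t. point_of t = x"
proof (induction x)
  case Star
  show ?case by (rule exI[of _ TStar]) simp
next
  case (Pr a b)
  then show ?case by (metis point_of.simps(2))
next
  case (PL a)
  then show ?case by (metis point_of.simps(3))
next
  case (PR a)
  then show ?case by (metis point_of.simps(4))
next
  case (Ms m)
  then obtain f where f: "\<And>y. y \<in># m \<Longrightarrow> point_of (f y) = y" by metis
  obtain xs where xs: "mset xs = m" using ex_mset by blast
  have "map point_of (map f xs) = xs" using f xs by (auto intro!: map_idI)
  then have "point_of (TMs (map f xs)) = Ms m" using xs by simp
  then show ?case ..
qed

instance point :: countable
proof
  have "inj (\<lambda>x. to_nat (inv point_of x))"
    using point_of_surj by (auto intro!: injI) (metis surjI surj_f_inv_f)
  then show "\<exists>to_nat :: point \<Rightarrow> nat. inj to_nat" by blast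
qed

text \<open>
  A vector of [0,oo)^I is a finite-valued function that vanishes outside I, so that a sum over I is
  a sum over all points; values are taken in \<^typ>\<open>ennreal\<close> so that every sum is defined.
  A matrix with rows A and columns B is a vector indexed by the points \<^term>\<open>Pr a b\<close>.
\<close>

type_synonym vec = "point \<Rightarrow> ennreal"

definition vecs :: "point set \<Rightarrow> vec set" where
  "vecs I = {u. (\<forall>i. u i < top) \<and> (\<forall>i. i \<notin> I \<longrightarrow> u i = 0)}"

definition pairing :: "vec \<Rightarrow> vec \<Rightarrow> ennreal" where
  "pairing u v = (\<Sum>\<^sub>\<infinity>i. u i * v i)"

definition perp :: "point set \<Rightarrow> vec set \<Rightarrow> vec set" where
  "perp I F = {v \<in> vecs I. \<forall>u\<in>F. pairing u v \<le> 1}"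

record pcs =
  web :: "point set"
  pset :: "vec set"

definition dual :: "pcs \<Rightarrow> pcs" where
  "dual X = \<lparr>web = web X, pset = perp (web X) (pset X)\<rparr>"

definition pnorm :: "pcs \<Rightarrow> vec \<Rightarrow> ennreal" where
  "pnorm X u = (SUP v\<in>pset (dual X). pairing u v)"

definition pcs_empty :: pcs where
  "pcs_empty = \<lparr>web = {}, pset = {\<lambda>_. 0}\<rparr>"

definition pcs_one :: pcs where
  "pcs_one = \<lparr>web = {Star}, pset = {u \<in> vecs {Star}. u Star \<le> 1}\<rparr>"

definition unit_vec :: vec where
  "unit_vec = (\<lambda>x. if x = Star then 1 else 0)"

fun vtensor :: "vec \<Rightarrow> vec \<Rightarrow> vec" where
  "vtensor u v (Pr a b) = u a * v b"
| "vtensor u v _ = 0"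

definition tensor_web :: "point set \<Rightarrow> point set \<Rightarrow> point set" where
  "tensor_web A B = {Pr a b | a b. a \<in> A \<and> b \<in> B}"

definition pcs_tensor :: "pcs \<Rightarrow> pcs \<Rightarrow> pcs" where
  "pcs_tensor X Y =
     (let W = tensor_web (web X) (web Y) in
      \<lparr>web = W, pset = perp W (perp W {vtensor u v | u v. u \<in> pset X \<and> v \<in> pset Y})\<rparr>)"

definition pcs_lin :: "pcs \<Rightarrow> pcs \<Rightarrow> pcs" where
  "pcs_lin X Y = dual (pcs_tensor X (dual Y))"

definition pcs_plus :: "pcs \<Rightarrow> pcs \<Rightarrow> pcs" where
  "pcs_plus X Y =
     \<lparr>web = PL ` web X \<union> PR ` web Y,
      pset = {w \<in> vecs (PL ` web X \<union> PR ` web Y).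
                (\<lambda>a. w (PL a)) \<in> pset X \<and> (\<lambda>a. w (PR a)) \<in> pset Y \<and>
                pnorm X (\<lambda>a. w (PL a)) + pnorm Y (\<lambda>a. w (PR a)) \<le> 1}\<rparr>"

definition mpow :: "('a \<Rightarrow> ennreal) \<Rightarrow> 'a multiset \<Rightarrow> ennreal" where
  "mpow u b = (\<Prod>a\<in>set_mset b. u a ^ count b a)"

definition mfact :: "'a multiset \<Rightarrow> nat" where
  "mfact b = (\<Prod>a\<in>set_mset b. fact (count b a))"

fun prom :: "vec \<Rightarrow> vec" where
  "prom u (Ms b) = mpow u b"
| "prom u _ = 0"

definition bang_web :: "point set \<Rightarrow> point set" where
  "bang_web A = {Ms b | b. set_mset b \<subseteq> A}"

definition pcs_bang :: "pcs \<Rightarrow> pcs" where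
  "pcs_bang X =
     (let W = bang_web (web X) in
      \<lparr>web = W, pset = perp W (perp W (prom ` pset X))\<rparr>)"


section \<open>Morphisms\<close>

definition mapp :: "vec \<Rightarrow> vec \<Rightarrow> vec" where
  "mapp t u = (\<lambda>b. \<Sum>\<^sub>\<infinity>a. t (Pr a b) * u a)"

definition Pcoh :: "pcs \<Rightarrow> pcs \<Rightarrow> vec set" where
  "Pcoh X Y = {t \<in> vecs (tensor_web (web X) (web Y)). \<forall>u\<in>pset X. mapp t u \<in> pset Y}"

text \<open>\<open>mcomp s t\<close> is the composite "s after t".\<close>

fun mcomp :: "vec \<Rightarrow> vec \<Rightarrow> vec" where
  "mcomp s t (Pr a c) = (\<Sum>\<^sub>\<infinity>b. t (Pr a b) * s (Pr b c))"
| "mcomp s t _ = 0"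

fun mtensor :: "vec \<Rightarrow> vec \<Rightarrow> vec" where
  "mtensor s t (Pr (Pr a1 a2) (Pr b1 b2)) = s (Pr a1 b1) * t (Pr a2 b2)"
| "mtensor s t _ = 0"

fun mbang :: "vec \<Rightarrow> vec" where
  "mbang t (Pr (Ms c) (Ms d)) =
     (\<Sum>\<^sub>\<infinity>r\<in>{r :: (point \<times> point) multiset. image_mset fst r = c \<and> image_mset snd r = d}.
        of_nat (mfact d) / of_nat (mfact r) * mpow (\<lambda>(a, b). t (Pr a b)) r)"
| "mbang t _ = 0"

fun der :: "pcs \<Rightarrow> vec" where
  "der X (Pr (Ms b) a) = (if a \<in> web X \<and> b = {#a#} then 1 else 0)"
| "der X _ = 0"

fun dig :: "pcs \<Rightarrow> vec" where
  "dig X (Pr (Ms b) (Ms B)) =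
     (if set_mset b \<subseteq> web X \<and> (\<exists>bs. B = image_mset Ms bs \<and> b = \<Sum>\<^sub># bs) then 1 else 0)"
| "dig X _ = 0"

fun inj_l :: "pcs \<Rightarrow> vec" where
  "inj_l X (Pr a (PL b)) = (if a \<in> web X \<and> a = b then 1 else 0)"
| "inj_l X _ = 0"

fun inj_r :: "pcs \<Rightarrow> vec" where
  "inj_r X (Pr a (PR b)) = (if a \<in> web X \<and> a = b then 1 else 0)"
| "inj_r X _ = 0"

fun rho_l :: "pcs \<Rightarrow> vec" where
  "rho_l X (Pr (PL a) b) = (if a \<in> web X \<and> a = b then 1 else 0)"
| "rho_l X _ = 0"

fun rho_r :: "pcs \<Rightarrow> vec" where
  "rho_r X (Pr (PR a) b) = (if a \<in> web X \<and> a = b then 1 else 0)"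
| "rho_r X _ = 0"

definition mon :: "pcs \<Rightarrow> pcs \<Rightarrow> vec" where
  "mon X Y = (THE m. m \<in> Pcoh (pcs_tensor (pcs_bang X) (pcs_bang Y)) (pcs_bang (pcs_tensor X Y)) \<and>
     (\<forall>u\<in>pset X. \<forall>v\<in>pset Y. mapp m (vtensor (prom u) (prom v)) = prom (vtensor u v)))"


section \<open>Coalgebras\<close>

record coalg =
  spc :: pcs
  str :: vec

definition coalgebraic :: "coalg \<Rightarrow> vec \<Rightarrow> bool" where
  "coalgebraic C u \<longleftrightarrow> u \<in> pset (spc C) \<and> mapp (str C) u = prom u"

definition coalg_empty :: coalg where
  "coalg_empty = \<lparr>spc = pcs_empty, str = (\<lambda>_. 0)\<rparr>"

fun one_str :: vec where
  "one_str (Pr Star (Ms b)) = (if set_mset b \<subseteq> {Star} then 1 else 0)"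
| "one_str _ = 0"

definition coalg_one :: coalg where
  "coalg_one = \<lparr>spc = pcs_one, str = one_str\<rparr>"

definition coalg_bang :: "pcs \<Rightarrow> coalg" where
  "coalg_bang X = \<lparr>spc = pcs_bang X, str = dig X\<rparr>"

definition coalg_tensor :: "coalg \<Rightarrow> coalg \<Rightarrow> coalg" where
  "coalg_tensor C D =
     \<lparr>spc = pcs_tensor (spc C) (spc D),
      str = mcomp (mon (spc C) (spc D)) (mtensor (str C) (str D))\<rparr>"

text \<open>
  The row of index \<^term>\<open>PL a\<close> of h is the row of index a of the composite of h with the left
  injection, which is required to be \<open>mcomp (mbang (inj_l X)) h\<^sub>X\<close>; likewise on the right.
\<close>

fun plus_str :: "coalg \<Rightarrow> coalg \<Rightarrow> vec" where
  "plus_str C D (Pr (PL a) c) = mcomp (mbang (inj_l (spc C))) (str C) (Pr a c)"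
| "plus_str C D (Pr (PR a) c) = mcomp (mbang (inj_r (spc D))) (str D) (Pr a c)"
| "plus_str C D _ = 0"

definition coalg_plus :: "coalg \<Rightarrow> coalg \<Rightarrow> coalg" where
  "coalg_plus C D = \<lparr>spc = pcs_plus (spc C) (spc D), str = plus_str C D\<rparr>"

text \<open>
  Least upper bound of an increasing chain of coalgebras. Compatibility of the structure maps with
  the inclusions says that the row of index a is the same, up to extension by 0, in all members of
  the chain whose web contains a; it is zero in the others. Hence the structure map of the union is
  the pointwise supremum.
\<close>

definition coalg_Union :: "(nat \<Rightarrow> coalg) \<Rightarrow> coalg" where
  "coalg_Union S =
     (let W = (\<Union>n. web (spc (S n))) in
      \<lparr>spc = \<lparr>web = W,
              pset = {u \<in> vecs W.
                \<forall>n. (\<lambda>a. if a \<in> web (spc (S n)) then u a else 0) \<in> pset (spc (S n))}\<rparr>,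
       str = (\<lambda>x. SUP n. str (S n) x)\<rparr>)"


section \<open>Types\<close>

text \<open>Type variables are de Bruijn indices; \<open>Mu\<close> binds index 0.\<close>

datatype pty =
    One
  | Bang ty
  | Tensor pty pty
  | Plus pty pty
  | TVar nat
  | Mu pty
and ty =
    Pos pty
  | Lolli pty ty

text \<open>All free variables are less than k; in particular \<open>k = 0\<close> means closed.\<close>

primrec wf_pty :: "pty \<Rightarrow> nat \<Rightarrow> bool" and wf_ty :: "ty \<Rightarrow> nat \<Rightarrow> bool" where
  "wf_pty One k = True"
| "wf_pty (Bang s) k = wf_ty s k"
| "wf_pty (Tensor p q) k = (wf_pty p k \<and> wf_pty q k)"
| "wf_pty (Plus p q) k = (wf_pty p k \<and> wf_pty q k)"
| "wf_pty (TVar i) k = (i < k)"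
| "wf_pty (Mu p) k = wf_pty p (Suc k)"
| "wf_ty (Pos p) k = wf_pty p k"
| "wf_ty (Lolli p s) k = (wf_pty p k \<and> wf_ty s k)"

primrec lift_pty :: "pty \<Rightarrow> nat \<Rightarrow> pty" and lift_ty :: "ty \<Rightarrow> nat \<Rightarrow> ty" where
  "lift_pty One k = One"
| "lift_pty (Bang s) k = Bang (lift_ty s k)"
| "lift_pty (Tensor p q) k = Tensor (lift_pty p k) (lift_pty q k)"
| "lift_pty (Plus p q) k = Plus (lift_pty p k) (lift_pty q k)"
| "lift_pty (TVar i) k = TVar (if i < k then i else Suc i)"
| "lift_pty (Mu p) k = Mu (lift_pty p (Suc k))"
| "lift_ty (Pos p) k = Pos (lift_pty p k)"
| "lift_ty (Lolli p s) k = Lolli (lift_pty p k) (lift_ty s k)"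

text \<open>\<open>subst_pty p r k\<close> replaces index k by r and decrements the larger indices.\<close>

primrec subst_pty :: "pty \<Rightarrow> pty \<Rightarrow> nat \<Rightarrow> pty" and subst_ty :: "ty \<Rightarrow> pty \<Rightarrow> nat \<Rightarrow> ty" where
  "subst_pty One r k = One"
| "subst_pty (Bang s) r k = Bang (subst_ty s r k)"
| "subst_pty (Tensor p q) r k = Tensor (subst_pty p r k) (subst_pty q r k)"
| "subst_pty (Plus p q) r k = Plus (subst_pty p r k) (subst_pty q r k)"
| "subst_pty (TVar i) r k = (if k < i then TVar (i - 1) else if i = k then r else TVar i)"
| "subst_pty (Mu p) r k = Mu (subst_pty p (lift_pty r 0) (Suc k))"
| "subst_ty (Pos p) r k = Pos (subst_pty p r k)"
| "subst_ty (Lolli p s) r k = Lolli (subst_pty p r k) (subst_ty s r k)"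

definition unroll :: "pty \<Rightarrow> pty" where
  "unroll p = subst_pty p (Mu p) 0"

primrec pty_open_interp :: "pty \<Rightarrow> (nat \<Rightarrow> coalg) \<Rightarrow> coalg"
  and ty_open_interp :: "ty \<Rightarrow> (nat \<Rightarrow> coalg) \<Rightarrow> pcs" where
  "pty_open_interp One E = coalg_one"
| "pty_open_interp (Bang s) E = coalg_bang (ty_open_interp s E)"
| "pty_open_interp (Tensor p q) E = coalg_tensor (pty_open_interp p E) (pty_open_interp q E)"
| "pty_open_interp (Plus p q) E = coalg_plus (pty_open_interp p E) (pty_open_interp q E)"
| "pty_open_interp (TVar i) E = E i"
| "pty_open_interp (Mu p) E =
     coalg_Union (\<lambda>n. ((\<lambda>C. pty_open_interp p (case_nat C E)) ^^ n) coalg_empty)"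
| "ty_open_interp (Pos p) E = spc (pty_open_interp p E)"
| "ty_open_interp (Lolli p s) E = pcs_lin (spc (pty_open_interp p E)) (ty_open_interp s E)"

text \<open>Closed types only: the environment is irrelevant.\<close>

definition pty_interp :: "pty \<Rightarrow> coalg" where
  "pty_interp p = pty_open_interp p (\<lambda>_. coalg_empty)"

definition ty_interp :: "ty \<Rightarrow> pcs" where
  "ty_interp s = ty_open_interp s (\<lambda>_. coalg_empty)"


section \<open>Terms\<close>

text \<open>
  De Bruijn indices: \<open>Lam\<close>, \<open>Fix\<close> and each of the two branches of \<open>Case\<close> bind index 0.
\<close>

datatype trm =
    Var nat
  | Unt
  | Stop trm
  | Tup trm trm
  | InL trm
  | InR trm
  | Lam pty trm
  | App trm trm
  | Case trm trm trm
  | PrL trm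
  | PrR trm
  | Go trm
  | Fix ty trm
  | Fold trm
  | Unfold trm
  | Coin rat

primrec lift :: "trm \<Rightarrow> nat \<Rightarrow> trm" where
  "lift (Var i) k = Var (if i < k then i else Suc i)"
| "lift Unt k = Unt"
| "lift (Stop M) k = Stop (lift M k)"
| "lift (Tup M N) k = Tup (lift M k) (lift N k)"
| "lift (InL M) k = InL (lift M k)"
| "lift (InR M) k = InR (lift M k)"
| "lift (Lam p M) k = Lam p (lift M (Suc k))"
| "lift (App M N) k = App (lift M k) (lift N k)"
| "lift (Case M N R) k = Case (lift M k) (lift N (Suc k)) (lift R (Suc k))"
| "lift (PrL M) k = PrL (lift M k)"
| "lift (PrR M) k = PrR (lift M k)"
| "lift (Go M) k = Go (lift M k)"
| "lift (Fix s M) k = Fix s (lift M (Suc k))"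
| "lift (Fold M) k = Fold (lift M k)"
| "lift (Unfold M) k = Unfold (lift M k)"
| "lift (Coin r) k = Coin r"

primrec subst :: "trm \<Rightarrow> trm \<Rightarrow> nat \<Rightarrow> trm" where
  "subst (Var i) V k = (if k < i then Var (i - 1) else if i = k then V else Var i)"
| "subst Unt V k = Unt"
| "subst (Stop M) V k = Stop (subst M V k)"
| "subst (Tup M N) V k = Tup (subst M V k) (subst N V k)"
| "subst (InL M) V k = InL (subst M V k)"
| "subst (InR M) V k = InR (subst M V k)"
| "subst (Lam p M) V k = Lam p (subst M (lift V 0) (Suc k))"
| "subst (App M N) V k = App (subst M V k) (subst N V k)"
| "subst (Case M N R) V k =
     Case (subst M V k) (subst N (lift V 0) (Suc k)) (subst R (lift V 0) (Suc k))"
| "subst (PrL M) V k = PrL (subst M V k)"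
| "subst (PrR M) V k = PrR (subst M V k)"
| "subst (Go M) V k = Go (subst M V k)"
| "subst (Fix s M) V k = Fix s (subst M (lift V 0) (Suc k))"
| "subst (Fold M) V k = Fold (subst M V k)"
| "subst (Unfold M) V k = Unfold (subst M V k)"
| "subst (Coin r) V k = Coin r"

text \<open>
  The head of a context is the most recently bound variable. Types in judgements are closed: the
  side conditions are placed where a type is not already determined by the premises.
\<close>

inductive typing :: "pty list \<Rightarrow> trm \<Rightarrow> ty \<Rightarrow> bool" where
  "i < length G \<Longrightarrow> typing G (Var i) (Pos (G ! i))"
| "typing G Unt (Pos One)"
| "wf_pty p 0 \<Longrightarrow> typing (p # G) M s \<Longrightarrow> typing G (Lam p M) (Lolli p s)"
| "typing G M (Lolli p s) \<Longrightarrow> typing G N (Pos p) \<Longrightarrow> typing G (App M N) s"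
| "typing G M s \<Longrightarrow> typing G (Stop M) (Pos (Bang s))"
| "typing G M (Pos (Bang s)) \<Longrightarrow> typing G (Go M) s"
| "typing G M (Pos p) \<Longrightarrow> typing G N (Pos q) \<Longrightarrow> typing G (Tup M N) (Pos (Tensor p q))"
| "wf_pty q 0 \<Longrightarrow> typing G M (Pos p) \<Longrightarrow> typing G (InL M) (Pos (Plus p q))"
| "wf_pty p 0 \<Longrightarrow> typing G M (Pos q) \<Longrightarrow> typing G (InR M) (Pos (Plus p q))"
| "typing G M (Pos (Tensor p q)) \<Longrightarrow> typing G (PrL M) (Pos p)"
| "typing G M (Pos (Tensor p q)) \<Longrightarrow> typing G (PrR M) (Pos q)"
| "wf_ty s 0 \<Longrightarrow> typing (Bang s # G) M s \<Longrightarrow> typing G (Fix s M) s"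
| "typing G M (Pos (Plus p q)) \<Longrightarrow> typing (p # G) N s \<Longrightarrow> typing (q # G) R s \<Longrightarrow>
     typing G (Case M N R) s"
| "0 \<le> r \<Longrightarrow> r \<le> 1 \<Longrightarrow> typing G (Coin r) (Pos (Plus One One))"
| "typing G M (Pos (unroll p)) \<Longrightarrow> typing G (Fold M) (Pos (Mu p))"
| "typing G M (Pos (Mu p)) \<Longrightarrow> typing G (Unfold M) (Pos (unroll p))"


section \<open>Operational semantics\<close>

inductive val :: "trm \<Rightarrow> bool" where
  "val (Var i)"
| "val Unt"
| "val (Stop M)"
| "val V \<Longrightarrow> val W \<Longrightarrow> val (Tup V W)"
| "val V \<Longrightarrow> val (InL V)"
| "val V \<Longrightarrow> val (InR V)"
| "val V \<Longrightarrow> val (Fold V)"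

inductive wred :: "trm \<Rightarrow> trm \<Rightarrow> bool" where
  "wred (Go (Stop M)) M"
| "val V \<Longrightarrow> wred (App (Lam p M) V) (subst M V 0)"
| "val V \<Longrightarrow> val W \<Longrightarrow> wred (PrL (Tup V W)) V"
| "val V \<Longrightarrow> val W \<Longrightarrow> wred (PrR (Tup V W)) W"
| "wred (Fix s M) (subst M (Stop (Fix s M)) 0)"
| "val V \<Longrightarrow> wred (Case (InL V) M N) (subst M V 0)"
| "val V \<Longrightarrow> wred (Case (InR V) M N) (subst N V 0)"
| "val V \<Longrightarrow> wred (Unfold (Fold V)) V"

inductive step :: "trm \<Rightarrow> real \<Rightarrow> trm \<Rightarrow> bool" where
  "wred M M' \<Longrightarrow> step M 1 M'"
| "step (Coin r) (of_rat r) (InL Unt)"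
| "step (Coin r) (1 - of_rat r) (InR Unt)"
| "step M x M' \<Longrightarrow> step (Go M) x (Go M')"
| "step M x M' \<Longrightarrow> val V \<Longrightarrow> step (App M V) x (App M' V)"
| "step M x M' \<Longrightarrow> step (App N M) x (App N M')"
| "step M x M' \<Longrightarrow> step (PrL M) x (PrL M')"
| "step M x M' \<Longrightarrow> step (PrR M) x (PrR M')"
| "step M x M' \<Longrightarrow> step (Tup M N) x (Tup M' N)"
| "step M x M' \<Longrightarrow> val V \<Longrightarrow> step (Tup V M) x (Tup V M')"
| "step M x M' \<Longrightarrow> step (InL M) x (InL M')"
| "step M x M' \<Longrightarrow> step (InR M) x (InR M')"
| "step M x M' \<Longrightarrow> step (Case M N R) x (Case M' N R)"
| "step M x M' \<Longrightarrow> step (Fold M) x (Fold M')"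
| "step M x M' \<Longrightarrow> step (Unfold M) x (Unfold M')"

definition weak_normal :: "trm \<Rightarrow> bool" where
  "weak_normal M \<longleftrightarrow> \<not> (\<exists>x M'. step M x M')"

definition Red :: "trm \<Rightarrow> trm \<Rightarrow> ennreal" where
  "Red M M' =
     (if \<exists>x. step M x M' then ennreal (THE x. step M x M')
      else if weak_normal M \<and> M' = M then 1
      else 0)"

primrec Red_pow :: "nat \<Rightarrow> trm \<Rightarrow> trm \<Rightarrow> ennreal" where
  "Red_pow 0 M M' = (if M = M' then 1 else 0)"
| "Red_pow (Suc n) M M' = (\<Sum>\<^sub>\<infinity>N. Red M N * Red_pow n N M')"

definition Red_inf :: "trm \<Rightarrow> trm \<Rightarrow> ennreal" where
  "Red_inf M M' = (if weak_normal M' then (SUP n. Red_pow n M M') else 0)"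


section \<open>Denotational semantics\<close>

text \<open>
  The context x1 : p1, ..., xk : pk is the list [pk, ..., p1], interpreted as the left-nested tensor
  product (..((1 * p1) * p2)..) * pk.
\<close>

primrec ctx_interp :: "pty list \<Rightarrow> pcs" where
  "ctx_interp [] = pcs_one"
| "ctx_interp (p # G) = pcs_tensor (ctx_interp G) (spc (pty_interp p))"

primrec tuple :: "vec list \<Rightarrow> vec" where
  "tuple [] = unit_vec"
| "tuple (u # us) = vtensor (tuple us) u"

definition cpoints :: "pty list \<Rightarrow> vec list set" where
  "cpoints G = {us. list_all2 (\<lambda>p u. coalgebraic (pty_interp p) u) G us}"

definition morphs :: "pty list \<Rightarrow> ty \<Rightarrow> vec set" where
  "morphs G s = Pcoh (ctx_interp G) (ty_interp s)"

definition ev :: "vec \<Rightarrow> vec list \<Rightarrow> vec" where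
  "ev t us = mapp t (tuple us)"

fun proj_l :: "coalg \<Rightarrow> coalg \<Rightarrow> vec" where
  "proj_l C D (Pr (Pr a b) c) =
     (if a \<in> web (spc C) \<and> a = c then str D (Pr b (Ms {#})) else 0)"
| "proj_l C D _ = 0"

fun proj_r :: "coalg \<Rightarrow> coalg \<Rightarrow> vec" where
  "proj_r C D (Pr (Pr a b) c) =
     (if b \<in> web (spc D) \<and> b = c then str C (Pr a (Ms {#})) else 0)"
| "proj_r C D _ = 0"

text \<open>
  \<open>sem G M s t\<close>: the morphism t is the interpretation of the judgement G |- M : s. It is defined
  along typing derivations, because a term need not determine the types of its subterms (the
  injections and \<open>Fold\<close> carry no annotation). In each case t is the morphism determined by its
  values on tensors of coalgebraic points; the argument of a branch of \<open>Case\<close> need not be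
  coalgebraic.
\<close>

inductive sem :: "pty list \<Rightarrow> trm \<Rightarrow> ty \<Rightarrow> vec \<Rightarrow> bool" where
  sem_Var: "\<lbrakk>i < length G; t \<in> morphs G (Pos (G ! i));
     \<forall>us\<in>cpoints G. ev t us = us ! i\<rbrakk>
   \<Longrightarrow> sem G (Var i) (Pos (G ! i)) t"
| sem_Unt: "\<lbrakk>t \<in> morphs G (Pos One);
     \<forall>us\<in>cpoints G. ev t us = unit_vec\<rbrakk>
   \<Longrightarrow> sem G Unt (Pos One) t"
| sem_Lam: "\<lbrakk>wf_pty p 0; sem (p # G) M s m; t \<in> morphs G (Lolli p s);
     \<forall>us\<in>cpoints G. \<forall>v. coalgebraic (pty_interp p) v \<longrightarrow> mapp (ev t us) v = ev m (v # us)\<rbrakk>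
   \<Longrightarrow> sem G (Lam p M) (Lolli p s) t"
| sem_App: "\<lbrakk>sem G M (Lolli p s) m; sem G N (Pos p) n; t \<in> morphs G s;
     \<forall>us\<in>cpoints G. ev t us = mapp (ev m us) (ev n us)\<rbrakk>
   \<Longrightarrow> sem G (App M N) s t"
| sem_Stop: "\<lbrakk>sem G M s m; t \<in> morphs G (Pos (Bang s));
     \<forall>us\<in>cpoints G. ev t us = prom (ev m us)\<rbrakk>
   \<Longrightarrow> sem G (Stop M) (Pos (Bang s)) t"
| sem_Go: "\<lbrakk>sem G M (Pos (Bang s)) m; t \<in> morphs G s;
     \<forall>us\<in>cpoints G. ev t us = mapp (der (ty_interp s)) (ev m us)\<rbrakk>
   \<Longrightarrow> sem G (Go M) s t"
| sem_Tup: "\<lbrakk>sem G M (Pos p) m; sem G N (Pos q) n; t \<in> morphs G (Pos (Tensor p q));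
     \<forall>us\<in>cpoints G. ev t us = vtensor (ev m us) (ev n us)\<rbrakk>
   \<Longrightarrow> sem G (Tup M N) (Pos (Tensor p q)) t"
| sem_InL: "\<lbrakk>wf_pty q 0; sem G M (Pos p) m; t \<in> morphs G (Pos (Plus p q));
     \<forall>us\<in>cpoints G. ev t us = mapp (inj_l (spc (pty_interp p))) (ev m us)\<rbrakk>
   \<Longrightarrow> sem G (InL M) (Pos (Plus p q)) t"
| sem_InR: "\<lbrakk>wf_pty p 0; sem G M (Pos q) m; t \<in> morphs G (Pos (Plus p q));
     \<forall>us\<in>cpoints G. ev t us = mapp (inj_r (spc (pty_interp q))) (ev m us)\<rbrakk>
   \<Longrightarrow> sem G (InR M) (Pos (Plus p q)) t"
| sem_PrL: "\<lbrakk>sem G M (Pos (Tensor p q)) m; t \<in> morphs G (Pos p);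
     \<forall>us\<in>cpoints G. ev t us = mapp (proj_l (pty_interp p) (pty_interp q)) (ev m us)\<rbrakk>
   \<Longrightarrow> sem G (PrL M) (Pos p) t"
| sem_PrR: "\<lbrakk>sem G M (Pos (Tensor p q)) m; t \<in> morphs G (Pos q);
     \<forall>us\<in>cpoints G. ev t us = mapp (proj_r (pty_interp p) (pty_interp q)) (ev m us)\<rbrakk>
   \<Longrightarrow> sem G (PrR M) (Pos q) t"
| sem_Fix: "\<lbrakk>wf_ty s 0; sem (Bang s # G) M s m; t \<in> morphs G s;
     \<forall>us\<in>cpoints G. ev t us =
       (\<lambda>b. SUP n. ((\<lambda>w. ev m (prom w # us)) ^^ n) (\<lambda>_. 0) b)\<rbrakk>
   \<Longrightarrow> sem G (Fix s M) s t"
| sem_Case: "\<lbrakk>sem G M (Pos (Plus p q)) m; sem (p # G) N s n; sem (q # G) R s r;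
     t \<in> morphs G s;
     \<forall>us\<in>cpoints G. ev t us =
       (\<lambda>b. ev n (mapp (rho_l (spc (pty_interp p))) (ev m us) # us) b
          + ev r (mapp (rho_r (spc (pty_interp q))) (ev m us) # us) b)\<rbrakk>
   \<Longrightarrow> sem G (Case M N R) s t"
| sem_Coin: "\<lbrakk>0 \<le> x; x \<le> 1; t \<in> morphs G (Pos (Plus One One));
     \<forall>us\<in>cpoints G. ev t us =
       (\<lambda>b. if b = PL Star then ennreal (of_rat x)
            else if b = PR Star then ennreal (1 - of_rat x) else 0)\<rbrakk>
   \<Longrightarrow> sem G (Coin x) (Pos (Plus One One)) t"
| sem_Fold: "sem G M (Pos (unroll p)) t \<Longrightarrow> sem G (Fold M) (Pos (Mu p)) t"
| sem_Unfold: "sem G M (Pos (Mu p)) t \<Longrightarrow> sem G (Unfold M) (Pos (unroll p)) t"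

text \<open>
  For a closed term, the morphism from 1 is identified with its value at \<^term>\<open>unit_vec\<close>, a vector
  of the space interpreting s.
\<close>

definition closed_interp :: "trm \<Rightarrow> ty \<Rightarrow> vec" where
  "closed_interp M s = ev (THE t. sem [] M s t) []"

end

theory Submission
  imports Defs
begin

text \<open>
  No logical relation is needed. Weighting every term constructor that can fire a reduction by a cost
  factor z gives a family of interpretations, the original one being at z = 1. If M reduces, its
  interpretation at cost z is z times the average of those of its reducts. As the interpretation of a
  closed term of type 1 is at most 1, at cost z it exceeds the probability of having reached the value
  () after n steps by at most \<open>z ^ n\<close>, while the one at z = 1 is an upper bound of this
  probability. For z < 1 the excess vanishes as n grows, and then z may increase to 1 because the
  interpretation is continuous in z.

  The semantics fixes a morphism only through its values on coalgebraic points. That these determine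
  it (density) rests on the uniqueness of the coefficients of a power series. A term may have several
  typing derivations; at type 1 their interpretations agree because adequacy holds for each of them.
\<close>

section \<open>Sums of extended nonnegative reals\<close>

text \<open>A plain induction on types is obstructed by recursive types, on which no variance
  condition is imposed. Counting reductions avoids it: the error \<open>z ^ n\<close> does not
  depend on the types of the subterms. For the equation between a term and its reducts, a
  substituted value has to denote a coalgebraic point, because a morphism can be made to duplicate
  or discard its argument only at such points. A multiple \<open>z u\<close> of a coalgebraic point
  \<open>u\<close> with \<open>z < 1\<close> is no longer coalgebraic, so the cost must not be
  charged to constructors of values. The reduct equation passes under an evaluation context because,
  in call by value, the denotation is linear in the hole. Density is needed at every positive type,
  recursive ones included. It is therefore carried through the construction of types, together with
  monotonicity for inclusion, and it has to survive unions of chains.\<close>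

instance multiset :: (countable) countable
proof
  have "inj (\<lambda>m :: 'a multiset. to_nat (SOME xs. mset xs = m))"
  proof (rule injI)
    fix m m' :: "'a multiset"
    assume "to_nat (SOME xs. mset xs = m) = to_nat (SOME xs. mset xs = m')"
    then have "(SOME xs. mset xs = m) = (SOME xs. mset xs = m')" by simp
    then show "m = m'" by (metis (mono_tags, lifting) ex_mset someI_ex)
  qed
  then show "\<exists>f :: 'a multiset \<Rightarrow> nat. inj f" by blast
qed

text \<open>Seen as an integral for the counting measure, an unordered sum inherits linearity,
  Tonelli and monotone convergence. The development uses sums only through the consequences derived
  from this identity.\<close>

lemma infsum_eq_nn_integral:
  fixes f :: "'a::countable \<Rightarrow> ennreal"
  shows "infsum f UNIV = (\<integral>\<^sup>+x. f x \<partial>count_space UNIV)"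
proof (rule antisym)
  have *: "infsum f UNIV = (SUP F\<in>{F. finite F \<and> F\<subseteq>UNIV}. sum f F)"
    by (rule nonneg_infsum_complete) simp
  have "sum f F \<le> (\<integral>\<^sup>+x. f x \<partial>count_space UNIV)" if "finite F" for F
  proof -
    have "sum f F = (\<integral>\<^sup>+x. f x \<partial>count_space F)" using that by (simp add: nn_integral_count_space_finite)
    also have "\<dots> = (\<integral>\<^sup>+x. f x * indicator F x \<partial>count_space UNIV)"
      by (simp add: nn_integral_count_space_indicator)
    also have "\<dots> \<le> (\<integral>\<^sup>+x. f x \<partial>count_space UNIV)"
      by (intro nn_integral_mono) (auto simp: indicator_def)
    finally show ?thesis .
  qed
  then show "infsum f UNIV \<le> (\<integral>\<^sup>+x. f x \<partial>count_space UNIV)" unfolding * by (auto intro!: SUP_least)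
  \<comment> \<open>The points of code at most n form a finite set, and these sets exhaust the type.
    The integral is thus the limit of integrals over finite sets, each of which is a partial
    sum.\<close>
  let ?A = "\<lambda>n. {x::'a. to_nat x \<le> n}"
  have fin: "finite (?A n)" for n
    using finite_vimageI[of "{..n}" "to_nat :: 'a \<Rightarrow> nat"] by (simp add: vimage_def)
  have "(\<integral>\<^sup>+x. f x \<partial>count_space UNIV) = (\<integral>\<^sup>+x. (SUP n. f x * indicator (?A n) x) \<partial>count_space UNIV)"
  proof (intro nn_integral_cong antisym)
    fix x :: 'a
    show "f x \<le> (SUP n. f x * indicator (?A n) x)"
      by (rule SUP_upper2[of "to_nat x"]) auto
    show "(SUP n. f x * indicator (?A n) x) \<le> f x"
      by (rule SUP_least) (auto simp: indicator_def)
  qed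
  also have "\<dots> = (SUP n. \<integral>\<^sup>+x. f x * indicator (?A n) x \<partial>count_space UNIV)"
    by (rule nn_integral_monotone_convergence_SUP)
       (auto simp: incseq_def le_fun_def indicator_def)
  also have "\<dots> \<le> infsum f UNIV"
  proof (rule SUP_least)
    fix n
    have "(\<integral>\<^sup>+x. f x * indicator (?A n) x \<partial>count_space UNIV) = (\<integral>\<^sup>+x. f x \<partial>count_space (?A n))"
      by (simp add: nn_integral_count_space_indicator)
    also have "\<dots> = sum f (?A n)" using fin by (simp add: nn_integral_count_space_finite)
    also have "\<dots> \<le> infsum f UNIV" unfolding * using fin by (intro SUP_upper) auto
    finally show "(\<integral>\<^sup>+x. f x * indicator (?A n) x \<partial>count_space UNIV) \<le> infsum f UNIV" .
  qed
  finally show "(\<integral>\<^sup>+x. f x \<partial>count_space UNIV) \<le> infsum f UNIV" .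
qed

lemma infsum_ennreal_mono:
  fixes f g :: "'a::countable \<Rightarrow> ennreal"
  shows "(\<And>x. f x \<le> g x) \<Longrightarrow> infsum f UNIV \<le> infsum g UNIV"
  by (simp add: infsum_eq_nn_integral nn_integral_mono)

lemma infsum_ennreal_cmult:
  fixes f :: "'a::countable \<Rightarrow> ennreal"
  shows "(\<Sum>\<^sub>\<infinity>x. c * f x) = c * infsum f UNIV"
  by (simp add: infsum_eq_nn_integral nn_integral_cmult)

lemma infsum_ennreal_cmult2:
  fixes f :: "'a::countable \<Rightarrow> ennreal"
  shows "(\<Sum>\<^sub>\<infinity>x. f x * c) = infsum f UNIV * c"
  by (simp add: infsum_eq_nn_integral nn_integral_multc)

lemma infsum_ennreal_plus:
  fixes f g :: "'a::countable \<Rightarrow> ennreal"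
  shows "(\<Sum>\<^sub>\<infinity>x. f x + g x) = infsum f UNIV + infsum g UNIV"
  by (simp add: infsum_eq_nn_integral nn_integral_add)

lemma infsum_ennreal_pair:
  fixes f :: "('a::countable \<times> 'b::countable) \<Rightarrow> ennreal"
  shows "infsum f UNIV = (\<Sum>\<^sub>\<infinity>x. \<Sum>\<^sub>\<infinity>y. f (x, y))"
  by (simp add: infsum_eq_nn_integral nn_integral_fst_count_space)

lemma infsum_ennreal_swap:
  fixes f :: "'a::countable \<Rightarrow> 'b::countable \<Rightarrow> ennreal"
  shows "(\<Sum>\<^sub>\<infinity>x. \<Sum>\<^sub>\<infinity>y. f x y) = (\<Sum>\<^sub>\<infinity>y. \<Sum>\<^sub>\<infinity>x. f x y)"
  using nn_integral_fst_count_space[of "\<lambda>(x,y). f x y"] nn_integral_snd_count_space[of "\<lambda>(x,y). f x y"]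
  by (simp add: infsum_eq_nn_integral)

lemma infsum_ennreal_finsum:
  fixes f :: "'i \<Rightarrow> 'a::countable \<Rightarrow> ennreal"
  shows "(\<Sum>\<^sub>\<infinity>x. \<Sum>i\<in>I. f i x) = (\<Sum>i\<in>I. infsum (f i) UNIV)"
  by (simp add: infsum_eq_nn_integral nn_integral_sum)

lemma infsum_ennreal_ge:
  fixes f :: "'a::countable \<Rightarrow> ennreal"
  shows "f a \<le> infsum f UNIV"
proof -
  have "f a = (\<integral>\<^sup>+x. f x * indicator {a} x \<partial>count_space UNIV)" by simp
  also have "\<dots> \<le> (\<integral>\<^sup>+x. f x \<partial>count_space UNIV)"
    by (intro nn_integral_mono) (auto simp: indicator_def)
  finally show ?thesis by (simp add: infsum_eq_nn_integral)
qed

lemma infsum_ennreal_single: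
  fixes f :: "'a \<Rightarrow> ennreal"
  assumes "\<And>x. x \<noteq> a \<Longrightarrow> f x = 0"
  shows "infsum f UNIV = f a"
proof -
  have "infsum f UNIV = infsum f {a}" by (rule infsum_cong_neutral) (use assms in auto)
  then show ?thesis by simp
qed

lemma infsum_ennreal_delta [simp]:
  fixes f :: "'a \<Rightarrow> ennreal"
  shows "(\<Sum>\<^sub>\<infinity>x. if x = a then f x else 0) = f a" "(\<Sum>\<^sub>\<infinity>x. if a = x then f x else 0) = f a"
  by (subst infsum_ennreal_single[of a]; simp)+

lemma infsum_ennreal_SUP:
  fixes f :: "nat \<Rightarrow> 'a::countable \<Rightarrow> ennreal"
  assumes "\<And>x. incseq (\<lambda>n. f n x)"
  shows "(\<Sum>\<^sub>\<infinity>x. SUP n. f n x) = (SUP n. infsum (f n) UNIV)"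
  unfolding infsum_eq_nn_integral
  by (rule nn_integral_monotone_convergence_SUP) (use assms in \<open>auto simp: incseq_def le_fun_def\<close>)

text \<open>Vectors live on all points but vanish outside a web whose points share one or two
  constructors. Reindexing along an injective constructor removes the other points from a
  sum.\<close>

lemma infsum_ennreal_neutral_reindex:
  fixes f :: "'b \<Rightarrow> ennreal" and h :: "'a \<Rightarrow> 'b"
  assumes "inj h" "\<And>y. y \<notin> range h \<Longrightarrow> f y = 0"
  shows "infsum f UNIV = (\<Sum>\<^sub>\<infinity>x. f (h x))"
proof -
  have "infsum f UNIV = infsum f (range h)" by (rule infsum_cong_neutral) (use assms in auto)
  also have "\<dots> = infsum (f \<circ> h) UNIV" by (rule infsum_reindex) (use assms in auto)
  finally show ?thesis by (simp add: o_def)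
qed

lemma infsum_ennreal_Pr:
  fixes f :: "point \<Rightarrow> ennreal"
  assumes "\<And>x. (\<And>a b. x \<noteq> Pr a b) \<Longrightarrow> f x = 0"
  shows "infsum f UNIV = (\<Sum>\<^sub>\<infinity>a. \<Sum>\<^sub>\<infinity>b. f (Pr a b))"
proof -
  have "infsum f UNIV = (\<Sum>\<^sub>\<infinity>x. f ((\<lambda>(a, b). Pr a b) x))"
    by (rule infsum_ennreal_neutral_reindex) (auto simp: inj_def intro!: assms)
  also have "\<dots> = (\<Sum>\<^sub>\<infinity>a. \<Sum>\<^sub>\<infinity>b. f (Pr a b))" by (simp add: infsum_ennreal_pair)
  finally show ?thesis .
qed

lemma infsum_ennreal_Ms:
  fixes f :: "point \<Rightarrow> ennreal"
  assumes "\<And>x. (\<And>a. x \<noteq> Ms a) \<Longrightarrow> f x = 0"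
  shows "infsum f UNIV = (\<Sum>\<^sub>\<infinity>a. f (Ms a))"
  by (rule infsum_ennreal_neutral_reindex) (auto simp: inj_def intro!: assms)

lemma infsum_ennreal_LR:
  fixes f :: "point \<Rightarrow> ennreal"
  assumes "\<And>x. (\<And>a. x \<noteq> PL a) \<Longrightarrow> (\<And>a. x \<noteq> PR a) \<Longrightarrow> f x = 0"
  shows "infsum f UNIV = (\<Sum>\<^sub>\<infinity>a. f (PL a)) + (\<Sum>\<^sub>\<infinity>a. f (PR a))"
proof -
  let ?l = "\<lambda>x. if x \<in> range PL then f x else 0" and ?r = "\<lambda>x. if x \<in> range PR then f x else 0"
  have "f x = ?l x + ?r x" for x using assms by (cases x) auto
  then have "infsum f UNIV = infsum (\<lambda>x. ?l x + ?r x) UNIV" by (rule infsum_cong)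
  also have "\<dots> = infsum ?l UNIV + infsum ?r UNIV" by (rule infsum_ennreal_plus)
  also have "infsum ?l UNIV = (\<Sum>\<^sub>\<infinity>a. ?l (PL a))" by (rule infsum_ennreal_neutral_reindex) (auto simp: inj_def)
  also have "infsum ?r UNIV = (\<Sum>\<^sub>\<infinity>a. ?r (PR a))" by (rule infsum_ennreal_neutral_reindex) (auto simp: inj_def)
  finally show ?thesis by simp
qed

text \<open>The diagonal is cofinal: \<open>f m * g n\<close> is below the product at
  \<open>max m n\<close>.\<close>

lemma SUP_mult_chain:
  fixes f g :: "nat \<Rightarrow> ennreal"
  assumes "incseq f" "incseq g"
  shows "(SUP n. f n * g n) = (SUP n. f n) * (SUP n. g n)"
proof (rule antisym)
  show "(SUP n. f n * g n) \<le> (SUP n. f n) * (SUP n. g n)"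
    by (intro SUP_least mult_mono SUP_upper) auto
  have "f m * g n \<le> (SUP n. f n * g n)" for m n
  proof -
    have "f m * g n \<le> f (max m n) * g (max m n)"
      using assms by (intro mult_mono) (auto simp: incseq_def)
    also have "\<dots> \<le> (SUP n. f n * g n)" by (rule SUP_upper) simp
    finally show ?thesis .
  qed
  then show "(SUP n. f n) * (SUP n. g n) \<le> (SUP n. f n * g n)"
    by (simp add: SUP_mult_left_ennreal SUP_mult_right_ennreal) (auto intro!: SUP_least)
qed

lemma incseq_mult_ennreal:
  fixes f g :: "nat \<Rightarrow> ennreal"
  shows "incseq f \<Longrightarrow> incseq g \<Longrightarrow> incseq (\<lambda>n. f n * g n)"
  by (auto simp: incseq_def intro!: mult_mono)

lemma incseq_suminf:
  fixes f :: "nat \<Rightarrow> 'a::countable \<Rightarrow> ennreal"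
  shows "(\<And>x. incseq (\<lambda>n. f n x)) \<Longrightarrow> incseq (\<lambda>n. infsum (f n) UNIV)"
  by (auto simp: incseq_def intro!: infsum_ennreal_mono)

section \<open>Orthogonality\<close>

lemma pairing_commute: "pairing u v = pairing v u"
  by (simp add: pairing_def mult.commute)

lemma pairing_mono: "(\<And>x. u x \<le> u' x) \<Longrightarrow> (\<And>x. v x \<le> v' x) \<Longrightarrow> pairing u v \<le> pairing u' v'"
  unfolding pairing_def by (intro infsum_ennreal_mono mult_mono) auto

lemma pairing_ge: "u a * v a \<le> pairing u v"
  unfolding pairing_def by (rule infsum_ennreal_ge)

lemma pairing_plus: "pairing (\<lambda>x. u x + v x) w = pairing u w + pairing v w"
  unfolding pairing_def by (simp add: distrib_right infsum_ennreal_plus)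

lemma pairing_scale: "pairing (\<lambda>x. c * u x) w = c * pairing u w"
  unfolding pairing_def by (simp add: mult.assoc infsum_ennreal_cmult)

lemma pairing_SUP:
  assumes "\<And>x. incseq (\<lambda>n. f n x)"
  shows "pairing (\<lambda>x. SUP n. f n x) w = (SUP n. pairing (f n) w)"
  unfolding pairing_def using assms
  by (subst infsum_ennreal_SUP[symmetric]) (auto simp: SUP_mult_right_ennreal incseq_def intro!: mult_right_mono)

lemma pairing_zero [simp]: "pairing (\<lambda>_. 0) w = 0" "pairing w (\<lambda>_. 0) = 0"
  by (simp_all add: pairing_def)

lemma vecsI: "(\<And>i. u i < top) \<Longrightarrow> (\<And>i. i \<notin> I \<Longrightarrow> u i = 0) \<Longrightarrow> u \<in> vecs I"
  by (auto simp: vecs_def)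

lemma vecs_fin: "u \<in> vecs I \<Longrightarrow> u i < top" by (auto simp: vecs_def)
lemma vecs_out: "u \<in> vecs I \<Longrightarrow> i \<notin> I \<Longrightarrow> u i = 0" by (auto simp: vecs_def)

lemma perp_vecs: "perp I F \<subseteq> vecs I" by (auto simp: perp_def)

lemma perp_anti: "F \<subseteq> G \<Longrightarrow> perp I G \<subseteq> perp I F" by (auto simp: perp_def)

lemma perp_perp_ge: "F \<subseteq> vecs I \<Longrightarrow> F \<subseteq> perp I (perp I F)"
  by (auto simp: perp_def pairing_commute)

lemma perp_perp_perp: "F \<subseteq> vecs I \<Longrightarrow> perp I (perp I (perp I F)) = perp I F"
  by (meson antisym perp_anti perp_perp_ge perp_vecs)

text \<open>The local boundedness of the paper is stated as positivity of the dual, which makes the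
  notion self-dual.\<close>

definition is_pcs :: "pcs \<Rightarrow> bool" where
  "is_pcs X \<longleftrightarrow> pset X = perp (web X) (perp (web X) (pset X)) \<and>
     (\<forall>a\<in>web X. \<exists>u\<in>pset X. u a \<noteq> 0) \<and>
     (\<forall>a\<in>web X. \<exists>v\<in>perp (web X) (pset X). v a \<noteq> 0)"

lemma web_dual [simp]: "web (dual X) = web X" by (simp add: dual_def)
lemma pset_dual: "pset (dual X) = perp (web X) (pset X)" by (simp add: dual_def)

lemma is_pcs_vecs: "is_pcs X \<Longrightarrow> pset X \<subseteq> vecs (web X)"
  unfolding is_pcs_def using perp_vecs by metis

lemma is_pcs_fin: "is_pcs X \<Longrightarrow> u \<in> pset X \<Longrightarrow> u a < top"
  using is_pcs_vecs vecs_fin by blast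

lemma is_pcs_out: "is_pcs X \<Longrightarrow> u \<in> pset X \<Longrightarrow> a \<notin> web X \<Longrightarrow> u a = 0"
  using is_pcs_vecs vecs_out by blast

lemma is_pcs_dual: "is_pcs X \<Longrightarrow> is_pcs (dual X)"
  unfolding is_pcs_def dual_def by (auto simp: perp_perp_perp perp_vecs)

lemma dual_dual: "is_pcs X \<Longrightarrow> dual (dual X) = X"
  unfolding is_pcs_def dual_def by (cases X) auto

lemma pairing_le_1: "u \<in> pset X \<Longrightarrow> v \<in> pset (dual X) \<Longrightarrow> pairing u v \<le> 1"
  by (auto simp: pset_dual perp_def)

lemma is_pcs_pos: "is_pcs X \<Longrightarrow> a \<in> web X \<Longrightarrow> \<exists>u\<in>pset X. u a \<noteq> 0"
  by (auto simp: is_pcs_def)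

lemma is_pcs_dual_pos: "is_pcs X \<Longrightarrow> a \<in> web X \<Longrightarrow> \<exists>u\<in>pset (dual X). u a \<noteq> 0"
  by (auto simp: is_pcs_def pset_dual)

text \<open>An infinite factor next to a nonzero one gives an infinite product. Finiteness of
  entries, which \<open>vecs\<close> demands, is obtained in this way from the bounds on
  pairings.\<close>

lemma ennreal_mult_le_1_fin: "(x::ennreal) * y \<le> 1 \<Longrightarrow> y \<noteq> 0 \<Longrightarrow> x < top"
  by (metis ennreal_top_mult less_top neq_top_trans ennreal_one_neq_top top.not_eq_extremum)

text \<open>Finiteness of the entries is not a premise: every point of the web is charged by some
  dual vector, and the bounded pairing with that vector bounds the entry.\<close>

lemma pcs_memI:
  assumes "is_pcs X" "\<And>a. a \<notin> web X \<Longrightarrow> u a = 0" "\<And>v. v \<in> pset (dual X) \<Longrightarrow> pairing u v \<le> 1"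
  shows "u \<in> pset X"
proof -
  have "u a < top" for a
  proof (cases "a \<in> web X")
    case True
    then obtain v where v: "v \<in> pset (dual X)" "v a \<noteq> 0" using is_pcs_dual_pos assms by blast
    have "u a * v a \<le> 1" using pairing_ge[of u a v] assms(3)[OF v(1)] by simp
    then show ?thesis using v ennreal_mult_le_1_fin by blast
  qed (simp add: assms)
  then have "u \<in> perp (web X) (pset (dual X))"
    using assms(2,3) by (auto simp: perp_def vecs_def pairing_commute)
  then show ?thesis using assms(1) by (simp add: is_pcs_def pset_dual)
qed

lemma dual_memI:
  assumes "is_pcs X" "\<And>a. a \<notin> web X \<Longrightarrow> v a = 0" "\<And>u. u \<in> pset X \<Longrightarrow> pairing u v \<le> 1"
  shows "v \<in> pset (dual X)"
  using pcs_memI[OF is_pcs_dual[OF assms(1)], of v] assms by (simp add: dual_dual pairing_commute)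

section \<open>Closure properties of the set of vectors of a space\<close>

lemma pset_zero: "is_pcs X \<Longrightarrow> (\<lambda>_. 0) \<in> pset X"
  by (rule pcs_memI) auto

text \<open>Membership is tested by pairing with dual vectors. Pairing with a fixed vector is
  monotone, linear and continuous for increasing suprema, so the set of vectors is closed downwards,
  under convex combinations and under such suprema.\<close>

lemma pset_down: "is_pcs X \<Longrightarrow> u \<in> pset X \<Longrightarrow> (\<And>x. v x \<le> u x) \<Longrightarrow> v \<in> pset X"
  by (rule pcs_memI, assumption)
     (metis is_pcs_out le_zero_eq, meson order_refl order_trans pairing_le_1 pairing_mono)

lemma pset_SUP:
  assumes "is_pcs X" "\<And>n. f n \<in> pset X" "\<And>x. incseq (\<lambda>n. f n x)"
  shows "(\<lambda>x. SUP n. f n x) \<in> pset X"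
  by (rule pcs_memI)
     (use assms in \<open>auto simp: is_pcs_out pairing_SUP intro!: SUP_least pairing_le_1\<close>)

lemma pset_convex:
  assumes "is_pcs X" "u \<in> pset X" "v \<in> pset X" "c + d \<le> 1"
  shows "(\<lambda>x. c * u x + d * v x) \<in> pset X"
proof (rule pcs_memI)
  fix w assume w: "w \<in> pset (dual X)"
  have "c * pairing u w + d * pairing v w \<le> c * 1 + d * 1"
    using assms w by (intro add_mono mult_left_mono pairing_le_1) auto
  then show "pairing (\<lambda>x. c * u x + d * v x) w \<le> 1"
    using assms by (simp add: pairing_plus pairing_scale)
qed (use assms in \<open>auto simp: is_pcs_out\<close>)

lemma pset_scale: "is_pcs X \<Longrightarrow> u \<in> pset X \<Longrightarrow> c \<le> 1 \<Longrightarrow> (\<lambda>x. c * u x) \<in> pset X"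
  by (erule pset_down) (auto intro: mult_right_mono[of c 1, simplified])

text \<open>Averaging two vectors keeps both supports. Such a vector spans a polydisc of positive
  radii inside the space, on which power series in finitely many variables can be compared.\<close>

lemma pset_finite_pos:
  assumes "is_pcs X" "finite S" "S \<subseteq> web X"
  shows "\<exists>u\<in>pset X. \<forall>a\<in>S. u a \<noteq> 0"
  using assms(2,3)
proof (induction S rule: finite_induct)
  case empty then show ?case using pset_zero[OF assms(1)] by auto
next
  case (insert a S)
  then obtain u where u: "u \<in> pset X" "\<forall>a\<in>S. u a \<noteq> 0" by auto
  obtain v where v: "v \<in> pset X" "v a \<noteq> 0" using insert.prems is_pcs_pos[OF assms(1), of a] by auto
  have "(1/2 :: ennreal) + 1/2 = (1 + 1) / 2" by (rule add_divide_distrib_ennreal[symmetric])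
  also have "\<dots> = 1" by (simp only: one_add_one) (rule ennreal_divide_self, auto)
  finally have half: "(1/2 :: ennreal) + 1/2 \<le> 1" by (rule eq_refl)
  have w: "(\<lambda>x. 1/2 * u x + 1/2 * v x) \<in> pset X"
    by (rule pset_convex[OF assms(1) u(1) v(1) half])
  have "1/2 * u b + 1/2 * v b \<noteq> 0" if "b \<in> insert a S" for b
  proof -
    have "u b \<noteq> 0 \<or> v b \<noteq> 0" using that u v by blast
    moreover have "1/2 \<noteq> (0::ennreal)" by (simp add: ennreal_divide_eq_0_iff)
    ultimately show ?thesis unfolding add_eq_0_iff_both_eq_0 mult_eq_0_iff by blast
  qed
  then show ?case by (intro bexI[OF _ w]) blast
qed

section \<open>Matrices\<close>

lemma mapp_mcomp: "mapp (mcomp s t) u = mapp s (mapp t u)"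
proof
  fix c
  have "mapp (mcomp s t) u c = (\<Sum>\<^sub>\<infinity>a. \<Sum>\<^sub>\<infinity>b. t (Pr a b) * s (Pr b c) * u a)"
    by (simp add: mapp_def infsum_ennreal_cmult2)
  also have "\<dots> = (\<Sum>\<^sub>\<infinity>b. \<Sum>\<^sub>\<infinity>a. t (Pr a b) * s (Pr b c) * u a)" by (rule infsum_ennreal_swap)
  also have "\<dots> = (\<Sum>\<^sub>\<infinity>b. \<Sum>\<^sub>\<infinity>a. s (Pr b c) * (t (Pr a b) * u a))" by (simp add: mult_ac)
  also have "\<dots> = mapp s (mapp t u) c" by (simp add: mapp_def infsum_ennreal_cmult)
  finally show "mapp (mcomp s t) u c = mapp s (mapp t u) c" .
qed

text \<open>The transpose of \<open>t\<close> applied to \<open>y\<close>, that is, the adjoint of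
  \<open>mapp t\<close> for the pairing. It pulls dual vectors back along a morphism.\<close>

definition tr :: "vec \<Rightarrow> vec \<Rightarrow> vec" where
  "tr t y = (\<lambda>a. \<Sum>\<^sub>\<infinity>b. t (Pr a b) * y b)"

lemma pairing_mapp: "pairing (mapp t u) y = pairing u (tr t y)"
proof -
  have "pairing (mapp t u) y = (\<Sum>\<^sub>\<infinity>b. \<Sum>\<^sub>\<infinity>a. t (Pr a b) * u a * y b)"
    by (simp add: pairing_def mapp_def infsum_ennreal_cmult2)
  also have "\<dots> = (\<Sum>\<^sub>\<infinity>a. \<Sum>\<^sub>\<infinity>b. t (Pr a b) * u a * y b)" by (rule infsum_ennreal_swap)
  also have "\<dots> = (\<Sum>\<^sub>\<infinity>a. \<Sum>\<^sub>\<infinity>b. u a * (t (Pr a b) * y b))" by (simp add: mult_ac)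
  also have "\<dots> = pairing u (tr t y)" by (simp add: pairing_def tr_def infsum_ennreal_cmult)
  finally show ?thesis .
qed

lemma pairing_vtensor:
  "pairing (vtensor u v) w = (\<Sum>\<^sub>\<infinity>a. \<Sum>\<^sub>\<infinity>b. u a * v b * w (Pr a b))"
  unfolding pairing_def by (subst infsum_ennreal_Pr) (simp_all, metis mult_zero_left point.exhaust vtensor.simps)

lemma pairing_vtensor_mapp: "pairing (vtensor u v) t = pairing (mapp t u) v"
proof -
  have "pairing (vtensor u v) t = (\<Sum>\<^sub>\<infinity>b. \<Sum>\<^sub>\<infinity>a. u a * v b * t (Pr a b))"
    unfolding pairing_vtensor by (rule infsum_ennreal_swap)
  also have "\<dots> = (\<Sum>\<^sub>\<infinity>b. \<Sum>\<^sub>\<infinity>a. t (Pr a b) * u a * v b)" by (simp add: mult_ac)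
  finally show ?thesis by (simp add: pairing_def mapp_def infsum_ennreal_cmult2)
qed

lemma pairing_vtensor_tr: "pairing (vtensor u v) t = pairing u (tr t v)"
  by (simp add: pairing_vtensor_mapp pairing_mapp)

lemma pairing_vtensor_vtensor:
  "pairing (vtensor u v) (vtensor u' v') = pairing u u' * pairing v v'"
proof -
  have "pairing (vtensor u v) (vtensor u' v') = (\<Sum>\<^sub>\<infinity>a. \<Sum>\<^sub>\<infinity>b. (u a * u' a) * (v b * v' b))"
    by (simp add: pairing_vtensor mult_ac)
  then show ?thesis by (simp add: infsum_ennreal_cmult infsum_ennreal_cmult2 pairing_def)
qed

lemma mapp_vtensor:
  "mapp t (vtensor u v) c = (\<Sum>\<^sub>\<infinity>a. \<Sum>\<^sub>\<infinity>b. t (Pr (Pr a b) c) * (u a * v b))"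
  unfolding mapp_def by (subst infsum_ennreal_Pr) (simp_all, metis mult_zero_right point.exhaust vtensor.simps)

lemma mapp_mtensor: "mapp (mtensor s t) (vtensor u v) = vtensor (mapp s u) (mapp t v)"
proof
  fix c
  show "mapp (mtensor s t) (vtensor u v) c = vtensor (mapp s u) (mapp t v) c"
  proof (cases c)
    case (Pr c d)
    have "mapp (mtensor s t) (vtensor u v) (Pr c d)
        = (\<Sum>\<^sub>\<infinity>a. \<Sum>\<^sub>\<infinity>b. (s (Pr a c) * u a) * (t (Pr b d) * v b))"
      by (simp add: mapp_vtensor mult_ac)
    then show ?thesis by (simp add: infsum_ennreal_cmult infsum_ennreal_cmult2 mapp_def Pr)
  qed (simp_all add: mapp_vtensor)
qed

lemma mapp_scale_mat: "mapp (\<lambda>x. c * t x) u = (\<lambda>b. c * mapp t u b)"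
  by (simp add: mapp_def mult.assoc infsum_ennreal_cmult)

lemma mapp_zero [simp]: "mapp t (\<lambda>_. 0) = (\<lambda>_. 0)"
  by (simp add: mapp_def)

lemma mapp_mono: "(\<And>x. t x \<le> t' x) \<Longrightarrow> (\<And>x. u x \<le> u' x) \<Longrightarrow> mapp t u b \<le> mapp t' u' b"
  unfolding mapp_def by (intro infsum_ennreal_mono mult_mono) auto

lemma mapp_SUP:
  assumes "\<And>x. incseq (\<lambda>n. t n x)" "\<And>x. incseq (\<lambda>n. u n x)"
  shows "mapp (\<lambda>x. SUP n. t n x) (\<lambda>x. SUP n. u n x) b = (SUP n. mapp (t n) (u n) b)"
  unfolding mapp_def using assms
  by (subst infsum_ennreal_SUP[symmetric]) (auto simp: SUP_mult_chain intro!: incseq_mult_ennreal)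

lemma mapp_SUP_vec:
  assumes "\<And>x. incseq (\<lambda>n. u n x)"
  shows "mapp t (\<lambda>x. SUP n. u n x) b = (SUP n. mapp t (u n) b)"
  using mapp_SUP[of "\<lambda>_. t" u b] assms by simp

lemma mapp_SUP_mat:
  assumes "\<And>x. incseq (\<lambda>n. t n x)"
  shows "mapp (\<lambda>x. SUP n. t n x) u b = (SUP n. mapp (t n) u b)"
  using mapp_SUP[of t "\<lambda>_. u" b] assms by simp

lemma mapp_finsum: "mapp t (\<lambda>x. \<Sum>i\<in>I. c i * u i x) = (\<lambda>b. \<Sum>i\<in>I. c i * mapp t (u i) b)"
  unfolding mapp_def
  by (simp add: sum_distrib_left infsum_ennreal_finsum mult.left_commute infsum_ennreal_cmult)

section \<open>Spaces generated by a set of vectors\<close>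

text \<open>As in \<open>pcs_memI\<close>, finiteness comes for free, here from generators that
  charge every point.\<close>

lemma perp_memI:
  assumes "\<And>a. a \<in> W \<Longrightarrow> \<exists>u\<in>G. u a \<noteq> 0" "\<And>a. a \<notin> W \<Longrightarrow> v a = 0"
    "\<And>u. u \<in> G \<Longrightarrow> pairing u v \<le> 1"
  shows "v \<in> perp W G"
proof -
  have "v a < top" for a
  proof (cases "a \<in> W")
    case True
    then obtain u where u: "u \<in> G" "u a \<noteq> 0" using assms by blast
    have "v a * u a \<le> 1" using pairing_ge[of u a v] assms(3)[OF u(1)] by (simp add: mult.commute)
    then show ?thesis using u ennreal_mult_le_1_fin by blast
  qed (simp add: assms)
  then show ?thesis using assms by (auto simp: perp_def vecs_def)
qed

text \<open>Tensor products and exponentials are both of this form, so the space axioms, the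
  construction of morphisms and inclusions are treated once, for generated spaces.\<close>

definition gen :: "point set \<Rightarrow> vec set \<Rightarrow> pcs" where
  "gen W G = \<lparr>web = W, pset = perp W (perp W G)\<rparr>"

text \<open>The last two conditions are positivity of the generators and of their polar. The polar
  is already biorthogonally closed, so nothing else is required for the generated space to be a
  coherence space.\<close>

definition gen_ok :: "point set \<Rightarrow> vec set \<Rightarrow> bool" where
  "gen_ok W G \<longleftrightarrow> G \<subseteq> vecs W \<and> (\<forall>a\<in>W. \<exists>u\<in>G. u a \<noteq> 0) \<and> (\<forall>a\<in>W. \<exists>v\<in>perp W G. v a \<noteq> 0)"

lemma web_gen [simp]: "web (gen W G) = W" by (simp add: gen_def)

lemma gen_mem: "gen_ok W G \<Longrightarrow> u \<in> G \<Longrightarrow> u \<in> pset (gen W G)"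
  using perp_perp_ge[of G W] by (auto simp: gen_def gen_ok_def)

lemma dual_gen: "gen_ok W G \<Longrightarrow> pset (dual (gen W G)) = perp W G"
  by (simp add: pset_dual gen_def gen_ok_def perp_perp_perp)

lemma is_pcs_gen: "gen_ok W G \<Longrightarrow> is_pcs (gen W G)"
  using gen_mem[of W G] dual_gen[of W G]
  by (fastforce simp: is_pcs_def gen_ok_def gen_def pset_dual perp_perp_perp perp_vecs)

lemma gen_dual_memI:
  assumes "gen_ok W G" "\<And>a. a \<notin> W \<Longrightarrow> v a = 0" "\<And>u. u \<in> G \<Longrightarrow> pairing u v \<le> 1"
  shows "v \<in> pset (dual (gen W G))"
  unfolding dual_gen[OF assms(1)] by (rule perp_memI) (use assms in \<open>auto simp: gen_ok_def\<close>)

lemma tensor_web_iff [simp]: "Pr a b \<in> tensor_web A B \<longleftrightarrow> a \<in> A \<and> b \<in> B"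
  by (auto simp: tensor_web_def)

lemma tensor_webE: "x \<in> tensor_web A B \<Longrightarrow> (\<And>a b. x = Pr a b \<Longrightarrow> a \<in> A \<Longrightarrow> b \<in> B \<Longrightarrow> P) \<Longrightarrow> P"
  by (auto simp: tensor_web_def)

lemma mapp_out: "(\<And>x. x \<notin> tensor_web A B \<Longrightarrow> t x = 0) \<Longrightarrow> b \<notin> B \<Longrightarrow> mapp t u b = 0"
  by (simp add: mapp_def)

text \<open>Values on generators suffice. For \<open>y\<close> in the dual of \<open>Z\<close>, the
  bounds on generators say that \<open>tr t y\<close> is orthogonal to all of them, hence it lies in
  the dual of the generated space and is bounded on the whole biorthogonal.\<close>

lemma Pcoh_genI:
  assumes "gen_ok W G" "is_pcs Z" "\<And>x. x \<notin> tensor_web W (web Z) \<Longrightarrow> t x = 0"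
    "\<And>u. u \<in> G \<Longrightarrow> mapp t u \<in> pset Z"
  shows "t \<in> Pcoh (gen W G) Z"
proof -
  have fin: "t x < top" for x
  proof (cases "x \<in> tensor_web W (web Z)")
    case True
    then obtain a b where x: "x = Pr a b" "a \<in> W" "b \<in> web Z" by (auto elim: tensor_webE)
    then obtain u where u: "u \<in> G" "u a \<noteq> 0" using assms(1) by (auto simp: gen_ok_def)
    have "t x * u a \<le> mapp t u b" unfolding x mapp_def by (rule infsum_ennreal_ge[of "\<lambda>a. t (Pr a b) * u a" a])
    also have "\<dots> < top" using assms(2,4) u is_pcs_fin by blast
    finally show ?thesis using u by (metis ennreal_top_mult less_top less_irrefl)
  qed (simp add: assms)
  have "mapp t u \<in> pset Z" if u: "u \<in> pset (gen W G)" for u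
  proof (rule pcs_memI[OF assms(2)])
    fix b assume "b \<notin> web Z" then show "mapp t u b = 0" using assms(3) mapp_out by metis
  next
    fix y assume y: "y \<in> pset (dual Z)"
    have "tr t y \<in> pset (dual (gen W G))"
    proof (rule gen_dual_memI[OF assms(1)])
      fix a assume "a \<notin> W" then show "tr t y a = 0" by (simp add: tr_def assms(3))
    next
      fix u assume "u \<in> G" then show "pairing u (tr t y) \<le> 1"
        using assms(4) y by (simp add: pairing_mapp[symmetric] pairing_le_1[of _ Z])
    qed
    then show "pairing (mapp t u) y \<le> 1" using u pairing_le_1 by (simp add: pairing_mapp)
  qed
  then show ?thesis using fin assms(3) by (auto simp: Pcoh_def vecs_def)
qed

text \<open>A space is generated by its own vectors, which makes facts about generated spaces
  available for arbitrary ones.\<close>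

lemma gen_self: "is_pcs X \<Longrightarrow> gen (web X) (pset X) = X \<and> gen_ok (web X) (pset X)"
  using is_pcs_vecs[of X] by (cases X) (auto simp: gen_def gen_ok_def is_pcs_def)

lemma PcohI:
  assumes "is_pcs X" "is_pcs Z" "\<And>x. x \<notin> tensor_web (web X) (web Z) \<Longrightarrow> t x = 0"
    "\<And>u. u \<in> pset X \<Longrightarrow> mapp t u \<in> pset Z"
  shows "t \<in> Pcoh X Z"
  using Pcoh_genI[of "web X" "pset X" Z t] gen_self[OF assms(1)] assms by auto

lemma Pcoh_mapp: "t \<in> Pcoh X Y \<Longrightarrow> u \<in> pset X \<Longrightarrow> mapp t u \<in> pset Y" by (auto simp: Pcoh_def)
lemma Pcoh_out: "t \<in> Pcoh X Y \<Longrightarrow> x \<notin> tensor_web (web X) (web Y) \<Longrightarrow> t x = 0" by (auto simp: Pcoh_def vecs_def)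

lemma tr_dual:
  assumes "is_pcs X" "t \<in> Pcoh X Y" "y \<in> pset (dual Y)"
  shows "tr t y \<in> pset (dual X)"
proof (rule dual_memI[OF assms(1)])
  fix a assume "a \<notin> web X" then show "tr t y a = 0" using Pcoh_out[OF assms(2)] by (simp add: tr_def)
next
  fix u assume "u \<in> pset X" then show "pairing u (tr t y) \<le> 1"
    using assms by (simp add: pairing_mapp[symmetric] Pcoh_mapp pairing_le_1[of _ Y])
qed

lemma mcomp_out:
  assumes "\<And>x. x \<notin> tensor_web A B \<Longrightarrow> t x = 0" "\<And>x. x \<notin> tensor_web B C \<Longrightarrow> s x = 0" "x \<notin> tensor_web A C"
  shows "mcomp s t x = 0"
proof (cases x)
  case (Pr a c)
  then have "a \<notin> A \<or> c \<notin> C" using assms(3) by simp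
  then have "t (Pr a b) = 0 \<or> s (Pr b c) = 0" for b using assms(1,2) by fastforce
  then show ?thesis unfolding Pr by (auto intro!: infsum_0)
qed simp_all

lemma mcomp_Pcoh:
  assumes "is_pcs X" "is_pcs Z" "t \<in> Pcoh X Y" "s \<in> Pcoh Y Z"
  shows "mcomp s t \<in> Pcoh X Z"
  by (rule PcohI) (use assms in \<open>auto simp: mapp_mcomp intro!: Pcoh_mapp mcomp_out[OF Pcoh_out Pcoh_out]\<close>)

lemma scale_Pcoh:
  assumes "is_pcs X" "is_pcs Y" "t \<in> Pcoh X Y" "c \<le> 1"
  shows "(\<lambda>x. c * t x) \<in> Pcoh X Y"
  by (rule PcohI) (use assms in \<open>auto simp: mapp_scale_mat Pcoh_out intro!: pset_scale Pcoh_mapp\<close>)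

lemma SUP_Pcoh:
  assumes "is_pcs X" "is_pcs Y" "\<And>n. t n \<in> Pcoh X Y" "\<And>x. incseq (\<lambda>n. t n x)"
  shows "(\<lambda>x. SUP n. t n x) \<in> Pcoh X Y"
proof (rule PcohI)
  fix u assume u: "u \<in> pset X"
  have "mapp (\<lambda>x. SUP n. t n x) u = (\<lambda>b. SUP n. mapp (t n) u b)"
    using mapp_SUP_mat[of t u, OF assms(4)] by blast
  also have "\<dots> \<in> pset Y"
    using assms u by (intro pset_SUP) (auto simp: incseq_def intro!: Pcoh_mapp mapp_mono)
  finally show "mapp (\<lambda>x. SUP n. t n x) u \<in> pset Y" .
qed (use assms in \<open>auto simp: Pcoh_out[OF assms(3)]\<close>)

lemma zero_Pcoh: "is_pcs X \<Longrightarrow> is_pcs Y \<Longrightarrow> (\<lambda>_. 0) \<in> Pcoh X Y"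
  by (rule PcohI) (auto simp: mapp_def pset_zero)

section \<open>Tensor product and linear maps\<close>

definition tgen :: "pcs \<Rightarrow> pcs \<Rightarrow> vec set" where
  "tgen X Y = {vtensor u v | u v. u \<in> pset X \<and> v \<in> pset Y}"

lemma pcs_tensor_gen: "pcs_tensor X Y = gen (tensor_web (web X) (web Y)) (tgen X Y)"
  by (simp add: pcs_tensor_def gen_def tgen_def Let_def)

lemma web_tensor [simp]: "web (pcs_tensor X Y) = tensor_web (web X) (web Y)"
  by (simp add: pcs_tensor_gen)

lemma vtensor_out:
  "(\<And>a. a \<notin> A \<Longrightarrow> u a = 0) \<Longrightarrow> (\<And>b. b \<notin> B \<Longrightarrow> v b = 0) \<Longrightarrow> x \<notin> tensor_web A B \<Longrightarrow> vtensor u v x = 0"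
  by (cases x) auto

lemma vtensor_vecs:
  assumes "u \<in> vecs A" "v \<in> vecs B" shows "vtensor u v \<in> vecs (tensor_web A B)"
proof (rule vecsI)
  fix x show "vtensor u v x < top" using assms by (cases x) (auto simp: vecs_def ennreal_mult_less_top)
next
  fix x assume "x \<notin> tensor_web A B" then show "vtensor u v x = 0"
    using assms vtensor_out[of A u B v] by (auto simp: vecs_def)
qed

text \<open>Pairings of pure tensors factor. A pure tensor of dual vectors is therefore in the
  polar, and a suitable one is positive at any given pair.\<close>

lemma tensor_ok:
  assumes "is_pcs X" "is_pcs Y"
  shows "gen_ok (tensor_web (web X) (web Y)) (tgen X Y)"
  unfolding gen_ok_def
proof (intro conjI ballI)
  show sub: "tgen X Y \<subseteq> vecs (tensor_web (web X) (web Y))"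
    using assms is_pcs_vecs vtensor_vecs by (fastforce simp: tgen_def)
  show pos: "\<exists>u\<in>tgen X Y. u x \<noteq> 0" if xw: "x \<in> tensor_web (web X) (web Y)" for x
  proof -
    obtain a b where x: "x = Pr a b" "a \<in> web X" "b \<in> web Y" using xw by (auto elim: tensor_webE)
    obtain u v where "u \<in> pset X" "u a \<noteq> 0" "v \<in> pset Y" "v b \<noteq> 0"
      using x is_pcs_pos assms by meson
    then show ?thesis by (intro bexI[of _ "vtensor u v"]) (auto simp: x tgen_def)
  qed
  show "\<exists>v\<in>perp (tensor_web (web X) (web Y)) (tgen X Y). v x \<noteq> 0" if xw: "x \<in> tensor_web (web X) (web Y)" for x
  proof -
    obtain a b where x: "x = Pr a b" "a \<in> web X" "b \<in> web Y" using xw by (auto elim: tensor_webE)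
    obtain u v where uv: "u \<in> pset (dual X)" "u a \<noteq> 0" "v \<in> pset (dual Y)" "v b \<noteq> 0"
      using x is_pcs_dual_pos assms by meson
    have "vtensor u v \<in> perp (tensor_web (web X) (web Y)) (tgen X Y)"
    proof (rule perp_memI)
      fix y assume "y \<notin> tensor_web (web X) (web Y)"
      then show "vtensor u v y = 0"
        using is_pcs_out[OF is_pcs_dual[OF assms(1)] uv(1)] is_pcs_out[OF is_pcs_dual[OF assms(2)] uv(3)]
        by (intro vtensor_out[of "web X" u "web Y" v]) auto
    next
      fix w assume "w \<in> tgen X Y"
      then show "pairing w (vtensor u v) \<le> 1"
        using uv pairing_le_1 by (auto simp: tgen_def pairing_vtensor_vtensor intro!: mult_le_one)
    qed (use pos in auto)
    then show ?thesis using uv by (intro bexI[of _ "vtensor u v"]) (auto simp: x)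
  qed
qed

lemma is_pcs_tensor: "is_pcs X \<Longrightarrow> is_pcs Y \<Longrightarrow> is_pcs (pcs_tensor X Y)"
  by (simp add: pcs_tensor_gen is_pcs_gen tensor_ok)

lemma vtensor_mem: "is_pcs X \<Longrightarrow> is_pcs Y \<Longrightarrow> u \<in> pset X \<Longrightarrow> v \<in> pset Y \<Longrightarrow> vtensor u v \<in> pset (pcs_tensor X Y)"
  unfolding pcs_tensor_gen by (rule gen_mem[OF tensor_ok]) (auto simp: tgen_def)

lemma Pcoh_tensorI:
  assumes "is_pcs X" "is_pcs Y" "is_pcs Z"
    "\<And>x. x \<notin> tensor_web (tensor_web (web X) (web Y)) (web Z) \<Longrightarrow> t x = 0"
    "\<And>u v. u \<in> pset X \<Longrightarrow> v \<in> pset Y \<Longrightarrow> mapp t (vtensor u v) \<in> pset Z"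
  shows "t \<in> Pcoh (pcs_tensor X Y) Z"
  unfolding pcs_tensor_gen
  by (rule Pcoh_genI[OF tensor_ok]) (use assms in \<open>auto simp: tgen_def\<close>)

lemma dual_tensor:
  "is_pcs X \<Longrightarrow> is_pcs Y \<Longrightarrow> pset (dual (pcs_tensor X Y)) = perp (tensor_web (web X) (web Y)) (tgen X Y)"
  unfolding pcs_tensor_gen by (rule dual_gen[OF tensor_ok])

lemma mtensor_Pcoh:
  assumes "is_pcs X" "is_pcs Y" "is_pcs X'" "is_pcs Y'" "s \<in> Pcoh X X'" "t \<in> Pcoh Y Y'"
  shows "mtensor s t \<in> Pcoh (pcs_tensor X Y) (pcs_tensor X' Y')"
proof (rule Pcoh_tensorI)
  fix x assume x: "x \<notin> tensor_web (tensor_web (web X) (web Y)) (web (pcs_tensor X' Y'))"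
  show "mtensor s t x = 0"
  proof (rule ccontr)
    assume "mtensor s t x \<noteq> 0"
    then obtain a1 a2 b1 b2 where y: "x = Pr (Pr a1 a2) (Pr b1 b2)" "s (Pr a1 b1) \<noteq> 0" "t (Pr a2 b2) \<noteq> 0"
      by (cases "(s, t, x)" rule: mtensor.cases) auto
    then have "Pr a1 b1 \<in> tensor_web (web X) (web X')" "Pr a2 b2 \<in> tensor_web (web Y) (web Y')"
      using Pcoh_out assms(5,6) by blast+
    then show False using x y by auto
  qed
qed (use assms in \<open>auto simp: mapp_mtensor is_pcs_tensor intro!: vtensor_mem Pcoh_mapp\<close>)

lemma web_lin [simp]: "web (pcs_lin X Y) = tensor_web (web X) (web Y)"
  by (simp add: pcs_lin_def)

lemma is_pcs_lin: "is_pcs X \<Longrightarrow> is_pcs Y \<Longrightarrow> is_pcs (pcs_lin X Y)"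
  by (simp add: pcs_lin_def is_pcs_dual is_pcs_tensor)

text \<open>Pairing \<open>t\<close> with the pure tensor of \<open>u\<close> and \<open>v\<close>
  is pairing \<open>mapp t u\<close> with \<open>v\<close>. Orthogonality to all tensors with
  \<open>v\<close> dual to \<open>Y\<close> thus says that \<open>mapp t u\<close> is in the bidual
  of \<open>Y\<close>, which is \<open>Y\<close>.\<close>

lemma pset_lin:
  assumes "is_pcs X" "is_pcs Y"
  shows "pset (pcs_lin X Y) = Pcoh X Y"
proof -
  have "pset (pcs_lin X Y) = perp (tensor_web (web X) (web Y)) (tgen X (dual Y))"
    using dual_tensor[of X "dual Y"] assms by (simp add: pcs_lin_def is_pcs_dual)
  also have "\<dots> = Pcoh X Y"
  proof (intro antisym subsetI)
    fix t assume t: "t \<in> perp (tensor_web (web X) (web Y)) (tgen X (dual Y))"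
    show "t \<in> Pcoh X Y"
    proof (rule PcohI)
      fix x assume "x \<notin> tensor_web (web X) (web Y)" then show "t x = 0" using t perp_vecs vecs_out by blast
    next
      fix u assume u: "u \<in> pset X"
      show "mapp t u \<in> pset Y"
      proof (rule pcs_memI)
        fix b assume "b \<notin> web Y" then show "mapp t u b = 0"
          using t perp_vecs vecs_out mapp_out by (metis (no_types, lifting) in_mono)
      next
        fix v assume "v \<in> pset (dual Y)"
        then have "vtensor u v \<in> tgen X (dual Y)" using u by (auto simp: tgen_def)
        then show "pairing (mapp t u) v \<le> 1" using t by (auto simp: perp_def pairing_vtensor_mapp[symmetric])
      qed (use assms in auto)
    qed (use assms in auto)
  next
    fix t assume t: "t \<in> Pcoh X Y"
    then show "t \<in> perp (tensor_web (web X) (web Y)) (tgen X (dual Y))"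
      by (auto simp: Pcoh_def perp_def tgen_def pairing_vtensor_mapp pairing_le_1[of _ Y])
  qed
  finally show ?thesis .
qed

section \<open>Unit, empty space and coproduct\<close>

lemma is_pcs_empty: "is_pcs pcs_empty"
  by (auto simp: is_pcs_def pcs_empty_def perp_def vecs_def fun_eq_iff)

lemma unit_vec_vecs: "unit_vec \<in> vecs {Star}" by (auto simp: vecs_def unit_vec_def)

lemma pairing_unit: "pairing unit_vec v = v Star"
  unfolding pairing_def by (subst infsum_ennreal_single[of Star]) (auto simp: unit_vec_def)

lemma web_one [simp]: "web pcs_one = {Star}" by (simp add: pcs_one_def)

lemma pset_one: "pset pcs_one = perp {Star} {unit_vec}"
  by (auto simp: pcs_one_def perp_def pairing_unit)

lemma unit_mem: "unit_vec \<in> pset pcs_one" by (auto simp: pset_one perp_def pairing_unit unit_vec_vecs) (simp add: unit_vec_def)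

lemma is_pcs_one: "is_pcs pcs_one"
proof -
  have "unit_vec \<in> perp {Star} (pset pcs_one)"
    by (auto simp: perp_def pset_one unit_vec_vecs pairing_commute[of _ unit_vec] pairing_unit)
  then show ?thesis
    using perp_perp_perp[of "{unit_vec}" "{Star}"] unit_vec_vecs unit_mem
    by (auto simp: is_pcs_def pset_one intro!: bexI[of _ unit_vec]) (auto simp: unit_vec_def)
qed

fun vplus :: "vec \<Rightarrow> vec \<Rightarrow> vec" where
  "vplus u v (PL a) = u a"
| "vplus u v (PR a) = v a"
| "vplus u v _ = 0"

definition lpart :: "vec \<Rightarrow> vec" where "lpart w = (\<lambda>a. w (PL a))"
definition rpart :: "vec \<Rightarrow> vec" where "rpart w = (\<lambda>a. w (PR a))"

lemma parts_vplus [simp]: "lpart (vplus u v) = u" "rpart (vplus u v) = v"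
  by (simp_all add: lpart_def rpart_def)

lemma pairing_vplus: "pairing (vplus m n) w = pairing m (lpart w) + pairing n (rpart w)"
  unfolding pairing_def lpart_def rpart_def
  by (subst infsum_ennreal_LR) (simp_all, metis mult_zero_left point.exhaust vplus.simps)

lemma pnorm_le: "v \<in> pset (dual X) \<Longrightarrow> pairing u v \<le> pnorm X u"
  by (auto simp: pnorm_def intro: SUP_upper)

lemma web_plus [simp]: "web (pcs_plus X Y) = PL ` web X \<union> PR ` web Y" by (simp add: pcs_plus_def)

text \<open>These are the vectors of the cartesian product of the duals, which is the dual of the
  coproduct.\<close>

definition pgen :: "pcs \<Rightarrow> pcs \<Rightarrow> vec set" where
  "pgen X Y = {vplus m n | m n. m \<in> pset (dual X) \<and> n \<in> pset (dual Y)}"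

lemma vplus_vecs: "u \<in> vecs A \<Longrightarrow> v \<in> vecs B \<Longrightarrow> vplus u v \<in> vecs (PL ` A \<union> PR ` B)"
  by (rule vecsI; (case_tac i)?) (auto simp: vecs_def image_iff)

lemma pgen_vecs: "is_pcs X \<Longrightarrow> is_pcs Y \<Longrightarrow> pgen X Y \<subseteq> vecs (PL ` web X \<union> PR ` web Y)"
  using is_pcs_vecs[OF is_pcs_dual[of X]] is_pcs_vecs[OF is_pcs_dual[of Y]] vplus_vecs
  by (fastforce simp: pgen_def)

text \<open>The two norms are suprema over independent dual vectors \<open>m\<close> and
  \<open>n\<close>, so bounding their sum by 1 means bounding every
  \<open>pairing m (lpart w) + pairing n (rpart w)\<close>. Written as a polar, the space is
  biorthogonally closed.\<close>

lemma pset_plus: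
  assumes "is_pcs X" "is_pcs Y"
  shows "pset (pcs_plus X Y) = perp (PL ` web X \<union> PR ` web Y) (pgen X Y)"
proof (intro antisym subsetI)
  fix w assume w: "w \<in> pset (pcs_plus X Y)"
  have "pairing m (lpart w) + pairing n (rpart w) \<le> 1" if "m \<in> pset (dual X)" "n \<in> pset (dual Y)" for m n
  proof -
    have "pairing m (lpart w) + pairing n (rpart w) \<le> pnorm X (lpart w) + pnorm Y (rpart w)"
      using that by (intro add_mono) (simp_all add: pairing_commute[of m] pairing_commute[of n] pnorm_le)
    also have "\<dots> \<le> 1" using w by (auto simp: pcs_plus_def lpart_def rpart_def)
    finally show ?thesis .
  qed
  then show "w \<in> perp (PL ` web X \<union> PR ` web Y) (pgen X Y)"
    using w by (auto simp: pcs_plus_def perp_def pgen_def pairing_vplus)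
next
  fix w assume w: "w \<in> perp (PL ` web X \<union> PR ` web Y) (pgen X Y)"
  have le: "pairing m (lpart w) + pairing n (rpart w) \<le> 1" if "m \<in> pset (dual X)" "n \<in> pset (dual Y)" for m n
  proof -
    have "vplus m n \<in> pgen X Y" using that by (auto simp: pgen_def)
    then show ?thesis using w by (auto simp: perp_def pairing_vplus[symmetric])
  qed
  have wv: "w \<in> vecs (PL ` web X \<union> PR ` web Y)" using w perp_vecs by blast
  have z: "(\<lambda>_. 0) \<in> pset (dual X)" "(\<lambda>_. 0) \<in> pset (dual Y)" using assms by (simp_all add: pset_zero is_pcs_dual)
  have l: "lpart w \<in> pset X"
  proof (rule pcs_memI)
    fix a assume "a \<notin> web X" then show "lpart w a = 0" using wv by (auto simp: lpart_def vecs_def)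
  next
    fix v assume "v \<in> pset (dual X)" then show "pairing (lpart w) v \<le> 1"
      using le[OF _ z(2)] by (simp add: pairing_commute)
  qed (use assms in auto)
  have r: "rpart w \<in> pset Y"
  proof (rule pcs_memI)
    fix a assume "a \<notin> web Y" then show "rpart w a = 0" using wv by (auto simp: rpart_def vecs_def)
  next
    fix v assume "v \<in> pset (dual Y)" then show "pairing (rpart w) v \<le> 1"
      using le[OF z(1)] by (simp add: pairing_commute)
  qed (use assms in auto)
  \<comment> \<open>The two suprema are taken one after the other. Adding a constant commutes with
    the supremum of a nonempty family, and the zero vector shows that the families are
    nonempty.\<close>
  have "pairing (lpart w) m + pnorm Y (rpart w) \<le> 1" if "m \<in> pset (dual X)" for m
    unfolding pnorm_def using z le[OF that]
    by (subst ennreal_SUP_add_right)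
       (auto intro!: SUP_least simp: pairing_commute[of "lpart w"] pairing_commute[of "rpart w"])
  then have "pnorm X (lpart w) + pnorm Y (rpart w) \<le> 1"
    unfolding pnorm_def[of X] using z
    by (subst ennreal_SUP_add_left[symmetric]) (auto intro!: SUP_least)
  then show "w \<in> pset (pcs_plus X Y)" using wv l r by (simp add: pcs_plus_def lpart_def rpart_def)
qed

lemma plus_parts: "w \<in> pset (pcs_plus X Y) \<Longrightarrow> lpart w \<in> pset X \<and> rpart w \<in> pset Y"
  by (simp add: pcs_plus_def lpart_def rpart_def)

lemma vplus_mem_l:
  assumes "is_pcs X" "is_pcs Y" "u \<in> pset X" shows "vplus u (\<lambda>_. 0) \<in> pset (pcs_plus X Y)"
proof -
  have "u \<in> vecs (web X)" "(\<lambda>_. 0) \<in> vecs (web Y)" using assms is_pcs_vecs by (auto simp: vecs_def)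
  then have "vplus u (\<lambda>_. 0) \<in> vecs (PL ` web X \<union> PR ` web Y)" by (rule vplus_vecs)
  then show ?thesis unfolding pset_plus[OF assms(1,2)] using assms pairing_le_1
    by (auto simp: perp_def pgen_def pairing_vplus pairing_commute[of _ u])
qed

lemma vplus_mem_r:
  assumes "is_pcs X" "is_pcs Y" "v \<in> pset Y" shows "vplus (\<lambda>_. 0) v \<in> pset (pcs_plus X Y)"
proof -
  have "v \<in> vecs (web Y)" "(\<lambda>_. 0) \<in> vecs (web X)" using assms is_pcs_vecs by (auto simp: vecs_def)
  then have "vplus (\<lambda>_. 0) v \<in> vecs (PL ` web X \<union> PR ` web Y)" using vplus_vecs by blast
  then show ?thesis unfolding pset_plus[OF assms(1,2)] using assms pairing_le_1
    by (auto simp: perp_def pgen_def pairing_vplus pairing_commute[of _ v])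
qed

lemma is_pcs_plus:
  assumes "is_pcs X" "is_pcs Y"
  shows "is_pcs (pcs_plus X Y)"
proof -
  let ?W = "PL ` web X \<union> PR ` web Y"
  have z: "(\<lambda>_. 0) \<in> pset (dual X)" "(\<lambda>_. 0) \<in> pset (dual Y)" using assms by (simp_all add: pset_zero is_pcs_dual)
  have p: "\<exists>u\<in>pset (pcs_plus X Y). u x \<noteq> 0" if "x \<in> ?W" for x
    using that assms vplus_mem_l[OF assms] vplus_mem_r[OF assms]
    by (auto dest!: is_pcs_pos[OF assms(1)] is_pcs_pos[OF assms(2)]) (metis vplus.simps)+
  have d: "\<exists>v\<in>perp ?W (pset (pcs_plus X Y)). v x \<noteq> 0" if x: "x \<in> ?W" for x
  proof -
    have "\<exists>v\<in>pgen X Y. v x \<noteq> 0"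
      using x
    proof
      assume "x \<in> PL ` web X"
      then obtain a m where "x = PL a" "m \<in> pset (dual X)" "m a \<noteq> 0" using is_pcs_dual_pos[OF assms(1)] by blast
      then show ?thesis using z by (intro bexI[of _ "vplus m (\<lambda>_. 0)"]) (auto simp: pgen_def)
    next
      assume "x \<in> PR ` web Y"
      then obtain a m where "x = PR a" "m \<in> pset (dual Y)" "m a \<noteq> 0" using is_pcs_dual_pos[OF assms(2)] by blast
      then show ?thesis using z by (intro bexI[of _ "vplus (\<lambda>_. 0) m"]) (auto simp: pgen_def)
    qed
    then show ?thesis unfolding pset_plus[OF assms] using perp_perp_ge[OF pgen_vecs[OF assms]] by blast
  qed
  show ?thesis unfolding is_pcs_def using p d perp_perp_perp[OF pgen_vecs[OF assms]]
    by (simp add: pset_plus[OF assms])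
qed

text \<open>A dual vector of \<open>Z\<close>, pulled back along both components, gives an element
  of \<open>pgen X Y\<close>, against which \<open>w\<close> is bounded by 1. The norm condition on
  \<open>w\<close> is what allows the two values to be added.\<close>

lemma copair_mem:
  assumes "is_pcs X" "is_pcs Y" "is_pcs Z" "s \<in> Pcoh X Z" "r \<in> Pcoh Y Z" "w \<in> pset (pcs_plus X Y)"
  shows "(\<lambda>c. mapp s (lpart w) c + mapp r (rpart w) c) \<in> pset Z"
proof (rule pcs_memI)
  fix a assume "a \<notin> web Z"
  then show "mapp s (lpart w) a + mapp r (rpart w) a = 0"
    using mapp_out[OF Pcoh_out[OF assms(4)]] mapp_out[OF Pcoh_out[OF assms(5)]] by simp
next
  fix z assume z: "z \<in> pset (dual Z)"
  then have "vplus (tr s z) (tr r z) \<in> pgen X Y" using tr_dual[of X s Z z] tr_dual[of Y r Z z] assms by (auto simp: pgen_def)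
  then have "pairing (vplus (tr s z) (tr r z)) w \<le> 1" using assms by (auto simp: pset_plus perp_def)
  then show "pairing (\<lambda>c. mapp s (lpart w) c + mapp r (rpart w) c) z \<le> 1"
    by (simp add: pairing_plus pairing_mapp pairing_vplus pairing_commute[of "tr s z"] pairing_commute[of "tr r z"])
qed (use assms in auto)

section \<open>The exponential\<close>

text \<open>As a product over the multiset, a monomial is accessible to induction on
  multisets.\<close>

lemma mpow_prod_mset: "mpow u b = (\<Prod>x\<in>#b. u x)"
  by (simp add: mpow_def image_prod_mset_multiplicity)

lemma mpow_empty [simp]: "mpow u {#} = 1" by (simp add: mpow_prod_mset)
lemma mpow_add_mset [simp]: "mpow u (add_mset a b) = u a * mpow u b" by (simp add: mpow_prod_mset)
lemma mpow_union: "mpow u (b + c) = mpow u b * mpow u c" by (simp add: mpow_prod_mset)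
lemma mpow_replicate: "mpow u (replicate_mset k x) = u x ^ k" by (induction k) auto

lemma mpow_zero: "a \<in># b \<Longrightarrow> u a = 0 \<Longrightarrow> mpow u b = 0"
  by (induction b) auto

lemma mpow_nonzero: "(\<And>a. a \<in># b \<Longrightarrow> u a \<noteq> 0) \<Longrightarrow> mpow u b \<noteq> 0"
  by (induction b) auto

lemma mpow_mult: "mpow (\<lambda>x. u x * v x) b = mpow u b * mpow v b"
  by (induction b) (auto simp: mult_ac)

lemma mpow_mono: "(\<And>a. a \<in># b \<Longrightarrow> u a \<le> v a) \<Longrightarrow> mpow u b \<le> mpow v b"
  by (induction b) (auto intro!: mult_mono)

lemma mpow_fin: "(\<And>a. a \<in># b \<Longrightarrow> u a < top) \<Longrightarrow> mpow u b < top"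
  by (induction b) (auto simp: ennreal_mult_less_top)

lemma mpow_cong: "(\<And>a. a \<in># b \<Longrightarrow> u a = v a) \<Longrightarrow> mpow u b = mpow v b"
  by (induction b) auto

lemma mpow_one: "mpow (\<lambda>_. 1) b = 1"
  by (induction b) auto

lemma mpow_image: "mpow u (image_mset f b) = mpow (\<lambda>x. u (f x)) b"
  by (induction b) auto

lemma incseq_mpow: "(\<And>x. incseq (\<lambda>n. u n x)) \<Longrightarrow> incseq (\<lambda>n. mpow (u n) b)"
  by (auto simp: incseq_def intro!: mpow_mono)

lemma mpow_SUP:
  assumes "\<And>x. incseq (\<lambda>n. u n x)"
  shows "mpow (\<lambda>x. SUP n. u n x) b = (SUP n. mpow (u n) b)"
  by (induction b) (auto simp: SUP_mult_chain assms incseq_mpow)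

lemma bang_web_iff [simp]: "Ms b \<in> bang_web A \<longleftrightarrow> set_mset b \<subseteq> A"
  by (auto simp: bang_web_def)

lemma bang_webE: "x \<in> bang_web A \<Longrightarrow> (\<And>b. x = Ms b \<Longrightarrow> set_mset b \<subseteq> A \<Longrightarrow> P) \<Longrightarrow> P"
  by (auto simp: bang_web_def)

lemma pcs_bang_gen: "pcs_bang X = gen (bang_web (web X)) (prom ` pset X)"
  by (simp add: pcs_bang_def gen_def Let_def)

lemma web_bang [simp]: "web (pcs_bang X) = bang_web (web X)" by (simp add: pcs_bang_gen)

lemma prom_out:
  assumes "\<And>a. a \<notin> A \<Longrightarrow> u a = 0" "x \<notin> bang_web A" shows "prom u x = 0"
  using assms by (cases x) (auto intro: mpow_zero)

lemma pairing_prom: "pairing (prom u) F = (\<Sum>\<^sub>\<infinity>b. mpow u b * F (Ms b))"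
  unfolding pairing_def by (subst infsum_ennreal_Ms) (simp_all, metis mult_zero_left point.exhaust prom.simps)

lemma mapp_prom: "mapp t (prom u) c = (\<Sum>\<^sub>\<infinity>b. t (Pr (Ms b) c) * mpow u b)"
  unfolding mapp_def by (subst infsum_ennreal_Ms) (simp_all, metis mult_zero_right point.exhaust prom.simps)

text \<open>At a multiset \<open>b\<close>, a generator that is positive on the finite support of
  \<open>b\<close> gives positivity, and a suitable multiple of the coefficient functional at
  \<open>b\<close> gives positivity of the polar.\<close>

lemma bang_ok:
  assumes "is_pcs X"
  shows "gen_ok (bang_web (web X)) (prom ` pset X)"
  unfolding gen_ok_def
proof (intro conjI ballI)
  show "prom ` pset X \<subseteq> vecs (bang_web (web X))"
  proof clarify
    fix u assume u: "u \<in> pset X"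
    show "prom u \<in> vecs (bang_web (web X))"
    proof (rule vecsI)
      fix x show "prom u x < top" using u assms is_pcs_fin by (cases x) (auto intro!: mpow_fin)
    next
      fix x assume "x \<notin> bang_web (web X)" then show "prom u x = 0"
        using u assms is_pcs_out prom_out by metis
    qed
  qed
  show pos: "\<exists>u\<in>prom ` pset X. u x \<noteq> 0" if xw: "x \<in> bang_web (web X)" for x
  proof -
    obtain b where b: "x = Ms b" "set_mset b \<subseteq> web X" using xw by (auto elim: bang_webE)
    obtain u where u: "u \<in> pset X" "\<forall>a\<in>set_mset b. u a \<noteq> 0" using pset_finite_pos[OF assms _ b(2)] by auto
    have "prom u x \<noteq> 0" unfolding b prom.simps by (rule mpow_nonzero) (use u in auto)
    then show ?thesis using u by blast
  qed
  show "\<exists>v\<in>perp (bang_web (web X)) (prom ` pset X). v x \<noteq> 0" if xw: "x \<in> bang_web (web X)" for x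
  proof -
    obtain b where b: "x = Ms b" "set_mset b \<subseteq> web X" using xw by (auto elim: bang_webE)
    obtain V where V: "\<And>a. a \<in> web X \<Longrightarrow> V a \<in> pset (dual X) \<and> V a a \<noteq> 0"
      using is_pcs_dual_pos[OF assms] by metis
    \<comment> \<open>The weight at \<open>b\<close> is the product of the entries
      \<open>V a a\<close>. Every \<open>u a * V a a\<close> is at most 1, so the pairing with a
      promotion is a product of numbers at most 1.\<close>
    define m where "m = (\<lambda>y. if y = Ms b then mpow (\<lambda>a. V a a) b else 0)"
    have "m \<in> perp (bang_web (web X)) (prom ` pset X)"
    proof (rule perp_memI)
      fix y assume "y \<notin> bang_web (web X)" then show "m y = 0" using b by (auto simp: m_def)
    next
      fix w assume "w \<in> prom ` pset X"
      then obtain u where u: "u \<in> pset X" "w = prom u" by auto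
      have "pairing w m = mpow u b * mpow (\<lambda>a. V a a) b"
        unfolding pairing_def by (subst infsum_ennreal_single[of "Ms b"]) (auto simp: m_def u)
      also have "\<dots> = mpow (\<lambda>a. u a * V a a) b" by (simp add: mpow_mult)
      also have "\<dots> \<le> mpow (\<lambda>a. 1) b"
      proof (rule mpow_mono)
        fix a assume "a \<in># b"
        then have "V a \<in> pset (dual X)" using V b by auto
        then show "u a * V a a \<le> 1" using pairing_ge[of u a "V a"] pairing_le_1[of u X "V a"] u by simp
      qed
      finally show "pairing w m \<le> 1" by (simp add: mpow_one)
    qed (use pos in auto)
    moreover have "m x \<noteq> 0" unfolding b m_def using V b by (auto intro!: mpow_nonzero)
    ultimately show ?thesis by blast
  qed
qed

lemma is_pcs_bang: "is_pcs X \<Longrightarrow> is_pcs (pcs_bang X)"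
  by (simp add: pcs_bang_gen is_pcs_gen bang_ok)

lemma prom_mem: "is_pcs X \<Longrightarrow> u \<in> pset X \<Longrightarrow> prom u \<in> pset (pcs_bang X)"
  unfolding pcs_bang_gen by (rule gen_mem[OF bang_ok]) auto

lemma Pcoh_bangI:
  assumes "is_pcs X" "is_pcs Z"
    "\<And>x. x \<notin> tensor_web (bang_web (web X)) (web Z) \<Longrightarrow> t x = 0"
    "\<And>u. u \<in> pset X \<Longrightarrow> mapp t (prom u) \<in> pset Z"
  shows "t \<in> Pcoh (pcs_bang X) Z"
  unfolding pcs_bang_gen by (rule Pcoh_genI[OF bang_ok]) (use assms in auto)

text \<open>Each promotion has entry 1 at the empty multiset, so evaluation there is a dual vector.
  The bound limits the weight produced when an argument is discarded.\<close>

lemma bang_empty_le: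
  assumes "is_pcs X" "w \<in> pset (pcs_bang X)" shows "w (Ms {#}) \<le> 1"
proof -
  let ?e = "\<lambda>x. if x = Ms {#} then 1 else 0 :: ennreal"
  have pe: "pairing w ?e = w (Ms {#})" for w
    unfolding pairing_def by (subst infsum_ennreal_single[of "Ms {#}"]) auto
  have "?e \<in> pset (dual (pcs_bang X))"
    unfolding pcs_bang_gen by (rule gen_dual_memI[OF bang_ok[OF assms(1)]]) (auto simp: pe)
  then have "pairing w ?e \<le> 1" by (rule pairing_le_1[OF assms(2)])
  then show ?thesis by (simp only: pe)
qed

section \<open>Separation\<close>

lemma ennreal_mult_cancel_fin: "(x::ennreal) * v = y * v \<Longrightarrow> v \<noteq> 0 \<Longrightarrow> v < top \<Longrightarrow> x = y"
  by (metis ennreal_mult_cancel_left less_irrefl mult.commute)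

text \<open>The classical comparison: drop the common terms below n, divide by \<open>z ^ n\<close>
  and let z tend to 0. The terms of \<open>g\<close> above n contribute at most
  \<open>z ^ Suc n\<close> times the finite sum of the coefficients.\<close>

lemma powser1_le:
  fixes f g :: "nat \<Rightarrow> ennreal"
  assumes eq: "\<And>z. z \<le> 1 \<Longrightarrow> (\<Sum>\<^sub>\<infinity>k. f k * z ^ k) = (\<Sum>\<^sub>\<infinity>k. g k * z ^ k)"
    and fin: "infsum g UNIV < top" and IH: "\<And>k. k < n \<Longrightarrow> f k = g k"
  shows "f n \<le> g n"
proof -
  define C where "C = infsum g UNIV"
  have key: "f n \<le> g n + z * C" if z: "0 < z" "z \<le> 1" for z :: ennreal
  proof -
    \<comment> \<open>The part below n is common to both series by \<open>IH\<close>. It is kept on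
      both sides of the inequalities and cancelled at the end, which is legitimate because it is
      finite.\<close>
    define P where "P = (\<Sum>\<^sub>\<infinity>k. if k < n then f k * z ^ k else 0)"
    have zp: "z ^ k \<le> 1" for k using z by (simp add: power_le_one)
    have "P \<le> C" unfolding P_def C_def
    proof (rule infsum_ennreal_mono)
      fix k show "(if k < n then f k * z ^ k else 0) \<le> g k"
        using IH[of k] mult_left_mono[OF zp[of k], of "g k"] by auto
    qed
    then have Pf: "P < top" using fin by (auto simp: C_def)
    have "f n * z ^ n + P = (\<Sum>\<^sub>\<infinity>k. (if k = n then f k * z ^ k else 0) + (if k < n then f k * z ^ k else 0))"
      by (simp add: infsum_ennreal_plus P_def)
    also have "\<dots> \<le> (\<Sum>\<^sub>\<infinity>k. f k * z ^ k)" by (rule infsum_ennreal_mono) auto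
    also have "\<dots> = (\<Sum>\<^sub>\<infinity>k. g k * z ^ k)" using z eq by simp
    also have "\<dots> \<le> (\<Sum>\<^sub>\<infinity>k. ((if k = n then g k * z ^ k else 0) + (if k < n then f k * z ^ k else 0)) + z ^ Suc n * g k)"
    proof (rule infsum_ennreal_mono)
      fix k
      have "g k * z ^ k \<le> z ^ Suc n * g k" if "k > n"
      proof -
        have "z ^ k \<le> z ^ Suc n" using that z by (intro power_decreasing) auto
        then show ?thesis using mult_left_mono by (metis mult.commute zero_le)
      qed
      then show "g k * z ^ k \<le> ((if k = n then g k * z ^ k else 0) + (if k < n then f k * z ^ k else 0)) + z ^ Suc n * g k"
        using IH[of k] by (cases k n rule: linorder_cases) auto
    qed
    also have "\<dots> = (g n * z ^ n + P) + z ^ Suc n * C"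
      by (simp add: infsum_ennreal_plus infsum_ennreal_cmult P_def C_def del: power_Suc)
    finally have "f n * z ^ n + P \<le> (g n * z ^ n + z ^ Suc n * C) + P" by (simp add: add_ac)
    then have "f n * z ^ n \<le> g n * z ^ n + z ^ Suc n * C"
      using Pf by (metis add.commute ennreal_add_left_cancel_le infinity_ennreal_def less_irrefl)
    also have "\<dots> = (g n + z * C) * z ^ n" by (simp add: distrib_left distrib_right mult_ac)
    finally have l: "z ^ n * f n \<le> z ^ n * (g n + z * C)" by (simp add: mult.commute)
    have "z ^ n \<noteq> 0" "z ^ n \<noteq> top" using z zp[of n] by (auto simp: top_unique)
    then show ?thesis using l by (simp add: ennreal_mult_le_mult_iff)
  qed
  obtain c where c: "C = ennreal c" "c \<ge> 0" using fin unfolding C_def by (metis ennreal_cases less_irrefl)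
  show ?thesis
  proof (rule ennreal_le_epsilon)
    fix e :: real assume e: "0 < e"
    \<comment> \<open>The denominator \<open>c + 1\<close> is positive even when
      \<open>c = 0\<close>, and the minimum with 1 keeps z in the range where the series are known
      to agree.\<close>
    define z where "z = min 1 (e / (c + 1))"
    have z: "0 < z" "z \<le> 1" "z * c \<le> e"
    proof -
      show "0 < z" "z \<le> 1" using e c by (auto simp: z_def)
      have "z * c \<le> e / (c + 1) * c" using c by (intro mult_right_mono) (auto simp: z_def)
      also have "\<dots> \<le> e" using c e by (simp add: field_simps)
      finally show "z * c \<le> e" .
    qed
    have "f n \<le> g n + ennreal z * C" using z by (intro key) auto
    also have "\<dots> \<le> g n + ennreal e" unfolding c using z c
      by (intro add_left_mono) (simp add: ennreal_mult[symmetric] ennreal_leI)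
    finally show "f n \<le> g n + ennreal e" .
  qed
qed

lemma powser1_unique1:
  fixes f g :: "nat \<Rightarrow> ennreal"
  assumes eq: "\<And>z. z \<le> 1 \<Longrightarrow> (\<Sum>\<^sub>\<infinity>k. f k * z ^ k) = (\<Sum>\<^sub>\<infinity>k. g k * z ^ k)"
    and fin: "infsum g UNIV < top"
  shows "f n = g n"
proof (induction n rule: less_induct)
  case (less n)
  have ff: "infsum f UNIV < top" using eq[of 1] fin by simp
  show ?case
    using powser1_le[of f g n, OF eq fin less] powser1_le[of g f n, OF eq[symmetric] ff less[symmetric]] by simp
qed

text \<open>Rescaling the variable by \<open>e\<close> reduces to the unit interval. Division by
  \<open>e ^ n\<close> is possible because \<open>e\<close> is neither 0 nor infinite.\<close>

lemma powser1_unique: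
  fixes f g :: "nat \<Rightarrow> ennreal"
  assumes eq: "\<And>z. z \<le> e \<Longrightarrow> (\<Sum>\<^sub>\<infinity>k. f k * z ^ k) = (\<Sum>\<^sub>\<infinity>k. g k * z ^ k)"
    and fin: "(\<Sum>\<^sub>\<infinity>k. g k * e ^ k) < top" and e: "e \<noteq> 0" "e < top"
  shows "f n = g n"
proof -
  have "f n * e ^ n = g n * e ^ n"
  proof (rule powser1_unique1)
    fix z :: ennreal assume "z \<le> 1"
    then have "e * z \<le> e" by (metis mult_left_mono mult.right_neutral zero_le)
    then show "(\<Sum>\<^sub>\<infinity>k. f k * e ^ k * z ^ k) = (\<Sum>\<^sub>\<infinity>k. g k * e ^ k * z ^ k)"
      using eq[of "e * z"] by (simp add: power_mult_distrib mult.assoc)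
  qed (rule fin)
  moreover have "e ^ n \<noteq> 0" "e ^ n < top" using e by (auto simp: power_less_top_ennreal)
  ultimately show ?thesis by (rule ennreal_mult_cancel_fin)
qed

text \<open>A multiset over \<open>insert x S\<close> is a multiplicity of \<open>x\<close> together
  with a multiset over \<open>S\<close>. This presents a series in several variables as a series in
  \<open>x\<close> whose coefficients are series in the other variables.\<close>

lemma infsum_ennreal_multiset_insert:
  fixes F :: "'a::countable multiset \<Rightarrow> ennreal"
  assumes "x \<notin> S"
  shows "(\<Sum>\<^sub>\<infinity>b. if set_mset b \<subseteq> insert x S then F b else 0) =
    (\<Sum>\<^sub>\<infinity>k. \<Sum>\<^sub>\<infinity>b. if set_mset b \<subseteq> S then F (replicate_mset k x + b) else 0)"
proof -
  have bij: "bij_betw (\<lambda>(k, b). replicate_mset k x + b) (UNIV \<times> {b. set_mset b \<subseteq> S}) {b. set_mset b \<subseteq> insert x S}"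
  proof (rule bij_betw_byWitness[where f'="\<lambda>b. (count b x, filter_mset (\<lambda>y. y \<noteq> x) b)"])
    show "\<forall>a\<in>UNIV \<times> {b. set_mset b \<subseteq> S}.
       (count ((\<lambda>(k, b). replicate_mset k x + b) a) x, filter_mset (\<lambda>y. y \<noteq> x) ((\<lambda>(k, b). replicate_mset k x + b) a)) = a"
    proof (clarsimp, intro conjI)
      fix k b assume b: "set_mset b \<subseteq> S"
      then have "x \<notin># b" using assms by auto
      then show "count b x = 0" by (simp add: not_in_iff)
      have "filter_mset (\<lambda>y. y \<noteq> x) (replicate_mset k x) = {#}" by (induction k) auto
      moreover have "filter_mset (\<lambda>y. y \<noteq> x) b = b" using \<open>x \<notin># b\<close> by (auto simp: filter_mset_eq_conv)
      ultimately show "filter_mset (\<lambda>y. y \<noteq> x) (replicate_mset k x) + filter_mset (\<lambda>y. y \<noteq> x) b = b" by simp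
    qed
    show "\<forall>a'\<in>{b. set_mset b \<subseteq> insert x S}.
       (\<lambda>(k, b). replicate_mset k x + b) (count a' x, filter_mset (\<lambda>y. y \<noteq> x) a') = a'"
      by (auto intro!: multiset_eqI)
    show "(\<lambda>(k, b). replicate_mset k x + b) ` (UNIV \<times> {b. set_mset b \<subseteq> S}) \<subseteq> {b. set_mset b \<subseteq> insert x S}"
      by (auto split: if_splits)
    show "(\<lambda>b. (count b x, filter_mset (\<lambda>y. y \<noteq> x) b)) ` {b. set_mset b \<subseteq> insert x S} \<subseteq> UNIV \<times> {b. set_mset b \<subseteq> S}"
      by auto
  qed
  have "(\<Sum>\<^sub>\<infinity>b. if set_mset b \<subseteq> insert x S then F b else 0) = infsum F {b. set_mset b \<subseteq> insert x S}"
    by (rule infsum_cong_neutral) auto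
  also have "\<dots> = (\<Sum>\<^sub>\<infinity>p\<in>UNIV \<times> {b. set_mset b \<subseteq> S}. F ((\<lambda>(k, b). replicate_mset k x + b) p))"
    by (rule infsum_reindex_bij_betw[OF bij, symmetric])
  also have "\<dots> = (\<Sum>\<^sub>\<infinity>p. case p of (k, b) \<Rightarrow> if set_mset b \<subseteq> S then F (replicate_mset k x + b) else 0)"
    by (rule infsum_cong_neutral) (auto split: if_splits)
  also have "\<dots> = (\<Sum>\<^sub>\<infinity>k. \<Sum>\<^sub>\<infinity>b. if set_mset b \<subseteq> S then F (replicate_mset k x + b) else 0)"
    by (simp add: infsum_ennreal_pair)
  finally show ?thesis .
qed

text \<open>One variable is removed at a time. Finiteness at the single point \<open>e\<close> with
  nonzero entries is enough, since all terms are nonnegative and every compared point is below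
  \<open>e\<close>.\<close>

lemma powser_unique:
  fixes f g :: "'a::countable multiset \<Rightarrow> ennreal"
  assumes "finite S" "\<And>a. a \<in> S \<Longrightarrow> e a \<noteq> 0" "\<And>a. a \<in> S \<Longrightarrow> e a < top"
    "\<And>u. (\<And>a. a \<in> S \<Longrightarrow> u a \<le> e a) \<Longrightarrow>
      (\<Sum>\<^sub>\<infinity>b. if set_mset b \<subseteq> S then f b * mpow u b else 0) = (\<Sum>\<^sub>\<infinity>b. if set_mset b \<subseteq> S then g b * mpow u b else 0)"
    "(\<Sum>\<^sub>\<infinity>b. if set_mset b \<subseteq> S then g b * mpow e b else 0) < top"
    "set_mset b \<subseteq> S"
  shows "f b = g b"
  using assms
proof (induction S arbitrary: f g b rule: finite_induct)
  case empty
  have "(\<Sum>\<^sub>\<infinity>b. if set_mset b \<subseteq> {} then h b * mpow e b else 0) = h {#}" for h :: "'a multiset \<Rightarrow> ennreal"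
    by (subst infsum_ennreal_single[of "{#}"]) auto
  then show ?case using empty.prems(3)[of e] empty.prems(5) by simp
next
  case (insert x S)
  \<comment> \<open>\<open>Fk h k u\<close> is the coefficient of the k-th power of the variable
    \<open>x\<close> in the series of \<open>h\<close>, as a function of the other
    variables.\<close>
  define Fk where "Fk h k u = (\<Sum>\<^sub>\<infinity>b. if set_mset b \<subseteq> S then h (replicate_mset k x + b) * mpow u b else 0)"
    for h :: "'a multiset \<Rightarrow> ennreal" and k u
  have split: "(\<Sum>\<^sub>\<infinity>b. if set_mset b \<subseteq> insert x S then h b * mpow u b else 0) = (\<Sum>\<^sub>\<infinity>k. Fk h k u * u x ^ k)"
    for h :: "'a multiset \<Rightarrow> ennreal" and u
    unfolding infsum_ennreal_multiset_insert[OF insert.hyps(2)] Fk_def infsum_ennreal_cmult2[symmetric]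
    by (intro infsum_cong) (auto simp: mpow_union mpow_replicate mult_ac)
  have FkS: "Fk h k u = Fk h k u'" if "\<And>a. a \<in> S \<Longrightarrow> u a = u' a" for h k u u'
    unfolding Fk_def by (intro infsum_cong) (use that in \<open>auto intro!: arg_cong2[of _ _ _ _ "(*)"] mpow_cong\<close>)
  have Fkm: "Fk h k u \<le> Fk h k u'" if "\<And>a. a \<in> S \<Longrightarrow> u a \<le> u' a" for h k u u'
    unfolding Fk_def by (intro infsum_ennreal_mono) (use that in \<open>auto intro!: mult_left_mono mpow_mono\<close>)
  have fin: "(\<Sum>\<^sub>\<infinity>k. Fk g k e * e x ^ k) < top" using insert.prems(4) by (simp add: split)
  have eq: "Fk f k u = Fk g k u" if u: "\<And>a. a \<in> S \<Longrightarrow> u a \<le> e a" for k u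
  proof (rule powser1_unique[of "e x"])
    fix z assume z: "z \<le> e x"
    let ?u = "u(x := z)"
    have "(\<Sum>\<^sub>\<infinity>k. Fk f k ?u * ?u x ^ k) = (\<Sum>\<^sub>\<infinity>k. Fk g k ?u * ?u x ^ k)"
      unfolding split[symmetric] by (rule insert.prems(3)) (use u z in auto)
    moreover have "Fk h k ?u = Fk h k u" for h k by (rule FkS) (use insert.hyps in auto)
    ultimately show "(\<Sum>\<^sub>\<infinity>k. Fk f k u * z ^ k) = (\<Sum>\<^sub>\<infinity>k. Fk g k u * z ^ k)" by simp
  next
    have "(\<Sum>\<^sub>\<infinity>k. Fk g k u * e x ^ k) \<le> (\<Sum>\<^sub>\<infinity>k. Fk g k e * e x ^ k)"
      by (intro infsum_ennreal_mono mult_right_mono Fkm u) auto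
    then show "(\<Sum>\<^sub>\<infinity>k. Fk g k u * e x ^ k) < top" using fin by (rule le_less_trans)
  qed (use insert.prems in auto)
  have IH: "f (replicate_mset k x + b) = g (replicate_mset k x + b)" if "set_mset b \<subseteq> S" for k b
  proof (rule insert.IH[of "\<lambda>b. f (replicate_mset k x + b)" "\<lambda>b. g (replicate_mset k x + b)"])
    fix u assume "\<And>a. a \<in> S \<Longrightarrow> u a \<le> e a"
    then show "(\<Sum>\<^sub>\<infinity>b. if set_mset b \<subseteq> S then f (replicate_mset k x + b) * mpow u b else 0) =
      (\<Sum>\<^sub>\<infinity>b. if set_mset b \<subseteq> S then g (replicate_mset k x + b) * mpow u b else 0)"
      using eq[of u k] by (simp add: Fk_def)
  next
    \<comment> \<open>A single term of the finite series is finite, and its factor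
      \<open>e x ^ k\<close> is not 0, so the coefficient itself is finite, as the induction
      hypothesis requires.\<close>
    have "Fk g k e * e x ^ k \<le> (\<Sum>\<^sub>\<infinity>k. Fk g k e * e x ^ k)" by (rule infsum_ennreal_ge)
    then have "Fk g k e * e x ^ k < top" using fin by (rule le_less_trans)
    moreover have "e x ^ k \<noteq> 0" using insert.prems(1) by auto
    ultimately have "Fk g k e < top" by (metis ennreal_top_mult less_top)
    then show "(\<Sum>\<^sub>\<infinity>b. if set_mset b \<subseteq> S then g (replicate_mset k x + b) * mpow e b else 0) < top"
      by (simp add: Fk_def)
  qed (use insert.prems that in auto)
  have "b = replicate_mset (count b x) x + filter_mset (\<lambda>y. y \<noteq> x) b" by (auto intro!: multiset_eqI)
  moreover have "set_mset (filter_mset (\<lambda>y. y \<noteq> x) b) \<subseteq> S" using insert.prems(5) by auto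
  ultimately show ?case using IH by metis
qed

section \<open>Separating sets of vectors and uniqueness of morphisms\<close>

definition separating :: "pcs \<Rightarrow> vec set \<Rightarrow> bool" where
  "separating X G \<longleftrightarrow> G \<subseteq> pset X \<and> (\<forall>f\<in>pset (dual X). \<forall>g\<in>pset (dual X).
     (\<forall>u\<in>G. pairing u f = pairing u g) \<longrightarrow> f = g)"

lemma separatingD:
  "separating X G \<Longrightarrow> f \<in> pset (dual X) \<Longrightarrow> g \<in> pset (dual X) \<Longrightarrow> (\<And>u. u \<in> G \<Longrightarrow> pairing u f = pairing u g) \<Longrightarrow> f = g"
  by (auto simp: separating_def)

lemma separating_mono: "separating X G \<Longrightarrow> G \<subseteq> H \<Longrightarrow> H \<subseteq> pset X \<Longrightarrow> separating X H"
  unfolding separating_def by blast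

text \<open>Pairing with a promotion is a power series in the entries of the vector. To compare the
  coefficients at \<open>b\<close>, the vector is restricted to the finite support of
  \<open>b\<close>, which leaves a series in finitely many variables.\<close>

lemma separating_bang:
  assumes X: "is_pcs X" shows "separating (pcs_bang X) (prom ` pset X)"
  unfolding separating_def
proof (intro conjI ballI impI)
  show "prom ` pset X \<subseteq> pset (pcs_bang X)" using prom_mem[OF X] by auto
  fix f g assume f: "f \<in> pset (dual (pcs_bang X))" and g: "g \<in> pset (dual (pcs_bang X))"
    and eq: "\<forall>u\<in>prom ` pset X. pairing u f = pairing u g"
  show "f = g"
  proof
    fix x show "f x = g x"
    proof (cases "x \<in> bang_web (web X)")
      case False
      then show ?thesis using is_pcs_out[OF is_pcs_dual[OF is_pcs_bang[OF X]], of f x]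
          is_pcs_out[OF is_pcs_dual[OF is_pcs_bang[OF X]], of g x] f g by simp
    next
      case True
      then obtain b where b: "x = Ms b" "set_mset b \<subseteq> web X" by (auto elim: bang_webE)
      let ?S = "set_mset b"
      obtain e where e: "e \<in> pset X" "\<forall>a\<in>?S. e a \<noteq> 0" using pset_finite_pos[OF X _ b(2)] by auto
      \<comment> \<open>With all entries outside the support of \<open>b\<close> set to 0, the
        monomials that involve other variables vanish. The restricted vector stays in the space
        because it is below \<open>e\<close>.\<close>
      define cut where "cut u = (\<lambda>a. if a \<in> ?S then u a else 0 :: ennreal)" for u :: vec
      have cut: "cut u \<in> pset X" if "\<And>a. a \<in> ?S \<Longrightarrow> u a \<le> e a" for u
        by (rule pset_down[OF X e(1)]) (use that in \<open>auto simp: cut_def\<close>)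
      have pc: "pairing (prom (cut u)) h = (\<Sum>\<^sub>\<infinity>b. if set_mset b \<subseteq> ?S then h (Ms b) * mpow u b else 0)" for u h
        unfolding pairing_prom
      proof (rule infsum_cong)
        fix c show "mpow (cut u) c * h (Ms c) = (if set_mset c \<subseteq> ?S then h (Ms c) * mpow u c else 0)"
        proof (cases "set_mset c \<subseteq> ?S")
          case True
          then have "mpow (cut u) c = mpow u c" by (intro mpow_cong) (auto simp: cut_def)
          then show ?thesis using True by (simp add: mult.commute)
        next
          case False
          then have "mpow (cut u) c = 0" by (auto simp: cut_def intro: mpow_zero)
          then show ?thesis using False by simp
        qed
      qed
      have "f (Ms b) = g (Ms b)"
      proof (rule powser_unique[of ?S e "\<lambda>b. f (Ms b)" "\<lambda>b. g (Ms b)"])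
        fix u assume "\<And>a. a \<in> ?S \<Longrightarrow> u a \<le> e a"
        then have "cut u \<in> pset X" by (rule cut)
        then show "(\<Sum>\<^sub>\<infinity>b. if set_mset b \<subseteq> ?S then f (Ms b) * mpow u b else 0) =
          (\<Sum>\<^sub>\<infinity>b. if set_mset b \<subseteq> ?S then g (Ms b) * mpow u b else 0)"
          using eq by (simp add: pc[symmetric])
      next
        have "pairing (prom (cut e)) g \<le> 1" using cut[of e] prom_mem[OF X] g pairing_le_1 by blast
        then show "(\<Sum>\<^sub>\<infinity>b. if set_mset b \<subseteq> ?S then g (Ms b) * mpow e b else 0) < top"
          unfolding pc by (rule le_less_trans) simp
      qed (use e is_pcs_fin[OF X] in auto)
      then show ?thesis by (simp add: b)
    qed
  qed
qed

lemma tensor_dual_mapp: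
  assumes "is_pcs X" "is_pcs Y" "F \<in> pset (dual (pcs_tensor X Y))" "u \<in> pset X"
  shows "mapp F u \<in> pset (dual Y)"
proof (rule dual_memI[OF assms(2)])
  have o: "F x = 0" if "x \<notin> tensor_web (web X) (web Y)" for x
    using is_pcs_out[OF is_pcs_dual[OF is_pcs_tensor[OF assms(1,2)]] assms(3)] that by simp
  then show "mapp F u a = 0" if "a \<notin> web Y" for a using mapp_out that by metis
  fix v assume "v \<in> pset Y"
  then have "pairing (vtensor u v) F \<le> 1" using assms vtensor_mem pairing_le_1 by blast
  then show "pairing v (mapp F u) \<le> 1" by (simp add: pairing_vtensor_mapp pairing_commute[of v])
qed

lemma tensor_dual_tr:
  assumes "is_pcs X" "is_pcs Y" "F \<in> pset (dual (pcs_tensor X Y))" "v \<in> pset Y"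
  shows "tr F v \<in> pset (dual X)"
proof (rule dual_memI[OF assms(1)])
  have o: "F x = 0" if "x \<notin> tensor_web (web X) (web Y)" for x
    using is_pcs_out[OF is_pcs_dual[OF is_pcs_tensor[OF assms(1,2)]] assms(3)] that by simp
  then show "tr F v a = 0" if "a \<notin> web X" for a using that by (simp add: tr_def)
  fix u assume "u \<in> pset X"
  then have "pairing (vtensor u v) F \<le> 1" using assms vtensor_mem pairing_le_1 by blast
  then show "pairing u (tr F v) \<le> 1" by (simp add: pairing_vtensor_tr)
qed

text \<open>A column need not be a dual vector, but its multiple by \<open>v b\<close> is, being
  below \<open>tr t v\<close>. Pairing that multiple with \<open>u\<close> yields
  \<open>mapp t u b * v b\<close>, so \<open>G\<close> determines it, and the finite nonzero factor
  cancels.\<close>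

lemma separating_col_eq:
  assumes "is_pcs X" "separating X G" "tr t v \<in> pset (dual X)" "tr t' v \<in> pset (dual X)"
    "v b \<noteq> 0" "v b < top" "\<And>u. u \<in> G \<Longrightarrow> mapp t u b = mapp t' u b"
  shows "t (Pr a b) = t' (Pr a b)"
proof -
  have le: "t (Pr a b) * v b \<le> tr t v a" for t a
    unfolding tr_def by (rule infsum_ennreal_ge)
  have d: "(\<lambda>a. t (Pr a b) * v b) \<in> pset (dual X)" if "tr t v \<in> pset (dual X)" for t
    by (rule pset_down[OF is_pcs_dual[OF assms(1)] that]) (rule le)
  have p: "pairing u (\<lambda>a. t (Pr a b) * v b) = mapp t u b * v b" for u t
    unfolding pairing_def mapp_def infsum_ennreal_cmult2[symmetric] by (simp add: mult_ac)
  have "(\<lambda>a. t (Pr a b) * v b) = (\<lambda>a. t' (Pr a b) * v b)"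
    using separatingD[OF assms(2) d[OF assms(3)] d[OF assms(4)]] assms(7) by (simp add: p)
  then show ?thesis using assms(5,6) ennreal_mult_cancel_fin by meson
qed

text \<open>One factor at a time: for \<open>u\<close> in \<open>G\<close>, the set \<open>H\<close>
  identifies \<open>mapp F u\<close> with \<open>mapp F' u\<close>. Each column of the two matrices
  is then determined by \<open>G\<close>.\<close>

lemma separating_tensor:
  assumes X: "is_pcs X" and Y: "is_pcs Y" and G: "separating X G" and H: "separating Y H"
  shows "separating (pcs_tensor X Y) {vtensor u v | u v. u \<in> G \<and> v \<in> H}"
  unfolding separating_def
proof (intro conjI ballI impI)
  have GX: "G \<subseteq> pset X" "H \<subseteq> pset Y" using G H by (auto simp: separating_def)
  show "{vtensor u v | u v. u \<in> G \<and> v \<in> H} \<subseteq> pset (pcs_tensor X Y)"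
    using GX vtensor_mem[OF X Y] by auto
  fix F F' assume F: "F \<in> pset (dual (pcs_tensor X Y))" and F': "F' \<in> pset (dual (pcs_tensor X Y))"
    and eq: "\<forall>u\<in>{vtensor u v | u v. u \<in> G \<and> v \<in> H}. pairing u F = pairing u F'"
  have m: "mapp F u = mapp F' u" if u: "u \<in> G" for u
  proof (rule separatingD[OF H])
    fix v assume "v \<in> H"
    then have "pairing (vtensor u v) F = pairing (vtensor u v) F'" using eq u by blast
    then show "pairing v (mapp F u) = pairing v (mapp F' u)"
      by (simp add: pairing_vtensor_mapp pairing_commute[of v])
  qed (use u GX tensor_dual_mapp[OF X Y] F F' in auto)
  show "F = F'"
  proof
    fix x show "F x = F' x"
    proof (cases "x \<in> tensor_web (web X) (web Y)")
      case False
      then show ?thesis using is_pcs_out[OF is_pcs_dual[OF is_pcs_tensor[OF X Y]], of F x]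
          is_pcs_out[OF is_pcs_dual[OF is_pcs_tensor[OF X Y]], of F' x] F F' by simp
    next
      case True
      then obtain a b where x: "x = Pr a b" "b \<in> web Y" by (auto elim: tensor_webE)
      obtain v where v: "v \<in> pset Y" "v b \<noteq> 0" using is_pcs_pos[OF Y x(2)] by blast
      show ?thesis unfolding x
        by (rule separating_col_eq[OF X G]) (use v m tensor_dual_tr[OF X Y] F F' is_pcs_fin[OF Y] in auto)
    qed
  qed
qed

lemma separating_Pcoh_eq:
  assumes X: "is_pcs X" and Y: "is_pcs Y" and G: "separating X G" and t: "t \<in> Pcoh X Y" "t' \<in> Pcoh X Y"
    and eq: "\<And>u. u \<in> G \<Longrightarrow> mapp t u = mapp t' u"
  shows "t = t'"
proof
  fix x show "t x = t' x"
  proof (cases "x \<in> tensor_web (web X) (web Y)")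
    case False
    then show ?thesis using t Pcoh_out by metis
  next
    case True
    then obtain a b where x: "x = Pr a b" "b \<in> web Y" by (auto elim: tensor_webE)
    obtain v where v: "v \<in> pset (dual Y)" "v b \<noteq> 0" using is_pcs_dual_pos[OF Y x(2)] by blast
    show ?thesis unfolding x
      by (rule separating_col_eq[OF X G]) (use v eq tr_dual[OF X] t is_pcs_fin[OF is_pcs_dual[OF Y]] in auto)
  qed
qed

section \<open>Bilinear morphisms and the monoidality of the exponential\<close>

section \<open>Structural morphisms of the exponential\<close>

text \<open>A matrix on a tensor product with its first argument fixed at \<open>u\<close>. Besides
  checking bilinear maps one argument at a time, it is the denotation of an abstraction in a context
  with value \<open>u\<close>.\<close>

fun rowfix :: "vec \<Rightarrow> vec \<Rightarrow> vec" where
  "rowfix t u (Pr b c) = (\<Sum>\<^sub>\<infinity>a. t (Pr (Pr a b) c) * u a)"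
| "rowfix t u _ = 0"

fun colfix :: "vec \<Rightarrow> vec \<Rightarrow> vec" where
  "colfix t v (Pr a c) = (\<Sum>\<^sub>\<infinity>b. t (Pr (Pr a b) c) * v b)"
| "colfix t v _ = 0"

lemma mapp_rowfix: "mapp (rowfix t u) v = mapp t (vtensor u v)"
proof
  fix c
  have "mapp (rowfix t u) v c = (\<Sum>\<^sub>\<infinity>b. \<Sum>\<^sub>\<infinity>a. t (Pr (Pr a b) c) * u a * v b)"
    unfolding mapp_def by (simp add: infsum_ennreal_cmult2)
  also have "\<dots> = (\<Sum>\<^sub>\<infinity>a. \<Sum>\<^sub>\<infinity>b. t (Pr (Pr a b) c) * u a * v b)" by (rule infsum_ennreal_swap)
  finally show "mapp (rowfix t u) v c = mapp t (vtensor u v) c" by (simp add: mapp_vtensor mult.assoc)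
qed

lemma mapp_colfix: "mapp (colfix t v) u = mapp t (vtensor u v)"
proof
  fix c
  have "mapp (colfix t v) u c = (\<Sum>\<^sub>\<infinity>a. \<Sum>\<^sub>\<infinity>b. t (Pr (Pr a b) c) * v b * u a)"
    unfolding mapp_def by (simp add: infsum_ennreal_cmult2)
  then show "mapp (colfix t v) u c = mapp t (vtensor u v) c" by (simp add: mapp_vtensor mult_ac)
qed

text \<open>With a generator fixed in one argument, the other argument extends from generators to
  the whole space. The roles are then exchanged.\<close>

lemma Pcoh_tensor_genI:
  assumes ok: "gen_ok W G" "gen_ok W' H" and Z: "is_pcs Z"
    and out: "\<And>x. x \<notin> tensor_web (tensor_web W W') (web Z) \<Longrightarrow> t x = 0"
    and gens: "\<And>u v. u \<in> G \<Longrightarrow> v \<in> H \<Longrightarrow> mapp t (vtensor u v) \<in> pset Z"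
  shows "t \<in> Pcoh (pcs_tensor (gen W G) (gen W' H)) Z"
proof (rule Pcoh_tensorI)
  show P: "is_pcs (gen W G)" "is_pcs (gen W' H)" using ok is_pcs_gen by auto
  have 1: "mapp t (vtensor u v) \<in> pset Z" if u: "u \<in> G" and v: "v \<in> pset (gen W' H)" for u v
  proof -
    have "rowfix t u \<in> Pcoh (gen W' H) Z"
    proof (rule Pcoh_genI[OF ok(2) Z])
      fix x assume "x \<notin> tensor_web W' (web Z)"
      then show "rowfix t u x = 0" by (cases x) (auto intro!: infsum_0 out)
    qed (use u gens in \<open>simp add: mapp_rowfix\<close>)
    then show ?thesis using v Pcoh_mapp by (metis mapp_rowfix)
  qed
  show "mapp t (vtensor u v) \<in> pset Z" if u: "u \<in> pset (gen W G)" and v: "v \<in> pset (gen W' H)" for u v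
  proof -
    have "colfix t v \<in> Pcoh (gen W G) Z"
    proof (rule Pcoh_genI[OF ok(1) Z])
      fix x assume "x \<notin> tensor_web W (web Z)"
      then show "colfix t v x = 0" by (cases x) (auto intro!: infsum_0 out)
    qed (use v 1 in \<open>simp add: mapp_colfix\<close>)
    then show ?thesis using u Pcoh_mapp by (metis mapp_colfix)
  qed
qed (use Z out in auto)

text \<open>The default \<open>Star\<close> is immaterial: multisets are projected only when they
  lie over a tensor web, all of whose points are pairs.\<close>

definition fstP :: "point \<Rightarrow> point" where "fstP x = (case x of Pr a b \<Rightarrow> a | _ \<Rightarrow> Star)"
definition sndP :: "point \<Rightarrow> point" where "sndP x = (case x of Pr a b \<Rightarrow> b | _ \<Rightarrow> Star)"

lemma fstP_sndP [simp]: "fstP (Pr a b) = a" "sndP (Pr a b) = b" by (simp_all add: fstP_def sndP_def)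

lemma tensor_web_P: "x \<in> tensor_web A B \<Longrightarrow> fstP x \<in> A" "x \<in> tensor_web A B \<Longrightarrow> sndP x \<in> B"
  by (auto simp: tensor_web_def)

text \<open>The explicit matrix of the monoidality morphism: a multiset of pairs receives weight 1
  from its two marginals, because a monomial of a pure tensor is the product of the monomials of the
  marginals.\<close>

fun monm :: "pcs \<Rightarrow> pcs \<Rightarrow> vec" where
  "monm X Y (Pr (Pr a b) (Ms d)) =
     (if set_mset d \<subseteq> tensor_web (web X) (web Y) \<and> a = Ms (image_mset fstP d) \<and> b = Ms (image_mset sndP d)
      then 1 else 0)"
| "monm X Y _ = 0"

lemma mpow_vtensor:
  assumes "set_mset d \<subseteq> tensor_web A B"
  shows "mpow (vtensor u v) d = mpow u (image_mset fstP d) * mpow v (image_mset sndP d)"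
  using assms by (induction d) (auto elim!: tensor_webE simp: mult_ac)

lemma monm_prom:
  assumes "\<And>a. a \<notin> web X \<Longrightarrow> u a = 0" "\<And>a. a \<notin> web Y \<Longrightarrow> v a = 0"
  shows "mapp (monm X Y) (vtensor (prom u) (prom v)) = prom (vtensor u v)"
proof
  fix x
  show "mapp (monm X Y) (vtensor (prom u) (prom v)) x = prom (vtensor u v) x"
  proof (cases x)
    case (Ms d)
    let ?A = "Ms (image_mset fstP d)" and ?B = "Ms (image_mset sndP d)"
    show ?thesis
    proof (cases "set_mset d \<subseteq> tensor_web (web X) (web Y)")
      case True
      have "mapp (monm X Y) (vtensor (prom u) (prom v)) (Ms d) =
        (\<Sum>\<^sub>\<infinity>a. \<Sum>\<^sub>\<infinity>b. (if a = ?A \<and> b = ?B then 1 else 0) * (prom u a * prom v b))"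
        unfolding mapp_vtensor using True by simp
      also have "\<dots> = (\<Sum>\<^sub>\<infinity>b. (if ?A = ?A \<and> b = ?B then 1 else 0) * (prom u ?A * prom v b))"
        by (rule infsum_ennreal_single) simp
      also have "\<dots> = prom u ?A * prom v ?B"
        by (subst infsum_ennreal_single[of ?B]) auto
      finally show ?thesis using True by (simp add: Ms mpow_vtensor)
    next
      case False
      then obtain y where "y \<in># d" "y \<notin> tensor_web (web X) (web Y)" by auto
      then have "mpow (vtensor u v) d = 0" using vtensor_out[of "web X" u "web Y" v y, OF assms] mpow_zero[of y d "vtensor u v"] by blast
      then show ?thesis using False by (simp add: Ms mapp_vtensor)
    qed
  qed (simp_all add: mapp_vtensor)
qed

text \<open>The description in \<open>mon\<close> has at most one solution because promotions
  separate an exponential and tensors of separating sets separate the tensor product.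
  \<open>monm\<close> is a solution.\<close>

lemma mon_eq:
  assumes X: "is_pcs X" and Y: "is_pcs Y"
  shows "mon X Y = monm X Y"
    and "monm X Y \<in> Pcoh (pcs_tensor (pcs_bang X) (pcs_bang Y)) (pcs_bang (pcs_tensor X Y))"
proof -
  have XY: "is_pcs (pcs_tensor X Y)" using X Y by (rule is_pcs_tensor)
  have pr: "mapp (monm X Y) (vtensor (prom u) (prom v)) = prom (vtensor u v)" if "u \<in> pset X" "v \<in> pset Y" for u v
    by (rule monm_prom) (use that X Y is_pcs_out in auto)
  show m: "monm X Y \<in> Pcoh (pcs_tensor (pcs_bang X) (pcs_bang Y)) (pcs_bang (pcs_tensor X Y))"
    unfolding pcs_bang_gen[of X] pcs_bang_gen[of Y]
  proof (rule Pcoh_tensor_genI)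
    fix x assume x: "x \<notin> tensor_web (tensor_web (bang_web (web X)) (bang_web (web Y))) (web (pcs_bang (pcs_tensor X Y)))"
    show "monm X Y x = 0"
    proof (rule ccontr)
      assume nz: "monm X Y x \<noteq> 0"
      then obtain a b d where y: "x = Pr (Pr a b) (Ms d)" "set_mset d \<subseteq> tensor_web (web X) (web Y)"
         "a = Ms (image_mset fstP d)" "b = Ms (image_mset sndP d)"
        by (cases "(X, Y, x)" rule: monm.cases) (auto split: if_splits)
      then have "fstP ` set_mset d \<subseteq> web X" "sndP ` set_mset d \<subseteq> web Y" using tensor_web_P by blast+
      then show False using x y by auto
    qed
  qed (use X Y XY bang_ok is_pcs_bang prom_mem vtensor_mem in \<open>auto simp: pr\<close>)
  show "mon X Y = monm X Y"
    unfolding mon_def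
  proof (rule the_equality)
    fix m assume a: "m \<in> Pcoh (pcs_tensor (pcs_bang X) (pcs_bang Y)) (pcs_bang (pcs_tensor X Y)) \<and>
     (\<forall>u\<in>pset X. \<forall>v\<in>pset Y. mapp m (vtensor (prom u) (prom v)) = prom (vtensor u v))"
    show "m = monm X Y"
      by (rule separating_Pcoh_eq[OF _ _ separating_tensor[OF _ _ separating_bang[OF X] separating_bang[OF Y]] conjunct1[OF a] m])
         (use a X Y XY is_pcs_bang is_pcs_tensor pr in auto)
  qed (use m pr in auto)
qed

section \<open>Functoriality of the exponential and the multinomial expansion\<close>

lemma mfact_add_mset: "mfact (add_mset a b) = Suc (count b a) * mfact b"
proof (cases "a \<in># b")
  case True
  have "mfact (add_mset a b) = (\<Prod>x\<in>set_mset b. fact (count (add_mset a b) x))"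
    using True by (simp add: mfact_def insert_absorb)
  also have "\<dots> = fact (Suc (count b a)) * (\<Prod>x\<in>set_mset b - {a}. fact (count (add_mset a b) x))"
    using True by (simp add: prod.remove)
  also have "(\<Prod>x\<in>set_mset b - {a}. fact (count (add_mset a b) x)) = (\<Prod>x\<in>set_mset b - {a}. fact (count b x))"
    by (rule prod.cong) auto
  also have "fact (Suc (count b a)) * (\<Prod>x\<in>set_mset b - {a}. fact (count b x)) =
     Suc (count b a) * (fact (count b a) * (\<Prod>x\<in>set_mset b - {a}. fact (count b x)))"
    by (simp only: fact_Suc mult.assoc of_nat_id)
  also have "fact (count b a) * (\<Prod>x\<in>set_mset b - {a}. fact (count b x)) = mfact b"
    unfolding mfact_def using True by (simp add: prod.remove[of _ a])
  finally show ?thesis .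
next
  case False
  then have "mfact (add_mset a b) = fact (count (add_mset a b) a) * (\<Prod>x\<in>set_mset b. fact (count (add_mset a b) x))"
    by (simp add: mfact_def)
  also have "(\<Prod>x\<in>set_mset b. fact (count (add_mset a b) x)) = mfact b"
    unfolding mfact_def by (rule prod.cong) (use False in auto)
  finally show ?thesis using False by (simp add: not_in_iff)
qed

lemma mfact_empty [simp]: "mfact {#} = 1" by (simp add: mfact_def)
lemma mfact_pos: "mfact b > 0" by (simp add: mfact_def)

lemma infsum_ennreal_count_snd:
  fixes r :: "('a::countable \<times> 'b) multiset"
  shows "(\<Sum>\<^sub>\<infinity>a. of_nat (count r (a, b)) :: ennreal) = of_nat (count (image_mset snd r) b)"
proof (induction r)
  case (add p r)
  obtain a' b' where p: "p = (a', b')" by force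
  have "(\<Sum>\<^sub>\<infinity>a. of_nat (count (add_mset p r) (a, b)) :: ennreal) =
    (\<Sum>\<^sub>\<infinity>a. (if a = a' then (if b' = b then 1 else 0) else 0) + of_nat (count r (a, b)))"
    by (intro infsum_cong) (auto simp: p)
  also have "\<dots> = (if b' = b then 1 else 0) + of_nat (count (image_mset snd r) b)"
    unfolding infsum_ennreal_plus add.IH by simp
  finally show ?case by (simp add: p)
qed simp

lemma of_nat_divide_ennreal: "k > 0 \<Longrightarrow> (of_nat m / of_nat k :: ennreal) = ennreal (real m / real k)"
  by (simp add: ennreal_of_nat_eq_real_of_nat divide_ennreal)

text \<open>By induction on d: removing one occurrence of a pair (a, b) from r multiplies the coefficient by
  the multiplicity of (a, b), and these multiplicities add up to that of b in d.\<close>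

lemma multinomial:
  fixes x :: "('a::countable \<times> 'b::countable) \<Rightarrow> ennreal"
  shows "(\<Sum>\<^sub>\<infinity>r. if image_mset snd r = d then of_nat (mfact d) / of_nat (mfact r) * mpow x r else 0)
    = mpow (\<lambda>b. \<Sum>\<^sub>\<infinity>a. x (a, b)) d"
proof (induction d)
  case empty
  show ?case by (subst infsum_ennreal_single[of "{#}"]) auto
next
  case (add b0 d)
  define W where "W d r = (if image_mset snd r = d then of_nat (mfact d) / of_nat (mfact r) * mpow x r else 0 :: ennreal)"
    for d r
  have step: "W (add_mset b0 d) r =
     (\<Sum>\<^sub>\<infinity>a. if (a, b0) \<in># r then W d (r - {#(a, b0)#}) * x (a, b0) else 0)" for r
  proof (cases "image_mset snd r = add_mset b0 d")
    case True
    have c: "count (image_mset snd r) b0 = Suc (count d b0)" by (simp add: True)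
    have one: "(if (a, b0) \<in># r then W d (r - {#(a, b0)#}) * x (a, b0) else 0) =
       of_nat (count r (a, b0)) * (ennreal (real (mfact d) / real (mfact r)) * mpow x r)" for a
    proof (cases "(a, b0) \<in># r")
      case in_r: True
      define r' where "r' = r - {#(a, b0)#}"
      have r: "r = add_mset (a, b0) r'" using in_r by (simp add: r'_def)
      have s: "image_mset snd r' = d" using True by (simp add: r)
      have f: "real (mfact r) = real (count r (a, b0)) * real (mfact r')"
        unfolding r mfact_add_mset by (simp add: algebra_simps)
      have cp: "count r (a, b0) > 0" using in_r by simp
      have "real (mfact d) / real (mfact r') = real (count r (a, b0)) * (real (mfact d) / real (mfact r))"
        unfolding f using cp mfact_pos[of r'] by (simp add: field_simps)
      then have "ennreal (real (mfact d) / real (mfact r')) = of_nat (count r (a, b0)) * ennreal (real (mfact d) / real (mfact r))"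
        by (simp only: ennreal_of_nat_eq_real_of_nat) (rule ennreal_mult', simp)
      moreover have "mpow x r = x (a, b0) * mpow x r'" by (simp add: r)
      ultimately have "W d r' * x (a, b0) =
          of_nat (count r (a, b0)) * (ennreal (real (mfact d) / real (mfact r)) * mpow x r)"
        using s by (simp add: W_def of_nat_divide_ennreal[OF mfact_pos] mult_ac)
      then show ?thesis using in_r by (simp add: r'_def)
    qed (auto simp: count_eq_zero_iff)
    have "(\<Sum>\<^sub>\<infinity>a. if (a, b0) \<in># r then W d (r - {#(a, b0)#}) * x (a, b0) else 0) =
      of_nat (Suc (count d b0)) * (ennreal (real (mfact d) / real (mfact r)) * mpow x r)"
      unfolding one infsum_ennreal_cmult2 infsum_ennreal_count_snd c by simp
    also have "\<dots> = ennreal (real (Suc (count d b0)) * (real (mfact d) / real (mfact r))) * mpow x r"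
      by (simp only: ennreal_of_nat_eq_real_of_nat ennreal_mult' of_nat_0_le_iff mult.assoc)
    also have "\<dots> = W (add_mset b0 d) r"
      unfolding W_def if_P[OF True] of_nat_divide_ennreal[OF mfact_pos]
      by (simp only: mfact_add_mset of_nat_mult times_divide_eq_right)
    finally show ?thesis by simp
  next
    case False
    have "(if (a, b0) \<in># r then W d (r - {#(a, b0)#}) * x (a, b0) else 0) = 0" for a
    proof (cases "(a, b0) \<in># r")
      case True
      then obtain r' where r: "r = add_mset (a, b0) r'" by (metis insert_DiffM)
      then have "image_mset snd r' \<noteq> d" using False by auto
      then show ?thesis by (simp add: r W_def)
    qed simp
    then show ?thesis using False by (simp add: W_def)
  qed
  have "(\<Sum>\<^sub>\<infinity>r. W (add_mset b0 d) r) =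
    (\<Sum>\<^sub>\<infinity>a. \<Sum>\<^sub>\<infinity>r. if (a, b0) \<in># r then W d (r - {#(a, b0)#}) * x (a, b0) else 0)"
    unfolding step by (rule infsum_ennreal_swap)
  also have "\<dots> = (\<Sum>\<^sub>\<infinity>a. \<Sum>\<^sub>\<infinity>r. W d r * x (a, b0))"
  proof (rule infsum_cong)
    fix a
    have "(\<Sum>\<^sub>\<infinity>r. if (a, b0) \<in># r then W d (r - {#(a, b0)#}) * x (a, b0) else 0) =
      (\<Sum>\<^sub>\<infinity>r. if (a, b0) \<in># add_mset (a, b0) r then W d (add_mset (a, b0) r - {#(a, b0)#}) * x (a, b0) else 0)"
      by (rule infsum_ennreal_neutral_reindex) (auto simp: inj_def, metis insert_DiffM rangeI)
    then show "(\<Sum>\<^sub>\<infinity>r. if (a, b0) \<in># r then W d (r - {#(a, b0)#}) * x (a, b0) else 0) = (\<Sum>\<^sub>\<infinity>r. W d r * x (a, b0))"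
      by simp
  qed
  also have "\<dots> = (\<Sum>\<^sub>\<infinity>r. W d r) * (\<Sum>\<^sub>\<infinity>a. x (a, b0))" by (simp add: infsum_ennreal_cmult infsum_ennreal_cmult2)
  also have "(\<Sum>\<^sub>\<infinity>r. W d r) = mpow (\<lambda>b. \<Sum>\<^sub>\<infinity>a. x (a, b)) d" unfolding W_def by (rule add.IH)
  finally show ?case by (simp add: W_def mult.commute)
qed

lemma mbang_suminf:
  "mbang t (Pr (Ms c) (Ms d)) =
     (\<Sum>\<^sub>\<infinity>r. if image_mset fst r = c \<and> image_mset snd r = d
        then of_nat (mfact d) / of_nat (mfact r) * mpow (\<lambda>(a, b). t (Pr a b)) r else 0)"
  unfolding mbang.simps by (rule infsum_cong_neutral) auto

text \<open>The factor \<open>d! / r!\<close> is the multinomial coefficient in the expansion of the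
  product over \<open>d\<close> of the sums defining the entries of \<open>mapp t u\<close>.\<close>

lemma mbang_prom: "mapp (mbang t) (prom u) = prom (mapp t u)"
proof
  fix x
  show "mapp (mbang t) (prom u) x = prom (mapp t u) x"
  proof (cases x)
    case (Ms d)
    let ?k = "\<lambda>r :: (point \<times> point) multiset. of_nat (mfact d) / of_nat (mfact r) :: ennreal"
    let ?m = "\<lambda>r. mpow (\<lambda>(a, b). t (Pr a b)) r"
    have "mapp (mbang t) (prom u) (Ms d) =
      (\<Sum>\<^sub>\<infinity>c. \<Sum>\<^sub>\<infinity>r. (if image_mset fst r = c \<and> image_mset snd r = d then ?k r * ?m r else 0) * mpow u c)"
      unfolding mapp_prom mbang_suminf infsum_ennreal_cmult2 ..
    \<comment> \<open>After the exchange only one \<open>c\<close> contributes for each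
      \<open>r\<close>, namely its first marginal. The monomial of \<open>u\<close> at
      \<open>c\<close> then merges with the one of \<open>t\<close> at \<open>r\<close>.\<close>
    also have "\<dots> = (\<Sum>\<^sub>\<infinity>r. \<Sum>\<^sub>\<infinity>c. (if image_mset fst r = c \<and> image_mset snd r = d then ?k r * ?m r else 0) * mpow u c)"
      by (rule infsum_ennreal_swap)
    also have "\<dots> = (\<Sum>\<^sub>\<infinity>r. if image_mset snd r = d then ?k r * mpow (\<lambda>(a, b). t (Pr a b) * u a) r else 0)"
    proof (rule infsum_cong)
      fix r :: "(point \<times> point) multiset"
      have e: "mpow (\<lambda>(a, b). t (Pr a b) * u a) r = ?m r * mpow u (image_mset fst r)"
        unfolding mpow_image mpow_mult[symmetric] by (rule arg_cong[of _ _ "\<lambda>f. mpow f r"]) auto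
      show "(\<Sum>\<^sub>\<infinity>c. (if image_mset fst r = c \<and> image_mset snd r = d then ?k r * ?m r else 0) * mpow u c) =
        (if image_mset snd r = d then ?k r * mpow (\<lambda>(a, b). t (Pr a b) * u a) r else 0)"
        by (subst infsum_ennreal_single[of "image_mset fst r"]) (auto simp: e mult.assoc)
    qed
    also have "\<dots> = mpow (\<lambda>b. \<Sum>\<^sub>\<infinity>a. (\<lambda>(a, b). t (Pr a b) * u a) (a, b)) d" by (rule multinomial)
    finally show ?thesis by (simp add: Ms mapp_def)
  qed (simp_all add: mapp_prom)
qed

lemma mbang_out:
  assumes "\<And>x. x \<notin> tensor_web A B \<Longrightarrow> t x = 0" "x \<notin> tensor_web (bang_web A) (bang_web B)"
  shows "mbang t x = 0"
proof (cases "\<exists>c d. x = Pr (Ms c) (Ms d)")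
  case True
  then obtain c d where x: "x = Pr (Ms c) (Ms d)" by blast
  have "mpow (\<lambda>(a, b). t (Pr a b)) r = 0" if r: "image_mset fst r = c \<and> image_mset snd r = d" for r
  proof -
    have "\<not> fst ` set_mset r \<subseteq> A \<or> \<not> snd ` set_mset r \<subseteq> B"
      using assms(2) r unfolding x by auto
    then obtain a b where "(a, b) \<in># r" "a \<notin> A \<or> b \<notin> B" by fastforce
    then show ?thesis using assms(1) by (intro mpow_zero[of "(a, b)"]) auto
  qed
  then show ?thesis unfolding x mbang_suminf by (auto intro!: infsum_0)
next
  case False
  then show ?thesis by (cases "(t, x)" rule: mbang.cases) auto
qed

lemma mbang_Pcoh:
  assumes "is_pcs X" "is_pcs Y" "t \<in> Pcoh X Y"
  shows "mbang t \<in> Pcoh (pcs_bang X) (pcs_bang Y)"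
  by (rule Pcoh_bangI)
     (use assms in \<open>auto simp: mbang_prom is_pcs_bang intro!: prom_mem Pcoh_mapp mbang_out[OF Pcoh_out[OF assms(3)]]\<close>)

section \<open>Digging and dereliction on promotions\<close>

lemma mpow_prom_image: "mpow (prom u) (image_mset Ms bs) = mpow u (\<Sum>\<^sub># bs)"
  by (induction bs) (auto simp: mpow_union)

lemma image_Ms_cases: "(\<exists>bs. B = image_mset Ms bs) \<or> (\<exists>x\<in>#B. \<forall>b. x \<noteq> Ms b)"
proof (induction B)
  case (add x B)
  show ?case
  proof (cases "\<exists>b. x = Ms b")
    case True
    then show ?thesis using add by (metis image_mset_add_mset union_iff insert_iff set_mset_add_mset_insert)
  qed auto
qed simp

lemma image_Ms_inject: "image_mset Ms bs = image_mset Ms cs \<Longrightarrow> bs = cs"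
proof -
  assume a: "image_mset Ms bs = image_mset Ms cs"
  have "image_mset (\<lambda>x. case x of Ms b \<Rightarrow> b) (image_mset Ms bs) = bs" for bs
    by (simp add: multiset.map_comp o_def)
  then show ?thesis using a by metis
qed

text \<open>For a multiset of multisets \<open>bs\<close>, digging reads the entry of
  \<open>prom u\<close> at their sum, and the monomial at a sum is the product of the monomials. At
  a multiset with an element that is not itself a multiset both sides vanish.\<close>

lemma dig_prom:
  assumes "\<And>a. a \<notin> web X \<Longrightarrow> u a = 0"
  shows "mapp (dig X) (prom u) = prom (prom u)"
proof
  fix x show "mapp (dig X) (prom u) x = prom (prom u) x"
  proof (cases x)
    case (Ms B)
    show ?thesis
    proof (cases "\<exists>bs. B = image_mset Ms bs")
      case True
      then obtain bs where B: "B = image_mset Ms bs" by blast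
      have d: "dig X (Pr (Ms b) (Ms B)) = (if b = \<Sum>\<^sub># bs \<and> set_mset b \<subseteq> web X then 1 else 0)" for b
        unfolding B using image_Ms_inject by auto
      have "mapp (dig X) (prom u) (Ms B) = (if set_mset (\<Sum>\<^sub># bs) \<subseteq> web X then 1 else 0) * mpow u (\<Sum>\<^sub># bs)"
        unfolding mapp_prom d by (subst infsum_ennreal_single[of "\<Sum>\<^sub># bs"]) auto
      also have "\<dots> = mpow u (\<Sum>\<^sub># bs)"
        using assms mpow_zero[of _ "\<Sum>\<^sub># bs" u] by auto
      finally show ?thesis by (simp add: Ms B mpow_prom_image)
    next
      case False
      then obtain y where y: "y \<in># B" "\<forall>b. y \<noteq> Ms b" using image_Ms_cases by blast
      then have "prom u y = 0" by (cases y) auto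
      then have "mpow (prom u) B = 0" by (rule mpow_zero[OF y(1)])
      then show ?thesis using False by (simp add: Ms mapp_prom)
    qed
  qed (simp_all add: mapp_prom)
qed

lemma dig_Pcoh:
  assumes "is_pcs X" shows "dig X \<in> Pcoh (pcs_bang X) (pcs_bang (pcs_bang X))"
proof (rule Pcoh_bangI)
  fix x assume x: "x \<notin> tensor_web (bang_web (web X)) (web (pcs_bang (pcs_bang X)))"
  show "dig X x = 0"
  proof (rule ccontr)
    assume "dig X x \<noteq> 0"
    then obtain b bs where "x = Pr (Ms b) (Ms (image_mset Ms bs))" "set_mset b \<subseteq> web X" "b = \<Sum>\<^sub># bs"
      by (cases "(X, x)" rule: dig.cases) (auto split: if_splits)
    then show False using x by fastforce
  qed
next
  fix u assume u: "u \<in> pset X"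
  then have "mapp (dig X) (prom u) = prom (prom u)" using dig_prom is_pcs_out[OF assms u] by blast
  then show "mapp (dig X) (prom u) \<in> pset (pcs_bang (pcs_bang X))"
    using u assms by (simp add: prom_mem is_pcs_bang)
qed (use assms in \<open>auto simp: is_pcs_bang\<close>)

lemma der_prom:
  assumes "\<And>a. a \<notin> web X \<Longrightarrow> u a = 0"
  shows "mapp (der X) (prom u) = u"
proof
  fix a
  have "mapp (der X) (prom u) a = (if a \<in> web X then 1 else 0) * mpow u {#a#}"
    unfolding mapp_prom by (subst infsum_ennreal_single[of "{#a#}"]) auto
  then show "mapp (der X) (prom u) a = u a" using assms by auto
qed

lemma der_Pcoh:
  assumes "is_pcs X" shows "der X \<in> Pcoh (pcs_bang X) X"
proof (rule Pcoh_bangI)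
  fix x assume x: "x \<notin> tensor_web (bang_web (web X)) (web X)"
  show "der X x = 0"
    by (rule ccontr, cases "(X, x)" rule: der.cases) (use x in \<open>auto split: if_splits\<close>)
qed (use assms der_prom is_pcs_out[OF assms] in auto)

text \<open>Extracting the quadratic part of a promotion is how a coalgebra duplicates its points.\<close>

fun sqm :: "pcs \<Rightarrow> vec" where
  "sqm X (Pr (Ms m) (Pr b c)) = (if m = {#b, c#} \<and> b \<in> web X \<and> c \<in> web X then 1 else 0)"
| "sqm X _ = 0"

lemma sqm_prom:
  assumes "\<And>a. a \<notin> web X \<Longrightarrow> u a = 0"
  shows "mapp (sqm X) (prom u) = vtensor u u"
proof
  fix x show "mapp (sqm X) (prom u) x = vtensor u u x"
  proof (cases x)
    case (Pr b c)
    have "mapp (sqm X) (prom u) (Pr b c) = (if b \<in> web X \<and> c \<in> web X then 1 else 0) * mpow u {#b, c#}"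
      unfolding mapp_prom by (subst infsum_ennreal_single[of "{#b, c#}"]) auto
    then show ?thesis using assms by (auto simp: Pr)
  qed (simp_all add: mapp_prom)
qed

lemma sqm_Pcoh:
  assumes "is_pcs X" shows "sqm X \<in> Pcoh (pcs_bang X) (pcs_tensor X X)"
proof (rule Pcoh_bangI)
  fix x assume x: "x \<notin> tensor_web (bang_web (web X)) (web (pcs_tensor X X))"
  show "sqm X x = 0"
    by (rule ccontr, cases "(X, x)" rule: sqm.cases) (use x in \<open>auto split: if_splits\<close>)
qed (use assms sqm_prom is_pcs_out[OF assms] in \<open>auto simp: is_pcs_tensor vtensor_mem\<close>)

section \<open>Dense coalgebras\<close>

text \<open>Density takes the place of the coalgebra laws: a morphism is determined by its values on
  coalgebraic points.\<close>

definition good :: "coalg \<Rightarrow> bool" where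
  "good C \<longleftrightarrow> is_pcs (spc C) \<and> str C \<in> Pcoh (spc C) (pcs_bang (spc C)) \<and>
     separating (spc C) {u. coalgebraic C u}"

lemma good_pcs: "good C \<Longrightarrow> is_pcs (spc C)" by (simp add: good_def)
lemma good_str: "good C \<Longrightarrow> str C \<in> Pcoh (spc C) (pcs_bang (spc C))" by (simp add: good_def)
lemma good_sep: "good C \<Longrightarrow> separating (spc C) {u. coalgebraic C u}" by (simp add: good_def)
lemma coalgebraic_mem: "coalgebraic C u \<Longrightarrow> u \<in> pset (spc C)" by (simp add: coalgebraic_def)
lemma coalgebraic_str: "coalgebraic C u \<Longrightarrow> mapp (str C) u = prom u" by (simp add: coalgebraic_def)

lemma good_out: "good C \<Longrightarrow> coalgebraic C u \<Longrightarrow> a \<notin> web (spc C) \<Longrightarrow> u a = 0"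
  using coalgebraic_mem good_pcs is_pcs_out by blast

lemma good_empty: "good coalg_empty"
proof -
  have "pset pcs_empty = {\<lambda>_. 0}" by (simp add: pcs_empty_def)
  moreover have "(\<lambda>_. 0) \<in> Pcoh pcs_empty (pcs_bang pcs_empty)"
    by (intro zero_Pcoh is_pcs_empty is_pcs_bang)
  moreover have "separating pcs_empty {u. coalgebraic coalg_empty u}"
    by (auto simp: separating_def coalgebraic_def coalg_empty_def pset_dual perp_def vecs_def pcs_empty_def fun_eq_iff)
  ultimately show ?thesis using is_pcs_empty by (simp add: good_def coalg_empty_def)
qed

lemma one_str_eq: "one_str (Pr Star c) = prom unit_vec c"
proof (cases c)
  case (Ms b)
  show ?thesis
  proof (cases "set_mset b \<subseteq> {Star}")
    case True
    then have "mpow unit_vec b = mpow (\<lambda>_. 1) b" by (intro mpow_cong) (auto simp: unit_vec_def)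
    then show ?thesis using True by (simp add: Ms mpow_one)
  next
    case False
    then obtain a where "a \<in># b" "a \<noteq> Star" by auto
    then have "mpow unit_vec b = 0" by (intro mpow_zero) (auto simp: unit_vec_def)
    then show ?thesis using False by (simp add: Ms)
  qed
qed simp_all

text \<open>The structure map of the unit has rank one. It lands in the exponential because the only
  entry of a vector is at most 1.\<close>

lemma mapp_one_str: "mapp one_str u = (\<lambda>c. u Star * prom unit_vec c)"
proof
  fix c
  have "one_str (Pr a c) = 0" if "a \<noteq> Star" for a using that by (cases "Pr a c" rule: one_str.cases) auto
  then show "mapp one_str u c = u Star * prom unit_vec c"
    unfolding mapp_def by (subst infsum_ennreal_single[of Star]) (auto simp: one_str_eq mult.commute)
qed

lemma coalgebraic_one: "coalgebraic coalg_one unit_vec"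
  by (simp add: coalgebraic_def coalg_one_def unit_mem mapp_one_str) (simp add: unit_vec_def)

lemma separating_one: "separating pcs_one {unit_vec}"
  unfolding separating_def
proof (intro conjI ballI impI)
  fix f g assume f: "f \<in> pset (dual pcs_one)" and g: "g \<in> pset (dual pcs_one)" and
    eq: "\<forall>u\<in>{unit_vec}. pairing u f = pairing u g"
  have "f x = 0" "g x = 0" if "x \<noteq> Star" for x
    using is_pcs_out[OF is_pcs_dual[OF is_pcs_one] f] is_pcs_out[OF is_pcs_dual[OF is_pcs_one] g] that by auto
  moreover have "f Star = g Star" using eq by (simp add: pairing_unit)
  ultimately show "f = g" by (metis ext)
qed (simp add: unit_mem)

lemma good_one: "good coalg_one"
proof -
  have "one_str \<in> Pcoh pcs_one (pcs_bang pcs_one)"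
  proof (rule PcohI)
    fix x assume x: "x \<notin> tensor_web (web pcs_one) (web (pcs_bang pcs_one))"
    show "one_str x = 0" by (rule ccontr, cases x rule: one_str.cases) (use x in \<open>auto split: if_splits\<close>)
  next
    fix u assume u: "u \<in> pset pcs_one"
    have "u Star \<le> 1" using u by (simp add: pcs_one_def)
    then show "mapp one_str u \<in> pset (pcs_bang pcs_one)"
      unfolding mapp_one_str by (intro pset_scale is_pcs_bang is_pcs_one prom_mem unit_mem)
  qed (auto simp: is_pcs_one is_pcs_bang)
  moreover have "separating pcs_one {u. coalgebraic coalg_one u}"
    by (rule separating_mono[OF separating_one]) (use coalgebraic_one coalgebraic_mem[of coalg_one] in \<open>auto simp: coalg_one_def\<close>)
  ultimately show ?thesis using is_pcs_one by (simp add: good_def coalg_one_def)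
qed

lemma coalgebraic_prom: "is_pcs X \<Longrightarrow> u \<in> pset X \<Longrightarrow> coalgebraic (coalg_bang X) (prom u)"
  unfolding coalgebraic_def coalg_bang_def using dig_prom[of X u] is_pcs_out[of X u] by (simp add: prom_mem)

text \<open>Promotions are coalgebraic for digging, and they already separate.\<close>

lemma good_bang:
  assumes "is_pcs X" shows "good (coalg_bang X)"
proof -
  have "separating (pcs_bang X) {u. coalgebraic (coalg_bang X) u}"
    by (rule separating_mono[OF separating_bang[OF assms]])
       (auto simp: coalgebraic_prom assms, simp add: coalgebraic_def coalg_bang_def)
  then show ?thesis using assms by (simp add: good_def coalg_bang_def is_pcs_bang dig_Pcoh)
qed

lemma spc_tensor [simp]: "spc (coalg_tensor C D) = pcs_tensor (spc C) (spc D)" by (simp add: coalg_tensor_def)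

lemma str_tensor:
  "good C \<Longrightarrow> good D \<Longrightarrow> str (coalg_tensor C D) = mcomp (monm (spc C) (spc D)) (mtensor (str C) (str D))"
  by (simp add: coalg_tensor_def mon_eq good_pcs)

lemma coalgebraic_tensor:
  assumes "good C" "good D" "coalgebraic C u" "coalgebraic D v"
  shows "coalgebraic (coalg_tensor C D) (vtensor u v)"
  unfolding coalgebraic_def
  using assms monm_prom[of "spc C" u "spc D" v, OF good_out[OF assms(1,3)] good_out[OF assms(2,4)]]
  by (simp add: str_tensor mapp_mcomp mapp_mtensor coalgebraic_str vtensor_mem good_pcs coalgebraic_mem)

text \<open>Tensors of coalgebraic points are coalgebraic, so density passes to the tensor product
  by \<open>separating_tensor\<close>.\<close>

lemma good_tensor:
  assumes "good C" "good D" shows "good (coalg_tensor C D)"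
  unfolding good_def
proof (intro conjI)
  show P: "is_pcs (spc (coalg_tensor C D))" using assms by (simp add: is_pcs_tensor good_pcs)
  show "str (coalg_tensor C D) \<in> Pcoh (spc (coalg_tensor C D)) (pcs_bang (spc (coalg_tensor C D)))"
    unfolding str_tensor[OF assms] spc_tensor
    by (rule mcomp_Pcoh[OF _ _ mtensor_Pcoh mon_eq(2)])
       (use assms in \<open>auto simp: good_pcs is_pcs_tensor is_pcs_bang good_str\<close>)
  show "separating (spc (coalg_tensor C D)) {u. coalgebraic (coalg_tensor C D) u}"
    unfolding spc_tensor
    by (rule separating_mono[OF separating_tensor[OF _ _ good_sep[OF assms(1)] good_sep[OF assms(2)]]])
       (use assms coalgebraic_tensor[OF assms] coalgebraic_mem in \<open>auto simp: good_pcs\<close>, fastforce)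
qed

lemma mapp_inj_l:
  assumes "\<And>a. a \<notin> web X \<Longrightarrow> u a = 0" shows "mapp (inj_l X) u = vplus u (\<lambda>_. 0)"
proof
  fix x show "mapp (inj_l X) u x = vplus u (\<lambda>_. 0) x"
  proof (cases x)
    case (PL b)
    have "mapp (inj_l X) u (PL b) = (if b \<in> web X then 1 else 0) * u b"
      unfolding mapp_def by (subst infsum_ennreal_single[of b]) auto
    then show ?thesis using assms by (auto simp: PL)
  qed (simp_all add: mapp_def)
qed

lemma mapp_inj_r:
  assumes "\<And>a. a \<notin> web X \<Longrightarrow> u a = 0" shows "mapp (inj_r X) u = vplus (\<lambda>_. 0) u"
proof
  fix x show "mapp (inj_r X) u x = vplus (\<lambda>_. 0) u x"
  proof (cases x)
    case (PR b)
    have "mapp (inj_r X) u (PR b) = (if b \<in> web X then 1 else 0) * u b"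
      unfolding mapp_def by (subst infsum_ennreal_single[of b]) auto
    then show ?thesis using assms by (auto simp: PR)
  qed (simp_all add: mapp_def)
qed

lemma inj_l_app: "is_pcs X \<Longrightarrow> u \<in> pset X \<Longrightarrow> mapp (inj_l X) u = vplus u (\<lambda>_. 0)"
  by (rule mapp_inj_l) (rule is_pcs_out)

lemma inj_r_app: "is_pcs X \<Longrightarrow> u \<in> pset X \<Longrightarrow> mapp (inj_r X) u = vplus (\<lambda>_. 0) u"
  by (rule mapp_inj_r) (rule is_pcs_out)

lemma inj_l_Pcoh:
  assumes "is_pcs X" "is_pcs Y" shows "inj_l X \<in> Pcoh X (pcs_plus X Y)"
proof (rule PcohI)
  fix x assume x: "x \<notin> tensor_web (web X) (web (pcs_plus X Y))"
  show "inj_l X x = 0" by (rule ccontr, cases "(X, x)" rule: inj_l.cases) (use x in \<open>auto split: if_splits\<close>)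
qed (use assms in \<open>auto simp: is_pcs_plus inj_l_app vplus_mem_l\<close>)

lemma inj_r_Pcoh:
  assumes "is_pcs X" "is_pcs Y" shows "inj_r Y \<in> Pcoh Y (pcs_plus X Y)"
proof (rule PcohI)
  fix x assume x: "x \<notin> tensor_web (web Y) (web (pcs_plus X Y))"
  show "inj_r Y x = 0" by (rule ccontr, cases "(Y, x)" rule: inj_r.cases) (use x in \<open>auto split: if_splits\<close>)
qed (use assms in \<open>auto simp: is_pcs_plus inj_r_app vplus_mem_r\<close>)

lemma spc_plus [simp]: "spc (coalg_plus C D) = pcs_plus (spc C) (spc D)" by (simp add: coalg_plus_def)
lemma str_plus [simp]: "str (coalg_plus C D) = plus_str C D" by (simp add: coalg_plus_def)

text \<open>The structure map of a coproduct is a copairing, which makes \<open>copair_mem\<close>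
  applicable.\<close>

lemma mapp_plus_str:
  "mapp (plus_str C D) w = (\<lambda>c. mapp (mcomp (mbang (inj_l (spc C))) (str C)) (lpart w) c +
     mapp (mcomp (mbang (inj_r (spc D))) (str D)) (rpart w) c)"
proof
  fix c
  have "plus_str C D (Pr x c) = 0" if "\<And>a. x \<noteq> PL a" "\<And>a. x \<noteq> PR a" for x
    using that by (cases x) auto
  then show "mapp (plus_str C D) w c = mapp (mcomp (mbang (inj_l (spc C))) (str C)) (lpart w) c +
     mapp (mcomp (mbang (inj_r (spc D))) (str D)) (rpart w) c"
    unfolding mapp_def lpart_def rpart_def by (subst infsum_ennreal_LR) (simp_all del: mcomp.simps)
qed

lemma plus_components:
  assumes "good C" "good D"
  shows "mcomp (mbang (inj_l (spc C))) (str C) \<in> Pcoh (spc C) (pcs_bang (pcs_plus (spc C) (spc D)))"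
    and "mcomp (mbang (inj_r (spc D))) (str D) \<in> Pcoh (spc D) (pcs_bang (pcs_plus (spc C) (spc D)))"
  using assms
  by (auto intro!: mcomp_Pcoh[OF _ _ good_str mbang_Pcoh] simp: good_pcs is_pcs_bang is_pcs_plus inj_l_Pcoh inj_r_Pcoh)

lemma coalgebraic_plus:
  assumes "good C" "good D"
  shows "coalgebraic C u \<Longrightarrow> coalgebraic (coalg_plus C D) (vplus u (\<lambda>_. 0))"
    and "coalgebraic D v \<Longrightarrow> coalgebraic (coalg_plus C D) (vplus (\<lambda>_. 0) v)"
  using assms
  by (auto simp: inj_l_app inj_r_app coalgebraic_def[of "coalg_plus C D"] mapp_plus_str mapp_mcomp coalgebraic_str mbang_prom
      good_pcs vplus_mem_l vplus_mem_r coalgebraic_mem)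

lemma plus_dual_parts:
  assumes "is_pcs X" "is_pcs Y" "F \<in> pset (dual (pcs_plus X Y))"
  shows "lpart F \<in> pset (dual X)" "rpart F \<in> pset (dual Y)"
proof -
  have o: "F x = 0" if "x \<notin> PL ` web X \<union> PR ` web Y" for x
    using is_pcs_out[OF is_pcs_dual[OF is_pcs_plus[OF assms(1,2)]] assms(3), of x] that by simp
  show "lpart F \<in> pset (dual X)"
  proof (rule dual_memI[OF assms(1)])
    fix a assume "a \<notin> web X" then show "lpart F a = 0" using o by (auto simp: lpart_def)
  next
    fix u assume "u \<in> pset X"
    then have "pairing (vplus u (\<lambda>_. 0)) F \<le> 1"
      by (rule pairing_le_1[OF vplus_mem_l[OF assms(1,2)] assms(3)])
    then show "pairing u (lpart F) \<le> 1" by (simp add: pairing_vplus)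
  qed
  show "rpart F \<in> pset (dual Y)"
  proof (rule dual_memI[OF assms(2)])
    fix a assume "a \<notin> web Y" then show "rpart F a = 0" using o by (auto simp: rpart_def)
  next
    fix u assume "u \<in> pset Y"
    then have "pairing (vplus (\<lambda>_. 0) u) F \<le> 1"
      by (rule pairing_le_1[OF vplus_mem_r[OF assms(1,2)] assms(3)])
    then show "pairing u (rpart F) \<le> 1" by (simp add: pairing_vplus)
  qed
qed

text \<open>The injected coalgebraic points of each summand test the corresponding half of a dual
  vector, which suffices although they are far from spanning all mixtures.\<close>

lemma good_plus:
  assumes "good C" "good D" shows "good (coalg_plus C D)"
  unfolding good_def
proof (intro conjI)
  let ?X = "spc C" and ?Y = "spc D"
  have X: "is_pcs ?X" "is_pcs ?Y" using assms by (auto simp: good_pcs)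
  show P: "is_pcs (spc (coalg_plus C D))" using X by (simp add: is_pcs_plus)
  show "str (coalg_plus C D) \<in> Pcoh (spc (coalg_plus C D)) (pcs_bang (spc (coalg_plus C D)))"
    unfolding spc_plus str_plus
  proof (rule PcohI)
    fix x assume x: "x \<notin> tensor_web (web (pcs_plus ?X ?Y)) (web (pcs_bang (pcs_plus ?X ?Y)))"
    show "plus_str C D x = 0"
    proof (cases "(C, D, x)" rule: plus_str.cases)
      case (1 C' D' a c)
      then have "Pr a c \<notin> tensor_web (web ?X) (web (pcs_bang (pcs_plus ?X ?Y)))" using x by auto
      then show ?thesis using Pcoh_out[OF plus_components(1)[OF assms]] 1 by (simp del: mcomp.simps)
    next
      case (2 C' D' a c)
      then have "Pr a c \<notin> tensor_web (web ?Y) (web (pcs_bang (pcs_plus ?X ?Y)))" using x by auto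
      then show ?thesis using Pcoh_out[OF plus_components(2)[OF assms]] 2 by (simp del: mcomp.simps)
    qed auto
  next
    fix w assume "w \<in> pset (pcs_plus ?X ?Y)"
    then show "mapp (plus_str C D) w \<in> pset (pcs_bang (pcs_plus ?X ?Y))"
      unfolding mapp_plus_str 
      by (rule copair_mem[OF X _ plus_components(1)[OF assms] plus_components(2)[OF assms], rotated])
         (use X in \<open>auto simp: is_pcs_bang is_pcs_plus\<close>)
  qed (use X in \<open>auto simp: is_pcs_plus is_pcs_bang\<close>)
  show "separating (spc (coalg_plus C D)) {u. coalgebraic (coalg_plus C D) u}"
    unfolding separating_def
  proof (intro conjI ballI impI)
    fix f g assume f: "f \<in> pset (dual (spc (coalg_plus C D)))" and g: "g \<in> pset (dual (spc (coalg_plus C D)))"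
      and eq: "\<forall>u\<in>{u. coalgebraic (coalg_plus C D) u}. pairing u f = pairing u g"
    have "lpart f = lpart g"
      by (rule separatingD[OF good_sep[OF assms(1)]])
         (use f g X eq coalgebraic_plus(1)[OF assms] in \<open>auto simp: plus_dual_parts(1)[OF X], metis (mono_tags, lifting) pairing_vplus pairing_zero(1) add.right_neutral\<close>)
    moreover have "rpart f = rpart g"
      by (rule separatingD[OF good_sep[OF assms(2)]])
         (use f g X eq coalgebraic_plus(2)[OF assms] in \<open>auto simp: plus_dual_parts(2)[OF X], metis (mono_tags, lifting) pairing_vplus pairing_zero(1) add.left_neutral\<close>)
    moreover have "f x = 0" "g x = 0" if "\<And>a. x \<noteq> PL a" "\<And>a. x \<noteq> PR a" for x
      using is_pcs_out[OF is_pcs_dual[OF P] f, of x] is_pcs_out[OF is_pcs_dual[OF P] g, of x] that by auto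
    ultimately show "f = g"
      by (intro ext) (metis lpart_def rpart_def)
  qed (auto simp: coalgebraic_def)
qed

section \<open>Substructures\<close>

definition vcut :: "point set \<Rightarrow> vec \<Rightarrow> vec" where
  "vcut A u = (\<lambda>a. if a \<in> A then u a else 0)"

lemma pairing_cut: "pairing (vcut A u) v = pairing u (vcut A v)"
  unfolding pairing_def vcut_def by (intro infsum_cong) auto

lemma cut_id: "(\<And>a. a \<notin> A \<Longrightarrow> u a = 0) \<Longrightarrow> vcut A u = u"
  by (auto simp: vcut_def)

lemma cut_cut: "A \<subseteq> B \<Longrightarrow> vcut A (vcut B u) = vcut A u" "A \<subseteq> B \<Longrightarrow> vcut B (vcut A u) = vcut A u"
  by (auto simp: vcut_def fun_eq_iff)

lemma cut_le: "vcut A u x \<le> u x" by (simp add: vcut_def)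

definition psub :: "pcs \<Rightarrow> pcs \<Rightarrow> bool" where
  "psub X Y \<longleftrightarrow> web X \<subseteq> web Y \<and> pset X \<subseteq> pset Y \<and> (\<forall>u\<in>pset Y. vcut (web X) u \<in> pset X)"

lemma psub_web: "psub X Y \<Longrightarrow> web X \<subseteq> web Y" by (simp add: psub_def)
lemma psub_pset: "psub X Y \<Longrightarrow> u \<in> pset X \<Longrightarrow> u \<in> pset Y" by (auto simp: psub_def)
lemma psub_cut: "psub X Y \<Longrightarrow> u \<in> pset Y \<Longrightarrow> vcut (web X) u \<in> pset X" by (auto simp: psub_def)

lemma psub_refl: "is_pcs X \<Longrightarrow> psub X X"
  using cut_id[of "web X"] is_pcs_out[of X] by (auto simp: psub_def)

lemma psub_trans: "psub X Y \<Longrightarrow> psub Y Z \<Longrightarrow> psub X Z"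
  unfolding psub_def using cut_cut(1)[of "web X" "web Y"] by (metis order_trans)

lemma psub_empty: "is_pcs X \<Longrightarrow> psub pcs_empty X"
  by (auto simp: psub_def pcs_empty_def vcut_def pset_zero)

text \<open>Restriction is self-adjoint for the pairing. Extending a vector is checked against
  restricted dual vectors, and restricting it against extended ones. Both tests reduce to
  generators.\<close>

lemma gen_psub:
  assumes ok: "gen_ok W G" "gen_ok W' G'" and W: "W \<subseteq> W'"
    and ext: "\<And>u. u \<in> G \<Longrightarrow> u \<in> pset (gen W' G')" and restr: "\<And>u. u \<in> G' \<Longrightarrow> vcut W u \<in> pset (gen W G)"
  shows "psub (gen W G) (gen W' G')"
  unfolding psub_def web_gen
proof (intro conjI subsetI ballI W)
  have P: "is_pcs (gen W G)" "is_pcs (gen W' G')" using ok is_pcs_gen by auto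
  fix w assume w: "w \<in> pset (gen W G)"
  have wo: "w a = 0" if "a \<notin> W" for a using is_pcs_out[OF P(1) w, of a] that by simp
  have cw: "vcut W w = w" using cut_id wo by blast
  show "w \<in> pset (gen W' G')"
  proof (rule pcs_memI[OF P(2)])
    fix a assume "a \<notin> web (gen W' G')" then show "w a = 0" using wo W by auto
  next
    fix v assume v: "v \<in> pset (dual (gen W' G'))"
    have "vcut W v \<in> pset (dual (gen W G))"
    proof (rule gen_dual_memI[OF ok(1)])
      fix a assume "a \<notin> W" then show "vcut W v a = 0" by (simp add: vcut_def)
    next
      fix u assume u: "u \<in> G"
      have "pairing u (vcut W v) \<le> pairing u v" by (intro pairing_mono) (auto simp: cut_le)
      also have "\<dots> \<le> 1" using ext[OF u] v by (rule pairing_le_1)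
      finally show "pairing u (vcut W v) \<le> 1" .
    qed
    then show "pairing w v \<le> 1" using pairing_le_1[OF w] by (metis cw pairing_cut)
  qed
next
  have P: "is_pcs (gen W G)" "is_pcs (gen W' G')" using ok is_pcs_gen by auto
  fix w assume w: "w \<in> pset (gen W' G')"
  show "vcut W w \<in> pset (gen W G)"
  proof (rule pcs_memI[OF P(1)])
    fix a assume "a \<notin> web (gen W G)" then show "vcut W w a = 0" by (auto simp: vcut_def)
  next
    fix v assume v: "v \<in> pset (dual (gen W G))"
    have vo: "v a = 0" if "a \<notin> W" for a using is_pcs_out[OF is_pcs_dual[OF P(1)] v, of a] that by simp
    have cv: "vcut W v = v" using cut_id vo by blast
    have "v \<in> pset (dual (gen W' G'))"
    proof (rule gen_dual_memI[OF ok(2)])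
      fix a assume "a \<notin> W'" then show "v a = 0" using vo W by auto
    next
      fix u assume u: "u \<in> G'"
      have "pairing u v = pairing (vcut W u) v" by (simp add: pairing_cut cv)
      also have "\<dots> \<le> 1" using restr[OF u] v by (rule pairing_le_1)
      finally show "pairing u v \<le> 1" .
    qed
    then have "pairing w v \<le> 1" using w by (simp add: pairing_le_1)
    then show "pairing (vcut W w) v \<le> 1" by (simp add: pairing_cut cv)
  qed
qed (use W in auto)

text \<open>Since restriction is self-adjoint, dualising exchanges the two requirements of
  \<open>psub\<close> and keeps its direction. Linear function spaces are therefore monotone in both
  arguments, which is why recursive types need no variance condition.\<close>

lemma psub_dual:
  assumes X: "is_pcs X" and Y: "is_pcs Y" and s: "psub X Y"
  shows "psub (dual X) (dual Y)"
  unfolding psub_def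
proof (intro conjI subsetI ballI)
  fix v assume v: "v \<in> pset (dual X)"
  have vo: "v a = 0" if "a \<notin> web X" for a using is_pcs_out[OF is_pcs_dual[OF X] v, of a] that by simp
  have cv: "vcut (web X) v = v" using cut_id vo by blast
  show "v \<in> pset (dual Y)"
  proof (rule dual_memI[OF Y])
    fix a assume "a \<notin> web Y" then show "v a = 0" using vo psub_web[OF s] by auto
  next
    fix u assume u: "u \<in> pset Y"
    have "pairing u v = pairing (vcut (web X) u) v" by (simp add: pairing_cut cv)
    also have "\<dots> \<le> 1" using psub_cut[OF s u] v by (rule pairing_le_1)
    finally show "pairing u v \<le> 1" .
  qed
next
  fix v assume v: "v \<in> pset (dual Y)"
  show "vcut (web (dual X)) v \<in> pset (dual X)"
  proof (rule dual_memI[OF X])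
    fix a assume "a \<notin> web X" then show "vcut (web (dual X)) v a = 0" by (simp add: vcut_def)
  next
    fix u assume u: "u \<in> pset X"
    have "pairing u (vcut (web (dual X)) v) \<le> pairing u v" by (intro pairing_mono) (auto simp: cut_le)
    also have "\<dots> \<le> 1" using psub_pset[OF s u] v by (rule pairing_le_1)
    finally show "pairing u (vcut (web (dual X)) v) \<le> 1" .
  qed
qed (use psub_web[OF s] in auto)

lemma tensor_web_mono: "A \<subseteq> A' \<Longrightarrow> B \<subseteq> B' \<Longrightarrow> tensor_web A B \<subseteq> tensor_web A' B'"
  by (auto simp: tensor_web_def)

lemma bang_web_mono: "A \<subseteq> A' \<Longrightarrow> bang_web A \<subseteq> bang_web A'"
  by (auto simp: bang_web_def)

lemma cut_vtensor: "vcut (tensor_web A B) (vtensor u v) = vtensor (vcut A u) (vcut B v)"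
proof
  fix x show "vcut (tensor_web A B) (vtensor u v) x = vtensor (vcut A u) (vcut B v) x"
    by (cases x) (auto simp: vcut_def)
qed

lemma cut_prom: "vcut (bang_web A) (prom u) = prom (vcut A u)"
proof
  fix x show "vcut (bang_web A) (prom u) x = prom (vcut A u) x"
  proof (cases x)
    case (Ms b)
    show ?thesis
    proof (cases "set_mset b \<subseteq> A")
      case True
      then have "mpow (vcut A u) b = mpow u b" by (intro mpow_cong) (auto simp: vcut_def)
      then show ?thesis using True by (simp add: Ms vcut_def)
    next
      case False
      then obtain a where "a \<in># b" "a \<notin> A" by auto
      then have "mpow (vcut A u) b = 0" by (intro mpow_zero) (auto simp: vcut_def)
      then show ?thesis using False by (simp add: Ms vcut_def)
    qed
  qed (auto simp: vcut_def)
qed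

lemma psub_tensor:
  assumes "is_pcs X" "is_pcs Y" "is_pcs X'" "is_pcs Y'" "psub X X'" "psub Y Y'"
  shows "psub (pcs_tensor X Y) (pcs_tensor X' Y')"
  unfolding pcs_tensor_gen
proof (rule gen_psub)
  show "u \<in> pset (gen (tensor_web (web X') (web Y')) (tgen X' Y'))" if u: "u \<in> tgen X Y" for u
  proof -
    have "u \<in> tgen X' Y'" using u psub_pset[OF assms(5)] psub_pset[OF assms(6)] unfolding tgen_def by blast
    then show ?thesis by (rule gen_mem[OF tensor_ok[OF assms(3,4)]])
  qed
  show "vcut (tensor_web (web X) (web Y)) u \<in> pset (gen (tensor_web (web X) (web Y)) (tgen X Y))" if u: "u \<in> tgen X' Y'" for u
  proof -
    have "vcut (tensor_web (web X) (web Y)) u \<in> tgen X Y"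
      using u psub_cut[OF assms(5)] psub_cut[OF assms(6)] cut_vtensor[of "web X" "web Y"]
      unfolding tgen_def by fastforce
    then show ?thesis by (rule gen_mem[OF tensor_ok[OF assms(1,2)]])
  qed
qed (use assms tensor_web_mono[OF psub_web[OF assms(5)] psub_web[OF assms(6)]] in \<open>auto simp: tensor_ok\<close>)

lemma psub_bang:
  assumes "is_pcs X" "is_pcs X'" "psub X X'"
  shows "psub (pcs_bang X) (pcs_bang X')"
  unfolding pcs_bang_gen
proof (rule gen_psub)
  show "u \<in> pset (gen (bang_web (web X')) (prom ` pset X'))" if "u \<in> prom ` pset X" for u
    by (rule gen_mem[OF bang_ok[OF assms(2)]]) (use that psub_pset[OF assms(3)] in auto)
  show "vcut (bang_web (web X)) u \<in> pset (gen (bang_web (web X)) (prom ` pset X))" if "u \<in> prom ` pset X'" for u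
    by (rule gen_mem[OF bang_ok[OF assms(1)]]) (use that psub_cut[OF assms(3)] in \<open>auto simp: cut_prom\<close>)
qed (use assms bang_web_mono[OF psub_web[OF assms(3)]] in \<open>auto simp: bang_ok\<close>)

lemma psub_lin:
  assumes "is_pcs X" "is_pcs Y" "is_pcs X'" "is_pcs Y'" "psub X X'" "psub Y Y'"
  shows "psub (pcs_lin X Y) (pcs_lin X' Y')"
  unfolding pcs_lin_def using assms by (intro psub_dual psub_tensor is_pcs_tensor is_pcs_dual)

text \<open>Both directions are read off the polar form of the coproduct, where only pairs of dual
  vectors have to be restricted or extended.\<close>

lemma psub_plus:
  assumes "is_pcs X" "is_pcs Y" "is_pcs X'" "is_pcs Y'" "psub X X'" "psub Y Y'"
  shows "psub (pcs_plus X Y) (pcs_plus X' Y')"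
  unfolding psub_def
proof (intro conjI subsetI ballI)
  have d: "psub (dual X) (dual X')" "psub (dual Y) (dual Y')" using assms psub_dual by auto
  let ?W = "PL ` web X \<union> PR ` web Y" and ?W' = "PL ` web X' \<union> PR ` web Y'"
  have W: "?W \<subseteq> ?W'" using psub_web[OF assms(5)] psub_web[OF assms(6)] by auto
  then show "x \<in> web (pcs_plus X' Y')" if "x \<in> web (pcs_plus X Y)" for x using that by auto
  fix w assume w: "w \<in> pset (pcs_plus X Y)"
  have cl: "vcut (web X) (lpart w) = lpart w" "vcut (web Y) (rpart w) = rpart w"
    using plus_parts[OF w] is_pcs_out[OF assms(1)] is_pcs_out[OF assms(2)] by (auto intro!: cut_id)
  have "w \<in> vecs ?W" using w by (simp add: pcs_plus_def)
  then have wv: "w \<in> vecs ?W'" using W unfolding vecs_def by blast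
  have "pairing (vplus m n) w \<le> 1" if mn: "m \<in> pset (dual X')" "n \<in> pset (dual Y')" for m n
  proof -
    have "pairing (vplus m n) w = pairing (vplus (vcut (web X) m) (vcut (web Y) n)) w"
      unfolding pairing_vplus pairing_cut cl ..
    also have "\<dots> \<le> 1" using psub_cut[OF d(1) mn(1)] psub_cut[OF d(2) mn(2)] w
      unfolding pset_plus[OF assms(1,2)] perp_def pgen_def by auto
    finally show ?thesis .
  qed
  then show "w \<in> pset (pcs_plus X' Y')" unfolding pset_plus[OF assms(3,4)] using wv
    by (auto simp: perp_def pgen_def)
next
  have d: "psub (dual X) (dual X')" "psub (dual Y) (dual Y')" using assms psub_dual by auto
  fix w assume w: "w \<in> pset (pcs_plus X' Y')"
  let ?W = "PL ` web X \<union> PR ` web Y" and ?c = "vcut (web (pcs_plus X Y)) w"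
  have "w \<in> vecs (PL ` web X' \<union> PR ` web Y')" using w by (simp add: pcs_plus_def)
  then have v: "?c \<in> vecs ?W" by (auto simp: vecs_def vcut_def)
  have "pairing (vplus m n) ?c \<le> 1" if mn: "m \<in> pset (dual X)" "n \<in> pset (dual Y)" for m n
  proof -
    have "pairing (vplus m n) ?c \<le> pairing (vplus m n) w" by (intro pairing_mono) (auto simp: cut_le)
    also have "\<dots> \<le> 1" using psub_pset[OF d(1) mn(1)] psub_pset[OF d(2) mn(2)] w
      unfolding pset_plus[OF assms(3,4)] perp_def pgen_def by auto
    finally show ?thesis .
  qed
  then show "?c \<in> pset (pcs_plus X Y)" unfolding pset_plus[OF assms(1,2)] using v
    by (auto simp: perp_def pgen_def)
qed

text \<open>Compatibility with the structure maps is stated on rows: the row of a point of the smaller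
  coalgebra is the same in both.\<close>

definition csub :: "coalg \<Rightarrow> coalg \<Rightarrow> bool" where
  "csub C D \<longleftrightarrow> psub (spc C) (spc D) \<and> (\<forall>a\<in>web (spc C). \<forall>c. str D (Pr a c) = str C (Pr a c))"

lemma csub_psub: "csub C D \<Longrightarrow> psub (spc C) (spc D)" by (simp add: csub_def)
lemma csub_row: "csub C D \<Longrightarrow> a \<in> web (spc C) \<Longrightarrow> str D (Pr a c) = str C (Pr a c)" by (simp add: csub_def)
lemma csub_web: "csub C D \<Longrightarrow> web (spc C) \<subseteq> web (spc D)" by (simp add: csub_def psub_def)

lemma csub_refl: "good C \<Longrightarrow> csub C C" by (simp add: csub_def psub_refl good_pcs)

lemma csub_trans: "csub C D \<Longrightarrow> csub D E \<Longrightarrow> csub C E"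
  unfolding csub_def using psub_trans psub_web by (metis subsetD)

lemma csub_empty: "good C \<Longrightarrow> csub coalg_empty C"
  by (simp add: csub_def coalg_empty_def psub_empty good_pcs) (simp add: pcs_empty_def)

section \<open>Monotonicity of the coalgebra constructions\<close>

lemma csub_bang:
  assumes "is_pcs X" "is_pcs Y" "psub X Y" shows "csub (coalg_bang X) (coalg_bang Y)"
  unfolding csub_def coalg_bang_def
proof (simp add: psub_bang assms, intro ballI allI)
  fix a c assume "a \<in> bang_web (web X)"
  then obtain b where a: "a = Ms b" "set_mset b \<subseteq> web X" by (auto elim: bang_webE)
  then have "set_mset b \<subseteq> web Y" using psub_web[OF assms(3)] by auto
  then show "dig Y (Pr a c) = dig X (Pr a c)" using a by (cases c) auto
qed

text \<open>The two composites agree term by term. Intermediate points outside the smaller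
  exponentials have weight 0; at the others the rows of the structure maps and of
  \<open>monm\<close> are the same.\<close>

lemma csub_tensor:
  assumes "good C" "good D" "good C'" "good D'" "csub C C'" "csub D D'"
  shows "csub (coalg_tensor C D) (coalg_tensor C' D')"
  unfolding csub_def spc_tensor str_tensor[OF assms(1,2)] str_tensor[OF assms(3,4)]
proof (intro conjI ballI allI)
  show "psub (pcs_tensor (spc C) (spc D)) (pcs_tensor (spc C') (spc D'))"
    using assms by (intro psub_tensor) (auto simp: good_pcs csub_psub)
  fix x c assume "x \<in> web (pcs_tensor (spc C) (spc D))"
  then obtain a b where x: "x = Pr a b" "a \<in> web (spc C)" "b \<in> web (spc D)" by (auto elim: tensor_webE)
  have "mtensor (str C') (str D') (Pr x y) * monm (spc C') (spc D') (Pr y c) =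
        mtensor (str C) (str D) (Pr x y) * monm (spc C) (spc D) (Pr y c)" for y
  proof (cases "\<exists>p q. y = Pr p q")
    case True
    then obtain p q where y: "y = Pr p q" by blast
    have e: "mtensor (str C') (str D') (Pr x y) = str C (Pr a p) * str D (Pr b q)"
       "mtensor (str C) (str D) (Pr x y) = str C (Pr a p) * str D (Pr b q)"
      using csub_row[OF assms(5) x(2)] csub_row[OF assms(6) x(3)] by (simp_all add: x y)
    show ?thesis
    proof (cases "p \<in> bang_web (web (spc C)) \<and> q \<in> bang_web (web (spc D))")
      case True
      have "monm (spc C') (spc D') (Pr y c) = monm (spc C) (spc D) (Pr y c)"
      proof (cases c)
        case (Ms d)
        \<comment> \<open>The web enters \<open>monm\<close> only through this condition. Once the
          elements of \<open>d\<close> are known to be pairs, marginals over the smaller webs force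
          \<open>d\<close> itself over the smaller tensor web.\<close>
        have "set_mset d \<subseteq> tensor_web (web (spc C)) (web (spc D)) \<longleftrightarrow> set_mset d \<subseteq> tensor_web (web (spc C')) (web (spc D'))"
          if pq: "p = Ms (image_mset fstP d)" "q = Ms (image_mset sndP d)"
        proof
          assume "set_mset d \<subseteq> tensor_web (web (spc C)) (web (spc D))"
          then show "set_mset d \<subseteq> tensor_web (web (spc C')) (web (spc D'))"
            using tensor_web_mono[OF csub_web[OF assms(5)] csub_web[OF assms(6)]] by blast
        next
          assume s: "set_mset d \<subseteq> tensor_web (web (spc C')) (web (spc D'))"
          show "set_mset d \<subseteq> tensor_web (web (spc C)) (web (spc D))"
          proof
            fix z assume z: "z \<in># d"
            then obtain z1 z2 where zz: "z = Pr z1 z2" using s by (meson subsetD tensor_webE)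
            have "fstP z \<in> web (spc C)" "sndP z \<in> web (spc D)" using True z by (auto simp: pq)
            then show "z \<in> tensor_web (web (spc C)) (web (spc D))" by (simp add: zz)
          qed
        qed
        then show ?thesis by (auto simp: Ms y)
      qed (simp_all add: y)
      then show ?thesis by (simp add: e)
    next
      case False
      then have "str C (Pr a p) = 0 \<or> str D (Pr b q) = 0"
        using Pcoh_out[OF good_str[OF assms(1)], of "Pr a p"] Pcoh_out[OF good_str[OF assms(2)], of "Pr b q"] by auto
      then show ?thesis by (auto simp: e)
    qed
  next
    case False
    then have "mtensor s t (Pr x y) = 0" for s t by (cases y) (auto simp: x)
    then show ?thesis by simp
  qed
  then show "mcomp (monm (spc C') (spc D')) (mtensor (str C') (str D')) (Pr x c) =
     mcomp (monm (spc C) (spc D)) (mtensor (str C) (str D)) (Pr x c)" by simp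
qed

text \<open>A multiset of pairs with first marginal \<open>c\<close> involves only the rows of
  \<open>t\<close> at elements of \<open>c\<close>.\<close>

lemma mbang_rows:
  assumes "\<And>a b. a \<in># c \<Longrightarrow> t (Pr a b) = t' (Pr a b)"
  shows "mbang t (Pr (Ms c) d) = mbang t' (Pr (Ms c) d)"
proof (cases d)
  case (Ms d)
  have "mpow (\<lambda>(a, b). t (Pr a b)) r = mpow (\<lambda>(a, b). t' (Pr a b)) r" if "image_mset fst r = c" for r
    by (rule mpow_cong) (use assms that in force)
  then show ?thesis unfolding Ms mbang_suminf by (intro infsum_cong) auto
qed simp_all

lemma csub_plus:
  assumes "good C" "good D" "good C'" "good D'" "csub C C'" "csub D D'"
  shows "csub (coalg_plus C D) (coalg_plus C' D')"
  unfolding csub_def spc_plus str_plus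
proof (intro conjI ballI allI)
  show "psub (pcs_plus (spc C) (spc D)) (pcs_plus (spc C') (spc D'))"
    using assms by (intro psub_plus) (auto simp: good_pcs csub_psub)
  have row: "mcomp M' (str K') (Pr a c) = mcomp M (str K) (Pr a c)"
    if K: "good K" "csub K K'" "a \<in> web (spc K)"
      and M: "\<And>b. set_mset b \<subseteq> web (spc K) \<Longrightarrow> M' (Pr (Ms b) c) = M (Pr (Ms b) c)" for K K' M M' a c
    unfolding mcomp.simps
  proof (rule infsum_cong)
    fix y
    show "str K' (Pr a y) * M' (Pr y c) = str K (Pr a y) * M (Pr y c)"
    proof (cases "y \<in> bang_web (web (spc K))")
      case True
      then obtain b where "y = Ms b" "set_mset b \<subseteq> web (spc K)" by (auto elim: bang_webE)
      then show ?thesis using M csub_row[OF K(2,3)] by simp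
    next
      case False
      then have "str K (Pr a y) = 0" using Pcoh_out[OF good_str[OF K(1)], of "Pr a y"] by simp
      then show ?thesis using csub_row[OF K(2,3)] by simp
    qed
  qed
  fix x c assume "x \<in> web (pcs_plus (spc C) (spc D))"
  then show "plus_str C' D' (Pr x c) = plus_str C D (Pr x c)"
    unfolding web_plus
  proof
    assume "x \<in> PL ` web (spc C)"
    then obtain a where a: "x = PL a" "a \<in> web (spc C)" by auto
    show ?thesis unfolding a plus_str.simps
    proof (rule row[OF assms(1,5) a(2)], rule mbang_rows)
      fix b a d assume "set_mset b \<subseteq> web (spc C)" "a \<in># b"
      then have "a \<in> web (spc C)" "a \<in> web (spc C')" using csub_web[OF assms(5)] by auto
      then show "inj_l (spc C') (Pr a d) = inj_l (spc C) (Pr a d)" by (cases d) auto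
    qed
  next
    assume "x \<in> PR ` web (spc D)"
    then obtain a where a: "x = PR a" "a \<in> web (spc D)" by auto
    show ?thesis unfolding a plus_str.simps
    proof (rule row[OF assms(2,6) a(2)], rule mbang_rows)
      fix b a d assume "set_mset b \<subseteq> web (spc D)" "a \<in># b"
      then have "a \<in> web (spc D)" "a \<in> web (spc D')" using csub_web[OF assms(6)] by auto
      then show "inj_r (spc D') (Pr a d) = inj_r (spc D) (Pr a d)" by (cases d) auto
    qed
  qed
qed

section \<open>Unions of chains\<close>

definition cchain :: "(nat \<Rightarrow> coalg) \<Rightarrow> bool" where
  "cchain S \<longleftrightarrow> (\<forall>n. good (S n)) \<and> (\<forall>n. csub (S n) (S (Suc n)))"

lemma cchain_good: "cchain S \<Longrightarrow> good (S n)" by (simp add: cchain_def)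

lemma cchain_csub: "cchain S \<Longrightarrow> m \<le> n \<Longrightarrow> csub (S m) (S n)"
proof (induction n)
  case (Suc n)
  then show ?case by (cases "m = Suc n") (auto simp: cchain_def csub_refl intro: csub_trans)
qed (auto simp: cchain_def csub_refl)

lemma web_Union: "web (spc (coalg_Union S)) = (\<Union>n. web (spc (S n)))"
  by (simp add: coalg_Union_def Let_def)

lemma pset_Union: "pset (spc (coalg_Union S)) =
   {u \<in> vecs (\<Union>n. web (spc (S n))). \<forall>n. vcut (web (spc (S n))) u \<in> pset (spc (S n))}"
  by (simp add: coalg_Union_def Let_def vcut_def)

lemma str_Union: "str (coalg_Union S) x = (SUP n. str (S n) x)"
  by (simp add: coalg_Union_def Let_def)

lemma psub_Union:
  assumes "cchain S" shows "psub (spc (S n)) (spc (coalg_Union S))"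
  unfolding psub_def
proof (intro conjI subsetI ballI)
  fix u assume u: "u \<in> pset (spc (S n))"
  have P: "is_pcs (spc (S k))" for k using assms by (simp add: cchain_def good_pcs)
  have "u \<in> vecs (web (spc (S n)))" using u is_pcs_vecs[OF P] by blast
  then have "u \<in> vecs (\<Union>n. web (spc (S n)))" by (auto simp: vecs_def)
  moreover have "vcut (web (spc (S k))) u \<in> pset (spc (S k))" for k
  proof (cases "k \<le> n")
    case True
    then show ?thesis using psub_cut[OF csub_psub[OF cchain_csub[OF assms True]] u] by simp
  next
    case False
    then have "u \<in> pset (spc (S k))" using psub_pset[OF csub_psub[OF cchain_csub[OF assms, of n k]] u] by simp
    then show ?thesis using psub_cut[OF psub_refl[OF P]] by blast
  qed
  ultimately show "u \<in> pset (spc (coalg_Union S))" by (simp add: pset_Union)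
qed (auto simp: web_Union pset_Union)

text \<open>The row of a point is zero in the members that do not contain the point and constant in
  the others, so the supremum is already reached at stage n.\<close>

lemma row_Union:
  assumes "cchain S" "a \<in> web (spc (S n))"
  shows "str (coalg_Union S) (Pr a c) = str (S n) (Pr a c)"
  unfolding str_Union
proof (rule antisym)
  show "(SUP n. str (S n) (Pr a c)) \<le> str (S n) (Pr a c)"
  proof (rule SUP_least)
    fix k
    show "str (S k) (Pr a c) \<le> str (S n) (Pr a c)"
    proof (cases "a \<in> web (spc (S k))")
      case True
      then show ?thesis using csub_row[OF cchain_csub[OF assms(1), of n k] assms(2)]
          csub_row[OF cchain_csub[OF assms(1), of k n] True] by (cases "k \<le> n") auto
    next
      case False
      then show ?thesis using Pcoh_out[OF good_str[OF cchain_good[OF assms(1)]], of "Pr a c" k] by simp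
    qed
  qed
qed (rule SUP_upper, simp)

lemma csub_Union: "cchain S \<Longrightarrow> csub (S n) (coalg_Union S)"
  by (simp add: csub_def psub_Union row_Union)

text \<open>The vectors of the union form the polar of the union of the duals of the members:
  pairing a dual vector of a member with \<open>u\<close> involves only the restriction of
  \<open>u\<close> to that member.\<close>

lemma is_pcs_Union:
  assumes "cchain S" shows "is_pcs (spc (coalg_Union S))"
proof -
  have P: "is_pcs (spc (S k))" for k using assms by (simp add: cchain_def good_pcs)
  let ?W = "\<Union>n. web (spc (S n))" and ?G = "\<Union>n. pset (dual (spc (S n)))"
  have G: "?G \<subseteq> vecs ?W" using is_pcs_vecs[OF is_pcs_dual[OF P]] by (fastforce simp: vecs_def)
  have eq: "pset (spc (coalg_Union S)) = perp ?W ?G"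
  proof (intro antisym subsetI)
    fix u assume u: "u \<in> pset (spc (coalg_Union S))"
    have "pairing m u \<le> 1" if m: "m \<in> pset (dual (spc (S n)))" for m n
    proof -
      have "vcut (web (spc (S n))) m = m" using is_pcs_out[OF is_pcs_dual[OF P] m] by (intro cut_id) auto
      then have "pairing m u = pairing (vcut (web (spc (S n))) u) m" by (metis pairing_commute pairing_cut)
      also have "\<dots> \<le> 1" using u m by (intro pairing_le_1) (auto simp: pset_Union)
      finally show ?thesis .
    qed
    then show "u \<in> perp ?W ?G" using u by (auto simp: perp_def pset_Union)
  next
    fix u assume u: "u \<in> perp ?W ?G"
    have "vcut (web (spc (S n))) u \<in> pset (spc (S n))" for n
    proof (rule pcs_memI[OF P])
      fix v assume v: "v \<in> pset (dual (spc (S n)))"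
      have "vcut (web (spc (S n))) v = v" using is_pcs_out[OF is_pcs_dual[OF P] v] by (intro cut_id) auto
      then have "pairing (vcut (web (spc (S n))) u) v = pairing v u" by (metis pairing_commute pairing_cut)
      also have "\<dots> \<le> 1" using u v by (auto simp: perp_def)
      finally show "pairing (vcut (web (spc (S n))) u) v \<le> 1" .
    qed (simp add: vcut_def)
    then show "u \<in> pset (spc (coalg_Union S))" using u by (auto simp: perp_def pset_Union)
  qed
  show ?thesis unfolding is_pcs_def
  proof (intro conjI ballI)
    show "pset (spc (coalg_Union S)) = perp (web (spc (coalg_Union S))) (perp (web (spc (coalg_Union S))) (pset (spc (coalg_Union S))))"
      unfolding web_Union eq using perp_perp_perp[OF G] by simp
    fix a assume "a \<in> web (spc (coalg_Union S))"
    then obtain n where n: "a \<in> web (spc (S n))" by (auto simp: web_Union)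
    obtain u where "u \<in> pset (spc (S n))" "u a \<noteq> 0" using is_pcs_pos[OF P n] by blast
    then show "\<exists>u\<in>pset (spc (coalg_Union S)). u a \<noteq> 0" using psub_pset[OF psub_Union[OF assms]] by blast
    obtain v where "v \<in> pset (dual (spc (S n)))" "v a \<noteq> 0" using is_pcs_dual_pos[OF P n] by blast
    then show "\<exists>v\<in>perp (web (spc (coalg_Union S))) (pset (spc (coalg_Union S))). v a \<noteq> 0"
      unfolding web_Union eq using perp_perp_ge[OF G] by blast
  qed
qed

lemma SUP_cut:
  assumes "\<And>n. A n \<subseteq> A (Suc n)" "\<And>a. a \<notin> (\<Union>n. A n) \<Longrightarrow> u a = 0"
  shows "(\<lambda>x. SUP n. vcut (A n) u x) = u" "incseq (\<lambda>n. vcut (A n) u x)"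
proof -
  show "incseq (\<lambda>n. vcut (A n) u x)" for x
    by (rule incseq_SucI) (use assms(1) in \<open>auto simp: vcut_def\<close>)
  show "(\<lambda>x. SUP n. vcut (A n) u x) = u"
  proof
    fix x show "(SUP n. vcut (A n) u x) = u x"
    proof (cases "\<exists>n. x \<in> A n")
      case True
      then obtain n where "x \<in> A n" by blast
      then have "u x \<le> (SUP n. vcut (A n) u x)" by (intro SUP_upper2[of n]) (auto simp: vcut_def)
      then show ?thesis by (intro antisym SUP_least) (auto simp: cut_le)
    next
      case False
      then show ?thesis using assms(2)[of x] by (simp add: vcut_def)
    qed
  qed
qed

lemma mapp_rows:
  assumes "\<And>a b. a \<in> A \<Longrightarrow> t (Pr a b) = t' (Pr a b)" "\<And>a. a \<notin> A \<Longrightarrow> u a = 0"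
  shows "mapp t u = mapp t' u"
proof
  fix b show "mapp t u b = mapp t' u b" unfolding mapp_def
    by (rule infsum_cong) (metis assms mult_zero_right)
qed

lemma coalgebraic_csub:
  assumes "good C" "csub C D" "coalgebraic C u" shows "coalgebraic D u"
proof -
  have "mapp (str D) u = mapp (str C) u"
    by (rule mapp_rows[of "web (spc C)"]) (use assms csub_row good_out in auto)
  then show ?thesis using assms psub_pset[OF csub_psub[OF assms(2)]] by (auto simp: coalgebraic_def)
qed

text \<open>A vector is the supremum of its restrictions, which the structure map sends into the
  exponentials of the members. For density, a dual vector is determined by its restrictions, and a
  coalgebraic point of a member remains coalgebraic in the union.\<close>

lemma good_Union:
  assumes S: "cchain S" shows "good (coalg_Union S)"
  unfolding good_def
proof (intro conjI)
  let ?U = "spc (coalg_Union S)" and ?A = "\<lambda>n. web (spc (S n))"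
  have P: "is_pcs (spc (S k))" for k using S by (simp add: cchain_def good_pcs)
  show U: "is_pcs ?U" by (rule is_pcs_Union[OF S])
  have inc: "?A n \<subseteq> ?A (Suc n)" for n using S csub_web by (auto simp: cchain_def)
  show "str (coalg_Union S) \<in> Pcoh ?U (pcs_bang ?U)"
  proof (rule PcohI[OF U is_pcs_bang[OF U]])
    fix x assume x: "x \<notin> tensor_web (web ?U) (web (pcs_bang ?U))"
    have "str (S n) x = 0" for n
    proof (rule Pcoh_out[OF good_str[OF cchain_good[OF S]]])
      show "x \<notin> tensor_web (web (spc (S n))) (web (pcs_bang (spc (S n))))"
        using x tensor_web_mono[of "?A n" "web ?U" "bang_web (?A n)" "bang_web (web ?U)"]
          bang_web_mono[of "?A n" "web ?U"] by (auto simp: web_Union)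
    qed
    then show "str (coalg_Union S) x = 0" by (simp add: str_Union)
  next
    fix u assume u: "u \<in> pset ?U"
    have uo: "u a = 0" if "a \<notin> (\<Union>n. ?A n)" for a using is_pcs_out[OF U u, of a] that by (simp add: web_Union)
    have c: "vcut (?A n) u \<in> pset (spc (S n))" for n using u by (simp add: pset_Union)
    have m: "mapp (str (coalg_Union S)) (vcut (?A n) u) = mapp (str (S n)) (vcut (?A n) u)" for n
      by (rule mapp_rows[of "?A n"]) (auto simp: row_Union[OF S] vcut_def)
    have "mapp (str (S n)) (vcut (?A n) u) \<in> pset (pcs_bang (spc (S n)))" for n
      using Pcoh_mapp[OF good_str[OF cchain_good[OF S]] c] .
    then have mm: "mapp (str (coalg_Union S)) (vcut (?A n) u) \<in> pset (pcs_bang ?U)" for n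
      unfolding m using psub_pset[OF psub_bang[OF P U psub_Union[OF S]]] by blast
    have "mapp (str (coalg_Union S)) u = mapp (str (coalg_Union S)) (\<lambda>x. SUP n. vcut (?A n) u x)"
      using SUP_cut(1)[of ?A u, OF inc uo] by simp
    also have "\<dots> = (\<lambda>b. SUP n. mapp (str (coalg_Union S)) (vcut (?A n) u) b)"
      by (rule ext, rule mapp_SUP_vec) (rule SUP_cut(2)[of ?A u, OF inc uo])
    also have "\<dots> \<in> pset (pcs_bang ?U)"
    proof (rule pset_SUP[OF is_pcs_bang[OF U] mm])
      fix x show "incseq (\<lambda>n. mapp (str (coalg_Union S)) (vcut (?A n) u) x)"
        using SUP_cut(2)[of ?A u, OF inc uo] by (auto simp: incseq_def intro!: mapp_mono)
    qed
    finally show "mapp (str (coalg_Union S)) u \<in> pset (pcs_bang ?U)" .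
  qed
  show "separating ?U {u. coalgebraic (coalg_Union S) u}"
    unfolding separating_def
  proof (intro conjI ballI impI)
    fix f g assume f: "f \<in> pset (dual ?U)" and g: "g \<in> pset (dual ?U)"
      and eq: "\<forall>u\<in>{u. coalgebraic (coalg_Union S) u}. pairing u f = pairing u g"
    have ps: "psub (dual (spc (S n))) (dual ?U)" for n by (rule psub_dual[OF P U psub_Union[OF S]])
    have cuts: "vcut (?A n) f = vcut (?A n) g" for n
    proof (rule separatingD[OF good_sep[OF cchain_good[OF S, of n]]])
      show "vcut (?A n) f \<in> pset (dual (spc (S n)))" "vcut (?A n) g \<in> pset (dual (spc (S n)))"
        using psub_cut[OF ps f] psub_cut[OF ps g] by auto
      fix u assume u: "u \<in> {u. coalgebraic (S n) u}"
      have "vcut (?A n) u = u" using good_out[OF cchain_good[OF S]] u by (intro cut_id) auto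
      moreover have "coalgebraic (coalg_Union S) u"
        using coalgebraic_csub[OF cchain_good[OF S] csub_Union[OF S]] u by blast
      ultimately show "pairing u (vcut (?A n) f) = pairing u (vcut (?A n) g)"
        using eq by (metis mem_Collect_eq pairing_cut)
    qed
    show "f = g"
    proof
      fix x show "f x = g x"
      proof (cases "x \<in> web ?U")
        case True
        then obtain n where n: "x \<in> ?A n" by (auto simp: web_Union)
        have "vcut (?A n) f x = vcut (?A n) g x" by (simp add: cuts)
        then show ?thesis using n by (simp add: vcut_def)
      next
        case False
        then show ?thesis using is_pcs_out[OF is_pcs_dual[OF U] f, of x] is_pcs_out[OF is_pcs_dual[OF U] g, of x] by simp
      qed
    qed
  qed (auto simp: coalgebraic_def)
qed

text \<open>A vector of the union is the supremum of its restrictions, all of which lie in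
  \<open>Y\<close>. Conversely, cutting a vector of \<open>Y\<close> to the union and then to a
  member is cutting it to the member directly.\<close>

lemma csub_Union_least:
  assumes S: "cchain S" and Y: "good Y" and le: "\<And>n. csub (S n) Y"
  shows "csub (coalg_Union S) Y"
proof -
  let ?A = "\<lambda>n. web (spc (S n))"
  have inc: "?A n \<subseteq> ?A (Suc n)" for n using S csub_web by (auto simp: cchain_def)
  have "psub (spc (coalg_Union S)) (spc Y)"
    unfolding psub_def
  proof (intro conjI subsetI ballI)
    fix x assume "x \<in> web (spc (coalg_Union S))" then show "x \<in> web (spc Y)"
      using csub_web[OF le] by (auto simp: web_Union)
  next
    fix u assume u: "u \<in> pset (spc (coalg_Union S))"
    have uo: "u a = 0" if "a \<notin> (\<Union>n. ?A n)" for a using is_pcs_out[OF is_pcs_Union[OF S] u, of a] that by (simp add: web_Union)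
    have "(\<lambda>x. SUP n. vcut (?A n) u x) \<in> pset (spc Y)"
    proof (rule pset_SUP[OF good_pcs[OF Y]])
      fix n show "vcut (?A n) u \<in> pset (spc Y)"
        using psub_pset[OF csub_psub[OF le[of n]]] u by (auto simp: pset_Union)
      fix x show "incseq (\<lambda>n. vcut (?A n) u x)" by (rule SUP_cut(2)[of ?A u, OF inc uo])
    qed
    then show "u \<in> pset (spc Y)" using SUP_cut(1)[of ?A u, OF inc uo] by simp
  next
    fix u assume u: "u \<in> pset (spc Y)"
    have "vcut (?A n) (vcut (\<Union>n. ?A n) u) = vcut (?A n) u" for n by (rule cut_cut(1)) auto
    moreover have "vcut (\<Union>n. ?A n) u \<in> vecs (\<Union>n. ?A n)"
      using is_pcs_fin[OF good_pcs[OF Y] u] by (auto simp: vecs_def vcut_def)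
    ultimately show "vcut (web (spc (coalg_Union S))) u \<in> pset (spc (coalg_Union S))"
      unfolding web_Union pset_Union using psub_cut[OF csub_psub[OF le] u] by auto
  qed
  moreover have "str Y (Pr a c) = str (coalg_Union S) (Pr a c)" if "a \<in> web (spc (coalg_Union S))" for a c
    using that csub_row[OF le] row_Union[OF S] by (auto simp: web_Union)
  ultimately show ?thesis by (simp add: csub_def)
qed

text \<open>On equal webs restriction is the identity, and the inclusion fixes all rows. An equality
  of comparable coalgebras thus needs only the reverse inclusion of their webs.\<close>

lemma csub_antisym:
  assumes "good C" "good D" "csub C D" "web (spc D) \<subseteq> web (spc C)"
  shows "C = D"
proof -
  have w: "web (spc C) = web (spc D)" using assms csub_web by auto
  have "pset (spc D) \<subseteq> pset (spc C)"
  proof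
    fix u assume u: "u \<in> pset (spc D)"
    have "vcut (web (spc C)) u = u" using is_pcs_out[OF good_pcs[OF assms(2)] u] by (intro cut_id) (simp add: w)
    then show "u \<in> pset (spc C)" using psub_cut[OF csub_psub[OF assms(3)] u] by simp
  qed
  then have p: "pset (spc C) = pset (spc D)" using psub_pset[OF csub_psub[OF assms(3)]] by auto
  have "str C x = str D x" for x
  proof (cases "x \<in> tensor_web (web (spc C)) (bang_web (web (spc C)))")
    case True
    then show ?thesis using csub_row[OF assms(3)] by (auto elim!: tensor_webE)
  next
    case False
    then show ?thesis using Pcoh_out[OF good_str[OF assms(1)], of x] Pcoh_out[OF good_str[OF assms(2)], of x] w by simp
  qed
  then show ?thesis using w p by (cases C; cases D) (auto intro!: pcs.equality coalg.equality)
qed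

section \<open>Interpretation of types\<close>

definition goodE :: "(nat \<Rightarrow> coalg) \<Rightarrow> bool" where "goodE E \<longleftrightarrow> (\<forall>i. good (E i))"
definition subE :: "(nat \<Rightarrow> coalg) \<Rightarrow> (nat \<Rightarrow> coalg) \<Rightarrow> bool" where "subE E E' \<longleftrightarrow> (\<forall>i. csub (E i) (E' i))"

lemma goodE_case: "good C \<Longrightarrow> goodE E \<Longrightarrow> goodE (case_nat C E)"
  by (auto simp: goodE_def split: nat.split)

lemma subE_case: "csub C C' \<Longrightarrow> subE E E' \<Longrightarrow> subE (case_nat C E) (case_nat C' E')"
  by (auto simp: subE_def split: nat.split)

lemma subE_refl: "goodE E \<Longrightarrow> subE E E" by (simp add: subE_def goodE_def csub_refl)

definition mu_seq :: "pty \<Rightarrow> (nat \<Rightarrow> coalg) \<Rightarrow> nat \<Rightarrow> coalg" where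
  "mu_seq p E n = ((\<lambda>C. pty_open_interp p (case_nat C E)) ^^ n) coalg_empty"

lemma mu_seq_simps [simp]: "mu_seq p E 0 = coalg_empty"
  "mu_seq p E (Suc n) = pty_open_interp p (case_nat (mu_seq p E n) E)"
  by (simp_all add: mu_seq_def)

lemma Mu_interp: "pty_open_interp (Mu p) E = coalg_Union (mu_seq p E)"
  by (simp add: mu_seq_def[abs_def])

lemma mu_chain:
  assumes IH: "\<And>E. goodE E \<Longrightarrow> good (pty_open_interp p E)"
    "\<And>E E'. goodE E \<Longrightarrow> goodE E' \<Longrightarrow> subE E E' \<Longrightarrow> csub (pty_open_interp p E) (pty_open_interp p E')"
    and E: "goodE E"
  shows "cchain (mu_seq p E)"
proof -
  have g: "good (mu_seq p E n)" for n
    by (induction n) (auto simp: good_empty intro!: IH goodE_case E)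
  have "csub (mu_seq p E n) (mu_seq p E (Suc n))" for n
  proof (induction n)
    case 0 show ?case using g[of "Suc 0"] by (simp add: csub_empty)
  next
    case (Suc n)
    show ?case unfolding mu_seq_simps(2)[of p E "Suc n"] mu_seq_simps(2)[of p E n]
      using g[of n] g[of "Suc n"] Suc by (intro IH goodE_case E subE_case subE_refl) simp_all
  qed
  then show ?thesis using g by (simp add: cchain_def)
qed

text \<open>Well-formedness and monotonicity are proved together: the iterates of a recursive type
  form a chain only by monotonicity of its body, and the union is well behaved only for a
  chain.\<close>

lemma interp_good_mono:
  shows "(\<forall>E. goodE E \<longrightarrow> good (pty_open_interp p E)) \<and>
    (\<forall>E E'. goodE E \<longrightarrow> goodE E' \<longrightarrow> subE E E' \<longrightarrow> csub (pty_open_interp p E) (pty_open_interp p E'))"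
  and "(\<forall>E. goodE E \<longrightarrow> is_pcs (ty_open_interp s E)) \<and>
    (\<forall>E E'. goodE E \<longrightarrow> goodE E' \<longrightarrow> subE E E' \<longrightarrow> psub (ty_open_interp s E) (ty_open_interp s E'))"
proof (induction p and s)
  case One
  show ?case by (simp add: good_one csub_refl)
next
  case (Bang s)
  then show ?case by (simp add: good_bang csub_bang)
next
  case (Tensor p q)
  then show ?case by (simp add: good_tensor csub_tensor)
next
  case (Plus p q)
  then show ?case by (simp add: good_plus csub_plus)
next
  case (TVar i)
  then show ?case by (simp add: goodE_def subE_def)
next
  case (Mu p)
  have ch: "cchain (mu_seq p E)" if "goodE E" for E by (rule mu_chain) (use Mu that in auto)
  have m: "csub (mu_seq p E n) (mu_seq p E' n)" if "goodE E" "goodE E'" "subE E E'" for E E' n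
  proof (induction n)
    case 0 show ?case by (simp add: csub_refl good_empty)
  next
    case (Suc n)
    then show ?case using that Mu cchain_good[OF ch] by (simp add: goodE_case subE_case)
  qed
  have "csub (coalg_Union (mu_seq p E)) (coalg_Union (mu_seq p E'))" if "goodE E" "goodE E'" "subE E E'" for E E'
    by (rule csub_Union_least[OF ch[OF that(1)] good_Union[OF ch[OF that(2)]]])
       (rule csub_trans[OF m[OF that] csub_Union[OF ch[OF that(2)]]])
  then show ?case unfolding Mu_interp using ch good_Union by blast
next
  case (Pos p)
  then show ?case by (simp add: good_pcs csub_psub)
next
  case (Lolli p s)
  then show ?case by (simp add: is_pcs_lin psub_lin good_pcs csub_psub)
qed

lemma good_interp: "goodE E \<Longrightarrow> good (pty_open_interp p E)" using interp_good_mono by blast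
lemma interp_mono: "goodE E \<Longrightarrow> goodE E' \<Longrightarrow> subE E E' \<Longrightarrow> csub (pty_open_interp p E) (pty_open_interp p E')"
  using interp_good_mono by blast
lemma is_pcs_interp: "goodE E \<Longrightarrow> is_pcs (ty_open_interp s E)" using interp_good_mono by blast

text \<open>The web of a type depends on the webs of the environment only. Together with monotonicity this
  reduces continuity of the type operators to a statement about sets.\<close>

primrec pty_web :: "pty \<Rightarrow> (nat \<Rightarrow> point set) \<Rightarrow> point set"
  and ty_web :: "ty \<Rightarrow> (nat \<Rightarrow> point set) \<Rightarrow> point set" where
  "pty_web One A = {Star}"
| "pty_web (Bang s) A = bang_web (ty_web s A)"
| "pty_web (Tensor p q) A = tensor_web (pty_web p A) (pty_web q A)"
| "pty_web (Plus p q) A = PL ` pty_web p A \<union> PR ` pty_web q A"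
| "pty_web (TVar i) A = A i"
| "pty_web (Mu p) A = (\<Union>n. ((\<lambda>B. pty_web p (case_nat B A)) ^^ n) {})"
| "ty_web (Pos p) A = pty_web p A"
| "ty_web (Lolli p s) A = tensor_web (pty_web p A) (ty_web s A)"

definition webs :: "(nat \<Rightarrow> coalg) \<Rightarrow> nat \<Rightarrow> point set" where "webs E = (\<lambda>i. web (spc (E i)))"

lemma webs_case: "webs (case_nat C E) = case_nat (web (spc C)) (webs E)"
  by (auto simp: webs_def fun_eq_iff split: nat.split)

lemma web_interp:
  shows "\<forall>E. web (spc (pty_open_interp p E)) = pty_web p (webs E)"
  and "\<forall>E. web (ty_open_interp s E) = ty_web s (webs E)"
proof (induction p and s)
  case (Mu p)
  have "web (spc (mu_seq p E n)) = ((\<lambda>B. pty_web p (case_nat B (webs E))) ^^ n) {}" for E n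
    by (induction n) (simp_all add: Mu webs_case, simp add: coalg_empty_def pcs_empty_def)
  then show ?case unfolding Mu_interp web_Union by simp
qed (simp_all add: coalg_one_def coalg_bang_def webs_def)

section \<open>Continuity of the type operators on webs\<close>

lemma chain_mono: "(\<And>n. A n \<subseteq> A (Suc n)) \<Longrightarrow> m \<le> n \<Longrightarrow> (A m :: 'a set) \<subseteq> A n"
  by (rule lift_Suc_mono_le[of A]) auto

lemma bang_web_UN:
  assumes "\<And>n. A n \<subseteq> A (Suc n)"
  shows "bang_web (\<Union>n::nat. A n) = (\<Union>n. bang_web (A n))"
proof
  show "bang_web (\<Union>n. A n) \<subseteq> (\<Union>n. bang_web (A n))"
  proof
    fix x assume "x \<in> bang_web (\<Union>n. A n)"
    then obtain b where b: "x = Ms b" "set_mset b \<subseteq> (\<Union>n. A n)" by (auto elim: bang_webE)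
    then obtain k where k: "\<And>a. a \<in># b \<Longrightarrow> a \<in> A (k a)" by (metis UN_E subsetD)
    \<comment> \<open>A finite multiset is contained in one stage, the last among those of its
      elements. For the empty multiset the value of \<open>Max\<close> is unspecified, but the
      inclusion is vacuous.\<close>
    have "set_mset b \<subseteq> A (Max (k ` set_mset b))"
    proof
      fix a assume a: "a \<in># b"
      then have "k a \<le> Max (k ` set_mset b)" by simp
      then show "a \<in> A (Max (k ` set_mset b))" using k[OF a] chain_mono[of A, OF assms] by blast
    qed
    then show "x \<in> (\<Union>n. bang_web (A n))" using b by auto
  qed
qed (auto simp: bang_web_def)

lemma tensor_web_UN:
  assumes "\<And>n. A n \<subseteq> A (Suc n)" "\<And>n. B n \<subseteq> B (Suc n)"
  shows "tensor_web (\<Union>n::nat. A n) (\<Union>n. B n) = (\<Union>n. tensor_web (A n) (B n))"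
proof
  show "tensor_web (\<Union>n. A n) (\<Union>n. B n) \<subseteq> (\<Union>n. tensor_web (A n) (B n))"
  proof
    fix x assume "x \<in> tensor_web (\<Union>n. A n) (\<Union>n. B n)"
    then obtain a b m n where x: "x = Pr a b" "a \<in> A m" "b \<in> B n" by (auto elim: tensor_webE)
    have "a \<in> A (max m n)" "b \<in> B (max m n)"
      using x chain_mono[of A m "max m n", OF assms(1)] chain_mono[of B n "max m n", OF assms(2)] by auto
    then show "x \<in> (\<Union>n. tensor_web (A n) (B n))" using x by auto
  qed
qed (auto simp: tensor_web_def)

definition echain :: "(nat \<Rightarrow> nat \<Rightarrow> point set) \<Rightarrow> bool" where
  "echain A \<longleftrightarrow> (\<forall>n i. A n i \<subseteq> A (Suc n) i)"

lemma echain_case: "echain A \<Longrightarrow> (\<And>n. B n \<subseteq> B (Suc n)) \<Longrightarrow> echain (\<lambda>n. case_nat (B n) (A n))"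
  by (auto simp: echain_def split: nat.split)

lemma UN_case: "(\<lambda>i. \<Union>n. case_nat (B n) (A n) i) = case_nat (\<Union>n. B n) (\<lambda>i. \<Union>n. A n i)"
  by (auto simp: fun_eq_iff split: nat.split)

lemma web_continuous:
  shows "\<forall>A. echain A \<longrightarrow> (\<forall>n. pty_web p (A n) \<subseteq> pty_web p (A (Suc n))) \<and>
    pty_web p (\<lambda>i. \<Union>n. A n i) = (\<Union>n. pty_web p (A n))"
  and "\<forall>A. echain A \<longrightarrow> (\<forall>n. ty_web s (A n) \<subseteq> ty_web s (A (Suc n))) \<and>
    ty_web s (\<lambda>i. \<Union>n. A n i) = (\<Union>n. ty_web s (A n))"
proof (induction p and s)
  case (Bang s)
  then show ?case by (simp add: bang_web_UN bang_web_mono)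
next
  case (Tensor p q)
  then show ?case by (simp add: tensor_web_UN tensor_web_mono)
next
  case (Plus p q)
  then have IH: "pty_web p (A n) \<subseteq> pty_web p (A (Suc n))" "pty_web q (A n) \<subseteq> pty_web q (A (Suc n))"
    "pty_web p (\<lambda>i. \<Union>n. A n i) = (\<Union>n. pty_web p (A n))" "pty_web q (\<lambda>i. \<Union>n. A n i) = (\<Union>n. pty_web q (A n))"
    if "echain A" for A n using that by simp_all
  show ?case
  proof (intro allI impI conjI)
    fix A n assume A: "echain A"
    show "pty_web (Plus p q) (A n) \<subseteq> pty_web (Plus p q) (A (Suc n))"
      using IH(1,2)[OF A] by (simp add: image_mono le_supI1 le_supI2)
    show "pty_web (Plus p q) (\<lambda>i. \<Union>n. A n i) = (\<Union>n. pty_web (Plus p q) (A n))"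
      by (simp add: IH(3,4)[OF A] image_UN UN_Un_distrib)
  qed
next
  case (Mu p)
  define G where "G A n = ((\<lambda>B. pty_web p (case_nat B A)) ^^ n) {}" for A n
  have G0: "G A 0 = {}" and GS: "G A (Suc n) = pty_web p (case_nat (G A n) A)" for A n by (simp_all add: G_def)
  show ?case
  proof (intro allI impI)
    fix A assume A: "echain A"
    \<comment> \<open>Monotonicity and continuity of the k-th iterate go together, because the
      former supplies the chain to which continuity of the body is applied. The unions over n and
      over k are exchanged afterwards.\<close>
    have both: "(\<forall>n. G (A n) k \<subseteq> G (A (Suc n)) k) \<and> G (\<lambda>i. \<Union>n. A n i) k = (\<Union>n. G (A n) k)" for k
    proof (induction k)
      case 0 show ?case by (simp add: G0)
    next
      case (Suc k)
      have ch: "echain (\<lambda>n. case_nat (G (A n) k) (A n))" using Suc A by (intro echain_case) auto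
      have "G (\<lambda>i. \<Union>n. A n i) (Suc k) = pty_web p (\<lambda>i. \<Union>n. case_nat (G (A n) k) (A n) i)"
        unfolding GS UN_case using Suc by simp
      also have "\<dots> = (\<Union>n. G (A n) (Suc k))" unfolding GS using Mu ch by blast
      finally show ?case using Mu ch unfolding GS by blast
    qed
    have "(\<Union>k. \<Union>n. G (A n) k) = (\<Union>n. \<Union>k. G (A n) k)" by auto
    then show "(\<forall>n. pty_web (Mu p) (A n) \<subseteq> pty_web (Mu p) (A (Suc n))) \<and>
      pty_web (Mu p) (\<lambda>i. \<Union>n. A n i) = (\<Union>n. pty_web (Mu p) (A n))"
      using both unfolding pty_web.simps G_def[symmetric] by (simp add: SUP_mono')
  qed
next
  case (Lolli p s)
  then show ?case by (simp add: tensor_web_UN tensor_web_mono)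
qed (simp_all add: echain_def)

text \<open>Every iterate is below the unfolding by monotonicity, hence so is their union. By
  antisymmetry the converse is a question about webs only, settled by their continuity.\<close>

lemma Mu_fixpoint:
  assumes E: "goodE E"
  shows "pty_open_interp p (case_nat (pty_open_interp (Mu p) E) E) = pty_open_interp (Mu p) E"
proof -
  let ?C = "mu_seq p E" and ?X = "pty_open_interp (Mu p) E"
  let ?Y = "pty_open_interp p (case_nat ?X E)"
  have ch: "cchain ?C" by (rule mu_chain[OF good_interp interp_mono E])
  have gX: "good ?X" by (rule good_interp[OF E])
  have gY: "good ?Y" by (intro good_interp goodE_case gX E)
  have le: "csub (?C (Suc n)) ?Y" for n
    unfolding mu_seq_simps using csub_Union[OF ch, of n] unfolding Mu_interp[symmetric]
    by (intro interp_mono goodE_case subE_case subE_refl cchain_good[OF ch] gX E)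
  have "csub (?C n) ?Y" for n
    using csub_trans[OF cchain_csub[OF ch, of n "Suc n"] le[of n]] by simp
  then have "csub (coalg_Union ?C) ?Y" by (rule csub_Union_least[OF ch gY])
  then have "csub ?X ?Y" by (simp only: Mu_interp)
  moreover have "web (spc ?Y) \<subseteq> web (spc ?X)"
  proof -
    have inc: "web (spc (?C n)) \<subseteq> web (spc (?C (Suc n)))" for n using ch csub_web by (auto simp: cchain_def)
    have ec: "echain (\<lambda>n. case_nat (web (spc (?C n))) (webs E))"
      using inc by (intro echain_case) (auto simp: echain_def)
    have "web (spc ?Y) = pty_web p (case_nat (\<Union>n. web (spc (?C n))) (webs E))"
      using web_interp(1) by (simp add: webs_case Mu_interp web_Union del: pty_open_interp.simps(6))
    also have "\<dots> = pty_web p (\<lambda>i. \<Union>n. case_nat (web (spc (?C n))) (webs E) i)"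
      unfolding UN_case by simp
    also have "\<dots> = (\<Union>n. pty_web p (case_nat (web (spc (?C n))) (webs E)))"
      using web_continuous(1) ec by blast
    also have "\<dots> = (\<Union>n. web (spc (?C (Suc n))))" using web_interp(1) by (simp add: webs_case)
    also have "\<dots> \<subseteq> web (spc ?X)" unfolding Mu_interp web_Union by blast
    finally show ?thesis .
  qed
  ultimately show ?thesis using csub_antisym[OF gX gY] by simp
qed

section \<open>Substitution in types\<close>

definition ins :: "(nat \<Rightarrow> 'a) \<Rightarrow> nat \<Rightarrow> 'a \<Rightarrow> nat \<Rightarrow> 'a" where
  "ins E k x = (\<lambda>i. if i < k then E i else if i = k then x else E (i - 1))"

lemma case_nat_ins: "case_nat C (ins E k x) = ins (case_nat C E) (Suc k) x"
  by (auto simp: ins_def fun_eq_iff split: nat.split)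

lemma ins_0: "ins E 0 x = case_nat x E"
  by (auto simp: ins_def fun_eq_iff split: nat.split)

lemma interp_lift:
  shows "\<forall>E k x. pty_open_interp (lift_pty p k) (ins E k x) = pty_open_interp p E"
  and "\<forall>E k x. ty_open_interp (lift_ty s k) (ins E k x) = ty_open_interp s E"
  by (induction p and s) (auto simp: case_nat_ins, auto simp: ins_def)

lemma interp_subst:
  shows "\<forall>E k r. pty_open_interp (subst_pty p r k) E = pty_open_interp p (ins E k (pty_open_interp r E))"
  and "\<forall>E k r. ty_open_interp (subst_ty s r k) E = ty_open_interp s (ins E k (pty_open_interp r E))"
proof (induction p and s)
  case (Mu p)
  have "pty_open_interp (lift_pty r 0) (case_nat C E) = pty_open_interp r E" for r C E
    using interp_lift(1) unfolding ins_0[symmetric] by blast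
  then show ?case using Mu by (simp add: case_nat_ins)
qed (auto simp: ins_def)

lemma goodE_const: "goodE (\<lambda>_. coalg_empty)" by (simp add: goodE_def good_empty)

text \<open>This is an equality and not merely an isomorphism, so folding and unfolding need no
  morphism of their own.\<close>

lemma pty_interp_unroll: "pty_interp (unroll p) = pty_interp (Mu p)"
  unfolding pty_interp_def unroll_def
  using interp_subst(1) Mu_fixpoint[OF goodE_const, of p] by (simp add: ins_0 del: pty_open_interp.simps(6))

lemma good_pty: "good (pty_interp p)" by (simp add: pty_interp_def good_interp goodE_const)
lemma is_pcs_ty: "is_pcs (ty_interp s)" by (simp add: ty_interp_def is_pcs_interp goodE_const)
lemma is_pcs_pty: "is_pcs (spc (pty_interp p))" by (simp add: good_pty good_pcs)

lemma interp_simps [simp]: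
  "pty_interp One = coalg_one"
  "pty_interp (Bang s) = coalg_bang (ty_interp s)"
  "pty_interp (Tensor p q) = coalg_tensor (pty_interp p) (pty_interp q)"
  "pty_interp (Plus p q) = coalg_plus (pty_interp p) (pty_interp q)"
  "ty_interp (Pos p) = spc (pty_interp p)"
  "ty_interp (Lolli p s) = pcs_lin (spc (pty_interp p)) (ty_interp s)"
  by (simp_all add: pty_interp_def ty_interp_def)

section \<open>Morphisms interpreting the term constructors\<close>

lemma infsum_ennreal_indicator: "(\<Sum>\<^sub>\<infinity>a. (if a = b \<and> P then 1 else 0) * f a) = (if P then f b else 0 :: ennreal)"
  by (subst infsum_ennreal_single[of b]) auto

fun idm :: "pcs \<Rightarrow> vec" where
  "idm X (Pr a b) = (if a = b \<and> b \<in> web X then 1 else 0)"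
| "idm X _ = 0"

lemma idm_app: "is_pcs X \<Longrightarrow> u \<in> pset X \<Longrightarrow> mapp (idm X) u = u"
  unfolding mapp_def by (rule ext) (simp add: infsum_ennreal_indicator is_pcs_out)

lemma idm_Pcoh: "is_pcs X \<Longrightarrow> idm X \<in> Pcoh X X"
  by (rule PcohI) (simp_all add: idm_app, metis idm.elims tensor_web_iff)

section \<open>Duplicating and discarding a context\<close>

definition contr :: "coalg \<Rightarrow> vec" where "contr C = mcomp (sqm (spc C)) (str C)"

lemma contr_Pcoh: "good C \<Longrightarrow> contr C \<in> Pcoh (spc C) (pcs_tensor (spc C) (spc C))"
  unfolding contr_def
  by (rule mcomp_Pcoh[OF _ _ good_str sqm_Pcoh]) (auto simp: good_pcs is_pcs_tensor)

lemma contr_app: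
  assumes "good C" "coalgebraic C u" shows "mapp (contr C) u = vtensor u u"
  unfolding contr_def mapp_mcomp coalgebraic_str[OF assms(2)]
  by (rule sqm_prom) (rule good_out[OF assms])

text \<open>Two terms share one context: it is duplicated by \<open>contr\<close> and each copy goes
  to one of them. The value is a pure tensor only at coalgebraic points.\<close>

definition tpair :: "coalg \<Rightarrow> vec \<Rightarrow> vec \<Rightarrow> vec" where
  "tpair C m n = mcomp (mtensor m n) (contr C)"

lemma tpair_Pcoh:
  assumes "good C" "is_pcs Y" "is_pcs Z" "m \<in> Pcoh (spc C) Y" "n \<in> Pcoh (spc C) Z"
  shows "tpair C m n \<in> Pcoh (spc C) (pcs_tensor Y Z)"
  unfolding tpair_def
  by (rule mcomp_Pcoh[OF _ _ contr_Pcoh mtensor_Pcoh]) (use assms in \<open>auto simp: good_pcs is_pcs_tensor\<close>)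

lemma tpair_app:
  assumes "good C" "coalgebraic C u"
  shows "mapp (tpair C m n) u = vtensor (mapp m u) (mapp n u)"
  by (simp add: tpair_def mapp_mcomp contr_app[OF assms] mapp_mtensor)

text \<open>Discarding an argument uses the entry of its structure map at the empty multiset. That
  weight is at most 1 in general and equals 1 at a coalgebraic point.\<close>

fun constm :: "coalg \<Rightarrow> vec \<Rightarrow> vec" where
  "constm C w (Pr a b) = str C (Pr a (Ms {#})) * w b"
| "constm C w _ = 0"

lemma constm_mapp: "mapp (constm C w) u = (\<lambda>b. mapp (str C) u (Ms {#}) * w b)"
  unfolding mapp_def infsum_ennreal_cmult2[symmetric] by (simp add: mult_ac)

lemma str_empty_le: "good C \<Longrightarrow> u \<in> pset (spc C) \<Longrightarrow> mapp (str C) u (Ms {#}) \<le> 1"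
  by (rule bang_empty_le[OF good_pcs Pcoh_mapp[OF good_str]])

lemma str_empty_coalgebraic: "coalgebraic C u \<Longrightarrow> mapp (str C) u (Ms {#}) = 1"
  by (simp add: coalgebraic_str)

lemma constm_Pcoh:
  assumes "good C" "is_pcs Y" "w \<in> pset Y" shows "constm C w \<in> Pcoh (spc C) Y"
proof (rule PcohI)
  fix x assume x: "x \<notin> tensor_web (web (spc C)) (web Y)"
  show "constm C w x = 0"
  proof (cases x)
    case (Pr a b)
    then have "a \<notin> web (spc C) \<or> b \<notin> web Y" using x by auto
    then show ?thesis using Pcoh_out[OF good_str[OF assms(1)], of "Pr a (Ms {#})"] is_pcs_out[OF assms(2,3), of b]
      by (auto simp: Pr)
  qed simp_all
qed (use assms in \<open>auto simp: constm_mapp good_pcs intro!: pset_scale str_empty_le\<close>)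

lemma constm_app: "coalgebraic C u \<Longrightarrow> mapp (constm C w) u = w"
  by (simp add: constm_mapp str_empty_coalgebraic)

section \<open>Evaluation, currying, case distinction and projections\<close>

fun evalm :: "pcs \<Rightarrow> pcs \<Rightarrow> vec" where
  "evalm X Y (Pr (Pr (Pr a b) a') b') = (if a' = a \<and> b = b' \<and> a \<in> web X \<and> b \<in> web Y then 1 else 0)"
| "evalm X Y _ = 0"

lemma evalm_app:
  assumes "is_pcs X" "t \<in> Pcoh X Y" "u \<in> pset X"
  shows "mapp (evalm X Y) (vtensor t u) = mapp t u"
proof
  fix c
  have "mapp (evalm X Y) (vtensor t u) c =
     (\<Sum>\<^sub>\<infinity>a. \<Sum>\<^sub>\<infinity>b. \<Sum>\<^sub>\<infinity>a'. evalm X Y (Pr (Pr (Pr a b) a') c) * (t (Pr a b) * u a'))"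
    unfolding mapp_vtensor
  proof (rule infsum_ennreal_Pr)
    fix x assume "\<And>a b. x \<noteq> Pr a b"
    then have "evalm X Y (Pr (Pr x b) c) = 0" for b by (cases x) auto
    then show "(\<Sum>\<^sub>\<infinity>b. evalm X Y (Pr (Pr x b) c) * (t x * u b)) = 0" by simp
  qed
  also have "\<dots> = (\<Sum>\<^sub>\<infinity>a. t (Pr a c) * u a)"
  proof (rule infsum_cong)
    fix a
    have "(\<Sum>\<^sub>\<infinity>a'. evalm X Y (Pr (Pr (Pr a b) a') c) * (t (Pr a b) * u a')) =
      (if b = c \<and> a \<in> web X \<and> b \<in> web Y then t (Pr a b) * u a else 0)" for b
      by (simp add: infsum_ennreal_indicator)
    then have "(\<Sum>\<^sub>\<infinity>b. \<Sum>\<^sub>\<infinity>a'. evalm X Y (Pr (Pr (Pr a b) a') c) * (t (Pr a b) * u a')) =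
      (\<Sum>\<^sub>\<infinity>b. if b = c \<and> a \<in> web X \<and> b \<in> web Y then t (Pr a b) * u a else 0)" by simp
    also have "\<dots> = (if a \<in> web X \<and> c \<in> web Y then t (Pr a c) * u a else 0)"
      by (subst infsum_ennreal_single[of c]) auto
    also have "\<dots> = t (Pr a c) * u a" using Pcoh_out[OF assms(2), of "Pr a c"] by auto
    finally show "(\<Sum>\<^sub>\<infinity>b. \<Sum>\<^sub>\<infinity>a'. evalm X Y (Pr (Pr (Pr a b) a') c) * (t (Pr a b) * u a')) = t (Pr a c) * u a" .
  qed
  finally show "mapp (evalm X Y) (vtensor t u) c = mapp t u c" by (simp add: mapp_def)
qed

lemma evalm_Pcoh:
  assumes "is_pcs X" "is_pcs Y" shows "evalm X Y \<in> Pcoh (pcs_tensor (pcs_lin X Y) X) Y"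
proof (rule Pcoh_tensorI)
  fix x assume x: "x \<notin> tensor_web (tensor_web (web (pcs_lin X Y)) (web X)) (web Y)"
  show "evalm X Y x = 0" by (rule ccontr, cases "(X, Y, x)" rule: evalm.cases) (use x in \<open>auto split: if_splits\<close>)
qed (use assms in \<open>auto simp: is_pcs_lin pset_lin evalm_app Pcoh_mapp\<close>)

fun currym :: "vec \<Rightarrow> vec" where
  "currym m (Pr g (Pr a b)) = m (Pr (Pr g a) b)"
| "currym m _ = 0"

lemma currym_mapp: "mapp (currym m) u = rowfix m u"
proof
  fix x show "mapp (currym m) u x = rowfix m u x" by (cases x) (simp_all add: mapp_def)
qed

lemma rowfix_Pcoh:
  assumes "is_pcs X" "is_pcs Y" "is_pcs Z" "m \<in> Pcoh (pcs_tensor X Y) Z" "u \<in> pset X"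
  shows "rowfix m u \<in> Pcoh Y Z"
proof (rule PcohI)
  fix x assume "x \<notin> tensor_web (web Y) (web Z)"
  then show "rowfix m u x = 0" using Pcoh_out[OF assms(4)] by (cases x) (auto intro!: infsum_0)
qed (use assms in \<open>auto simp: mapp_rowfix vtensor_mem intro!: Pcoh_mapp[OF assms(4)]\<close>)

lemma currym_Pcoh:
  assumes "is_pcs X" "is_pcs Y" "is_pcs Z" "m \<in> Pcoh (pcs_tensor X Y) Z"
  shows "currym m \<in> Pcoh X (pcs_lin Y Z)"
proof (rule PcohI)
  fix x assume x: "x \<notin> tensor_web (web X) (web (pcs_lin Y Z))"
  then show "currym m x = 0" using Pcoh_out[OF assms(4)] by (cases "(m, x)" rule: currym.cases) auto
qed (use assms in \<open>auto simp: currym_mapp is_pcs_lin pset_lin intro!: rowfix_Pcoh\<close>)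

text \<open>The matrix is linear in the scrutinee: each branch receives the corresponding half
  \<open>lpart w\<close> or \<open>rpart w\<close>, coalgebraic or not.\<close>

fun casem :: "vec \<Rightarrow> vec \<Rightarrow> vec" where
  "casem n r (Pr (Pr g (PL a)) b) = n (Pr (Pr g a) b)"
| "casem n r (Pr (Pr g (PR a)) b) = r (Pr (Pr g a) b)"
| "casem n r _ = 0"

lemma casem_app:
  "mapp (casem n r) (vtensor u w) = (\<lambda>b. mapp n (vtensor u (lpart w)) b + mapp r (vtensor u (rpart w)) b)"
proof
  fix c
  have "(\<Sum>\<^sub>\<infinity>b. casem n r (Pr (Pr g b) c) * (u g * w b)) =
    (\<Sum>\<^sub>\<infinity>a. n (Pr (Pr g a) c) * (u g * w (PL a))) + (\<Sum>\<^sub>\<infinity>a. r (Pr (Pr g a) c) * (u g * w (PR a)))" for g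
  proof -
    have z: "casem n r (Pr (Pr g x) c) = 0" if "\<And>a. x \<noteq> PL a" "\<And>a. x \<noteq> PR a" for x
      using that by (cases x) auto
    show ?thesis by (subst infsum_ennreal_LR) (simp_all add: z)
  qed
  then show "mapp (casem n r) (vtensor u w) c = mapp n (vtensor u (lpart w)) c + mapp r (vtensor u (rpart w)) c"
    unfolding mapp_vtensor lpart_def rpart_def by (simp add: infsum_ennreal_plus)
qed

lemma casem_Pcoh:
  assumes "is_pcs X" "is_pcs P" "is_pcs Q" "is_pcs Z" "n \<in> Pcoh (pcs_tensor X P) Z" "r \<in> Pcoh (pcs_tensor X Q) Z"
  shows "casem n r \<in> Pcoh (pcs_tensor X (pcs_plus P Q)) Z"
proof (rule Pcoh_tensorI)
  fix x assume x: "x \<notin> tensor_web (tensor_web (web X) (web (pcs_plus P Q))) (web Z)"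
  show "casem n r x = 0"
  proof (cases "(n, r, x)" rule: casem.cases)
    case (1 n r g a b) then show ?thesis using x Pcoh_out[OF assms(5), of "Pr (Pr g a) b"] by auto
  next
    case (2 n r g a b) then show ?thesis using x Pcoh_out[OF assms(6), of "Pr (Pr g a) b"] by auto
  qed auto
next
  fix u w assume u: "u \<in> pset X" and w: "w \<in> pset (pcs_plus P Q)"
  show "mapp (casem n r) (vtensor u w) \<in> pset Z"
    unfolding casem_app mapp_rowfix[of n, symmetric] mapp_rowfix[of r, symmetric]
    by (rule copair_mem[OF assms(2,3,4) rowfix_Pcoh[OF assms(1,2,4,5) u] rowfix_Pcoh[OF assms(1,3,4,6) u] w])
qed (use assms in \<open>auto simp: is_pcs_plus\<close>)

text \<open>The discarded component leaves the weight \<open>mapp (str D) v (Ms {#})\<close> behind.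
  It is 1 when that component is coalgebraic, in particular when it is a value.\<close>

lemma proj_l_app:
  assumes "is_pcs (spc C)" "u \<in> pset (spc C)"
  shows "mapp (proj_l C D) (vtensor u v) = (\<lambda>c. mapp (str D) v (Ms {#}) * u c)"
proof
  fix c
  have e: "proj_l C D (Pr (Pr a b) c) * (u a * v b) =
     (if a = c \<and> c \<in> web (spc C) then 1 else 0) * (u a * (str D (Pr b (Ms {#})) * v b))" for a b
    by (auto simp: mult_ac)
  have "mapp (proj_l C D) (vtensor u v) c =
    (\<Sum>\<^sub>\<infinity>a. (if a = c \<and> c \<in> web (spc C) then 1 else 0) * (u a * mapp (str D) v (Ms {#})))"
    by (simp only: mapp_vtensor e infsum_ennreal_cmult mapp_def[of "str D"])
  also have "\<dots> = mapp (str D) v (Ms {#}) * u c"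
    unfolding infsum_ennreal_indicator using is_pcs_out[OF assms, of c] by (auto simp: mult.commute)
  finally show "mapp (proj_l C D) (vtensor u v) c = mapp (str D) v (Ms {#}) * u c" .
qed

lemma proj_r_app:
  assumes "is_pcs (spc D)" "v \<in> pset (spc D)"
  shows "mapp (proj_r C D) (vtensor u v) = (\<lambda>c. mapp (str C) u (Ms {#}) * v c)"
proof
  fix c
  have e: "proj_r C D (Pr (Pr a b) c) * (u a * v b) =
     (if b = c \<and> c \<in> web (spc D) then 1 else 0) * (v b * (str C (Pr a (Ms {#})) * u a))" for a b
    by (auto simp: mult_ac)
  have "mapp (proj_r C D) (vtensor u v) c =
    (\<Sum>\<^sub>\<infinity>b. \<Sum>\<^sub>\<infinity>a. (if b = c \<and> c \<in> web (spc D) then 1 else 0) * (v b * (str C (Pr a (Ms {#})) * u a)))"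
    unfolding mapp_vtensor e by (rule infsum_ennreal_swap)
  also have "\<dots> = (\<Sum>\<^sub>\<infinity>b. (if b = c \<and> c \<in> web (spc D) then 1 else 0) * (v b * mapp (str C) u (Ms {#})))"
    by (simp only: infsum_ennreal_cmult mapp_def[of "str C"])
  also have "\<dots> = mapp (str C) u (Ms {#}) * v c"
    unfolding infsum_ennreal_indicator using is_pcs_out[OF assms, of c] by (auto simp: mult.commute)
  finally show "mapp (proj_r C D) (vtensor u v) c = mapp (str C) u (Ms {#}) * v c" .
qed

lemma proj_l_Pcoh:
  assumes "good C" "good D" shows "proj_l C D \<in> Pcoh (pcs_tensor (spc C) (spc D)) (spc C)"
proof (rule Pcoh_tensorI)
  fix x assume x: "x \<notin> tensor_web (tensor_web (web (spc C)) (web (spc D))) (web (spc C))"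
  show "proj_l C D x = 0"
  proof (cases "(C, D, x)" rule: proj_l.cases)
    case (1 C' D' a b c)
    then show ?thesis using x Pcoh_out[OF good_str[OF assms(2)], of "Pr b (Ms {#})"] by auto
  qed auto
qed (use assms in \<open>auto simp: good_pcs proj_l_app intro!: pset_scale str_empty_le\<close>)

lemma proj_r_Pcoh:
  assumes "good C" "good D" shows "proj_r C D \<in> Pcoh (pcs_tensor (spc C) (spc D)) (spc D)"
proof (rule Pcoh_tensorI)
  fix x assume x: "x \<notin> tensor_web (tensor_web (web (spc C)) (web (spc D))) (web (spc D))"
  show "proj_r C D x = 0"
  proof (cases "(C, D, x)" rule: proj_r.cases)
    case (1 C' D' a b c)
    then show ?thesis using x Pcoh_out[OF good_str[OF assms(1)], of "Pr a (Ms {#})"] by auto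
  qed auto
qed (use assms in \<open>auto simp: good_pcs proj_r_app intro!: pset_scale str_empty_le\<close>)

lemma rho_app:
  assumes "is_pcs X" "is_pcs Y" "w \<in> pset (pcs_plus X Y)"
  shows "mapp (rho_l X) w = lpart w" "mapp (rho_r Y) w = rpart w"
proof -
  have l: "rho_l X (Pr x b) = (if x = PL b \<and> b \<in> web X then 1 else 0)" for x b by (cases x) auto
  have r: "rho_r Y (Pr x b) = (if x = PR b \<and> b \<in> web Y then 1 else 0)" for x b by (cases x) auto
  have p: "lpart w \<in> pset X" "rpart w \<in> pset Y" using plus_parts[OF assms(3)] by auto
  show "mapp (rho_l X) w = lpart w"
    unfolding mapp_def l infsum_ennreal_indicator using is_pcs_out[OF assms(1) p(1)] by (auto simp: lpart_def fun_eq_iff)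
  show "mapp (rho_r Y) w = rpart w"
    unfolding mapp_def r infsum_ennreal_indicator using is_pcs_out[OF assms(2) p(2)] by (auto simp: rpart_def fun_eq_iff)
qed

definition sc :: "ennreal \<Rightarrow> vec \<Rightarrow> vec" where "sc z t = (\<lambda>x. z * t x)"

lemma sc_1 [simp]: "sc 1 t = t" by (simp add: sc_def)
lemma mapp_sc: "mapp (sc z t) u = sc z (mapp t u)" by (simp add: sc_def mapp_scale_mat)
lemma sc_Pcoh: "is_pcs X \<Longrightarrow> is_pcs Y \<Longrightarrow> t \<in> Pcoh X Y \<Longrightarrow> z \<le> 1 \<Longrightarrow> sc z t \<in> Pcoh X Y"
  by (simp add: sc_def scale_Pcoh)

definition stopM :: "coalg \<Rightarrow> vec \<Rightarrow> vec" where "stopM C m = mcomp (mbang m) (str C)"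

lemma stopM_Pcoh: "good C \<Longrightarrow> is_pcs Y \<Longrightarrow> m \<in> Pcoh (spc C) Y \<Longrightarrow> stopM C m \<in> Pcoh (spc C) (pcs_bang Y)"
  unfolding stopM_def by (rule mcomp_Pcoh[OF _ _ good_str mbang_Pcoh]) (auto simp: good_pcs is_pcs_bang)

lemma stopM_app: "coalgebraic C u \<Longrightarrow> mapp (stopM C m) u = prom (mapp m u)"
  by (simp add: stopM_def mapp_mcomp coalgebraic_str mbang_prom)

section \<open>Continuity\<close>

text \<open>All interpretations are built from sums and products of nonnegative numbers, and these
  commute with increasing suprema. Continuity is therefore stated as pointwise monotone
  convergence.\<close>

definition ups :: "(nat \<Rightarrow> vec) \<Rightarrow> vec \<Rightarrow> bool" where
  "ups T t \<longleftrightarrow> (\<forall>x. incseq (\<lambda>k. T k x) \<and> t x = (SUP k. T k x))"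

lemma upsI: "(\<And>x. incseq (\<lambda>k. T k x)) \<Longrightarrow> (\<And>x. t x = (SUP k. T k x)) \<Longrightarrow> ups T t" by (simp add: ups_def)
lemma ups_inc: "ups T t \<Longrightarrow> incseq (\<lambda>k. T k x)" by (simp add: ups_def)
lemma ups_SUP: "ups T t \<Longrightarrow> t x = (SUP k. T k x)" by (simp add: ups_def)
lemma ups_eq: "ups T t \<Longrightarrow> t = (\<lambda>x. SUP k. T k x)" by (auto simp: ups_def)

lemma ups_const: "ups (\<lambda>_. t) t" by (simp add: ups_def)

lemma ups_mcomp:
  assumes "ups S s" "ups T t" shows "ups (\<lambda>k. mcomp (S k) (T k)) (mcomp s t)"
proof (rule upsI)
  note i = ups_inc[OF assms(1)] ups_inc[OF assms(2)]
  fix x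
  show "incseq (\<lambda>k. mcomp (S k) (T k) x)"
    by (cases x) (auto intro!: incseq_suminf incseq_mult_ennreal i simp: incseq_const)
  show "mcomp s t x = (SUP k. mcomp (S k) (T k) x)"
  proof (cases x)
    case (Pr a c)
    show ?thesis unfolding Pr mcomp.simps
      by (subst infsum_ennreal_SUP[symmetric])
         (auto intro!: incseq_mult_ennreal i infsum_cong simp: SUP_mult_chain i ups_SUP[OF assms(1)] ups_SUP[OF assms(2)])
  qed simp_all
qed

lemma ups_mtensor:
  assumes "ups S s" "ups T t" shows "ups (\<lambda>k. mtensor (S k) (T k)) (mtensor s t)"
proof (rule upsI)
  note i = ups_inc[OF assms(1)] ups_inc[OF assms(2)]
  fix x
  show "incseq (\<lambda>k. mtensor (S k) (T k) x)"
    by (cases "(s, t, x)" rule: mtensor.cases) (auto intro!: incseq_mult_ennreal i simp: incseq_const)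
  show "mtensor s t x = (SUP k. mtensor (S k) (T k) x)"
    by (cases "(s, t, x)" rule: mtensor.cases)
       (auto simp: SUP_mult_chain i ups_SUP[OF assms(1)] ups_SUP[OF assms(2)])
qed

lemma ups_mbang:
  assumes "ups T t" shows "ups (\<lambda>k. mbang (T k)) (mbang t)"
proof (rule upsI)
  note i = ups_inc[OF assms]
  fix x
  have ip: "incseq (\<lambda>k. (\<lambda>(a, b). T k (Pr a b)) p)" for p by (cases p) (simp add: i)
  have inc: "incseq (\<lambda>k. if P then c * mpow (\<lambda>(a, b). T k (Pr a b)) r else 0)"
    for P c and r :: "(point \<times> point) multiset"
    using incseq_mult_ennreal[OF incseq_const[of c] incseq_mpow[of "\<lambda>k (a, b). T k (Pr a b)" r, OF ip]]
    by (cases P) auto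
  show "incseq (\<lambda>k. mbang (T k) x)"
  proof (cases "(t, x)" rule: mbang.cases)
    case (1 t' c d)
    then have x: "x = Pr (Ms c) (Ms d)" by simp
    show ?thesis unfolding x mbang_suminf by (rule incseq_suminf) (rule inc)
  qed (auto simp: incseq_const)
  show "mbang t x = (SUP k. mbang (T k) x)"
  proof (cases "(t, x)" rule: mbang.cases)
    case (1 t' c d)
    then have x: "x = Pr (Ms c) (Ms d)" by simp
    have tt: "(\<lambda>(a, b). t (Pr a b)) = (\<lambda>p. SUP k. (\<lambda>(a, b). T k (Pr a b)) p)"
      by (auto simp: fun_eq_iff ups_SUP[OF assms])
    have "mpow (\<lambda>(a, b). t (Pr a b)) r = (SUP k. mpow (\<lambda>(a, b). T k (Pr a b)) r)" for r
      unfolding tt by (rule mpow_SUP[of "\<lambda>k (a, b). T k (Pr a b)", OF ip])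
    then have "mbang t (Pr (Ms c) (Ms d)) = (\<Sum>\<^sub>\<infinity>r. SUP k. if image_mset fst r = c \<and> image_mset snd r = d
        then of_nat (mfact d) / of_nat (mfact r) * mpow (\<lambda>(a, b). T k (Pr a b)) r else 0)"
      unfolding mbang_suminf by (intro infsum_cong) (auto simp: SUP_mult_left_ennreal)
    also have "\<dots> = (SUP k. mbang (T k) (Pr (Ms c) (Ms d)))"
      unfolding mbang_suminf by (rule infsum_ennreal_SUP) (rule inc)
    finally show ?thesis by (simp only: x)
  qed auto
qed

lemma ups_currym: "ups T t \<Longrightarrow> ups (\<lambda>k. currym (T k)) (currym t)"
proof (rule upsI)
  assume a: "ups T t"
  fix x
  show "incseq (\<lambda>k. currym (T k) x)" by (cases "(t, x)" rule: currym.cases) (auto simp: ups_inc[OF a] incseq_const)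
  show "currym t x = (SUP k. currym (T k) x)" by (cases "(t, x)" rule: currym.cases) (auto simp: ups_SUP[OF a])
qed

lemma ups_casem: "ups S s \<Longrightarrow> ups T t \<Longrightarrow> ups (\<lambda>k. casem (S k) (T k)) (casem s t)"
proof (rule upsI)
  assume a: "ups S s" "ups T t"
  fix x
  show "incseq (\<lambda>k. casem (S k) (T k) x)"
    by (cases "(s, t, x)" rule: casem.cases) (auto simp: ups_inc[OF a(1)] ups_inc[OF a(2)] incseq_const)
  show "casem s t x = (SUP k. casem (S k) (T k) x)"
    by (cases "(s, t, x)" rule: casem.cases) (auto simp: ups_SUP[OF a(1)] ups_SUP[OF a(2)])
qed

lemma ups_sc: "incseq zs \<Longrightarrow> ups T t \<Longrightarrow> ups (\<lambda>k. sc (zs k) (T k)) (sc (SUP k. zs k) t)"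
  by (rule upsI) (auto simp: sc_def SUP_mult_chain ups_inc ups_SUP[of T t] incseq_mult_ennreal)

lemma ups_tpair: "ups S s \<Longrightarrow> ups T t \<Longrightarrow> ups (\<lambda>k. tpair C (S k) (T k)) (tpair C s t)"
  unfolding tpair_def by (intro ups_mcomp ups_mtensor ups_const)

lemma ups_stopM: "ups T t \<Longrightarrow> ups (\<lambda>k. stopM C (T k)) (stopM C t)"
  unfolding stopM_def by (intro ups_mcomp ups_mbang ups_const)

lemma ups_mapp: "ups S s \<Longrightarrow> ups T t \<Longrightarrow> ups (\<lambda>k. mapp (S k) (T k)) (mapp s t)"
proof (rule upsI)
  assume a: "ups S s" "ups T t"
  fix x
  show "incseq (\<lambda>k. mapp (S k) (T k) x)"
    using ups_inc[OF a(1)] ups_inc[OF a(2)] by (auto simp: incseq_def intro!: mapp_mono)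
  show "mapp s t x = (SUP k. mapp (S k) (T k) x)"
    unfolding ups_eq[OF a(1)] ups_eq[OF a(2)] by (rule mapp_SUP) (rule ups_inc[OF a(1)], rule ups_inc[OF a(2)])
qed

lemma ups_prom: "ups T t \<Longrightarrow> ups (\<lambda>k. prom (T k)) (prom t)"
proof (rule upsI)
  assume a: "ups T t"
  fix x
  show "incseq (\<lambda>k. prom (T k) x)" by (cases x) (auto simp: incseq_const ups_inc[OF a] intro!: incseq_mpow)
  show "prom t x = (SUP k. prom (T k) x)" unfolding ups_eq[OF a]
    by (cases x) (auto simp: mpow_SUP ups_inc[OF a])
qed

lemma ups_vtensor: "ups S s \<Longrightarrow> ups T t \<Longrightarrow> ups (\<lambda>k. vtensor (S k) (T k)) (vtensor s t)"
proof (rule upsI)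
  assume a: "ups S s" "ups T t"
  fix x
  show "incseq (\<lambda>k. vtensor (S k) (T k) x)"
    by (cases x) (auto simp: incseq_const ups_inc[OF a(1)] ups_inc[OF a(2)] intro!: incseq_mult_ennreal)
  show "vtensor s t x = (SUP k. vtensor (S k) (T k) x)"
    by (cases x) (auto simp: SUP_mult_chain ups_inc[OF a(1)] ups_inc[OF a(2)] ups_SUP[OF a(1)] ups_SUP[OF a(2)])
qed

section \<open>Contexts\<close>

text \<open>A context is needed as a coalgebra, not only as a space, because pairing and promotion
  of terms act through its structure map.\<close>

primrec ctxC :: "pty list \<Rightarrow> coalg" where
  "ctxC [] = coalg_one"
| "ctxC (p # G) = coalg_tensor (ctxC G) (pty_interp p)"

lemma spc_ctxC: "spc (ctxC G) = ctx_interp G"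
  by (induction G) (simp_all add: coalg_one_def)

lemma good_ctxC: "good (ctxC G)"
  by (induction G) (simp_all add: good_one good_tensor good_pty)

lemma is_pcs_ctx: "is_pcs (ctx_interp G)" using good_pcs[OF good_ctxC] by (simp add: spc_ctxC)

lemma cpoints_Nil: "us \<in> cpoints [] \<longleftrightarrow> us = []" by (simp add: cpoints_def)

lemma cpoints_Cons: "us \<in> cpoints (p # G) \<longleftrightarrow> (\<exists>v vs. us = v # vs \<and> coalgebraic (pty_interp p) v \<and> vs \<in> cpoints G)"
  by (cases us) (auto simp: cpoints_def)

lemma tuple_coalgebraic: "us \<in> cpoints G \<Longrightarrow> coalgebraic (ctxC G) (tuple us)"
  by (induction G arbitrary: us)
     (auto simp: cpoints_Nil cpoints_Cons coalgebraic_one good_ctxC good_pty intro!: coalgebraic_tensor)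

lemma tuple_mem: "us \<in> cpoints G \<Longrightarrow> tuple us \<in> pset (ctx_interp G)"
  using coalgebraic_mem[OF tuple_coalgebraic] by (simp add: spc_ctxC)

lemma tuple_Cons_mem: "us \<in> cpoints G \<Longrightarrow> v \<in> pset (spc (pty_interp p)) \<Longrightarrow> tuple (v # us) \<in> pset (ctx_interp (p # G))"
  by (simp add: vtensor_mem is_pcs_ctx is_pcs_pty tuple_mem)

lemma separating_ctx: "separating (ctx_interp G) (tuple ` cpoints G)"
proof (induction G)
  case Nil
  have "tuple ` cpoints [] = {unit_vec}" by (auto simp: cpoints_Nil image_def)
  then show ?case by (simp add: separating_one)
next
  case (Cons p G)
  have "{vtensor u v | u v. u \<in> tuple ` cpoints G \<and> v \<in> {u. coalgebraic (pty_interp p) u}} = tuple ` cpoints (p # G)"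
    (is "?L = ?R")
  proof (intro equalityI subsetI)
    fix x assume "x \<in> ?L"
    then obtain us v where "x = tuple (v # us)" "us \<in> cpoints G" "coalgebraic (pty_interp p) v" by auto
    then show "x \<in> ?R" by (metis cpoints_Cons image_eqI)
  next
    fix x assume "x \<in> ?R"
    then obtain us v where "x = vtensor (tuple us) v" "us \<in> cpoints G" "coalgebraic (pty_interp p) v"
      by (auto simp: cpoints_Cons)
    then show "x \<in> ?L" by blast
  qed
  then show ?case using separating_tensor[OF is_pcs_ctx is_pcs_pty Cons good_sep[OF good_pty[of p]]] by simp
qed

text \<open>Density for contexts: tuples of coalgebraic points separate the tensor product of
  positive types.\<close>

lemma morphs_eqI:
  assumes "t \<in> morphs G s" "t' \<in> morphs G s" "\<And>us. us \<in> cpoints G \<Longrightarrow> ev t us = ev t' us"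
  shows "t = t'"
  by (rule separating_Pcoh_eq[OF is_pcs_ctx is_pcs_ty separating_ctx assms(1,2)[unfolded morphs_def]])
     (use assms(3) in \<open>auto simp: ev_def\<close>)

lemma ev_mem: "t \<in> morphs G s \<Longrightarrow> us \<in> cpoints G \<Longrightarrow> ev t us \<in> pset (ty_interp s)"
  unfolding ev_def morphs_def by (rule Pcoh_mapp[OF _ tuple_mem])

lemma ev_Cons_mem:
  "t \<in> morphs (p # G) s \<Longrightarrow> us \<in> cpoints G \<Longrightarrow> v \<in> pset (spc (pty_interp p)) \<Longrightarrow> ev t (v # us) \<in> pset (ty_interp s)"
  unfolding ev_def morphs_def by (rule Pcoh_mapp[OF _ tuple_Cons_mem])

section \<open>Semantics with a cost factor\<close>

text \<open>T is indexed by the cost factor z; for z > 1 its values need not be morphisms.\<close>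

definition mrep :: "pty list \<Rightarrow> ty \<Rightarrow> (ennreal \<Rightarrow> vec) \<Rightarrow> (ennreal \<Rightarrow> vec list \<Rightarrow> vec) \<Rightarrow> bool" where
  "mrep G s T F \<longleftrightarrow> (\<forall>z\<le>1. T z \<in> morphs G s \<and> (\<forall>us\<in>cpoints G. ev (T z) us = F z us))"

lemma mrepI:
  "(\<And>z. z \<le> 1 \<Longrightarrow> T z \<in> morphs G s) \<Longrightarrow> (\<And>z us. z \<le> 1 \<Longrightarrow> us \<in> cpoints G \<Longrightarrow> ev (T z) us = F z us) \<Longrightarrow> mrep G s T F"
  by (simp add: mrep_def)

lemma mrep_morphs: "mrep G s T F \<Longrightarrow> z \<le> 1 \<Longrightarrow> T z \<in> morphs G s" by (simp add: mrep_def)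
lemma mrep_ev: "mrep G s T F \<Longrightarrow> z \<le> 1 \<Longrightarrow> us \<in> cpoints G \<Longrightarrow> ev (T z) us = F z us" by (simp add: mrep_def)

lemma mrep_cong:
  "mrep G s T F \<Longrightarrow> (\<And>z us. z \<le> 1 \<Longrightarrow> us \<in> cpoints G \<Longrightarrow> F z us = F' z us) \<Longrightarrow> mrep G s T F'"
  by (simp add: mrep_def)

lemma mrep_trans: "mrep G s T F \<Longrightarrow> mrep G s T' (\<lambda>z. ev (T z)) \<Longrightarrow> mrep G s T' F"
  by (simp add: mrep_def)

lemma mrep_unique: "mrep G s T F \<Longrightarrow> z \<le> 1 \<Longrightarrow> t \<in> morphs G s \<Longrightarrow> (\<And>us. us \<in> cpoints G \<Longrightarrow> ev t us = F z us) \<Longrightarrow> T z = t"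
  by (rule morphs_eqI) (auto simp: mrep_def)

text \<open>Continuity in the cost factor is required at 1 only, and along this one sequence, whose
  terms stay strictly below 1.\<close>

definition zeta :: "nat \<Rightarrow> ennreal" where "zeta k = ennreal (1 - inverse (real (Suc k)))"

lemma zeta_less: "zeta k < 1"
  by (simp add: zeta_def ennreal_less_one_iff)

lemma zeta_inc: "incseq zeta"
  by (auto simp: incseq_def zeta_def intro!: ennreal_leI le_imp_inverse_le)

lemma zeta_SUP: "(SUP k. zeta k) = 1"
proof -
  have "(\<lambda>k. 1 - inverse (real (Suc k))) \<longlonglongrightarrow> 1 - 0"
    by (intro tendsto_diff tendsto_const LIMSEQ_inverse_real_of_nat)
  then have "zeta \<longlonglongrightarrow> ennreal 1" unfolding zeta_def by (intro tendsto_ennrealI) simp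
  moreover have "zeta \<longlonglongrightarrow> (SUP k. zeta k)" by (rule LIMSEQ_SUP[OF zeta_inc])
  ultimately show ?thesis using LIMSEQ_unique by force
qed

definition contin :: "(ennreal \<Rightarrow> vec) \<Rightarrow> bool" where "contin T \<longleftrightarrow> ups (\<lambda>k. T (zeta k)) (T 1)"

lemma contin_const: "contin (\<lambda>_. t)" by (simp add: contin_def ups_const)
lemma contin_mcomp: "contin S \<Longrightarrow> contin T \<Longrightarrow> contin (\<lambda>z. mcomp (S z) (T z))"
  unfolding contin_def by (rule ups_mcomp)
lemma contin_tpair: "contin S \<Longrightarrow> contin T \<Longrightarrow> contin (\<lambda>z. tpair C (S z) (T z))"
  unfolding contin_def by (rule ups_tpair)
lemma contin_stopM: "contin T \<Longrightarrow> contin (\<lambda>z. stopM C (T z))"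
  unfolding contin_def by (rule ups_stopM)
lemma contin_currym: "contin T \<Longrightarrow> contin (\<lambda>z. currym (T z))"
  unfolding contin_def by (rule ups_currym)
lemma contin_casem: "contin S \<Longrightarrow> contin T \<Longrightarrow> contin (\<lambda>z. casem (S z) (T z))"
  unfolding contin_def by (rule ups_casem)
lemma contin_sc: "contin T \<Longrightarrow> contin (\<lambda>z. sc z (T z))"
  unfolding contin_def using ups_sc[OF zeta_inc, of "\<lambda>k. T (zeta k)" "T 1"] by (simp only: zeta_SUP)

lemmas contin_intros = contin_const contin_mcomp contin_tpair contin_stopM contin_currym contin_casem contin_sc

abbreviation pspc :: "pty \<Rightarrow> pcs" where "pspc p \<equiv> spc (pty_interp p)"

text \<open>Value constructors and abstractions cost nothing, so that a value denotes a coalgebraic point for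
  every z.\<close>

inductive den :: "pty list \<Rightarrow> trm \<Rightarrow> ty \<Rightarrow> (ennreal \<Rightarrow> vec) \<Rightarrow> bool" where
  den_Var: "i < length G \<Longrightarrow> mrep G (Pos (G ! i)) T (\<lambda>z us. us ! i) \<Longrightarrow> den G (Var i) (Pos (G ! i)) T"
| den_Unt: "mrep G (Pos One) T (\<lambda>z us. unit_vec) \<Longrightarrow> den G Unt (Pos One) T"
| den_Lam: "den (p # G) M s m \<Longrightarrow> mrep G (Lolli p s) T (\<lambda>z us. rowfix (m z) (tuple us)) \<Longrightarrow>
    den G (Lam p M) (Lolli p s) T"
| den_App: "den G M (Lolli p s) m \<Longrightarrow> den G N (Pos p) n \<Longrightarrow>
    mrep G s T (\<lambda>z us. sc z (mapp (ev (m z) us) (ev (n z) us))) \<Longrightarrow> den G (App M N) s T"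
| den_Stop: "den G M s m \<Longrightarrow> mrep G (Pos (Bang s)) T (\<lambda>z us. prom (ev (m z) us)) \<Longrightarrow>
    den G (Stop M) (Pos (Bang s)) T"
| den_Go: "den G M (Pos (Bang s)) m \<Longrightarrow> mrep G s T (\<lambda>z us. sc z (mapp (der (ty_interp s)) (ev (m z) us))) \<Longrightarrow>
    den G (Go M) s T"
| den_Tup: "den G M (Pos p) m \<Longrightarrow> den G N (Pos q) n \<Longrightarrow>
    mrep G (Pos (Tensor p q)) T (\<lambda>z us. vtensor (ev (m z) us) (ev (n z) us)) \<Longrightarrow>
    den G (Tup M N) (Pos (Tensor p q)) T"
| den_InL: "den G M (Pos p) m \<Longrightarrow> mrep G (Pos (Plus p q)) T (\<lambda>z us. vplus (ev (m z) us) (\<lambda>_. 0)) \<Longrightarrow>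
    den G (InL M) (Pos (Plus p q)) T"
| den_InR: "den G M (Pos q) m \<Longrightarrow> mrep G (Pos (Plus p q)) T (\<lambda>z us. vplus (\<lambda>_. 0) (ev (m z) us)) \<Longrightarrow>
    den G (InR M) (Pos (Plus p q)) T"
| den_PrL: "den G M (Pos (Tensor p q)) m \<Longrightarrow>
    mrep G (Pos p) T (\<lambda>z us. sc z (mapp (proj_l (pty_interp p) (pty_interp q)) (ev (m z) us))) \<Longrightarrow>
    den G (PrL M) (Pos p) T"
| den_PrR: "den G M (Pos (Tensor p q)) m \<Longrightarrow>
    mrep G (Pos q) T (\<lambda>z us. sc z (mapp (proj_r (pty_interp p) (pty_interp q)) (ev (m z) us))) \<Longrightarrow>
    den G (PrR M) (Pos q) T"
| den_Fix: "den (Bang s # G) M s m \<Longrightarrow>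
    mrep G s T (\<lambda>z us b. SUP n. ((\<lambda>w. sc z (ev (m z) (prom w # us))) ^^ n) (\<lambda>_. 0) b) \<Longrightarrow>
    den G (Fix s M) s T"
| den_Case: "den G M (Pos (Plus p q)) m \<Longrightarrow> den (p # G) N s n \<Longrightarrow> den (q # G) R s r \<Longrightarrow>
    mrep G s T (\<lambda>z us. sc z (\<lambda>b. ev (n z) (lpart (ev (m z) us) # us) b + ev (r z) (rpart (ev (m z) us) # us) b)) \<Longrightarrow>
    den G (Case M N R) s T"
| den_Coin: "0 \<le> x \<Longrightarrow> x \<le> 1 \<Longrightarrow>
    mrep G (Pos (Plus One One)) T (\<lambda>z us. sc z (vplus (sc (ennreal (of_rat x)) unit_vec) (sc (ennreal (1 - of_rat x)) unit_vec))) \<Longrightarrow>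
    den G (Coin x) (Pos (Plus One One)) T"
| den_Fold: "den G M (Pos (unroll p)) m \<Longrightarrow> mrep G (Pos (Mu p)) T (\<lambda>z. ev (m z)) \<Longrightarrow> den G (Fold M) (Pos (Mu p)) T"
| den_Unfold: "den G M (Pos (Mu p)) m \<Longrightarrow> mrep G (Pos (unroll p)) T (\<lambda>z us. sc z (ev (m z) us)) \<Longrightarrow>
    den G (Unfold M) (Pos (unroll p)) T"

lemma den_morphs: "den G M s T \<Longrightarrow> z \<le> 1 \<Longrightarrow> T z \<in> morphs G s"
  by (cases rule: den.cases) (auto dest: mrep_morphs)

text \<open>Families with the same values at coalgebraic points for z up to 1 are interchangeable,
  although they may differ for larger z.\<close>

lemma den_ext: "den G M s T \<Longrightarrow> mrep G s T' (\<lambda>z. ev (T z)) \<Longrightarrow> den G M s T'"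
  by (erule den.cases; hypsubst) (blast intro: den.intros mrep_trans)+

section \<open>A family of morphisms for each term constructor\<close>

definition fam :: "pty list \<Rightarrow> ty \<Rightarrow> (ennreal \<Rightarrow> vec) \<Rightarrow> bool" where
  "fam G s T \<longleftrightarrow> (\<forall>z\<le>1. T z \<in> Pcoh (spc (ctxC G)) (ty_interp s))"

lemma famI: "den G M s T \<Longrightarrow> fam G s T"
  using den_morphs by (auto simp: fam_def morphs_def spc_ctxC)

lemma fam_Pcoh: "fam G s T \<Longrightarrow> z \<le> 1 \<Longrightarrow> T z \<in> Pcoh (spc (ctxC G)) (ty_interp s)" by (simp add: fam_def)

lemma fam_ev: "fam G s T \<Longrightarrow> z \<le> 1 \<Longrightarrow> us \<in> cpoints G \<Longrightarrow> ev (T z) us \<in> pset (ty_interp s)"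
  by (rule ev_mem) (simp_all add: fam_def morphs_def spc_ctxC)

text \<open>The same existence results serve twice: for families obtained from \<open>den\<close>,
  and for constant families, evaluated at z = 1, when a solution of the clauses of
  \<open>sem\<close> is needed.\<close>

lemma mrep_ctxI:
  assumes "\<And>z. z \<le> 1 \<Longrightarrow> T z \<in> Pcoh (spc (ctxC G)) (ty_interp s)"
    "\<And>z us. z \<le> 1 \<Longrightarrow> us \<in> cpoints G \<Longrightarrow> mapp (T z) (tuple us) = F z us"
  shows "mrep G s T F"
  using assms by (intro mrepI) (auto simp: morphs_def spc_ctxC ev_def)

fun varm :: "pty list \<Rightarrow> nat \<Rightarrow> vec" where
  "varm (p # G) 0 = proj_r (ctxC G) (pty_interp p)"
| "varm (p # G) (Suc i) = mcomp (varm G i) (proj_l (ctxC G) (pty_interp p))"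
| "varm [] i = (\<lambda>_. 0)"

lemma varm_ok:
  "i < length G \<Longrightarrow> varm G i \<in> Pcoh (spc (ctxC G)) (pspc (G ! i)) \<and>
    (\<forall>us\<in>cpoints G. mapp (varm G i) (tuple us) = us ! i)"
proof (induction G i rule: varm.induct)
  case (1 p G)
  then show ?case using proj_r_Pcoh[OF good_ctxC good_pty]
    by (auto simp: cpoints_Cons proj_r_app is_pcs_pty coalgebraic_mem str_empty_coalgebraic[OF tuple_coalgebraic])
next
  case (2 p G i)
  have "mapp (varm (p # G) (Suc i)) (tuple us) = us ! Suc i" if us: "us \<in> cpoints (p # G)" for us
  proof -
    obtain v vs where u: "us = v # vs" "coalgebraic (pty_interp p) v" "vs \<in> cpoints G" using us by (auto simp: cpoints_Cons)
    have "mapp (proj_l (ctxC G) (pty_interp p)) (vtensor (tuple vs) v) = tuple vs"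
      using u by (simp add: proj_l_app good_pcs[OF good_ctxC] coalgebraic_mem[OF tuple_coalgebraic] str_empty_coalgebraic)
    then show ?thesis using 2 u by (simp add: mapp_mcomp)
  qed
  moreover have "varm (p # G) (Suc i) \<in> Pcoh (spc (ctxC (p # G))) (pspc ((p # G) ! Suc i))"
    using 2 by (simp, intro mcomp_Pcoh[OF _ _ proj_l_Pcoh[OF good_ctxC good_pty]])
      (auto simp: is_pcs_tensor good_pcs good_ctxC good_pty)
  ultimately show ?case by blast
qed simp

lemma ex_Var: "i < length G \<Longrightarrow> \<exists>T. contin T \<and> mrep G (Pos (G ! i)) T (\<lambda>z us. us ! i)"
  by (rule exI[of _ "\<lambda>_. varm G i"]) (auto simp: contin_const varm_ok intro!: mrep_ctxI)

lemma ex_const: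
  assumes "\<And>z. z \<le> 1 \<Longrightarrow> w z \<in> pset (ty_interp s)" "contin (\<lambda>z. constm (ctxC G) (w z))"
  shows "\<exists>T. contin T \<and> mrep G s T (\<lambda>z us. w z)"
  by (rule exI[of _ "\<lambda>z. constm (ctxC G) (w z)"])
     (use assms in \<open>auto intro!: mrep_ctxI constm_Pcoh constm_app tuple_coalgebraic simp: good_ctxC is_pcs_ty\<close>)

lemma ex_Unt: "\<exists>T. contin T \<and> mrep G (Pos One) T (\<lambda>z us. unit_vec)"
  by (rule ex_const) (auto simp: contin_const unit_mem, simp add: coalg_one_def unit_mem)

lemma coin_mem:
  assumes "0 \<le> x" "x \<le> 1"
  shows "vplus (sc (ennreal x) unit_vec) (sc (ennreal (1 - x)) unit_vec) \<in> pset (pcs_plus pcs_one pcs_one)"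
proof -
  have l: "vplus unit_vec (\<lambda>_. 0) \<in> pset (pcs_plus pcs_one pcs_one)" by (intro vplus_mem_l is_pcs_one unit_mem)
  have r: "vplus (\<lambda>_. 0) unit_vec \<in> pset (pcs_plus pcs_one pcs_one)" by (intro vplus_mem_r is_pcs_one unit_mem)
  have s: "ennreal x + ennreal (1 - x) \<le> 1" using assms by (simp flip: ennreal_plus)
  have "vplus (sc (ennreal x) unit_vec) (sc (ennreal (1 - x)) unit_vec) =
    (\<lambda>c. ennreal x * vplus unit_vec (\<lambda>_. 0) c + ennreal (1 - x) * vplus (\<lambda>_. 0) unit_vec c)"
    (is "?l = ?r")
  proof
    fix c show "?l c = ?r c" by (cases c) (auto simp: sc_def)
  qed
  then show ?thesis using pset_convex[OF is_pcs_plus[OF is_pcs_one is_pcs_one] l r s] by simp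
qed

lemma constm_sc: "constm C (sc z w) = sc z (constm C w)"
proof
  fix x show "constm C (sc z w) x = sc z (constm C w) x" by (cases x) (auto simp: sc_def mult_ac)
qed

lemma ex_Coin:
  assumes "0 \<le> x" "x \<le> 1"
  shows "\<exists>T. contin T \<and> mrep G (Pos (Plus One One)) T
    (\<lambda>z us. sc z (vplus (sc (ennreal (of_rat x)) unit_vec) (sc (ennreal (1 - of_rat x)) unit_vec)))"
proof (rule ex_const)
  have x: "0 \<le> (of_rat x :: real)" "(of_rat x :: real) \<le> 1" using assms by (simp_all add: of_rat_le_1_iff)
  show "sc z (vplus (sc (ennreal (of_rat x)) unit_vec) (sc (ennreal (1 - of_rat x)) unit_vec)) \<in> pset (ty_interp (Pos (Plus One One)))"
    if "z \<le> 1" for z unfolding sc_def[of z] using pset_scale[OF is_pcs_plus[OF is_pcs_one is_pcs_one] coin_mem[OF x] that]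
    by (simp add: coalg_one_def)
qed (unfold constm_sc, intro contin_intros)

lemma ex_Lam:
  assumes "fam (p # G) s m"
  shows "\<exists>T. (contin m \<longrightarrow> contin T) \<and> mrep G (Lolli p s) T (\<lambda>z us. rowfix (m z) (tuple us))"
proof (rule exI[of _ "\<lambda>z. currym (m z)"], intro conjI impI contin_intros mrep_ctxI, (simp; fail)+)
  fix z :: ennreal assume "z \<le> 1"
  then show "currym (m z) \<in> Pcoh (spc (ctxC G)) (ty_interp (Lolli p s))"
    using currym_Pcoh[OF good_pcs[OF good_ctxC] is_pcs_pty is_pcs_ty, of "m z" G p s] fam_Pcoh[OF assms] by simp
qed (rule currym_mapp)

lemma ex_App:
  assumes m: "fam G (Lolli p s) m" and n: "fam G (Pos p) n"
  shows "\<exists>T. (contin m \<and> contin n \<longrightarrow> contin T) \<and> mrep G s T (\<lambda>z us. sc z (mapp (ev (m z) us) (ev (n z) us)))"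
proof (rule exI[of _ "\<lambda>z. sc z (mcomp (evalm (pspc p) (ty_interp s)) (tpair (ctxC G) (m z) (n z)))"],
    intro conjI impI contin_intros mrep_ctxI, (simp; fail)+)
  fix z :: ennreal assume z: "z \<le> 1"
  show "sc z (mcomp (evalm (pspc p) (ty_interp s)) (tpair (ctxC G) (m z) (n z))) \<in> Pcoh (spc (ctxC G)) (ty_interp s)"
    using fam_Pcoh[OF m z] fam_Pcoh[OF n z]
    by (intro sc_Pcoh z mcomp_Pcoh[OF _ _ tpair_Pcoh evalm_Pcoh])
       (auto simp: good_ctxC good_pcs is_pcs_ty is_pcs_pty is_pcs_lin)
  fix us assume us: "us \<in> cpoints G"
  have "ev (m z) us \<in> Pcoh (pspc p) (ty_interp s)" "ev (n z) us \<in> pset (pspc p)"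
    using fam_ev[OF m z us] fam_ev[OF n z us] by (auto simp: pset_lin is_pcs_pty is_pcs_ty)
  then show "mapp (sc z (mcomp (evalm (pspc p) (ty_interp s)) (tpair (ctxC G) (m z) (n z)))) (tuple us) =
     sc z (mapp (ev (m z) us) (ev (n z) us))"
    by (simp add: mapp_sc mapp_mcomp tpair_app[OF good_ctxC tuple_coalgebraic[OF us]] ev_def evalm_app is_pcs_pty)
qed

lemma ex_Stop:
  assumes m: "fam G s m"
  shows "\<exists>T. (contin m \<longrightarrow> contin T) \<and> mrep G (Pos (Bang s)) T (\<lambda>z us. prom (ev (m z) us))"
proof (rule exI[of _ "\<lambda>z. stopM (ctxC G) (m z)"], intro conjI impI contin_intros mrep_ctxI, (simp; fail)+)
  fix z :: ennreal assume z: "z \<le> 1"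
  show "stopM (ctxC G) (m z) \<in> Pcoh (spc (ctxC G)) (ty_interp (Pos (Bang s)))"
    using stopM_Pcoh[OF good_ctxC is_pcs_ty fam_Pcoh[OF m z]] by (simp add: coalg_bang_def)
qed (simp add: stopM_app tuple_coalgebraic ev_def)

lemma ex_post:
  assumes m: "fam G s m" and B: "B \<in> Pcoh (ty_interp s) (ty_interp s')"
  shows "\<exists>T. (contin m \<longrightarrow> contin T) \<and> mrep G s' T (\<lambda>z us. mapp B (ev (m z) us))"
proof (rule exI[of _ "\<lambda>z. mcomp B (m z)"], intro conjI impI contin_intros mrep_ctxI, (simp; fail)+)
  fix z :: ennreal assume z: "z \<le> 1"
  show "mcomp B (m z) \<in> Pcoh (spc (ctxC G)) (ty_interp s')"
    by (rule mcomp_Pcoh[OF _ _ fam_Pcoh[OF m z] B]) (auto simp: good_pcs good_ctxC is_pcs_ty)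
qed (simp add: mapp_mcomp ev_def)

lemma ex_sc:
  assumes "\<exists>T. (P \<longrightarrow> contin T) \<and> mrep G s T F"
  shows "\<exists>T. (P \<longrightarrow> contin T) \<and> mrep G s T (\<lambda>z us. sc z (F z us))"
proof -
  obtain T where T: "P \<longrightarrow> contin T" "mrep G s T F" using assms by blast
  show ?thesis
  proof (rule exI[of _ "\<lambda>z. sc z (T z)"], intro conjI impI mrepI)
    show "contin (\<lambda>z. sc z (T z))" if P using that T(1) by (simp add: contin_sc)
  qed (use T(2) in \<open>auto simp: mrep_def morphs_def sc_Pcoh is_pcs_ctx is_pcs_ty ev_def mapp_sc\<close>)
qed

lemma ex_InL:
  assumes m: "fam G (Pos p) m"
  shows "\<exists>T. (contin m \<longrightarrow> contin T) \<and> mrep G (Pos (Plus p q)) T (\<lambda>z us. vplus (ev (m z) us) (\<lambda>_. 0))"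
proof -
  have "inj_l (pspc p) \<in> Pcoh (ty_interp (Pos p)) (ty_interp (Pos (Plus p q)))"
    by (simp add: inj_l_Pcoh is_pcs_pty)
  from ex_post[OF m this] obtain T where "contin m \<longrightarrow> contin T"
    "mrep G (Pos (Plus p q)) T (\<lambda>z us. mapp (inj_l (pspc p)) (ev (m z) us))" by blast
  then show ?thesis using fam_ev[OF m]
    by (intro exI[of _ T] conjI) (auto elim!: mrep_cong simp: inj_l_app is_pcs_pty)
qed

lemma ex_InR:
  assumes m: "fam G (Pos q) m"
  shows "\<exists>T. (contin m \<longrightarrow> contin T) \<and> mrep G (Pos (Plus p q)) T (\<lambda>z us. vplus (\<lambda>_. 0) (ev (m z) us))"
proof -
  have "inj_r (pspc q) \<in> Pcoh (ty_interp (Pos q)) (ty_interp (Pos (Plus p q)))"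
    by (simp add: inj_r_Pcoh is_pcs_pty)
  from ex_post[OF m this] obtain T where "contin m \<longrightarrow> contin T"
    "mrep G (Pos (Plus p q)) T (\<lambda>z us. mapp (inj_r (pspc q)) (ev (m z) us))" by blast
  then show ?thesis using fam_ev[OF m]
    by (intro exI[of _ T] conjI) (auto elim!: mrep_cong simp: inj_r_app is_pcs_pty)
qed

lemma ex_Go:
  assumes m: "fam G (Pos (Bang s)) m"
  shows "\<exists>T. (contin m \<longrightarrow> contin T) \<and> mrep G s T (\<lambda>z us. sc z (mapp (der (ty_interp s)) (ev (m z) us)))"
  by (rule ex_sc, rule ex_post[OF m]) (simp add: coalg_bang_def der_Pcoh is_pcs_ty)

lemma ex_PrL:
  assumes m: "fam G (Pos (Tensor p q)) m"
  shows "\<exists>T. (contin m \<longrightarrow> contin T) \<and>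
    mrep G (Pos p) T (\<lambda>z us. sc z (mapp (proj_l (pty_interp p) (pty_interp q)) (ev (m z) us)))"
  by (rule ex_sc, rule ex_post[OF m]) (simp add: proj_l_Pcoh good_pty)

lemma ex_PrR:
  assumes m: "fam G (Pos (Tensor p q)) m"
  shows "\<exists>T. (contin m \<longrightarrow> contin T) \<and>
    mrep G (Pos q) T (\<lambda>z us. sc z (mapp (proj_r (pty_interp p) (pty_interp q)) (ev (m z) us)))"
  by (rule ex_sc, rule ex_post[OF m]) (simp add: proj_r_Pcoh good_pty)

lemma morphs_unroll: "morphs G (Pos (Mu p)) = morphs G (Pos (unroll p))"
  by (simp add: morphs_def pty_interp_unroll)

lemma ex_Fold: "fam G (Pos (unroll p)) m \<Longrightarrow> mrep G (Pos (Mu p)) m (\<lambda>z. ev (m z))"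
  unfolding mrep_def morphs_unroll by (simp add: fam_def morphs_def spc_ctxC)

lemma ex_Unfold:
  assumes m: "fam G (Pos (Mu p)) m"
  shows "\<exists>T. (contin m \<longrightarrow> contin T) \<and> mrep G (Pos (unroll p)) T (\<lambda>z us. sc z (ev (m z) us))"
  by (rule ex_sc, rule exI[of _ m])
     (use m in \<open>simp add: mrep_def morphs_unroll[symmetric], simp add: fam_def morphs_def spc_ctxC\<close>)

lemma ex_Tup:
  assumes m: "fam G (Pos p) m" and n: "fam G (Pos q) n"
  shows "\<exists>T. (contin m \<and> contin n \<longrightarrow> contin T) \<and> mrep G (Pos (Tensor p q)) T (\<lambda>z us. vtensor (ev (m z) us) (ev (n z) us))"
proof (rule exI[of _ "\<lambda>z. tpair (ctxC G) (m z) (n z)"],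
    intro conjI impI contin_intros mrep_ctxI, (simp; fail)+)
  fix z :: ennreal assume z: "z \<le> 1"
  show "tpair (ctxC G) (m z) (n z) \<in> Pcoh (spc (ctxC G)) (ty_interp (Pos (Tensor p q)))"
    using tpair_Pcoh[OF good_ctxC is_pcs_ty is_pcs_ty fam_Pcoh[OF m z] fam_Pcoh[OF n z]] by simp
qed (simp add: tpair_app good_ctxC tuple_coalgebraic ev_def)

lemma ex_Case:
  assumes m: "fam G (Pos (Plus p q)) m" and n: "fam (p # G) s n" and r: "fam (q # G) s r"
  shows "\<exists>T. (contin m \<and> contin n \<and> contin r \<longrightarrow> contin T) \<and> mrep G s T (\<lambda>z us. sc z (\<lambda>b. ev (n z) (lpart (ev (m z) us) # us) b
    + ev (r z) (rpart (ev (m z) us) # us) b))"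
proof (rule exI[of _ "\<lambda>z. sc z (mcomp (casem (n z) (r z)) (tpair (ctxC G) (idm (spc (ctxC G))) (m z)))"],
    intro conjI impI contin_intros mrep_ctxI, (simp; fail)+)
  fix z :: ennreal assume z: "z \<le> 1"
  have C: "is_pcs (spc (ctxC G))" by (simp add: good_pcs good_ctxC)
  show "sc z (mcomp (casem (n z) (r z)) (tpair (ctxC G) (idm (spc (ctxC G))) (m z))) \<in> Pcoh (spc (ctxC G)) (ty_interp s)"
    using fam_Pcoh[OF m z] fam_Pcoh[OF n z] fam_Pcoh[OF r z]
    by (intro sc_Pcoh z mcomp_Pcoh[OF _ _ tpair_Pcoh casem_Pcoh])
       (auto simp: good_ctxC C is_pcs_ty is_pcs_pty is_pcs_plus idm_Pcoh)
  fix us assume us: "us \<in> cpoints G"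
  have "mapp (idm (spc (ctxC G))) (tuple us) = tuple us"
    by (rule idm_app[OF C coalgebraic_mem[OF tuple_coalgebraic[OF us]]])
  then show "mapp (sc z (mcomp (casem (n z) (r z)) (tpair (ctxC G) (idm (spc (ctxC G))) (m z)))) (tuple us) =
     sc z (\<lambda>b. ev (n z) (lpart (ev (m z) us) # us) b + ev (r z) (rpart (ev (m z) us) # us) b)"
    by (simp add: mapp_sc mapp_mcomp tpair_app[OF good_ctxC tuple_coalgebraic[OF us]] casem_app ev_def)
qed

section \<open>Fixed points as suprema of morphisms\<close>

definition fixstep :: "coalg \<Rightarrow> ennreal \<Rightarrow> vec \<Rightarrow> vec \<Rightarrow> vec" where
  "fixstep C z m w = sc z (mcomp m (tpair C (idm (spc C)) (stopM C w)))"

text \<open>The iteration takes place among morphisms on the context. At a coalgebraic tuple the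
  j-th morphism takes the j-th iterate as its value, so that the supremum is visibly a
  morphism.\<close>

primrec fixn :: "coalg \<Rightarrow> ennreal \<Rightarrow> vec \<Rightarrow> nat \<Rightarrow> vec" where
  "fixn C z m 0 = (\<lambda>_. 0)"
| "fixn C z m (Suc j) = fixstep C z m (fixn C z m j)"

lemma ups_fixstep: "incseq zs \<Longrightarrow> ups M m \<Longrightarrow> ups W w \<Longrightarrow> ups (\<lambda>k. fixstep C (zs k) (M k) (W k)) (fixstep C (SUP k. zs k) m w)"
  unfolding fixstep_def by (intro ups_sc ups_mcomp ups_tpair ups_stopM ups_const)

lemma fixstep_mono: "(\<And>x. w x \<le> w' x) \<Longrightarrow> fixstep C z m w x \<le> fixstep C z m w' x"
proof -
  assume le: "\<And>x. w x \<le> w' x"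
  \<comment> \<open>Monotonicity is deduced from continuity, applied to the sequence that starts at
    \<open>w\<close> and is then constantly \<open>w'\<close>.\<close>
  let ?W = "\<lambda>k::nat. if k = 0 then w else w'"
  have "ups ?W w'"
  proof (rule upsI)
    fix x show "incseq (\<lambda>k. ?W k x)" using le by (auto simp: incseq_def)
    show "w' x = (SUP k. ?W k x)"
      by (rule antisym, rule SUP_upper2[of 1]) (auto intro!: SUP_least le)
  qed
  then have "ups (\<lambda>k. fixstep C z m (?W k)) (fixstep C (SUP k::nat. z) m w')"
    by (intro ups_fixstep ups_const) (auto simp: incseq_def)
  from ups_inc[OF this, of x] show ?thesis unfolding incseq_def by (metis le_numeral_extra(4) one_neq_zero zero_le)
qed

lemma fixn_inc: "incseq (\<lambda>j. fixn C z m j x)"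
proof (rule incseq_SucI)
  fix j show "fixn C z m j x \<le> fixn C z m (Suc j) x"
    by (induction j arbitrary: x) (auto intro!: fixstep_mono)
qed

lemma fixn_ups: "contin m \<Longrightarrow> ups (\<lambda>k. fixn C (zeta k) (m (zeta k)) j) (fixn C 1 (m 1) j)"
proof (induction j)
  case (Suc j)
  then show ?case using ups_fixstep[OF zeta_inc, of "\<lambda>k. m (zeta k)" "m 1"]
    by (simp add: zeta_SUP contin_def)
qed (simp add: ups_const)

lemma ex_Fix:
  assumes m: "fam (Bang s # G) s m"
  shows "\<exists>T. (contin m \<longrightarrow> contin T) \<and> mrep G s T (\<lambda>z us b. SUP n. ((\<lambda>w. sc z (ev (m z) (prom w # us))) ^^ n) (\<lambda>_. 0) b)"
proof (rule exI[of _ "\<lambda>z x. SUP j. fixn (ctxC G) z (m z) j x"], intro conjI impI mrep_ctxI)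
  let ?C = "ctxC G"
  assume "contin m"
  note u = fixn_ups[OF this, of ?C]
  show "contin (\<lambda>z x. SUP j. fixn ?C z (m z) j x)"
    unfolding contin_def
  proof (rule upsI)
    fix x
    show "incseq (\<lambda>k. SUP j. fixn ?C (zeta k) (m (zeta k)) j x)"
      unfolding incseq_def using ups_inc[OF u] by (auto simp: incseq_def intro!: SUP_mono')
    \<comment> \<open>Each iterate is continuous in the cost factor, and the suprema over iterates
      and over cost factors commute.\<close>
    show "(SUP j. fixn ?C 1 (m 1) j x) = (SUP k. SUP j. fixn ?C (zeta k) (m (zeta k)) j x)"
      unfolding ups_SUP[OF u] by (rule SUP_commute)
  qed
next
  let ?C = "ctxC G"
  fix z :: ennreal assume z: "z \<le> 1"
  have C: "is_pcs (spc ?C)" by (simp add: good_pcs good_ctxC)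
  have P: "fixn ?C z (m z) j \<in> Pcoh (spc ?C) (ty_interp s)" for j
  proof (induction j)
    case 0 show ?case by (simp add: zero_Pcoh C is_pcs_ty)
  next
    case (Suc j)
    then show ?case unfolding fixn.simps fixstep_def using fam_Pcoh[OF m z]
      by (intro sc_Pcoh z mcomp_Pcoh[OF _ _ tpair_Pcoh[OF _ _ _ idm_Pcoh stopM_Pcoh]])
         (auto simp: good_ctxC C is_pcs_ty is_pcs_bang coalg_bang_def)
  qed
  show "(\<lambda>x. SUP j. fixn ?C z (m z) j x) \<in> Pcoh (spc ?C) (ty_interp s)"
    by (rule SUP_Pcoh[OF C is_pcs_ty P fixn_inc])
  fix us assume us: "us \<in> cpoints G"
  have c: "coalgebraic ?C (tuple us)" by (rule tuple_coalgebraic[OF us])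
  have "mapp (fixn ?C z (m z) j) (tuple us) = ((\<lambda>w. sc z (ev (m z) (prom w # us))) ^^ j) (\<lambda>_. 0)" for j
  proof (induction j)
    case 0 show ?case by (simp add: mapp_def)
  next
    case (Suc j)
    then show ?case
      by (simp add: fixstep_def mapp_sc mapp_mcomp tpair_app[OF good_ctxC c] stopM_app[OF c] idm_app[OF C coalgebraic_mem[OF c]] ev_def)
  qed
  then show "mapp (\<lambda>x. SUP j. fixn ?C z (m z) j x) (tuple us) =
      (\<lambda>b. SUP n. ((\<lambda>w. sc z (ev (m z) (prom w # us))) ^^ n) (\<lambda>_. 0) b)"
    by (intro ext) (simp add: mapp_SUP_mat fixn_inc)
qed

section \<open>Extension of the semantics to families, and its existence\<close>

lemma coin_vec: "(\<lambda>b. if b = PL Star then c else if b = PR Star then d else 0) = vplus (sc c unit_vec) (sc d unit_vec)"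
  (is "?l = ?r")
proof
  fix b show "?l b = ?r b" by (cases b) (auto simp: sc_def unit_vec_def)
qed

text \<open>The clause for abstractions constrains only coalgebraic arguments. Density at the
  argument type turns it into an equality of matrices.\<close>

lemma Lam_ev:
  assumes "m \<in> morphs (p # G) s" "t \<in> morphs G (Lolli p s)" "us \<in> cpoints G"
    "\<And>v. coalgebraic (pty_interp p) v \<Longrightarrow> mapp (ev t us) v = ev m (v # us)"
  shows "ev t us = rowfix m (tuple us)"
proof (rule separating_Pcoh_eq[OF is_pcs_pty is_pcs_ty good_sep[OF good_pty]])
  show "ev t us \<in> Pcoh (pspc p) (ty_interp s)"
    using ev_mem[OF assms(2,3)] by (simp add: pset_lin is_pcs_pty is_pcs_ty)
  show "rowfix m (tuple us) \<in> Pcoh (pspc p) (ty_interp s)"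
    using assms(1) by (intro rowfix_Pcoh[OF is_pcs_ctx is_pcs_pty is_pcs_ty _ tuple_mem[OF assms(3)]]) (simp add: morphs_def)
  fix v assume "v \<in> {u. coalgebraic (pty_interp p) u}"
  then show "mapp (ev t us) v = mapp (rowfix m (tuple us)) v" using assms(4) by (simp add: mapp_rowfix ev_def)
qed

lemma Case_rho:
  assumes "m \<in> morphs G (Pos (Plus p q))" "us \<in> cpoints G"
  shows "mapp (rho_l (pspc p)) (ev m us) = lpart (ev m us)" "mapp (rho_r (pspc q)) (ev m us) = rpart (ev m us)"
  using ev_mem[OF assms] rho_app[OF is_pcs_pty is_pcs_pty] by auto

lemma mrep_at_1: "mrep G s T F \<Longrightarrow> T 1 \<in> morphs G s \<and> (\<forall>us\<in>cpoints G. ev (T 1) us = F 1 us)"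
  by (simp add: mrep_def)

lemma mrep_eq_1: "mrep G s T F \<Longrightarrow> t \<in> morphs G s \<Longrightarrow> (\<And>us. us \<in> cpoints G \<Longrightarrow> ev t us = F 1 us) \<Longrightarrow> T 1 = t"
  using mrep_unique[of G s T F 1 t] by auto

text \<open>By density, each clause of the semantics has at most one solution, so that every derivation of
  the original semantics extends to a continuous family.\<close>

lemma sem_den: "sem G M s t \<Longrightarrow> \<exists>T. contin T \<and> den G M s T \<and> T 1 = t"
proof (induction rule: sem.induct)
  case (sem_Var i G t)
  then obtain T where T: "contin T" "mrep G (Pos (G ! i)) T (\<lambda>z us. us ! i)" using ex_Var by blast
  have "T 1 = t" by (rule mrep_eq_1[OF T(2)]) (use sem_Var in auto)
  then show ?case using T den_Var sem_Var by blast
next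
  case (sem_Unt t G)
  obtain T where T: "contin T" "mrep G (Pos One) T (\<lambda>z us. unit_vec)" using ex_Unt by blast
  have "T 1 = t" by (rule mrep_eq_1[OF T(2)]) (use sem_Unt in auto)
  then show ?case using T den_Unt by blast
next
  case (sem_Lam p G M s m0 t)
  then obtain m where m: "contin m" "den (p # G) M s m" "m 1 = m0" by blast
  obtain T where T: "contin T" "mrep G (Lolli p s) T (\<lambda>z us. rowfix (m z) (tuple us))"
    using ex_Lam[OF famI[OF m(2)]] m(1) by blast
  have "T 1 = t"
  proof (rule mrep_eq_1[OF T(2)])
    fix us assume us: "us \<in> cpoints G"
    show "ev t us = rowfix (m 1) (tuple us)"
      by (rule Lam_ev[OF den_morphs[OF m(2)]]) (use sem_Lam us m(3) in auto)
  qed (use sem_Lam in auto)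
  then show ?case using T den_Lam m by blast
next
  case (sem_App G M p s m0 N n0 t)
  then obtain m n where m: "contin m" "den G M (Lolli p s) m" "m 1 = m0" and n: "contin n" "den G N (Pos p) n" "n 1 = n0"
    by blast
  obtain T where T: "contin T" "mrep G s T (\<lambda>z us. sc z (mapp (ev (m z) us) (ev (n z) us)))"
    using ex_App[OF famI[OF m(2)] famI[OF n(2)]] m(1) n(1) by blast
  have "T 1 = t" by (rule mrep_eq_1[OF T(2)]) (use sem_App m(3) n(3) in auto)
  then show ?case using T den_App m n by blast
next
  case (sem_Stop G M s m0 t)
  then obtain m where m: "contin m" "den G M s m" "m 1 = m0" by blast
  obtain T where T: "contin T" "mrep G (Pos (Bang s)) T (\<lambda>z us. prom (ev (m z) us))"
    using ex_Stop[OF famI[OF m(2)]] m(1) by blast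
  have "T 1 = t" by (rule mrep_eq_1[OF T(2)]) (use sem_Stop m(3) in auto)
  then show ?case using T den_Stop m by blast
next
  case (sem_Go G M s m0 t)
  then obtain m where m: "contin m" "den G M (Pos (Bang s)) m" "m 1 = m0" by blast
  obtain T where T: "contin T" "mrep G s T (\<lambda>z us. sc z (mapp (der (ty_interp s)) (ev (m z) us)))"
    using ex_Go[OF famI[OF m(2)]] m(1) by blast
  have "T 1 = t" by (rule mrep_eq_1[OF T(2)]) (use sem_Go m(3) in auto)
  then show ?case using T den_Go m by blast
next
  case (sem_Tup G M p m0 N q n0 t)
  then obtain m n where m: "contin m" "den G M (Pos p) m" "m 1 = m0" and n: "contin n" "den G N (Pos q) n" "n 1 = n0"
    by blast
  obtain T where T: "contin T" "mrep G (Pos (Tensor p q)) T (\<lambda>z us. vtensor (ev (m z) us) (ev (n z) us))"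
    using ex_Tup[OF famI[OF m(2)] famI[OF n(2)]] m(1) n(1) by blast
  have "T 1 = t" by (rule mrep_eq_1[OF T(2)]) (use sem_Tup m(3) n(3) in auto)
  then show ?case using T den_Tup m n by blast
next
  case (sem_InL q G M p m0 t)
  then obtain m where m: "contin m" "den G M (Pos p) m" "m 1 = m0" by blast
  obtain T where T: "contin T" "mrep G (Pos (Plus p q)) T (\<lambda>z us. vplus (ev (m z) us) (\<lambda>_. 0))"
    using ex_InL[OF famI[OF m(2)]] m(1) by blast
  have "T 1 = t" by (rule mrep_eq_1[OF T(2)])
    (use sem_InL m(3) fam_ev[OF famI[OF m(2)], of 1] in \<open>auto simp: inj_l_app is_pcs_pty\<close>)
  then show ?case using T den_InL m by blast
next
  case (sem_InR p G M q m0 t)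
  then obtain m where m: "contin m" "den G M (Pos q) m" "m 1 = m0" by blast
  obtain T where T: "contin T" "mrep G (Pos (Plus p q)) T (\<lambda>z us. vplus (\<lambda>_. 0) (ev (m z) us))"
    using ex_InR[OF famI[OF m(2)]] m(1) by blast
  have "T 1 = t" by (rule mrep_eq_1[OF T(2)])
    (use sem_InR m(3) fam_ev[OF famI[OF m(2)], of 1] in \<open>auto simp: inj_r_app is_pcs_pty\<close>)
  then show ?case using T den_InR m by blast
next
  case (sem_PrL G M p q m0 t)
  then obtain m where m: "contin m" "den G M (Pos (Tensor p q)) m" "m 1 = m0" by blast
  obtain T where T: "contin T" "mrep G (Pos p) T (\<lambda>z us. sc z (mapp (proj_l (pty_interp p) (pty_interp q)) (ev (m z) us)))"
    using ex_PrL[OF famI[OF m(2)]] m(1) by blast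
  have "T 1 = t" by (rule mrep_eq_1[OF T(2)]) (use sem_PrL m(3) in auto)
  then show ?case using T den_PrL m by blast
next
  case (sem_PrR G M p q m0 t)
  then obtain m where m: "contin m" "den G M (Pos (Tensor p q)) m" "m 1 = m0" by blast
  obtain T where T: "contin T" "mrep G (Pos q) T (\<lambda>z us. sc z (mapp (proj_r (pty_interp p) (pty_interp q)) (ev (m z) us)))"
    using ex_PrR[OF famI[OF m(2)]] m(1) by blast
  have "T 1 = t" by (rule mrep_eq_1[OF T(2)]) (use sem_PrR m(3) in auto)
  then show ?case using T den_PrR m by blast
next
  case (sem_Fix s G M m0 t)
  then obtain m where m: "contin m" "den (Bang s # G) M s m" "m 1 = m0" by blast
  obtain T where T: "contin T" "mrep G s T (\<lambda>z us b. SUP n. ((\<lambda>w. sc z (ev (m z) (prom w # us))) ^^ n) (\<lambda>_. 0) b)"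
    using ex_Fix[OF famI[OF m(2)]] m(1) by blast
  have "T 1 = t" by (rule mrep_eq_1[OF T(2)]) (use sem_Fix m(3) in auto)
  then show ?case using T den_Fix m by blast
next
  case (sem_Case G M p q m0 N s n0 R r0 t)
  then obtain m n r where m: "contin m" "den G M (Pos (Plus p q)) m" "m 1 = m0"
    and n: "contin n" "den (p # G) N s n" "n 1 = n0" and r: "contin r" "den (q # G) R s r" "r 1 = r0" by blast
  obtain T where T: "contin T" "mrep G s T (\<lambda>z us. sc z (\<lambda>b. ev (n z) (lpart (ev (m z) us) # us) b + ev (r z) (rpart (ev (m z) us) # us) b))"
    using ex_Case[OF famI[OF m(2)] famI[OF n(2)] famI[OF r(2)]] m(1) n(1) r(1) by blast
  have "T 1 = t" by (rule mrep_eq_1[OF T(2)])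
    (use sem_Case m(3) n(3) r(3) Case_rho[OF den_morphs[OF m(2)], of 1] in auto)
  then show ?case using T den_Case m n r by blast
next
  case (sem_Coin x t G)
  then obtain T where T: "contin T" "mrep G (Pos (Plus One One)) T (\<lambda>z us. sc z (vplus (sc (ennreal (of_rat x)) unit_vec) (sc (ennreal (1 - of_rat x)) unit_vec)))"
    using ex_Coin by blast
  have "T 1 = t" by (rule mrep_eq_1[OF T(2)]) (use sem_Coin in \<open>auto simp: coin_vec\<close>)
  then show ?case using T den_Coin sem_Coin by blast
next
  case (sem_Fold G M p t)
  then obtain m where m: "contin m" "den G M (Pos (unroll p)) m" "m 1 = t" by blast
  then show ?case using den_Fold[OF m(2) ex_Fold[OF famI[OF m(2)]]] by blast
next
  case (sem_Unfold G M p t)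
  then obtain m where m: "contin m" "den G M (Pos (Mu p)) m" "m 1 = t" by blast
  obtain T where T: "contin T" "mrep G (Pos (unroll p)) T (\<lambda>z us. sc z (ev (m z) us))"
    using ex_Unfold[OF famI[OF m(2)]] m(1) by blast
  have "T 1 = t" by (rule mrep_eq_1[OF T(2)])
    (use m(3) den_morphs[OF m(2), of 1] in \<open>auto simp: morphs_unroll\<close>)
  then show ?case using T den_Unfold m by blast
qed

lemma sem_morphs: "sem G M s t \<Longrightarrow> t \<in> morphs G s"
  using sem_den den_morphs by fastforce

lemma sem_fam: "sem G M s t \<Longrightarrow> fam G s (\<lambda>_. t)"
  using sem_morphs by (simp add: fam_def morphs_def spc_ctxC)

text \<open>Each clause is solved by the morphism constructed above, taken at cost factor 1, where
  the scaling disappears.\<close>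

lemma typing_sem: "typing G M s \<Longrightarrow> \<exists>t. sem G M s t"
proof (induction rule: typing.induct)
  case (1 i G)
  then show ?case using ex_Var[THEN exE, of i G] mrep_at_1 sem_Var by (metis (no_types, lifting))
next
  case (2 G)
  obtain T where "mrep G (Pos One) T (\<lambda>z us. unit_vec)" using ex_Unt by blast
  then show ?case using mrep_at_1 sem_Unt by blast
next
  case (3 p G M s)
  then obtain m where m: "sem (p # G) M s m" by blast
  obtain T where T: "mrep G (Lolli p s) T (\<lambda>z us. rowfix m (tuple us))" using ex_Lam[OF sem_fam[OF m]] by blast
  have "sem G (Lam p M) (Lolli p s) (T 1)"
    by (rule sem_Lam[OF 3(1) m]) (use mrep_at_1[OF T] in \<open>auto simp: mapp_rowfix ev_def\<close>)
  then show ?case by blast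
next
  case (4 G M p s N)
  then obtain m n where m: "sem G M (Lolli p s) m" and n: "sem G N (Pos p) n" by blast
  obtain T where T: "mrep G s T (\<lambda>z us. sc z (mapp (ev m us) (ev n us)))" using ex_App[OF sem_fam[OF m] sem_fam[OF n]] by blast
  have "sem G (App M N) s (T 1)" by (rule sem_App[OF m n]) (use mrep_at_1[OF T] in auto)
  then show ?case by blast
next
  case (5 G M s)
  then obtain m where m: "sem G M s m" by blast
  obtain T where T: "mrep G (Pos (Bang s)) T (\<lambda>z us. prom (ev m us))" using ex_Stop[OF sem_fam[OF m]] by blast
  have "sem G (Stop M) (Pos (Bang s)) (T 1)" by (rule sem_Stop[OF m]) (use mrep_at_1[OF T] in auto)
  then show ?case by blast
next
  case (6 G M s)
  then obtain m where m: "sem G M (Pos (Bang s)) m" by blast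
  obtain T where T: "mrep G s T (\<lambda>z us. sc z (mapp (der (ty_interp s)) (ev m us)))" using ex_Go[OF sem_fam[OF m]] by blast
  have "sem G (Go M) s (T 1)" by (rule sem_Go[OF m]) (use mrep_at_1[OF T] in auto)
  then show ?case by blast
next
  case (7 G M p N q)
  then obtain m n where m: "sem G M (Pos p) m" and n: "sem G N (Pos q) n" by blast
  obtain T where T: "mrep G (Pos (Tensor p q)) T (\<lambda>z us. vtensor (ev m us) (ev n us))" using ex_Tup[OF sem_fam[OF m] sem_fam[OF n]] by blast
  have "sem G (Tup M N) (Pos (Tensor p q)) (T 1)" by (rule sem_Tup[OF m n]) (use mrep_at_1[OF T] in auto)
  then show ?case by blast
next
  case (8 q G M p)
  then obtain m where m: "sem G M (Pos p) m" by blast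
  obtain T where T: "mrep G (Pos (Plus p q)) T (\<lambda>z us. vplus (ev m us) (\<lambda>_. 0))" using ex_InL[OF sem_fam[OF m]] by blast
  have "sem G (InL M) (Pos (Plus p q)) (T 1)"
    by (rule sem_InL[OF 8(1) m]) (use mrep_at_1[OF T] ev_mem[OF sem_morphs[OF m]] in \<open>auto simp: inj_l_app is_pcs_pty\<close>)
  then show ?case by blast
next
  case (9 p G M q)
  then obtain m where m: "sem G M (Pos q) m" by blast
  obtain T where T: "mrep G (Pos (Plus p q)) T (\<lambda>z us. vplus (\<lambda>_. 0) (ev m us))" using ex_InR[OF sem_fam[OF m]] by blast
  have "sem G (InR M) (Pos (Plus p q)) (T 1)"
    by (rule sem_InR[OF 9(1) m]) (use mrep_at_1[OF T] ev_mem[OF sem_morphs[OF m]] in \<open>auto simp: inj_r_app is_pcs_pty\<close>)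
  then show ?case by blast
next
  case (10 G M p q)
  then obtain m where m: "sem G M (Pos (Tensor p q)) m" by blast
  obtain T where T: "mrep G (Pos p) T (\<lambda>z us. sc z (mapp (proj_l (pty_interp p) (pty_interp q)) (ev m us)))" using ex_PrL[OF sem_fam[OF m]] by blast
  have "sem G (PrL M) (Pos p) (T 1)" by (rule sem_PrL[OF m]) (use mrep_at_1[OF T] in auto)
  then show ?case by blast
next
  case (11 G M p q)
  then obtain m where m: "sem G M (Pos (Tensor p q)) m" by blast
  obtain T where T: "mrep G (Pos q) T (\<lambda>z us. sc z (mapp (proj_r (pty_interp p) (pty_interp q)) (ev m us)))" using ex_PrR[OF sem_fam[OF m]] by blast
  have "sem G (PrR M) (Pos q) (T 1)" by (rule sem_PrR[OF m]) (use mrep_at_1[OF T] in auto)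
  then show ?case by blast
next
  case (12 s G M)
  then obtain m where m: "sem (Bang s # G) M s m" by blast
  obtain T where T: "mrep G s T (\<lambda>z us b. SUP n. ((\<lambda>w. sc z (ev m (prom w # us))) ^^ n) (\<lambda>_. 0) b)" using ex_Fix[OF sem_fam[OF m]] by blast
  have "sem G (Fix s M) s (T 1)" by (rule sem_Fix[OF 12(1) m]) (use mrep_at_1[OF T] in auto)
  then show ?case by blast
next
  case (13 G M p q N s R)
  then obtain m n r where m: "sem G M (Pos (Plus p q)) m" and n: "sem (p # G) N s n" and r: "sem (q # G) R s r" by blast
  obtain T where T: "mrep G s T (\<lambda>z us. sc z (\<lambda>b. ev n (lpart (ev m us) # us) b + ev r (rpart (ev m us) # us) b))"
    using ex_Case[OF sem_fam[OF m] sem_fam[OF n] sem_fam[OF r]] by blast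
  have "sem G (Case M N R) s (T 1)"
    by (rule sem_Case[OF m n r]) (use mrep_at_1[OF T] Case_rho[OF sem_morphs[OF m]] in auto)
  then show ?case by blast
next
  case (14 x G)
  obtain T where T: "mrep G (Pos (Plus One One)) T (\<lambda>z us. sc z (vplus (sc (ennreal (of_rat x)) unit_vec) (sc (ennreal (1 - of_rat x)) unit_vec)))"
    using ex_Coin[OF 14] by blast
  have "sem G (Coin x) (Pos (Plus One One)) (T 1)"
    by (rule sem_Coin[OF 14]) (use mrep_at_1[OF T] in \<open>auto simp: coin_vec\<close>)
  then show ?case by blast
next
  case (15 G M p)
  then show ?case using sem_Fold by blast
next
  case (16 G M p)
  then show ?case using sem_Unfold by blast
qed

section \<open>Substitution\<close>

lemma den_closed_lift_subst: "den G M s T \<Longrightarrow> length G \<le> k \<Longrightarrow> lift M k = M \<and> subst M V k = M"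
  by (induction arbitrary: k V rule: den.induct) auto

text \<open>A semantic substitution: a morphism between contexts, given at coalgebraic tuples by a
  function to coalgebraic tuples.\<close>

definition cmap :: "pty list \<Rightarrow> pty list \<Rightarrow> (ennreal \<Rightarrow> vec) \<Rightarrow> (ennreal \<Rightarrow> vec list \<Rightarrow> vec list) \<Rightarrow> bool" where
  "cmap G' G S f \<longleftrightarrow> (\<forall>z\<le>1. S z \<in> Pcoh (ctx_interp G') (ctx_interp G) \<and>
     (\<forall>us\<in>cpoints G'. f z us \<in> cpoints G \<and> mapp (S z) (tuple us) = tuple (f z us)))"

lemma cmapD:
  assumes "cmap G' G S f" "z \<le> 1"
  shows "S z \<in> Pcoh (ctx_interp G') (ctx_interp G)" "us \<in> cpoints G' \<Longrightarrow> f z us \<in> cpoints G"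
    "us \<in> cpoints G' \<Longrightarrow> mapp (S z) (tuple us) = tuple (f z us)"
  using assms by (auto simp: cmap_def)

definition extm :: "pty \<Rightarrow> (ennreal \<Rightarrow> vec) \<Rightarrow> ennreal \<Rightarrow> vec" where
  "extm q S = (\<lambda>z. mtensor (S z) (idm (pspc q)))"

definition extf :: "(ennreal \<Rightarrow> vec list \<Rightarrow> vec list) \<Rightarrow> ennreal \<Rightarrow> vec list \<Rightarrow> vec list" where
  "extf f = (\<lambda>z us. hd us # f z (tl us))"

lemma extm_app:
  assumes "cmap G' G S f" "z \<le> 1" "us \<in> cpoints G'" "v \<in> pset (pspc q)"
  shows "mapp (extm q S z) (tuple (v # us)) = tuple (v # f z us)"
  using assms by (simp add: extm_def mapp_mtensor idm_app is_pcs_pty cmapD(3))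

lemma cmap_ext:
  assumes "cmap G' G S f" shows "cmap (q # G') (q # G) (extm q S) (extf f)"
  unfolding cmap_def
proof (intro allI impI conjI ballI)
  fix z :: ennreal assume z: "z \<le> 1"
  show "extm q S z \<in> Pcoh (ctx_interp (q # G')) (ctx_interp (q # G))"
    unfolding extm_def using cmapD(1)[OF assms z] by (simp add: mtensor_Pcoh is_pcs_ctx is_pcs_pty idm_Pcoh)
  fix us assume "us \<in> cpoints (q # G')"
  then obtain v vs where u: "us = v # vs" "coalgebraic (pty_interp q) v" "vs \<in> cpoints G'" by (auto simp: cpoints_Cons)
  show "extf f z us \<in> cpoints (q # G)" using u cmapD(2)[OF assms z] by (simp add: extf_def cpoints_Cons)
  show "mapp (extm q S z) (tuple us) = tuple (extf f z us)"
    using u extm_app[OF assms z u(3) coalgebraic_mem[OF u(2)]] by (simp add: extf_def)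
qed

lemma mrep_comp:
  assumes "mrep G s T F" "cmap G' G S f"
  shows "mrep G' s (\<lambda>z. mcomp (T z) (S z)) (\<lambda>z us. F z (f z us))"
proof (rule mrepI)
  fix z :: ennreal assume z: "z \<le> 1"
  show "mcomp (T z) (S z) \<in> morphs G' s"
    unfolding morphs_def using mrep_morphs[OF assms(1) z] cmapD(1)[OF assms(2) z]
    by (intro mcomp_Pcoh[of _ _ _ "ctx_interp G"]) (auto simp: is_pcs_ctx is_pcs_ty morphs_def)
  fix us assume us: "us \<in> cpoints G'"
  show "ev (mcomp (T z) (S z)) us = F z (f z us)"
    using mrep_ev[OF assms(1) z cmapD(2)[OF assms(2) z us]] cmapD(3)[OF assms(2) z us]
    by (simp add: ev_def mapp_mcomp)
qed

lemma ev_comp: "cmap G' G S f \<Longrightarrow> z \<le> 1 \<Longrightarrow> us \<in> cpoints G' \<Longrightarrow> ev (mcomp t (S z)) us = ev t (f z us)"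
  by (simp add: ev_def mapp_mcomp cmapD(3))

text \<open>The head \<open>v\<close> is an arbitrary vector of the space, since a branch of a case
  distinction may receive an argument that is not coalgebraic.\<close>

lemma ev_comp_Cons:
  "cmap G' G S f \<Longrightarrow> z \<le> 1 \<Longrightarrow> us \<in> cpoints G' \<Longrightarrow> v \<in> pset (pspc q) \<Longrightarrow>
    ev (mcomp t (extm q S z)) (v # us) = ev t (v # f z us)"
  unfolding ev_def mapp_mcomp by (simp only: extm_app)

text \<open>Index k is the last one of the context, since the substituted value is closed.\<close>

definition subok :: "pty list \<Rightarrow> pty list \<Rightarrow> pty \<Rightarrow> (ennreal \<Rightarrow> vec) \<Rightarrow> nat \<Rightarrow> (ennreal \<Rightarrow> vec list \<Rightarrow> vec list) \<Rightarrow> bool" where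
  "subok G' G p W k f \<longleftrightarrow> (\<forall>i<length G.
     (i < k \<and> i < length G' \<and> G' ! i = G ! i \<and> (\<forall>z\<le>1. \<forall>us\<in>cpoints G'. f z us ! i = us ! i)) \<or>
     (i = k \<and> G ! i = p \<and> (\<forall>z\<le>1. \<forall>us\<in>cpoints G'. f z us ! i = W z)))"

lemma subok_ext:
  assumes "subok G' G p W k f" shows "subok (q # G') (q # G) p W (Suc k) (extf f)"
  unfolding subok_def
proof (intro allI impI)
  fix i assume i: "i < length (q # G)"
  show "(i < Suc k \<and> i < length (q # G') \<and> (q # G') ! i = (q # G) ! i \<and>
      (\<forall>z\<le>1. \<forall>us\<in>cpoints (q # G'). extf f z us ! i = us ! i)) \<or>
     (i = Suc k \<and> (q # G) ! i = p \<and> (\<forall>z\<le>1. \<forall>us\<in>cpoints (q # G'). extf f z us ! i = W z))"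
  proof (cases i)
    case 0 then show ?thesis by (auto simp: extf_def cpoints_Cons)
  next
    case (Suc j)
    then have "j < length G" using i by simp
    with assms consider "j < k" "j < length G'" "G' ! j = G ! j" "\<forall>z\<le>1. \<forall>us\<in>cpoints G'. f z us ! j = us ! j"
      | "j = k" "G ! j = p" "\<forall>z\<le>1. \<forall>us\<in>cpoints G'. f z us ! j = W z" unfolding subok_def by blast
    then show ?thesis by cases (auto simp: Suc extf_def cpoints_Cons)
  qed
qed

text \<open>A closed term is unchanged under binders and has the same value in every context. The
  quantification over \<open>T\<close> covers every family that represents this constant.\<close>

definition vconst :: "trm \<Rightarrow> pty \<Rightarrow> (ennreal \<Rightarrow> vec) \<Rightarrow> bool" where
  "vconst V p W \<longleftrightarrow> lift V 0 = V \<and> (\<forall>G T. mrep G (Pos p) T (\<lambda>z us. W z) \<longrightarrow> den G V (Pos p) T)"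

lemma fix_iter_mem:
  assumes "m \<in> morphs (Bang s # G) s" "z \<le> 1" "us \<in> cpoints G"
  shows "((\<lambda>w. sc z (ev m (prom w # us))) ^^ n) (\<lambda>_. 0) \<in> pset (ty_interp s)"
proof (induction n)
  case 0 show ?case by (simp add: pset_zero is_pcs_ty)
next
  case (Suc n)
  then have "prom (((\<lambda>w. sc z (ev m (prom w # us))) ^^ n) (\<lambda>_. 0)) \<in> pset (pspc (Bang s))"
    by (simp add: coalg_bang_def prom_mem is_pcs_ty)
  then show ?case using ev_Cons_mem[OF assms(1,3)] assms(2) by (simp add: sc_def pset_scale is_pcs_ty)
qed

text \<open>Substitution is composition with a morphism of contexts. Under a binder the morphism is
  extended by the identity on the new variable.\<close>

lemma den_subst:
  assumes "den G M s T" "cmap G' G S f" "subok G' G p W k f" "vconst V p W"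
  shows "den G' (subst M V k) s (\<lambda>z. mcomp (T z) (S z))"
  using assms
proof (induction arbitrary: G' S f k rule: den.induct)
  case (den_Var i G T)
  have mr: "mrep G' (Pos (G ! i)) (\<lambda>z. mcomp (T z) (S z)) (\<lambda>z us. f z us ! i)"
    by (rule mrep_comp[OF den_Var(2,3)])
  from den_Var(1,4) consider "i < k" "i < length G'" "G' ! i = G ! i" "\<forall>z\<le>1. \<forall>us\<in>cpoints G'. f z us ! i = us ! i"
    | "i = k" "G ! i = p" "\<forall>z\<le>1. \<forall>us\<in>cpoints G'. f z us ! i = W z" unfolding subok_def by blast
  then show ?case
  proof cases
    case 1
    then have "mrep G' (Pos (G' ! i)) (\<lambda>z. mcomp (T z) (S z)) (\<lambda>z us. us ! i)" using mrep_cong[OF mr] by auto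
    then show ?thesis using den.den_Var[OF 1(2)] 1 by simp
  next
    case 2
    then have "mrep G' (Pos p) (\<lambda>z. mcomp (T z) (S z)) (\<lambda>z us. W z)" using mrep_cong[OF mr] by auto
    then show ?thesis using den_Var(5) 2 by (simp add: vconst_def)
  qed
next
  case (den_Unt G T)
  then show ?case using den.den_Unt mrep_comp by fastforce
next
  case (den_Lam q G M s m T)
  have l: "lift V 0 = V" using den_Lam(6) by (simp add: vconst_def)
  have IH: "den (q # G') (subst M V (Suc k)) s (\<lambda>z. mcomp (m z) (extm q S z))"
    by (rule den_Lam(3)[OF cmap_ext[OF den_Lam(4)] subok_ext[OF den_Lam(5)] den_Lam(6)])
  have "mrep G' (Lolli q s) (\<lambda>z. mcomp (T z) (S z)) (\<lambda>z us. rowfix (mcomp (m z) (extm q S z)) (tuple us))"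
  proof (rule mrep_cong[OF mrep_comp[OF den_Lam(2,4)]])
    fix z :: ennreal and us assume z: "z \<le> 1" and us: "us \<in> cpoints G'"
    note r = rowfix_Pcoh[OF is_pcs_ctx is_pcs_pty is_pcs_ty]
    show "rowfix (m z) (tuple (f z us)) = rowfix (mcomp (m z) (extm q S z)) (tuple us)"
    \<comment> \<open>Both sides are matrices on the bound variable, so by density they need only be
      compared at coalgebraic arguments.\<close>
    proof (rule separating_Pcoh_eq[OF is_pcs_pty is_pcs_ty good_sep[OF good_pty]])
      show "rowfix (m z) (tuple (f z us)) \<in> Pcoh (pspc q) (ty_interp s)"
        using den_morphs[OF den_Lam(1) z] by (intro r[of _ G] tuple_mem cmapD(2)[OF den_Lam(4) z us]) (simp add: morphs_def)
      show "rowfix (mcomp (m z) (extm q S z)) (tuple us) \<in> Pcoh (pspc q) (ty_interp s)"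
        using den_morphs[OF IH z] by (intro r[of _ G'] tuple_mem us) (simp add: morphs_def)
      fix v assume "v \<in> {u. coalgebraic (pty_interp q) u}"
      then have v: "v \<in> pset (pspc q)" by (simp add: coalgebraic_mem)
      show "mapp (rowfix (m z) (tuple (f z us))) v = mapp (rowfix (mcomp (m z) (extm q S z)) (tuple us)) v"
        using ev_comp_Cons[OF den_Lam(4) z us v, of "m z"] by (simp add: mapp_rowfix ev_def)
    qed
  qed
  then show ?case using den.den_Lam[OF IH] by (simp add: l)
next
  case (den_App G M q s m N n T)
  show ?case unfolding subst.simps
    by (rule den.den_App[OF den_App(4)[OF den_App(6-8)] den_App(5)[OF den_App(6-8)] mrep_cong[OF mrep_comp[OF den_App(3,6)]]])
       (simp add: ev_comp[OF den_App(6)])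
next
  case (den_Stop G M s m T)
  show ?case unfolding subst.simps
    by (rule den.den_Stop[OF den_Stop(3)[OF den_Stop(4-6)] mrep_cong[OF mrep_comp[OF den_Stop(2,4)]]])
       (simp add: ev_comp[OF den_Stop(4)])
next
  case (den_Go G M s m T)
  show ?case unfolding subst.simps
    by (rule den.den_Go[OF den_Go(3)[OF den_Go(4-6)] mrep_cong[OF mrep_comp[OF den_Go(2,4)]]])
       (simp add: ev_comp[OF den_Go(4)])
next
  case (den_Tup G M q m N q' n T)
  show ?case unfolding subst.simps
    by (rule den.den_Tup[OF den_Tup(4)[OF den_Tup(6-8)] den_Tup(5)[OF den_Tup(6-8)] mrep_cong[OF mrep_comp[OF den_Tup(3,6)]]])
       (simp add: ev_comp[OF den_Tup(6)])
next
  case (den_InL G M q m q' T)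
  show ?case unfolding subst.simps
    by (rule den.den_InL[OF den_InL(3)[OF den_InL(4-6)] mrep_cong[OF mrep_comp[OF den_InL(2,4)]]])
       (simp add: ev_comp[OF den_InL(4)])
next
  case (den_InR G M q m q' T)
  show ?case unfolding subst.simps
    by (rule den.den_InR[OF den_InR(3)[OF den_InR(4-6)] mrep_cong[OF mrep_comp[OF den_InR(2,4)]]])
       (simp add: ev_comp[OF den_InR(4)])
next
  case (den_PrL G M q q' m T)
  show ?case unfolding subst.simps
    by (rule den.den_PrL[OF den_PrL(3)[OF den_PrL(4-6)] mrep_cong[OF mrep_comp[OF den_PrL(2,4)]]])
       (simp add: ev_comp[OF den_PrL(4)])
next
  case (den_PrR G M q q' m T)
  show ?case unfolding subst.simps
    by (rule den.den_PrR[OF den_PrR(3)[OF den_PrR(4-6)] mrep_cong[OF mrep_comp[OF den_PrR(2,4)]]])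
       (simp add: ev_comp[OF den_PrR(4)])
next
  case (den_Fix s G M m T)
  have l: "lift V 0 = V" using den_Fix(6) by (simp add: vconst_def)
  have IH: "den (Bang s # G') (subst M V (Suc k)) s (\<lambda>z. mcomp (m z) (extm (Bang s) S z))"
    by (rule den_Fix(3)[OF cmap_ext[OF den_Fix(4)] subok_ext[OF den_Fix(5)] den_Fix(6)])
  have "mrep G' s (\<lambda>z. mcomp (T z) (S z)) (\<lambda>z us b. SUP n. ((\<lambda>w. sc z (ev (mcomp (m z) (extm (Bang s) S z)) (prom w # us))) ^^ n) (\<lambda>_. 0) b)"
  proof (rule mrep_cong[OF mrep_comp[OF den_Fix(2,4)]])
    fix z :: ennreal and us assume z: "z \<le> 1" and us: "us \<in> cpoints G'"
    let ?g = "\<lambda>w. sc z (ev (m z) (prom w # f z us))" and ?h = "\<lambda>w. sc z (ev (mcomp (m z) (extm (Bang s) S z)) (prom w # us))"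
    have "(?g ^^ n) (\<lambda>_. 0) = (?h ^^ n) (\<lambda>_. 0)" for n
    proof (induction n)
      case (Suc n)
      \<comment> \<open>The iterates have to stay in the space: only then is their promotion an
        admissible value of the bound variable.\<close>
      have "(?g ^^ n) (\<lambda>_. 0) \<in> pset (ty_interp s)"
        by (rule fix_iter_mem[OF den_morphs[OF den_Fix(1) z] z cmapD(2)[OF den_Fix(4) z us]])
      then have "prom ((?g ^^ n) (\<lambda>_. 0)) \<in> pset (pspc (Bang s))" by (simp add: coalg_bang_def prom_mem is_pcs_ty)
      then have "?g ((?g ^^ n) (\<lambda>_. 0)) = ?h ((?g ^^ n) (\<lambda>_. 0))" using ev_comp_Cons[OF den_Fix(4) z us] by simp
      then show ?case using Suc by simp
    qed simp
    then show "(\<lambda>b. SUP n. (?g ^^ n) (\<lambda>_. 0) b) = (\<lambda>b. SUP n. (?h ^^ n) (\<lambda>_. 0) b)" by simp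
  qed
  then show ?case using den.den_Fix[OF IH] by (simp add: l)
next
  case (den_Case G M q q' m N s n R r T)
  have l: "lift V 0 = V" using den_Case(10) by (simp add: vconst_def)
  have IH: "den (q # G') (subst N V (Suc k)) s (\<lambda>z. mcomp (n z) (extm q S z))"
    by (rule den_Case(6)[OF cmap_ext[OF den_Case(8)] subok_ext[OF den_Case(9)] den_Case(10)])
  have IH': "den (q' # G') (subst R V (Suc k)) s (\<lambda>z. mcomp (r z) (extm q' S z))"
    by (rule den_Case(7)[OF cmap_ext[OF den_Case(8)] subok_ext[OF den_Case(9)] den_Case(10)])
  have "mrep G' s (\<lambda>z. mcomp (T z) (S z))
    (\<lambda>z us. sc z (\<lambda>b. ev (mcomp (n z) (extm q S z)) (lpart (ev (mcomp (m z) (S z)) us) # us) b +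
      ev (mcomp (r z) (extm q' S z)) (rpart (ev (mcomp (m z) (S z)) us) # us) b))"
  proof (rule mrep_cong[OF mrep_comp[OF den_Case(4,8)]])
    fix z :: ennreal and us assume z: "z \<le> 1" and us: "us \<in> cpoints G'"
    have "ev (m z) (f z us) \<in> pset (pcs_plus (pspc q) (pspc q'))"
      using ev_mem[OF den_morphs[OF den_Case(1) z] cmapD(2)[OF den_Case(8) z us]] by simp
    from plus_parts[OF this]
    show "sc z (\<lambda>b. ev (n z) (lpart (ev (m z) (f z us)) # f z us) b + ev (r z) (rpart (ev (m z) (f z us)) # f z us) b) =
      sc z (\<lambda>b. ev (mcomp (n z) (extm q S z)) (lpart (ev (mcomp (m z) (S z)) us) # us) b +
        ev (mcomp (r z) (extm q' S z)) (rpart (ev (mcomp (m z) (S z)) us) # us) b)"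
      by (simp add: ev_comp[OF den_Case(8) z us] ev_comp_Cons[OF den_Case(8) z us])
  qed
  then show ?case using den.den_Case[OF den_Case(5)[OF den_Case(8-10)] IH IH'] by (simp add: l)
next
  case (den_Coin x G T)
  then show ?case using den.den_Coin[OF den_Coin(1,2) mrep_comp[OF den_Coin(3,4)]] by simp
next
  case (den_Fold G M q m T)
  show ?case unfolding subst.simps
    by (rule den.den_Fold[OF den_Fold(3)[OF den_Fold(4-6)] mrep_cong[OF mrep_comp[OF den_Fold(2,4)]]])
       (simp add: ev_comp[OF den_Fold(4)])
next
  case (den_Unfold G M q m T)
  show ?case unfolding subst.simps
    by (rule den.den_Unfold[OF den_Unfold(3)[OF den_Unfold(4-6)] mrep_cong[OF mrep_comp[OF den_Unfold(2,4)]]])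
       (simp add: ev_comp[OF den_Unfold(4)])
qed

lemma vconst_Unt: "vconst Unt One (\<lambda>_. unit_vec)"
  by (simp add: vconst_def den_Unt)

text \<open>Weakening is a degenerate substitution: a closed term is not changed by it, while its
  context changes. The dummy value is \<open>Unt\<close>, for which \<open>vconst\<close> is
  immediate; for other closed values \<open>vconst\<close> rests on the present lemma.\<close>

lemma den_weaken:
  assumes "den [] M s T" "mrep G s T' (\<lambda>z us. ev (T z) [])"
  shows "den G M s T'"
proof -
  have cm: "cmap G [] (\<lambda>_. constm (ctxC G) unit_vec) (\<lambda>z us. [])"
    unfolding cmap_def using constm_Pcoh[OF good_ctxC is_pcs_one unit_mem, of G]
    by (auto simp: spc_ctxC cpoints_Nil constm_app tuple_coalgebraic)
  have "den G (subst M Unt 0) s (\<lambda>z. mcomp (T z) (constm (ctxC G) unit_vec))"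
    by (rule den_subst[OF assms(1) cm _ vconst_Unt]) (simp add: subok_def)
  then have "den G M s (\<lambda>z. mcomp (T z) (constm (ctxC G) unit_vec))"
    using den_closed_lift_subst[OF assms(1), of 0 Unt] by simp
  then show ?thesis
    by (rule den_ext) (rule mrep_cong[OF assms(2)], simp add: ev_comp[OF cm])
qed

section \<open>Reduction\<close>

inductive_cases den_VarE: "den G (Var i) s T"
inductive_cases den_UntE: "den G Unt s T"
inductive_cases den_StopE: "den G (Stop M) s T"
inductive_cases den_TupE: "den G (Tup M N) s T"
inductive_cases den_InLE: "den G (InL M) s T"
inductive_cases den_InRE: "den G (InR M) s T"
inductive_cases den_FoldE: "den G (Fold M) s T"
inductive_cases den_LamE: "den G (Lam p M) s T"
inductive_cases wred_elims: "wred (Var i) N" "wred Unt N" "wred (Stop M) N" "wred (Tup M M') N" "wred (InL M) N"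
  "wred (InR M) N" "wred (Lam p M) N" "wred (App M M') N" "wred (Case M M' M'') N" "wred (PrL M) N" "wred (PrR M) N"
  "wred (Go M) N" "wred (Fix s M) N" "wred (Fold M) N" "wred (Unfold M) N" "wred (Coin r) N"
inductive_cases step_elims: "step (Var i) x N" "step Unt x N" "step (Stop M) x N" "step (Tup M M') x N" "step (InL M) x N"
  "step (InR M) x N" "step (Lam p M) x N" "step (App M M') x N" "step (Case M M' M'') x N" "step (PrL M) x N" "step (PrR M) x N"
  "step (Go M) x N" "step (Fix s M) x N" "step (Fold M) x N" "step (Unfold M) x N" "step (Coin r) x N"

lemma Nil_cpoints [simp]: "[] \<in> cpoints []" by (simp add: cpoints_Nil)

lemma val_no_step: "val V \<Longrightarrow> \<not> step V x N"
proof (induction arbitrary: x N rule: val.induct)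
qed (auto elim!: step_elims elim: wred_elims)

lemma Lam_no_step: "\<not> step (Lam p M) x N" by (auto elim!: step_elims elim: wred_elims)

lemma val_Pos: "val V \<Longrightarrow> den G V s T \<Longrightarrow> \<exists>p. s = Pos p"
  by (erule val.cases) (auto elim: den.cases)

text \<open>Closedness rules out variables. At the remaining value constructors coalgebraic points
  are closed under the corresponding operation, and a promotion is coalgebraic whatever term is
  suspended.\<close>

lemma val_coalgebraic: "val V \<Longrightarrow> den [] V (Pos p) T \<Longrightarrow> z \<le> 1 \<Longrightarrow> coalgebraic (pty_interp p) (ev (T z) [])"
proof (induction arbitrary: p T rule: val.induct)
  case (1 i)
  then show ?case by (auto elim: den_VarE)
next
  case 2
  then show ?case by (auto elim!: den_UntE simp: mrep_ev coalgebraic_one)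
next
  case (3 M)
  from 3(1) obtain s m where "p = Bang s" "den [] M s m" "mrep [] (Pos (Bang s)) T (\<lambda>z us. prom (ev (m z) us))"
    by (auto elim: den_StopE)
  then show ?case using 3(2) ev_mem[OF den_morphs[of "[]" M s m z]]
    by (auto simp: mrep_ev intro!: coalgebraic_prom is_pcs_ty)
next
  case (4 V W)
  from 4(5) obtain q r m n where "p = Tensor q r" "den [] V (Pos q) m" "den [] W (Pos r) n"
    "mrep [] (Pos (Tensor q r)) T (\<lambda>z us. vtensor (ev (m z) us) (ev (n z) us))" by (auto elim: den_TupE)
  then show ?case using 4 by (auto simp: mrep_ev intro!: coalgebraic_tensor good_pty)
next
  case (5 V)
  from 5(3) obtain q r m where "p = Plus q r" "den [] V (Pos q) m" "mrep [] (Pos (Plus q r)) T (\<lambda>z us. vplus (ev (m z) us) (\<lambda>_. 0))"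
    by (auto elim: den_InLE)
  then show ?case using 5 by (auto simp: mrep_ev intro!: coalgebraic_plus good_pty)
next
  case (6 V)
  from 6(3) obtain q r m where "p = Plus q r" "den [] V (Pos r) m" "mrep [] (Pos (Plus q r)) T (\<lambda>z us. vplus (\<lambda>_. 0) (ev (m z) us))"
    by (auto elim: den_InRE)
  then show ?case using 6 by (auto simp: mrep_ev intro!: coalgebraic_plus good_pty)
next
  case (7 V)
  from 7(3) obtain q m where q: "p = Mu q" "den [] V (Pos (unroll q)) m" "mrep [] (Pos (Mu q)) T (\<lambda>z. ev (m z))"
    by (auto elim: den_FoldE)
  then show ?case using 7(2)[OF q(2) 7(4)] 7(4) by (simp add: mrep_ev pty_interp_unroll)
qed

lemma subst_closed:
  assumes M: "den [p] M s m" and V: "den [] V (Pos p) n" "val V"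
  shows "\<exists>T. den [] (subst M V 0) s T \<and> (\<forall>z\<le>1. ev (T z) [] = ev (m z) [ev (n z) []])"
proof -
  let ?S = "\<lambda>z. tpair coalg_one (idm pcs_one) (n z)" and ?f = "\<lambda>z (us :: vec list). [ev (n z) []]"
  have cm: "cmap [] [p] ?S ?f"
    unfolding cmap_def
  proof (intro allI impI conjI ballI)
    fix z :: ennreal assume z: "z \<le> 1"
    have "n z \<in> Pcoh pcs_one (pspc p)" using den_morphs[OF V(1) z] by (simp add: morphs_def)
    then show "?S z \<in> Pcoh (ctx_interp []) (ctx_interp [p])"
      using tpair_Pcoh[OF good_one is_pcs_one is_pcs_pty, of "idm pcs_one" "n z" p] idm_Pcoh[OF is_pcs_one]
      by (simp add: coalg_one_def)
    fix us assume "us \<in> cpoints []"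
    then have us: "us = []" by (simp add: cpoints_Nil)
    show "?f z us \<in> cpoints [p]" using val_coalgebraic[OF V(2,1) z] by (simp add: cpoints_Cons)
    show "mapp (?S z) (tuple us) = tuple (?f z us)"
      by (simp add: us tpair_app[OF good_one coalgebraic_one] idm_app is_pcs_one unit_mem ev_def)
  qed
  \<comment> \<open>By weakening, the value keeps its denotation in every context, as is required
    where the variable occurs under binders.\<close>
  have vc: "vconst V p (\<lambda>z. ev (n z) [])"
    unfolding vconst_def using den_closed_lift_subst[OF V(1), of 0] den_weaken[OF V(1)] by simp
  have "den [] (subst M V 0) s (\<lambda>z. mcomp (m z) (?S z))"
    by (rule den_subst[OF M cm _ vc]) (simp add: subok_def)
  then show ?thesis using ev_comp[OF cm] by (intro exI conjI) auto
qed

text \<open>Linearity for finite combinations, indexed by terms because the combinations that occur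
  are averages over reducts.\<close>

definition linop :: "(vec \<Rightarrow> vec) \<Rightarrow> bool" where
  "linop L \<longleftrightarrow> (\<forall>(S :: trm set) c u. finite S \<longrightarrow>
     L (\<lambda>b. \<Sum>N\<in>S. c N * u N b) = (\<lambda>b. \<Sum>N\<in>S. c N * L (u N) b))"

lemma linopD: "linop L \<Longrightarrow> finite (S :: trm set) \<Longrightarrow> L (\<lambda>b. \<Sum>N\<in>S. c N * u N b) = (\<lambda>b. \<Sum>N\<in>S. c N * L (u N) b)"
  by (simp add: linop_def)

lemma linop_sc_comm: "linop L \<Longrightarrow> L (sc z u) = sc z (L u)"
  using linopD[of L "{Unt}" "\<lambda>_. z" "\<lambda>_. u"] by (simp add: sc_def)

lemma linop_id: "linop (\<lambda>u. u)" by (simp add: linop_def)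

lemma linop_mapp: "linop L \<Longrightarrow> linop (\<lambda>u. mapp t (L u))"
  by (simp add: linop_def mapp_finsum)

lemma linop_mapp_mat: "linop (\<lambda>u. mapp u w)"
  unfolding linop_def mapp_def
  by (simp add: sum_distrib_right infsum_ennreal_finsum mult.assoc infsum_ennreal_cmult)

lemma linop_sc: "linop L \<Longrightarrow> linop (\<lambda>u. sc z (L u))"
  by (simp add: linop_def sc_def sum_distrib_left mult.left_commute)

lemma linop_add: "linop L \<Longrightarrow> linop L' \<Longrightarrow> linop (\<lambda>u b. L u b + L' u b)"
  by (simp add: linop_def sum.distrib distrib_left)

lemma linop_vtensor_l: "linop L \<Longrightarrow> linop (\<lambda>u. vtensor (L u) v)"
  unfolding linop_def
proof (intro allI impI ext)
  fix S :: "trm set" and c u x assume a: "\<forall>(S :: trm set) c u. finite S \<longrightarrow> L (\<lambda>b. \<Sum>N\<in>S. c N * u N b) = (\<lambda>b. \<Sum>N\<in>S. c N * L (u N) b)"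
    and S: "finite S"
  show "vtensor (L (\<lambda>b. \<Sum>N\<in>S. c N * u N b)) v x = (\<Sum>N\<in>S. c N * vtensor (L (u N)) v x)"
    by (cases x) (simp_all add: a S sum_distrib_right mult.assoc)
qed

lemma linop_vtensor_r: "linop L \<Longrightarrow> linop (\<lambda>u. vtensor v (L u))"
  unfolding linop_def
proof (intro allI impI ext)
  fix S :: "trm set" and c u x assume a: "\<forall>(S :: trm set) c u. finite S \<longrightarrow> L (\<lambda>b. \<Sum>N\<in>S. c N * u N b) = (\<lambda>b. \<Sum>N\<in>S. c N * L (u N) b)"
    and S: "finite S"
  show "vtensor v (L (\<lambda>b. \<Sum>N\<in>S. c N * u N b)) x = (\<Sum>N\<in>S. c N * vtensor v (L (u N)) x)"
    by (cases x) (simp_all add: a S sum_distrib_left mult.left_commute)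
qed

lemma linop_vplus: "linop (\<lambda>u. vplus u (\<lambda>_. 0))" "linop (\<lambda>u. vplus (\<lambda>_. 0) u)"
  unfolding linop_def
proof (safe intro!: ext)
  fix S :: "trm set" and c u x
  show "vplus (\<lambda>b. \<Sum>N\<in>S. c N * u N b) (\<lambda>_. 0) x = (\<Sum>N\<in>S. c N * vplus (u N) (\<lambda>_. 0) x)" by (cases x) simp_all
  show "vplus (\<lambda>_. 0) (\<lambda>b. \<Sum>N\<in>S. c N * u N b) x = (\<Sum>N\<in>S. c N * vplus (\<lambda>_. 0) (u N) x)" by (cases x) simp_all
qed

lemma linop_parts: "linop lpart" "linop rpart"
  by (simp_all add: linop_def lpart_def rpart_def)

lemma linop_ev_Cons: "linop L \<Longrightarrow> linop (\<lambda>u. ev t (L u # us))"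
  unfolding ev_def tuple.simps by (intro linop_mapp linop_vtensor_r)

text \<open>The steps of \<open>M\<close> are described exactly, since all reducts enter the
  reduction matrix. Making the weight a function \<open>x\<close> of the reduct also settles the
  definite description in \<open>Red\<close>. The last clause charges one factor z for one
  step.\<close>

definition reducible :: "trm \<Rightarrow> ty \<Rightarrow> (ennreal \<Rightarrow> vec) \<Rightarrow> bool" where
  "reducible M s T \<longleftrightarrow> (\<exists>S x T'. finite S \<and> S \<noteq> {} \<and> (\<forall>y N. step M y N \<longleftrightarrow> N \<in> S \<and> y = x N) \<and>
     (\<forall>N\<in>S. 0 \<le> x N) \<and> sum x S = 1 \<and> (\<forall>N\<in>S. den [] N s (T' N)) \<and>
     (\<forall>z\<le>1. ev (T z) [] = sc z (\<lambda>b. \<Sum>N\<in>S. ennreal (x N) * ev (T' N z) [] b)))"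

lemma reducible_steps: "reducible M s T \<Longrightarrow> \<exists>y N. step M y N"
  unfolding reducible_def by blast

lemma reducible_not_val: "reducible M s T \<Longrightarrow> \<not> val M"
  using reducible_steps val_no_step by blast

lemma reducible_single:
  assumes "\<And>y N. step M y N \<longleftrightarrow> N = M' \<and> y = 1" "den [] M' s T'" "\<And>z. z \<le> 1 \<Longrightarrow> ev (T z) [] = sc z (ev (T' z) [])"
  shows "reducible M s T"
  unfolding reducible_def
  by (rule exI[of _ "{M'}"], rule exI[of _ "\<lambda>_. 1"], rule exI[of _ "\<lambda>_. T'"]) (use assms in auto)

text \<open>\<open>K\<close> is an evaluation context. It is injective, so reducts and weights are
  transported unchanged, and it acts linearly on denotations, so the average and the single factor z
  pass through it. The cost of \<open>K\<close> itself is part of \<open>L\<close>.\<close>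

lemma reducible_frame:
  assumes red: "reducible M s T"
    and st: "\<And>y N'. step (K M) y N' \<longleftrightarrow> (\<exists>N. N' = K N \<and> step M y N)"
    and inj: "\<And>N N'. K N = K N' \<Longrightarrow> N = N'"
    and d: "\<And>N T'. den [] N s T' \<Longrightarrow> \<exists>T''. den [] (K N) s' T'' \<and> (\<forall>z\<le>1. ev (T'' z) [] = L z (ev (T' z) []))"
    and TK: "\<And>z. z \<le> 1 \<Longrightarrow> ev (TK z) [] = L z (ev (T z) [])"
    and lin: "\<And>z. linop (L z)"
  shows "reducible (K M) s' TK"
proof -
  from red obtain S x T' where S: "finite S" "S \<noteq> {}" and stM: "\<And>y N. step M y N \<longleftrightarrow> N \<in> S \<and> y = x N"
    and x: "\<And>N. N \<in> S \<Longrightarrow> 0 \<le> x N" "sum x S = 1" and T': "\<And>N. N \<in> S \<Longrightarrow> den [] N s (T' N)"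
    and eq: "\<And>z. z \<le> 1 \<Longrightarrow> ev (T z) [] = sc z (\<lambda>b. \<Sum>N\<in>S. ennreal (x N) * ev (T' N z) [] b)"
    unfolding reducible_def by blast
  have "\<forall>N\<in>S. \<exists>T''. den [] (K N) s' T'' \<and> (\<forall>z\<le>1. ev (T'' z) [] = L z (ev (T' N z) []))" using d T' by blast
  then obtain T'' where T'': "\<And>N. N \<in> S \<Longrightarrow> den [] (K N) s' (T'' N)"
    "\<And>N z. N \<in> S \<Longrightarrow> z \<le> 1 \<Longrightarrow> ev (T'' N z) [] = L z (ev (T' N z) [])" by metis
  \<comment> \<open>The reducts of \<open>K M\<close> are indexed by terms as well; the inverse of
    \<open>K\<close> recovers the weight and the family that belong to the underlying reduct of
    \<open>M\<close>.\<close>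
  have iK: "inj K" using inj by (auto simp: inj_def)
  have inv: "inv K (K N) = N" for N by (rule inv_f_f[OF iK])
  show ?thesis unfolding reducible_def
  proof (rule exI[of _ "K ` S"], rule exI[of _ "x \<circ> inv K"], rule exI[of _ "T'' \<circ> inv K"], intro conjI allI ballI impI)
    show "finite (K ` S)" "K ` S \<noteq> {}" using S by auto
    show "step (K M) y N' \<longleftrightarrow> N' \<in> K ` S \<and> y = (x \<circ> inv K) N'" for y N' by (auto simp: st stM inv)
    show "0 \<le> (x \<circ> inv K) N'" if "N' \<in> K ` S" for N' using that x by (auto simp: inv)
    show "sum (x \<circ> inv K) (K ` S) = 1" using x(2) by (simp add: sum.reindex[OF inj_on_subset[OF iK]] inv)
    show "den [] N' s' ((T'' \<circ> inv K) N')" if "N' \<in> K ` S" for N' using that T'' by (auto simp: inv)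
    fix z :: ennreal assume z: "z \<le> 1"
    have "ev (TK z) [] = sc z (\<lambda>b. \<Sum>N\<in>S. ennreal (x N) * L z (ev (T' N z) []) b)"
      unfolding TK[OF z] eq[OF z] linop_sc_comm[OF lin] linopD[OF lin S(1)] ..
    also have "\<dots> = sc z (\<lambda>b. \<Sum>N\<in>S. ennreal (x N) * ev (T'' N z) [] b)" using T''(2)[OF _ z] by simp
    also have "\<dots> = sc z (\<lambda>b. \<Sum>N\<in>K ` S. ennreal ((x \<circ> inv K) N) * ev ((T'' \<circ> inv K) N z) [] b)"
      by (simp add: sum.reindex[OF inj_on_subset[OF iK]] inv)
    finally show "ev (TK z) [] = sc z (\<lambda>b. \<Sum>N\<in>K ` S. ennreal ((x \<circ> inv K) N) * ev ((T'' \<circ> inv K) N z) [] b)" .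
  qed
qed

lemma ex_den:
  assumes "\<exists>T. P T \<and> mrep [] s T F" "\<And>T. mrep [] s T F \<Longrightarrow> den [] M s T"
  shows "\<exists>T. den [] M s T \<and> (\<forall>z\<le>1. ev (T z) [] = F z [])"
  using assms mrep_ev[OF _ _ Nil_cpoints] by metis

section \<open>Steps under evaluation contexts\<close>

lemma step_Go: "\<not> val M \<Longrightarrow> step (Go M) y N' \<longleftrightarrow> (\<exists>N. N' = Go N \<and> step M y N)"
  by (auto elim!: step_elims elim: wred_elims intro: step.intros val.intros)

lemma step_App_arg: "\<not> val N \<Longrightarrow> step (App M N) y N' \<longleftrightarrow> (\<exists>N1. N' = App M N1 \<and> step N y N1)"
  by (auto elim!: step_elims elim: wred_elims intro: step.intros)

text \<open>A function that steps is not an abstraction, so there is no redex at the root, and the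
  argument is a value and cannot step.\<close>

lemma step_App_fun: "val V \<Longrightarrow> step M y0 M0 \<Longrightarrow> step (App M V) y N' \<longleftrightarrow> (\<exists>M1. N' = App M1 V \<and> step M y M1)"
  using val_no_step Lam_no_step by (auto elim!: step_elims elim: wred_elims intro: step.intros)

lemma step_PrL: "\<not> val M \<Longrightarrow> step (PrL M) y N' \<longleftrightarrow> (\<exists>N. N' = PrL N \<and> step M y N)"
  by (auto elim!: step_elims elim: wred_elims intro: step.intros val.intros)

lemma step_PrR: "\<not> val M \<Longrightarrow> step (PrR M) y N' \<longleftrightarrow> (\<exists>N. N' = PrR N \<and> step M y N)"
  by (auto elim!: step_elims elim: wred_elims intro: step.intros val.intros)

lemma step_Tup_fst: "\<not> val M \<Longrightarrow> step (Tup M N) y N' \<longleftrightarrow> (\<exists>M1. N' = Tup M1 N \<and> step M y M1)"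
  by (auto elim!: step_elims elim: wred_elims intro: step.intros)

lemma step_Tup_snd: "val V \<Longrightarrow> step (Tup V N) y N' \<longleftrightarrow> (\<exists>N1. N' = Tup V N1 \<and> step N y N1)"
  using val_no_step by (auto elim!: step_elims elim: wred_elims intro: step.intros)

lemma step_InL: "step (InL M) y N' \<longleftrightarrow> (\<exists>N. N' = InL N \<and> step M y N)"
  by (auto elim!: step_elims elim: wred_elims intro: step.intros)

lemma step_InR: "step (InR M) y N' \<longleftrightarrow> (\<exists>N. N' = InR N \<and> step M y N)"
  by (auto elim!: step_elims elim: wred_elims intro: step.intros)

lemma step_Case: "\<not> val M \<Longrightarrow> step (Case M P Q) y N' \<longleftrightarrow> (\<exists>N. N' = Case N P Q \<and> step M y N)"
  by (auto elim!: step_elims elim: wred_elims intro: step.intros val.intros)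

lemma step_Fold: "step (Fold M) y N' \<longleftrightarrow> (\<exists>N. N' = Fold N \<and> step M y N)"
  by (auto elim!: step_elims elim: wred_elims intro: step.intros)

lemma step_Unfold: "\<not> val M \<Longrightarrow> step (Unfold M) y N' \<longleftrightarrow> (\<exists>N. N' = Unfold N \<and> step M y N)"
  by (auto elim!: step_elims elim: wred_elims intro: step.intros val.intros)

text \<open>The Kleene fixed point equation. It holds for arbitrary matrices and cost factors, since
  promotion, tensor and matrix application are continuous.\<close>

lemma fix_unfold:
  assumes f: "\<And>w. f w = sc z (ev m (prom w # us))"
  shows "(\<lambda>b. SUP n. (f ^^ n) (\<lambda>_. 0) b) = f (\<lambda>b. SUP n. (f ^^ n) (\<lambda>_. 0) b)"
proof -
  have upf: "ups (\<lambda>n. f (W n)) (f w)" if W: "ups W w" for W w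
    unfolding f ev_def tuple.simps using ups_sc[of "\<lambda>_. z"] W
    by (simp add: incseq_const ups_mapp ups_vtensor ups_prom ups_const)
  have mono: "f w x \<le> f w' x" if le: "\<And>x. w x \<le> w' x" for w w' x
  proof -
    let ?W = "\<lambda>k::nat. if k = 0 then w else w'"
    have "ups ?W w'"
    proof (rule upsI)
      fix x show "incseq (\<lambda>k. ?W k x)" using le by (auto simp: incseq_def)
      show "w' x = (SUP k. ?W k x)"
        by (rule antisym, rule SUP_upper2[of 1]) (auto intro!: SUP_least le)
    qed
    from ups_inc[OF upf[OF this], of x] show ?thesis
      unfolding incseq_def by (metis le_numeral_extra(4) one_neq_zero zero_le)
  qed
  have inc: "incseq (\<lambda>n. (f ^^ n) (\<lambda>_. 0) x)" for x
  proof (rule incseq_SucI)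
    fix n show "(f ^^ n) (\<lambda>_. 0) x \<le> (f ^^ Suc n) (\<lambda>_. 0) x"
      by (induction n arbitrary: x) (auto intro!: mono)
  qed
  let ?D = "\<lambda>b. SUP n. (f ^^ n) (\<lambda>_. 0) b"
  have "ups (\<lambda>n. (f ^^ n) (\<lambda>_. 0)) ?D" using inc by (simp add: ups_def)
  from upf[OF this] have e: "f ?D x = (SUP n. (f ^^ Suc n) (\<lambda>_. 0) x)" for x by (simp add: ups_SUP)
  show ?thesis
  proof
    fix x
    have "?D x \<le> (SUP n. (f ^^ Suc n) (\<lambda>_. 0) x)"
      using inc[of x] unfolding incseq_Suc_iff by (intro SUP_mono) blast
    moreover have "(SUP n. (f ^^ Suc n) (\<lambda>_. 0) x) \<le> ?D x" by (rule SUP_least) (rule SUP_upper, simp)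
    ultimately show "?D x = f ?D x" unfolding e by (rule antisym)
  qed
qed

section \<open>Canonical forms of closed values\<close>

lemma canonical_Bang: "val V \<Longrightarrow> den [] V (Pos (Bang s)) T \<Longrightarrow> \<exists>M. V = Stop M"
  by (erule val.cases) (auto elim: den_VarE den_UntE den_StopE den_TupE den_InLE den_InRE den_FoldE)

lemma canonical_Tensor: "val V \<Longrightarrow> den [] V (Pos (Tensor p q)) T \<Longrightarrow> \<exists>M N. V = Tup M N \<and> val M \<and> val N"
  by (erule val.cases) (auto elim: den_VarE den_UntE den_StopE den_TupE den_InLE den_InRE den_FoldE)

lemma canonical_Plus: "val V \<Longrightarrow> den [] V (Pos (Plus p q)) T \<Longrightarrow> \<exists>M. (V = InL M \<or> V = InR M) \<and> val M"
  by (erule val.cases) (auto elim: den_VarE den_UntE den_StopE den_TupE den_InLE den_InRE den_FoldE)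

lemma canonical_Mu: "val V \<Longrightarrow> den [] V (Pos (Mu p)) T \<Longrightarrow> \<exists>M. V = Fold M \<and> val M"
  by (erule val.cases) (auto elim: den_VarE den_UntE den_StopE den_TupE den_InLE den_InRE den_FoldE)

lemma canonical_One: "val V \<Longrightarrow> den [] V (Pos One) T \<Longrightarrow> V = Unt"
  by (erule val.cases) (auto elim: den_VarE den_UntE den_StopE den_TupE den_InLE den_InRE den_FoldE)

lemma not_Lam_Pos: "den G (Lam q M) (Pos p) T \<Longrightarrow> P" by (auto elim: den_LamE)

text \<open>Progress and a quantitative form of subject reduction at once: \<open>reducible\<close>
  contains denotations of the reducts together with the averaging equation. Abstractions form a
  third alternative, as they are neither values nor reducible.\<close>

lemma progress:
  "den G M s T \<Longrightarrow> G = [] \<Longrightarrow> val M \<or> (\<exists>p N. M = Lam p N) \<or> reducible M s T"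
proof (induction rule: den.induct)
  case (den_App G M p s m N n T)
  note N = den_App(2)[unfolded den_App(6)] and M = den_App(1)[unfolded den_App(6)]
  note T = mrep_ev[OF den_App(3)[unfolded den_App(6)] _ Nil_cpoints]
  from den_App(5,6) consider (Nr) "reducible N (Pos p) n" | (Nv) "val N" using not_Lam_Pos N by blast
  then show ?case
  proof cases
    case Nr
    have "reducible (App M N) s T"
    proof (rule reducible_frame[OF Nr, where K="\<lambda>N. App M N" and L="\<lambda>z u. sc z (mapp (ev (m z) []) u)"])
      show "\<exists>T''. den [] (App M N') s T'' \<and> (\<forall>z\<le>1. ev (T'' z) [] = sc z (mapp (ev (m z) []) (ev (T' z) [])))"
        if "den [] N' (Pos p) T'" for N' T'
        using ex_den[OF ex_App[OF famI[OF M] famI[OF that]] den.den_App[OF M that]] by simp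
    qed (use step_App_arg[OF reducible_not_val[OF Nr]] T in \<open>auto intro!: linop_sc linop_mapp linop_id\<close>)
    then show ?thesis by blast
  next
    case Nv
    from den_App(4,6) consider (Mr) "reducible M (Lolli p s) m" | (Ml) q M' where "M = Lam q M'"
      using val_Pos M by blast
    then show ?thesis
    proof cases
      case Mr
      obtain y0 M0 where y0: "step M y0 M0" using reducible_steps[OF Mr] by blast
      have "reducible (App M N) s T"
      proof (rule reducible_frame[OF Mr, where K="\<lambda>M. App M N" and L="\<lambda>z u. sc z (mapp u (ev (n z) []))"])
        show "\<exists>T''. den [] (App M' N) s T'' \<and> (\<forall>z\<le>1. ev (T'' z) [] = sc z (mapp (ev (T' z) []) (ev (n z) [])))"
          if "den [] M' (Lolli p s) T'" for M' T'
          using ex_den[OF ex_App[OF famI[OF that] famI[OF N]] den.den_App[OF that N]] by simp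
      qed (use step_App_fun[OF Nv y0] T in \<open>auto intro!: linop_sc linop_mapp_mat\<close>)
      then show ?thesis by blast
    next
      case Ml
      from M[unfolded Ml] obtain m' where q: "q = p" and m': "den [p] M' s m'"
        "mrep [] (Lolli p s) m (\<lambda>z us. rowfix (m' z) (tuple us))" by (auto elim: den_LamE)
      obtain T' where T': "den [] (subst M' N 0) s T'" "\<forall>z\<le>1. ev (T' z) [] = ev (m' z) [ev (n z) []]"
        using subst_closed[OF m'(1) N Nv] by blast
      have "reducible (App M N) s T"
      proof (rule reducible_single[OF _ T'(1)])
        show "step (App M N) y N' \<longleftrightarrow> N' = subst M' N 0 \<and> y = 1" for y N'
          using val_no_step[OF Nv] Lam_no_step Nv unfolding Ml
          by (auto elim!: step_elims elim: wred_elims intro: step.intros wred.intros)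
        fix z :: ennreal assume z: "z \<le> 1"
        show "ev (T z) [] = sc z (ev (T' z) [])"
          using T[OF z] T'(2) z mrep_ev[OF m'(2) z Nil_cpoints] by (simp add: mapp_rowfix ev_def)
      qed
      then show ?thesis by blast
    qed
  qed
next
  case (den_Go G M s m T)
  note M = den_Go(1)[unfolded den_Go(4)] and T = mrep_ev[OF den_Go(2)[unfolded den_Go(4)] _ Nil_cpoints]
  from den_Go(3,4) consider (r) "reducible M (Pos (Bang s)) m" | (v) "val M" using not_Lam_Pos M by blast
  then show ?case
  proof cases
    case r
    have "reducible (Go M) s T"
    proof (rule reducible_frame[OF r, where K=Go and L="\<lambda>z u. sc z (mapp (der (ty_interp s)) u)"])
      show "\<exists>T''. den [] (Go N) s T'' \<and> (\<forall>z\<le>1. ev (T'' z) [] = sc z (mapp (der (ty_interp s)) (ev (T' z) [])))"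
        if "den [] N (Pos (Bang s)) T'" for N T'
        using ex_den[OF ex_Go[OF famI[OF that]] den.den_Go[OF that]] by simp
    qed (use step_Go[OF reducible_not_val[OF r]] T in \<open>auto intro!: linop_sc linop_mapp linop_id\<close>)
    then show ?thesis by blast
  next
    case v
    then obtain N where N: "M = Stop N" using canonical_Bang M by blast
    from M[unfolded N] obtain n where n: "den [] N s n" "mrep [] (Pos (Bang s)) m (\<lambda>z us. prom (ev (n z) us))"
      by (auto elim: den_StopE)
    have "reducible (Go M) s T"
    proof (rule reducible_single[OF _ n(1)])
      show "step (Go M) y N' \<longleftrightarrow> N' = N \<and> y = 1" for y N'
        unfolding N by (auto elim!: step_elims elim: wred_elims intro: step.intros wred.intros)
      fix z :: ennreal assume z: "z \<le> 1"
      have "ev (n z) [] \<in> pset (ty_interp s)" by (rule ev_mem[OF den_morphs[OF n(1) z]]) simp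
      then have "mapp (der (ty_interp s)) (prom (ev (n z) [])) = ev (n z) []"
        using is_pcs_out[OF is_pcs_ty] by (intro der_prom) auto
      then show "ev (T z) [] = sc z (ev (n z) [])" using T[OF z] mrep_ev[OF n(2) z Nil_cpoints] by simp
    qed
    then show ?thesis by blast
  qed
next
  case (den_Tup G M p m N q n T)
  note M = den_Tup(1)[unfolded den_Tup(6)] and N = den_Tup(2)[unfolded den_Tup(6)]
  note T = mrep_ev[OF den_Tup(3)[unfolded den_Tup(6)] _ Nil_cpoints]
  from den_Tup(4,6) consider (r) "reducible M (Pos p) m" | (v) "val M" using not_Lam_Pos M by blast
  then show ?case
  proof cases
    case r
    have "reducible (Tup M N) (Pos (Tensor p q)) T"
    proof (rule reducible_frame[OF r, where K="\<lambda>M. Tup M N" and L="\<lambda>z u. vtensor u (ev (n z) [])"])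
      show "\<exists>T''. den [] (Tup M' N) (Pos (Tensor p q)) T'' \<and> (\<forall>z\<le>1. ev (T'' z) [] = vtensor (ev (T' z) []) (ev (n z) []))"
        if "den [] M' (Pos p) T'" for M' T'
        using ex_den[OF ex_Tup[OF famI[OF that] famI[OF N]] den.den_Tup[OF that N]] by simp
    qed (use step_Tup_fst[OF reducible_not_val[OF r]] T in \<open>auto intro!: linop_vtensor_l linop_id\<close>)
    then show ?thesis by blast
  next
    case v
    from den_Tup(5,6) consider (Nr) "reducible N (Pos q) n" | (Nv) "val N" using not_Lam_Pos N by blast
    then show ?thesis
    proof cases
      case Nr
      have "reducible (Tup M N) (Pos (Tensor p q)) T"
      proof (rule reducible_frame[OF Nr, where K="\<lambda>N. Tup M N" and L="\<lambda>z u. vtensor (ev (m z) []) u"])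
        show "\<exists>T''. den [] (Tup M N') (Pos (Tensor p q)) T'' \<and> (\<forall>z\<le>1. ev (T'' z) [] = vtensor (ev (m z) []) (ev (T' z) []))"
          if "den [] N' (Pos q) T'" for N' T'
          using ex_den[OF ex_Tup[OF famI[OF M] famI[OF that]] den.den_Tup[OF M that]] by simp
      qed (use step_Tup_snd[OF v] T in \<open>auto intro!: linop_vtensor_r linop_id\<close>)
      then show ?thesis by blast
    qed (use v val.intros in blast)
  qed
next
  case (den_InL G M p m q T)
  note M = den_InL(1)[unfolded den_InL(4)] and T = mrep_ev[OF den_InL(2)[unfolded den_InL(4)] _ Nil_cpoints]
  from den_InL(3,4) consider (r) "reducible M (Pos p) m" | (v) "val M" using not_Lam_Pos M by blast
  then show ?case
  proof cases
    case r
    have "reducible (InL M) (Pos (Plus p q)) T"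
    proof (rule reducible_frame[OF r, where K=InL and L="\<lambda>z u. vplus u (\<lambda>_. 0)"])
      show "\<exists>T''. den [] (InL N) (Pos (Plus p q)) T'' \<and> (\<forall>z\<le>1. ev (T'' z) [] = vplus (ev (T' z) []) (\<lambda>_. 0))"
        if "den [] N (Pos p) T'" for N T'
        using ex_den[OF ex_InL[OF famI[OF that]] den.den_InL[OF that]] by simp
    qed (use step_InL T in \<open>auto intro!: linop_vplus\<close>)
    then show ?thesis by blast
  qed (use val.intros in blast)
next
  case (den_InR G M q m p T)
  note M = den_InR(1)[unfolded den_InR(4)] and T = mrep_ev[OF den_InR(2)[unfolded den_InR(4)] _ Nil_cpoints]
  from den_InR(3,4) consider (r) "reducible M (Pos q) m" | (v) "val M" using not_Lam_Pos M by blast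
  then show ?case
  proof cases
    case r
    have "reducible (InR M) (Pos (Plus p q)) T"
    proof (rule reducible_frame[OF r, where K=InR and L="\<lambda>z u. vplus (\<lambda>_. 0) u"])
      show "\<exists>T''. den [] (InR N) (Pos (Plus p q)) T'' \<and> (\<forall>z\<le>1. ev (T'' z) [] = vplus (\<lambda>_. 0) (ev (T' z) []))"
        if "den [] N (Pos q) T'" for N T'
        using ex_den[OF ex_InR[OF famI[OF that]] den.den_InR[OF that]] by simp
    qed (use step_InR T in \<open>auto intro!: linop_vplus\<close>)
    then show ?thesis by blast
  qed (use val.intros in blast)
next
  case (den_PrL G M p q m T)
  note M = den_PrL(1)[unfolded den_PrL(4)] and T = mrep_ev[OF den_PrL(2)[unfolded den_PrL(4)] _ Nil_cpoints]
  from den_PrL(3,4) consider (r) "reducible M (Pos (Tensor p q)) m" | (v) "val M" using not_Lam_Pos M by blast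
  then show ?case
  proof cases
    case r
    have "reducible (PrL M) (Pos p) T"
    proof (rule reducible_frame[OF r, where K=PrL and L="\<lambda>z u. sc z (mapp (proj_l (pty_interp p) (pty_interp q)) u)"])
      show "\<exists>T''. den [] (PrL N) (Pos p) T'' \<and> (\<forall>z\<le>1. ev (T'' z) [] = sc z (mapp (proj_l (pty_interp p) (pty_interp q)) (ev (T' z) [])))"
        if "den [] N (Pos (Tensor p q)) T'" for N T'
        using ex_den[OF ex_PrL[OF famI[OF that]] den.den_PrL[OF that]] by simp
    qed (use step_PrL[OF reducible_not_val[OF r]] T in \<open>auto intro!: linop_sc linop_mapp linop_id\<close>)
    then show ?thesis by blast
  next
    case v
    then obtain V W where V: "M = Tup V W" "val V" "val W" using canonical_Tensor M by blast
    from M[unfolded V(1)] obtain v w where v: "den [] V (Pos p) v" and w: "den [] W (Pos q) w"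
      and m: "mrep [] (Pos (Tensor p q)) m (\<lambda>z us. vtensor (ev (v z) us) (ev (w z) us))" by (auto elim: den_TupE)
    have "reducible (PrL M) (Pos p) T"
    proof (rule reducible_single[OF _ v])
      show "step (PrL M) y N' \<longleftrightarrow> N' = V \<and> y = 1" for y N'
        using val_no_step[OF val.intros(4)[OF V(2,3)]] V(2,3) unfolding V(1)
        by (auto elim!: step_elims(10) elim: wred_elims intro: step.intros wred.intros)
      fix z :: ennreal assume z: "z \<le> 1"
      \<comment> \<open>The discarded component is a value, hence coalgebraic, and its weight is
        exactly 1.\<close>
      show "ev (T z) [] = sc z (ev (v z) [])"
        using T[OF z] mrep_ev[OF m z Nil_cpoints] val_coalgebraic[OF V(2) v z] val_coalgebraic[OF V(3) w z]
        by (simp add: proj_l_app is_pcs_pty coalgebraic_mem str_empty_coalgebraic)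
    qed
    then show ?thesis by blast
  qed
next
  case (den_PrR G M p q m T)
  note M = den_PrR(1)[unfolded den_PrR(4)] and T = mrep_ev[OF den_PrR(2)[unfolded den_PrR(4)] _ Nil_cpoints]
  from den_PrR(3,4) consider (r) "reducible M (Pos (Tensor p q)) m" | (v) "val M" using not_Lam_Pos M by blast
  then show ?case
  proof cases
    case r
    have "reducible (PrR M) (Pos q) T"
    proof (rule reducible_frame[OF r, where K=PrR and L="\<lambda>z u. sc z (mapp (proj_r (pty_interp p) (pty_interp q)) u)"])
      show "\<exists>T''. den [] (PrR N) (Pos q) T'' \<and> (\<forall>z\<le>1. ev (T'' z) [] = sc z (mapp (proj_r (pty_interp p) (pty_interp q)) (ev (T' z) [])))"
        if "den [] N (Pos (Tensor p q)) T'" for N T'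
        using ex_den[OF ex_PrR[OF famI[OF that]] den.den_PrR[OF that]] by simp
    qed (use step_PrR[OF reducible_not_val[OF r]] T in \<open>auto intro!: linop_sc linop_mapp linop_id\<close>)
    then show ?thesis by blast
  next
    case v
    then obtain V W where V: "M = Tup V W" "val V" "val W" using canonical_Tensor M by blast
    from M[unfolded V(1)] obtain v w where v: "den [] V (Pos p) v" and w: "den [] W (Pos q) w"
      and m: "mrep [] (Pos (Tensor p q)) m (\<lambda>z us. vtensor (ev (v z) us) (ev (w z) us))" by (auto elim: den_TupE)
    have "reducible (PrR M) (Pos q) T"
    proof (rule reducible_single[OF _ w])
      show "step (PrR M) y N' \<longleftrightarrow> N' = W \<and> y = 1" for y N'
        using val_no_step[OF val.intros(4)[OF V(2,3)]] V(2,3) unfolding V(1)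
        by (auto elim!: step_elims(11) elim: wred_elims intro: step.intros wred.intros)
      fix z :: ennreal assume z: "z \<le> 1"
      show "ev (T z) [] = sc z (ev (w z) [])"
        using T[OF z] mrep_ev[OF m z Nil_cpoints] val_coalgebraic[OF V(2) v z] val_coalgebraic[OF V(3) w z]
        by (simp add: proj_r_app is_pcs_pty coalgebraic_mem str_empty_coalgebraic)
    qed
    then show ?thesis by blast
  qed
next
  case (den_Fix s G M m T)
  note M = den_Fix(1)[unfolded den_Fix(4)] and T = mrep_ev[OF den_Fix(2)[unfolded den_Fix(4)] _ Nil_cpoints]
  have F: "den [] (Fix s M) s T" using den.den_Fix[OF den_Fix(1,2)] den_Fix(4) by simp
  \<comment> \<open>The unfolding substitutes a closed value for the variable. Suspension is free,
    so the value denotes the promotion of the fixed point at the same z.\<close>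
  obtain n where n: "den [] (Stop (Fix s M)) (Pos (Bang s)) n" "\<forall>z\<le>1. ev (n z) [] = prom (ev (T z) [])"
    using ex_den[OF ex_Stop[OF famI[OF F]] den.den_Stop[OF F]] by blast
  obtain T' where T': "den [] (subst M (Stop (Fix s M)) 0) s T'" "\<forall>z\<le>1. ev (T' z) [] = ev (m z) [ev (n z) []]"
    using subst_closed[OF M n(1) val.intros(3)] by blast
  have "reducible (Fix s M) s T"
  proof (rule reducible_single[OF _ T'(1)])
    show "step (Fix s M) y N' \<longleftrightarrow> N' = subst M (Stop (Fix s M)) 0 \<and> y = 1" for y N'
      by (auto elim!: step_elims elim: wred_elims intro: step.intros wred.intros)
    fix z :: ennreal assume z: "z \<le> 1"
    show "ev (T z) [] = sc z (ev (T' z) [])"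
      using fix_unfold[of "\<lambda>w. sc z (ev (m z) [prom w])" z "m z" "[]"] T[OF z] T'(2) n(2) z by simp
  qed
  then show ?case by blast
next
  case (den_Case G M p q m P s n Q r T)
  note M = den_Case(1)[unfolded den_Case(8)] and P = den_Case(2)[unfolded den_Case(8)] and Q = den_Case(3)[unfolded den_Case(8)]
  note T = mrep_ev[OF den_Case(4)[unfolded den_Case(8)] _ Nil_cpoints]
  from den_Case(5,8) consider (r) "reducible M (Pos (Plus p q)) m" | (v) "val M" using not_Lam_Pos M by blast
  then show ?case
  proof cases
    case r
    have "reducible (Case M P Q) s T"
    proof (rule reducible_frame[OF r, where K="\<lambda>M. Case M P Q" and L="\<lambda>z u. sc z (\<lambda>b. ev (n z) [lpart u] b + ev (r z) [rpart u] b)"])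
      show "\<exists>T''. den [] (Case N P Q) s T'' \<and> (\<forall>z\<le>1. ev (T'' z) [] = sc z (\<lambda>b. ev (n z) [lpart (ev (T' z) [])] b + ev (r z) [rpart (ev (T' z) [])] b))"
        if "den [] N (Pos (Plus p q)) T'" for N T'
        using ex_den[OF ex_Case[OF famI[OF that] famI[OF P] famI[OF Q]] den.den_Case[OF that P Q]] by simp
    qed (use step_Case[OF reducible_not_val[OF r]] T in \<open>auto intro!: linop_sc linop_add linop_ev_Cons linop_parts\<close>)
    then show ?thesis by blast
  next
    case v
    then obtain V where V: "M = InL V \<or> M = InR V" "val V" using canonical_Plus M by blast
    \<comment> \<open>An injected value has a zero half. By linearity the branch not taken receives
      the zero vector and contributes nothing.\<close>
    have z0: "ev t [\<lambda>_. 0] = (\<lambda>_. 0)" for t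
    proof -
      have "vtensor unit_vec (\<lambda>_. 0) y = 0" for y by (cases y) auto
      then show ?thesis by (simp add: ev_def mapp_def)
    qed
    from V(1) show ?thesis
    proof
      assume l: "M = InL V"
      from M[unfolded l] obtain w where w: "den [] V (Pos p) w" and mm: "mrep [] (Pos (Plus p q)) m (\<lambda>z us. vplus (ev (w z) us) (\<lambda>_. 0))"
        by (auto elim: den_InLE)
      obtain T' where T': "den [] (subst P V 0) s T'" "\<forall>z\<le>1. ev (T' z) [] = ev (n z) [ev (w z) []]"
        using subst_closed[OF P w V(2)] by blast
      have "reducible (Case M P Q) s T"
      proof (rule reducible_single[OF _ T'(1)])
        show "step (Case M P Q) y N' \<longleftrightarrow> N' = subst P V 0 \<and> y = 1" for y N'
          using val_no_step[OF val.intros(5)[OF V(2)]] V(2) unfolding l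
          by (auto elim!: step_elims(9) elim: wred_elims intro: step.intros wred.intros)
        fix z :: ennreal assume z: "z \<le> 1"
        show "ev (T z) [] = sc z (ev (T' z) [])" using T[OF z] T'(2) z mrep_ev[OF mm z Nil_cpoints] by (simp add: z0)
      qed
      then show ?thesis by blast
    next
      assume l: "M = InR V"
      from M[unfolded l] obtain w where w: "den [] V (Pos q) w" and mm: "mrep [] (Pos (Plus p q)) m (\<lambda>z us. vplus (\<lambda>_. 0) (ev (w z) us))"
        by (auto elim: den_InRE)
      obtain T' where T': "den [] (subst Q V 0) s T'" "\<forall>z\<le>1. ev (T' z) [] = ev (r z) [ev (w z) []]"
        using subst_closed[OF Q w V(2)] by blast
      have "reducible (Case M P Q) s T"
      proof (rule reducible_single[OF _ T'(1)])
        show "step (Case M P Q) y N' \<longleftrightarrow> N' = subst Q V 0 \<and> y = 1" for y N'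
          using val_no_step[OF val.intros(6)[OF V(2)]] V(2) unfolding l
          by (auto elim!: step_elims(9) elim: wred_elims intro: step.intros wred.intros)
        fix z :: ennreal assume z: "z \<le> 1"
        show "ev (T z) [] = sc z (ev (T' z) [])" using T[OF z] T'(2) z mrep_ev[OF mm z Nil_cpoints] by (simp add: z0)
      qed
      then show ?thesis by blast
    qed
  qed
next
  case (den_Coin x G T)
  note T = mrep_ev[OF den_Coin(3)[unfolded den_Coin(4)] _ Nil_cpoints]
  obtain u where u: "den [] Unt (Pos One) u" "\<forall>z\<le>1. ev (u z) [] = unit_vec"
    using ex_den[OF ex_Unt den.den_Unt] by blast
  obtain l where l: "den [] (InL Unt) (Pos (Plus One One)) l" "\<forall>z\<le>1. ev (l z) [] = vplus (ev (u z) []) (\<lambda>_. 0)"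
    using ex_den[OF ex_InL[OF famI[OF u(1)]] den.den_InL[OF u(1)]] by blast
  obtain r where r: "den [] (InR Unt) (Pos (Plus One One)) r" "\<forall>z\<le>1. ev (r z) [] = vplus (\<lambda>_. 0) (ev (u z) [])"
    using ex_den[OF ex_InR[OF famI[OF u(1)]] den.den_InR[OF u(1)]] by blast
  \<comment> \<open>Both outcomes count as reducts even if one of them has weight 0. They are
    different terms, so a weight function exists.\<close>
  let ?x = "\<lambda>N. if N = InL Unt then of_rat x else 1 - of_rat x :: real"
  let ?T = "\<lambda>N. if N = InL Unt then l else r"
  have "reducible (Coin x) (Pos (Plus One One)) T"
    unfolding reducible_def
  proof (rule exI[of _ "{InL Unt, InR Unt}"], rule exI[of _ ?x], rule exI[of _ ?T], intro conjI allI ballI impI)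
    show "step (Coin x) y N \<longleftrightarrow> N \<in> {InL Unt, InR Unt} \<and> y = ?x N" for y N
      by (auto elim!: step_elims elim: wred_elims intro: step.intros)
    show "0 \<le> ?x N" for N using den_Coin(1,2) by (simp add: of_rat_le_1_iff)
    show "den [] N (Pos (Plus One One)) (?T N)" if "N \<in> {InL Unt, InR Unt}" for N using that l r by auto
    fix z :: ennreal assume z: "z \<le> 1"
    have e: "vplus (sc (ennreal (of_rat x)) unit_vec) (sc (ennreal (1 - of_rat x)) unit_vec) =
      (\<lambda>b. ennreal (of_rat x) * vplus unit_vec (\<lambda>_. 0) b + ennreal (1 - of_rat x) * vplus (\<lambda>_. 0) unit_vec b)"
      (is "?l = ?r")
    proof
      fix b show "?l b = ?r b" by (cases b) (auto simp: sc_def)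
    qed
    have lr: "ev (l z) [] = vplus unit_vec (\<lambda>_. 0)" "ev (r z) [] = vplus (\<lambda>_. 0) unit_vec"
      using u(2) l(2) r(2) z by auto
    show "ev (T z) [] = sc z (\<lambda>b. \<Sum>N\<in>{InL Unt, InR Unt}. ennreal (?x N) * ev (?T N z) [] b)"
      unfolding T[OF z] e by (simp add: lr)
  qed auto
  then show ?case by blast
next
  case (den_Fold G M p m T)
  note M = den_Fold(1)[unfolded den_Fold(4)] and T = mrep_ev[OF den_Fold(2)[unfolded den_Fold(4)] _ Nil_cpoints]
  from den_Fold(3,4) consider (r) "reducible M (Pos (unroll p)) m" | (v) "val M" using not_Lam_Pos M by blast
  then show ?case
  proof cases
    case r
    have "reducible (Fold M) (Pos (Mu p)) T"
    proof (rule reducible_frame[OF r, where K=Fold and L="\<lambda>z u. u"])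
      show "\<exists>T''. den [] (Fold N) (Pos (Mu p)) T'' \<and> (\<forall>z\<le>1. ev (T'' z) [] = ev (T' z) [])"
        if "den [] N (Pos (unroll p)) T'" for N T'
        using den.den_Fold[OF that ex_Fold[OF famI[OF that]]] by blast
    qed (use step_Fold T in \<open>auto intro!: linop_id\<close>)
    then show ?thesis by blast
  qed (use val.intros in blast)
next
  case (den_Unfold G M p m T)
  note M = den_Unfold(1)[unfolded den_Unfold(4)] and T = mrep_ev[OF den_Unfold(2)[unfolded den_Unfold(4)] _ Nil_cpoints]
  from den_Unfold(3,4) consider (r) "reducible M (Pos (Mu p)) m" | (v) "val M" using not_Lam_Pos M by blast
  then show ?case
  proof cases
    case r
    have "reducible (Unfold M) (Pos (unroll p)) T"
    proof (rule reducible_frame[OF r, where K=Unfold and L="\<lambda>z u. sc z u"])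
      show "\<exists>T''. den [] (Unfold N) (Pos (unroll p)) T'' \<and> (\<forall>z\<le>1. ev (T'' z) [] = sc z (ev (T' z) []))"
        if "den [] N (Pos (Mu p)) T'" for N T'
        using ex_den[OF ex_Unfold[OF famI[OF that]] den.den_Unfold[OF that]] by simp
    qed (use step_Unfold[OF reducible_not_val[OF r]] T in \<open>auto intro!: linop_sc linop_id\<close>)
    then show ?thesis by blast
  next
    case v
    then obtain V where V: "M = Fold V" "val V" using canonical_Mu M by blast
    from M[unfolded V(1)] obtain v where v: "den [] V (Pos (unroll p)) v" and m: "mrep [] (Pos (Mu p)) m (\<lambda>z. ev (v z))"
      by (auto elim: den_FoldE)
    have "reducible (Unfold M) (Pos (unroll p)) T"
    proof (rule reducible_single[OF _ v])
      show "step (Unfold M) y N' \<longleftrightarrow> N' = V \<and> y = 1" for y N'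
        using val_no_step[OF val.intros(7)[OF V(2)]] V(2) unfolding V(1)
        by (auto elim!: step_elims(15) elim: wred_elims intro: step.intros wred.intros)
      fix z :: ennreal assume z: "z \<le> 1"
      show "ev (T z) [] = sc z (ev (v z) [])" using T[OF z] mrep_ev[OF m z Nil_cpoints] by simp
    qed
    then show ?thesis by blast
  qed
qed (auto intro: val.intros)

section \<open>Adequacy\<close>

lemma weak_normal_Unt: "weak_normal Unt"
  using val_no_step[OF val.intros(2)] by (simp add: weak_normal_def)

lemma Red_Unt: "Red Unt N = (if N = Unt then 1 else 0)"
  using weak_normal_Unt unfolding Red_def weak_normal_def by auto

lemma Red_pow_Unt: "Red_pow n Unt Unt = 1"
  by (induction n) (simp_all add: Red_Unt infsum_ennreal_single[of Unt])

text \<open>A term with a step is not weak normal, so the reduction matrix has no additional loop at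
  \<open>M\<close>, and its row is supported by the reducts.\<close>

lemma Red_pow_step:
  assumes S: "finite S" "S \<noteq> {}" and st: "\<And>y N. step M y N \<longleftrightarrow> N \<in> S \<and> y = x N"
  shows "Red_pow (Suc n) M M' = (\<Sum>N\<in>S. ennreal (x N) * Red_pow n N M')"
proof -
  have nw: "\<not> weak_normal M" using S(2) st by (auto simp: weak_normal_def)
  have R: "Red M N = (if N \<in> S then ennreal (x N) else 0)" for N
    unfolding Red_def using st nw by auto
  have "Red_pow (Suc n) M M' = (\<Sum>\<^sub>\<infinity>N\<in>S. ennreal (x N) * Red_pow n N M')"
    unfolding Red_pow.simps R by (rule infsum_cong_neutral) auto
  then show ?thesis using S(1) by simp
qed

lemma den_One_le: "den [] M (Pos One) T \<Longrightarrow> z \<le> 1 \<Longrightarrow> ev (T z) [] Star \<le> 1"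
  using ev_mem[OF den_morphs, of "[]" M "Pos One" T z "[]"] by (simp add: coalg_one_def pcs_one_def)

text \<open>Both bounds unfold one step at a time for all terms of type 1. An average of errors
  \<open>z ^ n\<close> is \<open>z ^ n\<close> again, and the cost of the step turns it into
  \<open>z ^ Suc n\<close>.\<close>

lemma Red_pow_bounds:
  assumes "den [] M (Pos One) T"
  shows "z \<le> 1 \<Longrightarrow> ev (T z) [] Star \<le> Red_pow n M Unt + z ^ n" "Red_pow n M Unt \<le> ev (T 1) [] Star"
  using assms
proof (induction n arbitrary: M T)
  case 0
  \<comment> \<open>With no step taken the error is \<open>z ^ 0 = 1\<close>, which alone dominates
    a denotation at type 1. In the other bound the only nonzero case is \<open>M = Unt\<close>,
    whose denotation is 1.\<close>
  { case 1 then show ?case using den_One_le by (simp add: add_increasing)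
  next
    case 2 then show ?case by (auto elim!: den_UntE simp: mrep_ev unit_vec_def) }
next
  case (Suc n)
  have *: "(z \<le> 1 \<longrightarrow> ev (T z) [] Star \<le> Red_pow (Suc n) M Unt + z ^ Suc n) \<and> Red_pow (Suc n) M Unt \<le> ev (T 1) [] Star"
    if M: "den [] M (Pos One) T" for M T
  proof -
    from progress[OF M] consider (v) "val M" | (r) "reducible M (Pos One) T" using not_Lam_Pos M by blast
    then show ?thesis
    proof cases
      case v
      then have U: "M = Unt" using canonical_One M by blast
      have "ev (T z) [] Star = 1" if "z \<le> 1" for z using M that unfolding U by (auto elim!: den_UntE simp: mrep_ev unit_vec_def)
      then show ?thesis unfolding U Red_pow_Unt by simp
    next
      case r
      then obtain S x T' where S: "finite S" "S \<noteq> {}" and st: "\<And>y N. step M y N \<longleftrightarrow> N \<in> S \<and> y = x N"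
        and x: "\<And>N. N \<in> S \<Longrightarrow> 0 \<le> x N" "sum x S = 1" and T': "\<And>N. N \<in> S \<Longrightarrow> den [] N (Pos One) (T' N)"
        and eq: "\<And>z. z \<le> 1 \<Longrightarrow> ev (T z) [] = sc z (\<lambda>b. \<Sum>N\<in>S. ennreal (x N) * ev (T' N z) [] b)"
        unfolding reducible_def by blast
      have sx: "(\<Sum>N\<in>S. ennreal (x N)) = 1" using x by (simp add: sum_ennreal)
      have "ev (T z) [] Star \<le> Red_pow (Suc n) M Unt + z ^ Suc n" if z: "z \<le> 1"
      proof -
        have "ev (T z) [] Star = z * (\<Sum>N\<in>S. ennreal (x N) * ev (T' N z) [] Star)" using eq[OF z] by (simp add: sc_def)
        also have "\<dots> \<le> z * (\<Sum>N\<in>S. ennreal (x N) * (Red_pow n N Unt + z ^ n))"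
          using Suc(1)[OF z T'] by (intro mult_left_mono sum_mono) auto
        also have "\<dots> = z * Red_pow (Suc n) M Unt + z * (z ^ n * (\<Sum>N\<in>S. ennreal (x N)))"
          unfolding Red_pow_step[OF S st]
          by (simp add: distrib_left sum.distrib sum_distrib_left mult_ac)
        \<comment> \<open>The weights sum to 1, so averaging leaves the error term alone. The factor
          z in front of the probability is simply dropped.\<close>
        also have "\<dots> \<le> Red_pow (Suc n) M Unt + z ^ Suc n"
          unfolding sx using mult_right_mono[OF z, of "Red_pow (Suc n) M Unt"] by (simp del: Red_pow.simps)
        finally show ?thesis .
      qed
      moreover have "Red_pow (Suc n) M Unt \<le> ev (T 1) [] Star"
        unfolding Red_pow_step[OF S st] using eq[of 1] Suc(2)[OF T'] by (auto intro!: sum_mono mult_left_mono)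
      ultimately show ?thesis by blast
    qed
  qed
  { case 1 then show ?case using * by blast
  next
    case 2 then show ?case using * by blast }
qed

text \<open>The order of the limits matters: n grows while the cost factor stays at a fixed
  \<open>zeta k\<close>, and only then does k grow. At cost factor 1 itself the error would remain
  1.\<close>

lemma sem_adequate:
  assumes "sem [] M (Pos One) t"
  shows "ev t [] Star = Red_inf M Unt"
proof -
  obtain T where T: "contin T" "den [] M (Pos One) T" "T 1 = t" using sem_den[OF assms] by blast
  have R: "Red_inf M Unt = (SUP n. Red_pow n M Unt)" by (simp add: Red_inf_def weak_normal_Unt)
  have "ev (T (zeta k)) [] Star \<le> Red_inf M Unt" for k
  proof -
    \<comment> \<open>Convergence of the powers is taken from the reals, where \<open>?q\<close> is
      a nonnegative number strictly below 1.\<close>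
    have lim: "(\<lambda>n. zeta k ^ n) \<longlonglongrightarrow> 0"
    proof -
      let ?q = "1 - inverse (real (Suc k))"
      have q: "0 \<le> ?q" "?q < 1" by (auto simp: inverse_le_1_iff)
      have "(\<lambda>n. ennreal (?q ^ n)) \<longlonglongrightarrow> ennreal 0" by (intro tendsto_ennrealI LIMSEQ_realpow_zero q)
      then show ?thesis using q by (simp add: zeta_def ennreal_power)
    qed
    have "ev (T (zeta k)) [] Star \<le> Red_inf M Unt + zeta k ^ n" for n
    proof -
      have "Red_pow n M Unt \<le> Red_inf M Unt" unfolding R by (rule SUP_upper) simp
      then show ?thesis using Red_pow_bounds(1)[OF T(2) less_imp_le[OF zeta_less], of k n]
        by (meson add_right_mono order_trans)
    qed
    moreover have "(\<lambda>n. Red_inf M Unt + zeta k ^ n) \<longlonglongrightarrow> Red_inf M Unt + 0" by (intro tendsto_add tendsto_const lim)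
    ultimately show ?thesis using LIMSEQ_le_const by fastforce
  qed
  moreover have "ups (\<lambda>k. ev (T (zeta k)) []) (ev t [])"
    unfolding ev_def using T(1,3) by (auto simp: contin_def intro!: ups_mapp ups_const)
  ultimately have "ev t [] Star \<le> Red_inf M Unt" by (simp add: ups_SUP SUP_least)
  moreover have "Red_inf M Unt \<le> ev t [] Star"
    unfolding R using Red_pow_bounds(2)[OF T(2)] T(3) by (auto intro!: SUP_least)
  ultimately show ?thesis by (rule antisym)
qed

theorem theorem4p21:
  fixes M :: trm
  assumes "typing [] M (Pos One)"
  shows "(\<exists>!t. sem [] M (Pos One) t) \<and>
         closed_interp M (Pos One) Star \<in> {0..1} \<and>
         closed_interp M (Pos One) Star = Red_inf M Unt"
proof -
  obtain t where t: "sem [] M (Pos One) t" using typing_sem[OF assms] by blast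
  have mem: "ev t' [] \<in> pset pcs_one" if "sem [] M (Pos One) t'" for t'
    using ev_mem[OF sem_morphs[OF that] Nil_cpoints] by (simp add: coalg_one_def)
  \<comment> \<open>Adequacy fixes the entry at \<open>Star\<close>, and all other entries vanish.
    The empty context has a single coalgebraic tuple, so equal values there give equal
    morphisms.\<close>
  have uniq: "t' = t" if t': "sem [] M (Pos One) t'" for t'
  proof (rule morphs_eqI[OF sem_morphs[OF t'] sem_morphs[OF t]])
    fix us assume "us \<in> cpoints []"
    then have us: "us = []" by (simp add: cpoints_Nil)
    have "ev t' [] x = ev t [] x" for x
      using sem_adequate[OF t'] sem_adequate[OF t] is_pcs_out[OF is_pcs_one mem[OF t'], of x]
        is_pcs_out[OF is_pcs_one mem[OF t], of x] by (cases "x = Star") auto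
    then show "ev t' us = ev t us" unfolding us by blast
  qed
  have "(THE t. sem [] M (Pos One) t) = t" using t uniq by (rule the_equality)
  then have c: "closed_interp M (Pos One) = ev t []" by (simp add: closed_interp_def)
  have "ev t [] Star \<le> 1" using mem[OF t] by (simp add: pcs_one_def)
  then show ?thesis unfolding c by (intro conjI ex1I[of _ t] t uniq sem_adequate[OF t]) auto
qed

end
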